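(* Let $A\in\mathbb{R}^{3\times3}$ be a symmetric positive definite matrix, with associated operators $\mathscr L$ and $G(t)$, $t\in\mathbb{R}$. Given $\phi_0\in L^2(\mathbb{R}^3,\mathbb{R}^3)$, the function $\phi(\cdot,t):=G(t)\phi_0$ is a weak solution in $L^2(\mathbb{R}^3,\mathbb{R}^3)$ of the Cauchy problem $\frac{d}{dt}\phi=\mathscr L\phi$, $\phi(0)=\phi_0$. Moreover, if $\phi_0$ belongs to the domain $D(\mathscr L)\subset L^2(\mathbb{R}^3,\mathbb{R}^3)$ of $\mathscr L$, then $\phi$ is a strong solution in $L^2(\mathbb{R}^3,\mathbb{R}^3)$ of this problem. Furthermore, if $\phi_0$ is conservative, namely $\phi_0=\nabla f_0\in L^2(\mathbb{R}^3,\mathbb{R}^3)$, then $G(t)\phi_0$ is conservative (i.e. a gradient) for all $t\in\mathbb{R}$.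
   Context: Fourier transform: $\mathscr F[\phi](\xi)=\hat\phi(\xi)=\int_{\mathbb{R}^3}\phi(x)e^{-2\pi i\xi\cdot x}dx$, $\mathscr F^{-1}[\phi](x)=\int_{\mathbb{R}^3}\phi(\xi)e^{2\pi i\xi\cdot x}d\xi$, extended to $L^2$ by density. Let $I$ be the $3\times3$ identity matrix, $J=\begin{pmatrix}0&-1&0\\1&0&0\\0&0&0\end{pmatrix}$, $S=A^{-1}J(A-I)$, $\overline u(x)=Sx$, $m(x)=2\,\frac{x\cdot A^{-1}Jx}{x\cdot A^{-1}x}$ for $x\neq0$, and $\mathscr M_m$ multiplication by $m$. Define $$\mathscr L\phi=-(\overline u\cdot\nabla)\phi-S^T\phi+\mathscr F^{-1}\circ\mathscr M_m\circ\mathscr F[\phi],$$ with domain $D(\mathscr L)=\{\phi\in L^2(\mathbb{R}^3,\mathbb{R}^3):(\overline u\cdot\nabla)\phi\in L^2(\mathbb{R}^3,\mathbb{R}^3)\}$ (derivatives in the distributional sense). Put $\tilde m(t;\xi)=m(e^{-tS^T}\xi)$, $\tilde M(t;\xi)=e^{\int_0^t\tilde m(r;\xi)\,dr}$, and $$G(t)[\phi](x)=\int_{\mathbb{R}^3}e^{-tS^T}\hat\phi(\xi)\,\tilde M(t;\xi)\,e^{2\pi i\xi\cdot e^{-tS}x}\,d\xi ,$$ i.e. $G(t)[\phi](x)=e^{-tS^T}\big(\mathscr F^{-1}[\tilde M(t;\cdot)\hat\phi]\big)(e^{-tS}x)$. Strong solution in $L^2$: $\phi\in\mathcal C^1(\mathbb{R},L^2(\mathbb{R}^3,\mathbb{R}^3))$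 satisfying $\frac{d}{dt}\phi=\mathscr L\phi$ in $L^2$ for all $t\in\mathbb{R}$ and $\phi(0)=\phi_0$. Weak solution in $L^2$: $\phi\in\mathcal C^0(\mathbb{R};L^2(\mathbb{R}^3,\mathbb{R}^3))$ with $\phi(\cdot,0)=\phi_0$ in $L^2$ and $$\int_{\mathbb{R}}\int_{\mathbb{R}^3}\phi(x,t)\cdot\Big[\partial_tf(x,t)+(\overline u(x)\cdot\nabla)f(x,t)-Sf(x,t)+\mathscr F\circ\mathscr M_m\circ\mathscr F^{-1}[f(\cdot,t)](x)\Big]dx\,dt=0$$ for every $f\in\mathcal C_c^\infty(\mathbb{R}^3\times\mathbb{R};\mathbb{R}^3)$. *)

theory Defs
  imports "HOL-Analysis.Analysis"
begin

subsection \<open>Complexification of real vectors and matrices\<close>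

definition cvec :: "real ^ 3 \<Rightarrow> complex ^ 3" where
  "cvec v = (\<chi> i. complex_of_real (v $ i))"

definition Re_vec :: "complex ^ 3 \<Rightarrow> real ^ 3" where
  "Re_vec z = (\<chi> i. Re (z $ i))"

definition cmat :: "real ^ 3 ^ 3 \<Rightarrow> complex ^ 3 ^ 3" where
  "cmat M = (\<chi> i j. complex_of_real (M $ i $ j))"

text \<open>The multiplication of the ring class instance for vectors is componentwise, so the
  exponential series is written out with the matrix product.\<close>

definition mexp :: "real ^ 3 ^ 3 \<Rightarrow> real ^ 3 ^ 3" where
  "mexp M = (\<Sum>k. (1 / fact k) *\<^sub>R (((**) M) ^^ k) (mat 1))"

subsection \<open>Square-integrable functions\<close>

text \<open>Elements of \<open>L\<^sup>2\<close> are given by Borel representatives; equality in \<open>L\<^sup>2\<close>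
  is equality almost everywhere.\<close>

definition L2 :: "(real ^ 3 \<Rightarrow> 'b::euclidean_space) set" where
  "L2 = {f \<in> borel_measurable lborel. integrable lborel (\<lambda>x. (norm (f x))\<^sup>2)}"

definition L2norm :: "(real ^ 3 \<Rightarrow> 'b::euclidean_space) \<Rightarrow> real" where
  "L2norm f = sqrt (\<integral>x. (norm (f x))\<^sup>2 \<partial>lborel)"

definition L2_lim :: "(nat \<Rightarrow> real ^ 3 \<Rightarrow> 'b::euclidean_space) \<Rightarrow> (real ^ 3 \<Rightarrow> 'b) \<Rightarrow> bool" where
  "L2_lim fs g \<longleftrightarrow> (\<forall>n. fs n \<in> L2) \<and> g \<in> L2 \<and> (\<lambda>n. L2norm (\<lambda>x. fs n x - g x)) \<longlonglongrightarrow> 0"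

definition L2_continuous :: "(real \<Rightarrow> real ^ 3 \<Rightarrow> real ^ 3) \<Rightarrow> bool" where
  "L2_continuous \<phi> \<longleftrightarrow> (\<forall>t. \<phi> t \<in> L2) \<and>
     (\<forall>t. ((\<lambda>s. L2norm (\<lambda>x. \<phi> s x - \<phi> t x)) \<longlongrightarrow> 0) (at t))"

definition L2_has_derivative ::
  "(real \<Rightarrow> real ^ 3 \<Rightarrow> real ^ 3) \<Rightarrow> (real ^ 3 \<Rightarrow> real ^ 3) \<Rightarrow> real \<Rightarrow> bool" where
  "L2_has_derivative \<phi> D t \<longleftrightarrow> D \<in> L2 \<and>
     ((\<lambda>s. L2norm (\<lambda>x. (1 / (s - t)) *\<^sub>R (\<phi> s x - \<phi> t x) - D x)) \<longlongrightarrow> 0) (at t)"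

subsection \<open>Fourier transform\<close>

definition fourier_L1 :: "(real ^ 3 \<Rightarrow> complex ^ 3) \<Rightarrow> real ^ 3 \<Rightarrow> complex ^ 3" where
  "fourier_L1 f \<xi> = (\<integral>x. cis (- 2 * pi * (\<xi> \<bullet> x)) *s f x \<partial>lborel)"

definition inv_fourier_L1 :: "(real ^ 3 \<Rightarrow> complex ^ 3) \<Rightarrow> real ^ 3 \<Rightarrow> complex ^ 3" where
  "inv_fourier_L1 f x = (\<integral>\<xi>. cis (2 * pi * (\<xi> \<bullet> x)) *s f \<xi> \<partial>lborel)"

text \<open>Extension by density from \<open>L\<^sup>1 \<inter> L\<^sup>2\<close> to \<open>L\<^sup>2\<close>; the result is
  determined up to a null set, and depends only on the almost-everywhere class of the argument.\<close>

definition extend_L2 ::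
  "((real ^ 3 \<Rightarrow> complex ^ 3) \<Rightarrow> real ^ 3 \<Rightarrow> complex ^ 3) \<Rightarrow>
     (real ^ 3 \<Rightarrow> complex ^ 3) \<Rightarrow> real ^ 3 \<Rightarrow> complex ^ 3" where
  "extend_L2 T f = (SOME g. \<exists>fs. (\<forall>n. integrable lborel (fs n)) \<and>
     L2_lim fs f \<and> L2_lim (\<lambda>n. T (fs n)) g)"

definition fourier :: "(real ^ 3 \<Rightarrow> complex ^ 3) \<Rightarrow> real ^ 3 \<Rightarrow> complex ^ 3" where
  "fourier = extend_L2 fourier_L1"

definition inv_fourier :: "(real ^ 3 \<Rightarrow> complex ^ 3) \<Rightarrow> real ^ 3 \<Rightarrow> complex ^ 3" where
  "inv_fourier = extend_L2 inv_fourier_L1"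

subsection \<open>Test functions and distributional derivatives\<close>

fun Ck :: "nat \<Rightarrow> ('a::real_normed_vector \<Rightarrow> 'b::real_normed_vector) \<Rightarrow> bool" where
  "Ck 0 f \<longleftrightarrow> continuous_on UNIV f"
| "Ck (Suc k) f \<longleftrightarrow> (\<forall>x. f differentiable (at x)) \<and>
     (\<forall>v. Ck k (\<lambda>x. frechet_derivative f (at x) v))"

definition test_fun :: "('a::real_normed_vector \<Rightarrow> 'b::real_normed_vector) \<Rightarrow> bool" where
  "test_fun f \<longleftrightarrow> (\<forall>k. Ck k f) \<and> compact (closure {x. f x \<noteq> 0})"

definition partial_deriv :: "3 \<Rightarrow> (real ^ 3 \<Rightarrow> 'b::real_normed_vector) \<Rightarrow> real ^ 3 \<Rightarrow> 'b" where
  "partial_deriv j f x = frechet_derivative f (at x) (axis j 1)"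

text \<open>\<open>g = (u \<cdot> \<nabla>)\<phi>\<close> in the sense of distributions: for a smooth field \<open>u\<close>, the
  distribution \<open>u\<^sub>j \<partial>\<^sub>j \<phi>\<close> sends \<open>f\<close> to
  \<open>- \<integral> \<phi> \<bullet> \<partial>\<^sub>j (u\<^sub>j f)\<close>.\<close>

definition weak_transport ::
  "(real ^ 3 \<Rightarrow> real ^ 3) \<Rightarrow> (real ^ 3 \<Rightarrow> real ^ 3) \<Rightarrow> (real ^ 3 \<Rightarrow> real ^ 3) \<Rightarrow> bool" where
  "weak_transport u \<phi> g \<longleftrightarrow> (\<forall>f :: real ^ 3 \<Rightarrow> real ^ 3. test_fun f \<longrightarrow>
     (\<integral>x. g x \<bullet> f x \<partial>lborel) =
     - (\<integral>x. \<phi> x \<bullet> (\<Sum>j\<in>UNIV. partial_deriv j (\<lambda>y. u y $ j *\<^sub>R f y) x) \<partial>lborel))"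

definition transport ::
  "(real ^ 3 \<Rightarrow> real ^ 3) \<Rightarrow> (real ^ 3 \<Rightarrow> real ^ 3) \<Rightarrow> real ^ 3 \<Rightarrow> real ^ 3" where
  "transport u \<phi> = (SOME g. g \<in> L2 \<and> weak_transport u \<phi> g)"

text \<open>The potential is a locally integrable function and the gradient is distributional.\<close>

definition conservative :: "(real ^ 3 \<Rightarrow> real ^ 3) \<Rightarrow> bool" where
  "conservative \<phi> \<longleftrightarrow> \<phi> \<in> L2 \<and>
     (\<exists>f0 :: real ^ 3 \<Rightarrow> real.
        f0 \<in> borel_measurable lborel \<and>
        (\<forall>K. compact K \<longrightarrow> set_integrable lborel K f0) \<and>
        (\<forall>\<psi> :: real ^ 3 \<Rightarrow> real. test_fun \<psi> \<longrightarrow>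
           (\<forall>j. (\<integral>x. \<phi> x $ j * \<psi> x \<partial>lborel) = - (\<integral>x. f0 x * partial_deriv j \<psi> x \<partial>lborel))))"

subsection \<open>The operators\<close>

definition J_mat :: "real ^ 3 ^ 3" where
  "J_mat = vector [vector [0, -1, 0], vector [1, 0, 0], vector [0, 0, 0]]"

definition S_mat :: "real ^ 3 ^ 3 \<Rightarrow> real ^ 3 ^ 3" where
  "S_mat A = matrix_inv A ** J_mat ** (A - mat 1)"

definition u_bar :: "real ^ 3 ^ 3 \<Rightarrow> real ^ 3 \<Rightarrow> real ^ 3" where
  "u_bar A x = S_mat A *v x"

definition m_symb :: "real ^ 3 ^ 3 \<Rightarrow> real ^ 3 \<Rightarrow> real" where
  "m_symb A x = 2 * ((x \<bullet> ((matrix_inv A ** J_mat) *v x)) / (x \<bullet> (matrix_inv A *v x)))"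

definition mult_m :: "real ^ 3 ^ 3 \<Rightarrow> (real ^ 3 \<Rightarrow> complex ^ 3) \<Rightarrow> real ^ 3 \<Rightarrow> complex ^ 3" where
  "mult_m A g \<xi> = m_symb A \<xi> *\<^sub>R g \<xi>"

definition dom_L :: "real ^ 3 ^ 3 \<Rightarrow> (real ^ 3 \<Rightarrow> real ^ 3) set" where
  "dom_L A = {\<phi> \<in> L2. \<exists>g \<in> L2. weak_transport (u_bar A) \<phi> g}"

text \<open>The Fourier multiplier term is complex-valued as an expression, so \<open>\<L>\<phi>\<close> and
  \<open>G(t)\<phi>\<close> are complex-vector-valued; that they are real-valued is a consequence of \<open>m\<close>
  being even and real, and is not built into the definitions.\<close>

definition L_op :: "real ^ 3 ^ 3 \<Rightarrow> (real ^ 3 \<Rightarrow> real ^ 3) \<Rightarrow> real ^ 3 \<Rightarrow> complex ^ 3" where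
  "L_op A \<phi> x =
     - cvec (transport (u_bar A) \<phi> x) - cvec (transpose (S_mat A) *v \<phi> x)
     + inv_fourier (mult_m A (fourier (\<lambda>y. cvec (\<phi> y)))) x"

definition m_tilde :: "real ^ 3 ^ 3 \<Rightarrow> real \<Rightarrow> real ^ 3 \<Rightarrow> real" where
  "m_tilde A t \<xi> = m_symb A (mexp (- t *\<^sub>R transpose (S_mat A)) *v \<xi>)"

text \<open>The interval integral is oriented, as needed for negative \<open>t\<close>.\<close>

definition M_tilde :: "real ^ 3 ^ 3 \<Rightarrow> real \<Rightarrow> real ^ 3 \<Rightarrow> real" where
  "M_tilde A t \<xi> = exp (LBINT r=ereal 0..ereal t. m_tilde A r \<xi>)"

definition G_op :: "real ^ 3 ^ 3 \<Rightarrow> real \<Rightarrow> (real ^ 3 \<Rightarrow> real ^ 3) \<Rightarrow> real ^ 3 \<Rightarrow> complex ^ 3" where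
  "G_op A t \<phi> x =
     cmat (mexp (- t *\<^sub>R transpose (S_mat A))) *v
       inv_fourier (\<lambda>\<xi>. M_tilde A t \<xi> *\<^sub>R fourier (\<lambda>y. cvec (\<phi> y)) \<xi>)
         (mexp (- t *\<^sub>R S_mat A) *v x)"

subsection \<open>Solutions of the Cauchy problem\<close>

definition strong_solution ::
  "real ^ 3 ^ 3 \<Rightarrow> (real ^ 3 \<Rightarrow> real ^ 3) \<Rightarrow> (real \<Rightarrow> real ^ 3 \<Rightarrow> real ^ 3) \<Rightarrow> bool" where
  "strong_solution A \<phi>0 \<phi> \<longleftrightarrow>
     (\<forall>t. \<phi> t \<in> L2) \<and>
     (\<exists>\<phi>'. L2_continuous \<phi>' \<and>
        (\<forall>t. L2_has_derivative \<phi> (\<phi>' t) t \<and>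
             \<phi> t \<in> dom_L A \<and> (AE x in lborel. cvec (\<phi>' t x) = L_op A (\<phi> t) x))) \<and>
     (AE x in lborel. \<phi> 0 x = \<phi>0 x)"

definition adjoint_expr ::
  "real ^ 3 ^ 3 \<Rightarrow> ((real ^ 3) \<times> real \<Rightarrow> real ^ 3) \<Rightarrow> real \<Rightarrow> real ^ 3 \<Rightarrow> complex ^ 3" where
  "adjoint_expr A f t x =
     cvec (vector_derivative (\<lambda>s. f (x, s)) (at t)
           + frechet_derivative (\<lambda>y. f (y, t)) (at x) (u_bar A x)
           - S_mat A *v f (x, t))
     + fourier (mult_m A (inv_fourier (\<lambda>y. cvec (f (y, t))))) x"

definition weak_solution ::
  "real ^ 3 ^ 3 \<Rightarrow> (real ^ 3 \<Rightarrow> real ^ 3) \<Rightarrow> (real \<Rightarrow> real ^ 3 \<Rightarrow> real ^ 3) \<Rightarrow> bool" where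
  "weak_solution A \<phi>0 \<phi> \<longleftrightarrow>
     L2_continuous \<phi> \<and>
     (AE x in lborel. \<phi> 0 x = \<phi>0 x) \<and>
     (\<forall>f :: (real ^ 3) \<times> real \<Rightarrow> real ^ 3. test_fun f \<longrightarrow>
        (\<integral>t. (\<integral>x. (\<Sum>i\<in>UNIV. complex_of_real (\<phi> t x $ i) * adjoint_expr A f t x $ i)
                \<partial>lborel) \<partial>lborel) = 0)"

end

theory Submission
  imports Defs "HOL-Probability.Probability"
begin

text \<open>Since \<open>tr S = 0\<close>, the transport factor \<open>T(t)\<phi>(x) = exp(-tS\<^sup>T) \<phi>(exp(-tS)x)\<close> is built from a
  measure-preserving substitution, and the Fourier transform intertwines it with another such
  substitution. The cocycle identity for \<open>M(t; \<xi>)\<close> therefore makes \<open>G(t)\<close>, the product of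
  \<open>T(t)\<close> and the Fourier multiplier \<open>M(t; \<cdot>)\<close>, a group of bounded operators. As \<open>m\<close> is bounded, the
  multiplier factor is differentiable at \<open>t = 0\<close> on all of \<open>L\<^sup>2\<close> by dominated convergence, while the
  transport factor is differentiable exactly on \<open>D(\<L>)\<close>; the group property carries the derivative
  to every \<open>t\<close>. For general data, the pairing of \<open>G(t)\<phi>\<^sub>0\<close> with \<open>f(\<cdot>, t)\<close> is differentiable because
  the adjoint of \<open>T(t)\<close> acts differentiably on test functions; its derivative is the integrand of the
  weak formulation and integrates to zero. Finally, a field is conservative iff its Fourier transform
  \<open>F(\<xi>)\<close> is a.e. parallel to \<open>\<xi>\<close>, which \<open>G(t)\<close> preserves: the transform of the potential has modulus
  \<open>|F(\<xi>)| / (2\<pi>|\<xi>|)\<close>, which is in \<open>L\<^sup>1\<close> for \<open>|\<xi>| \<le> 1\<close> and in \<open>L\<^sup>2\<close> for \<open>|\<xi>| > 1\<close>.\<close>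

subsection \<open>The Hilbert space of square-integrable functions\<close>

text \<open>The symbol \<open>m\<close> is homogeneous of degree 0 and in general discontinuous at
  the origin, so its multipliers do not respect smoothness or decay, and the evolution has no
  evident invariant class of test functions. Only the transport factor has one. Hence the unbounded
  part is always differentiated on the adjoint side, against test functions, while the multiplier is
  handled as a bounded operator. \<open>fourier\<close>, \<open>inv_fourier\<close> and
  \<open>transport\<close> are selected by \<open>SOME\<close> and are fixed only up to null sets.
  Identities therefore live in a quotient \<open>l2\<close>, where each choice becomes a
  well-defined operator; statements on functions are recovered by \<open>cls_eq_iff\<close>.
  \<open>G_op\<close> is complex-valued. Since \<open>m\<close> is even and real, its operators
  commute with conjugation, so real data stay real and taking the real part loses nothing. At times
  other than 0, membership in the domain is obtained backwards: the difference quotients of the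
  group converge, hence those of its transport factor do, and duality identifies their limit as a
  distributional derivative.\<close>

lemma L2_iff:
  "f \<in> L2 \<longleftrightarrow> f \<in> borel_measurable borel \<and> integrable lborel (\<lambda>x. (norm (f x))\<^sup>2)"
  by (simp add: L2_def)

lemma L2_measurable: "f \<in> L2 \<Longrightarrow> f \<in> borel_measurable borel"
  by (simp add: L2_iff)

lemma L2_bound:
  fixes f :: "real ^ 3 \<Rightarrow> 'b::euclidean_space" and g :: "real ^ 3 \<Rightarrow> real"
  assumes "f \<in> borel_measurable borel" "integrable lborel (\<lambda>x. (g x)\<^sup>2)"
    and "AE x in lborel. norm (f x) \<le> g x"
  shows "f \<in> L2"
  unfolding L2_iff
proof
  show "integrable lborel (\<lambda>x. (norm (f x))\<^sup>2)"
  proof (rule Bochner_Integration.integrable_bound[OF assms(2)])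
    show "AE x in lborel. norm ((norm (f x))\<^sup>2) \<le> norm ((g x)\<^sup>2)"
      using assms(3) by eventually_elim (auto intro: power_mono)
  qed (use assms(1) in measurable)
qed fact

lemma L2_bound_L2:
  fixes f :: "real ^ 3 \<Rightarrow> 'b::euclidean_space" and g :: "real ^ 3 \<Rightarrow> 'c::euclidean_space"
  assumes "f \<in> borel_measurable borel" "g \<in> L2"
    and "AE x in lborel. norm (f x) \<le> C * norm (g x)"
  shows "f \<in> L2"
proof (rule L2_bound[OF assms(1) _ assms(3)])
  have "integrable lborel (\<lambda>x. C\<^sup>2 * (norm (g x))\<^sup>2)"
    using assms(2) by (auto simp: L2_iff)
  then show "integrable lborel (\<lambda>x. (C * norm (g x))\<^sup>2)"
    by (simp add: power_mult_distrib)
qed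

lemma L2_0: "(\<lambda>x. 0) \<in> L2"
  by (simp add: L2_iff)

lemma L2_add:
  assumes "f \<in> L2" "g \<in> L2" shows "(\<lambda>x. f x + g x) \<in> L2"
proof (rule L2_bound[where g = "\<lambda>x. norm (f x) + norm (g x)"])
  have "integrable lborel (\<lambda>x. 2 * (norm (f x))\<^sup>2 + 2 * (norm (g x))\<^sup>2)"
    using assms by (auto simp: L2_iff)
  then show "integrable lborel (\<lambda>x. (norm (f x) + norm (g x))\<^sup>2)"
  proof (rule Bochner_Integration.integrable_bound)
    show "AE x in lborel. norm ((norm (f x) + norm (g x))\<^sup>2) \<le> norm (2 * (norm (f x))\<^sup>2 + 2 * (norm (g x))\<^sup>2)"
    proof (intro AE_I2)
      fix x
      show "norm ((norm (f x) + norm (g x))\<^sup>2) \<le> norm (2 * (norm (f x))\<^sup>2 + 2 * (norm (g x))\<^sup>2)"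
        using sum_squares_bound[of "norm (f x)" "norm (g x)"] by (simp add: power2_sum)
    qed
  qed (use assms[THEN L2_measurable] in measurable)
  show "(\<lambda>x. f x + g x) \<in> borel_measurable borel"
    using assms[THEN L2_measurable] by measurable
qed (auto intro: norm_triangle_ineq)

lemma L2_linear:
  assumes "bounded_linear N" "f \<in> L2" shows "(\<lambda>x. N (f x)) \<in> L2"
proof -
  obtain C where C: "\<And>v. norm (N v) \<le> norm v * C"
    using bounded_linear.bounded[OF assms(1)] by blast
  have "N \<in> borel_measurable borel"
    by (intro borel_measurable_continuous_onI bounded_linear.continuous_on[OF assms(1)] continuous_on_id)
  then have "(\<lambda>x. N (f x)) \<in> borel_measurable borel"
    using L2_measurable[OF assms(2)] by measurable
  then show ?thesis
    by (rule L2_bound_L2[OF _ assms(2), where C = C]) (use C in \<open>simp add: mult.commute\<close>)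
qed

lemma L2_scaleR: "f \<in> L2 \<Longrightarrow> (\<lambda>x. c *\<^sub>R f x) \<in> L2"
  by (rule L2_linear[OF bounded_linear_scaleR_right])

lemma L2_minus: "f \<in> L2 \<Longrightarrow> (\<lambda>x. - f x) \<in> L2"
  by (rule L2_linear[OF bounded_linear_minus[OF bounded_linear_ident]])

lemma L2_diff: "f \<in> L2 \<Longrightarrow> g \<in> L2 \<Longrightarrow> (\<lambda>x. f x - g x) \<in> L2"
  using L2_add[OF _ L2_minus, of f g] by simp

lemma L2_sum: "(\<And>i. i \<in> I \<Longrightarrow> f i \<in> L2) \<Longrightarrow> (\<lambda>x. \<Sum>i\<in>I. f i x) \<in> L2"
  by (induction I rule: infinite_finite_induct) (simp_all add: L2_add L2_0)

lemma L2_inner_integrable: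
  assumes "f \<in> L2" "g \<in> L2" shows "integrable lborel (\<lambda>x. f x \<bullet> g x)"
proof (rule Bochner_Integration.integrable_bound)
  show "integrable lborel (\<lambda>x. (norm (f x))\<^sup>2 + (norm (g x))\<^sup>2)"
    using assms by (auto simp: L2_iff)
  show "(\<lambda>x. f x \<bullet> g x) \<in> borel_measurable lborel"
    using assms[THEN L2_measurable] by measurable
  show "AE x in lborel. norm (f x \<bullet> g x) \<le> norm ((norm (f x))\<^sup>2 + (norm (g x))\<^sup>2)"
  proof (intro AE_I2)
    fix x
    have "\<bar>f x \<bullet> g x\<bar> \<le> norm (f x) * norm (g x)" by (rule Cauchy_Schwarz_ineq2)
    also have "\<dots> \<le> (norm (f x))\<^sup>2 + (norm (g x))\<^sup>2"
      using sum_squares_bound[of "norm (f x)" "norm (g x)"]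
        mult_nonneg_nonneg[OF norm_ge_zero[of "f x"] norm_ge_zero[of "g x"]]
      by linarith
    finally show "norm (f x \<bullet> g x) \<le> norm ((norm (f x))\<^sup>2 + (norm (g x))\<^sup>2)" by simp
  qed
qed

section \<open>Almost-everywhere classes as a complete real inner product space\<close>

definition l2rel :: "(real ^ 3 \<Rightarrow> 'b::euclidean_space) \<Rightarrow> (real ^ 3 \<Rightarrow> 'b) \<Rightarrow> bool" where
  "l2rel f g \<longleftrightarrow> f \<in> L2 \<and> g \<in> L2 \<and> (AE x in lborel. f x = g x)"

lemma part_equivp_l2rel:
  "part_equivp (l2rel :: (real ^ 3 \<Rightarrow> 'b::euclidean_space) \<Rightarrow> _)"
proof (rule part_equivpI)
  show "\<exists>x :: real ^ 3 \<Rightarrow> 'b. l2rel x x" using L2_0 by (auto simp: l2rel_def)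
  show "symp (l2rel :: (real ^ 3 \<Rightarrow> 'b) \<Rightarrow> _)"
  proof (rule sympI)
    fix f g :: "real ^ 3 \<Rightarrow> 'b" assume fg: "l2rel f g"
    then have "AE x in lborel. f x = g x" by (simp add: l2rel_def)
    then have "AE x in lborel. g x = f x" by eventually_elim simp
    with fg show "l2rel g f" by (simp add: l2rel_def)
  qed
  show "transp (l2rel :: (real ^ 3 \<Rightarrow> 'b) \<Rightarrow> _)"
  proof (rule transpI)
    fix f g h :: "real ^ 3 \<Rightarrow> 'b" assume *: "l2rel f g" "l2rel g h"
    then have "AE x in lborel. f x = g x" "AE x in lborel. g x = h x" by (auto simp: l2rel_def)
    then have "AE x in lborel. f x = h x" by eventually_elim simp
    with * show "l2rel f h" by (simp add: l2rel_def)
  qed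
qed

\<comment> \<open>The relation is partial: functions outside \<open>L2\<close> are related to
  nothing. The quotient therefore consists of classes of square-integrable functions only, and its
  inner product is definite.\<close>
quotient_type (overloaded) 'b l2 = "real ^ 3 \<Rightarrow> 'b::euclidean_space" / partial: l2rel
  by (rule part_equivp_l2rel)

instantiation l2 :: (euclidean_space) real_vector
begin

lift_definition zero_l2 :: "'a l2" is "\<lambda>x. 0" by (simp add: l2rel_def L2_0)
lift_definition plus_l2 :: "'a l2 \<Rightarrow> 'a l2 \<Rightarrow> 'a l2" is "\<lambda>f g x. f x + g x"
  by (auto simp: l2rel_def intro: L2_add)
lift_definition uminus_l2 :: "'a l2 \<Rightarrow> 'a l2" is "\<lambda>f x. - f x"
  by (auto simp: l2rel_def intro: L2_minus)
lift_definition minus_l2 :: "'a l2 \<Rightarrow> 'a l2 \<Rightarrow> 'a l2" is "\<lambda>f g x. f x - g x"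
  by (auto simp: l2rel_def intro: L2_diff)
lift_definition scaleR_l2 :: "real \<Rightarrow> 'a l2 \<Rightarrow> 'a l2" is "\<lambda>c f x. c *\<^sub>R f x"
  by (auto simp: l2rel_def intro: L2_scaleR)

instance
proof
  fix a b c :: "'a l2" and r s :: real
  show "a + b + c = a + (b + c)" by transfer (auto simp: l2rel_def L2_add add.assoc)
  show "a + b = b + a" by transfer (auto simp: l2rel_def L2_add add.commute)
  show "0 + a = a" by transfer (auto simp: l2rel_def)
  show "- a + a = 0" by transfer (auto simp: l2rel_def L2_0)
  show "a - b = a + - b" by transfer (auto simp: l2rel_def L2_diff)
  show "r *\<^sub>R (a + b) = r *\<^sub>R a + r *\<^sub>R b"
    by transfer (auto simp: l2rel_def scaleR_right_distrib intro!: L2_add L2_scaleR)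
  show "(r + s) *\<^sub>R a = r *\<^sub>R a + s *\<^sub>R a"
    by transfer (auto simp: l2rel_def scaleR_left_distrib intro!: L2_add L2_scaleR)
  show "r *\<^sub>R s *\<^sub>R a = (r * s) *\<^sub>R a" by transfer (auto simp: l2rel_def intro!: L2_scaleR)
  show "1 *\<^sub>R a = a" by transfer (auto simp: l2rel_def)
qed

end

instantiation l2 :: (euclidean_space) real_inner
begin

lift_definition inner_l2 :: "'a l2 \<Rightarrow> 'a l2 \<Rightarrow> real" is "\<lambda>f g. (\<integral>x. f x \<bullet> g x \<partial>lborel)"
  by (rule integral_cong_AE) (auto simp: l2rel_def dest!: L2_measurable)
definition norm_l2 :: "'a l2 \<Rightarrow> real" where "norm_l2 a = sqrt (a \<bullet> a)"
definition sgn_l2 :: "'a l2 \<Rightarrow> 'a l2" where "sgn_l2 a = a /\<^sub>R norm a"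
definition dist_l2 :: "'a l2 \<Rightarrow> 'a l2 \<Rightarrow> real" where "dist_l2 a b = norm (a - b)"
definition uniformity_l2 :: "('a l2 \<times> 'a l2) filter" where
  "uniformity_l2 = (INF e\<in>{0<..}. principal {(x, y). dist x y < e})"
definition open_l2 :: "'a l2 set \<Rightarrow> bool" where
  "open_l2 U = (\<forall>x\<in>U. eventually (\<lambda>(x', y). x' = x \<longrightarrow> y \<in> U) uniformity)"

instance
proof
  fix a b c :: "'a l2" and r s :: real
  show "a \<bullet> b = b \<bullet> a" by transfer (simp add: inner_commute)
  show "(a + b) \<bullet> c = a \<bullet> c + b \<bullet> c"
    by transfer (auto simp: l2rel_def inner_add_left L2_inner_integrable
        intro!: Bochner_Integration.integral_add)
  show "(r *\<^sub>R a) \<bullet> b = r * (a \<bullet> b)" by transfer simp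
  show "0 \<le> a \<bullet> a" by transfer simp
  show "(a \<bullet> a = 0) = (a = 0)"
    by transfer (auto simp: l2rel_def L2_0 L2_inner_integrable integral_nonneg_eq_0_iff_AE)
  show "norm a = sqrt (a \<bullet> a)" by (rule norm_l2_def)
  show "sgn a = a /\<^sub>R norm a" by (rule sgn_l2_def)
  show "dist a b = norm (a - b)" by (rule dist_l2_def)
  show "uniformity = (INF e\<in>{0<..}. principal {(x, y :: 'a l2). dist x y < e})" by (rule uniformity_l2_def)
  show "open U = (\<forall>x\<in>U. eventually (\<lambda>(x', y). x' = x \<longrightarrow> y \<in> U) uniformity)" for U :: "'a l2 set"
    by (rule open_l2_def)
qed

end

section \<open>Passing between functions and classes\<close>

abbreviation "cls \<equiv> abs_l2"
abbreviation "rp \<equiv> rep_l2"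

lemma cls_eq_iff: "f \<in> L2 \<Longrightarrow> g \<in> L2 \<Longrightarrow> cls f = cls g \<longleftrightarrow> (AE x in lborel. f x = g x)"
  using Quotient_rel_abs2[OF Quotient_l2] Quotient_rel[OF Quotient_l2, of f g]
  by (auto simp: l2rel_def)

lemma cls_eqI: "f \<in> L2 \<Longrightarrow> g \<in> L2 \<Longrightarrow> (AE x in lborel. f x = g x) \<Longrightarrow> cls f = cls g"
  by (simp add: cls_eq_iff)

lemma cls_rp [simp]: "cls (rp a) = a"
  by (rule Quotient_abs_rep[OF Quotient_l2])

lemma rp_L2 [simp]: "rp a \<in> L2"
  using Quotient_rep_reflp[OF Quotient_l2, of a] by (simp add: l2rel_def)

lemma rp_cls: "f \<in> L2 \<Longrightarrow> AE x in lborel. rp (cls f) x = f x"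
  using cls_eq_iff[of "rp (cls f)" f] by simp

lemma rp_measurable [measurable]: "rp a \<in> borel_measurable borel"
  by (rule L2_measurable) simp

lemma cls_add: "f \<in> L2 \<Longrightarrow> g \<in> L2 \<Longrightarrow> cls (\<lambda>x. f x + g x) = cls f + cls g"
  by (subst plus_l2.abs_eq) (auto simp: eq_onp_def l2rel_def)

lemma cls_diff: "f \<in> L2 \<Longrightarrow> g \<in> L2 \<Longrightarrow> cls (\<lambda>x. f x - g x) = cls f - cls g"
  by (subst minus_l2.abs_eq) (auto simp: eq_onp_def l2rel_def)

lemma cls_minus: "f \<in> L2 \<Longrightarrow> cls (\<lambda>x. - f x) = - cls f"
  by (subst uminus_l2.abs_eq) (auto simp: eq_onp_def l2rel_def)

lemma cls_scaleR: "f \<in> L2 \<Longrightarrow> cls (\<lambda>x. c *\<^sub>R f x) = c *\<^sub>R cls f"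
  by (subst scaleR_l2.abs_eq) (auto simp: eq_onp_def l2rel_def)

lemma cls_0: "cls (\<lambda>x. 0) = 0"
  by (simp add: zero_l2_def)

lemma cls_sum: "(\<And>i. i \<in> I \<Longrightarrow> f i \<in> L2) \<Longrightarrow> cls (\<lambda>x. \<Sum>i\<in>I. f i x) = (\<Sum>i\<in>I. cls (f i))"
  by (induction I rule: infinite_finite_induct) (auto simp: cls_0 cls_add L2_sum)

lemma inner_cls: "f \<in> L2 \<Longrightarrow> g \<in> L2 \<Longrightarrow> cls f \<bullet> cls g = (\<integral>x. f x \<bullet> g x \<partial>lborel)"
  by (subst inner_l2.abs_eq) (auto simp: eq_onp_def l2rel_def)

lemma norm_cls: "f \<in> L2 \<Longrightarrow> norm (cls f) = L2norm f"
  by (simp add: norm_eq_sqrt_inner inner_cls L2norm_def power2_norm_eq_inner)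

lemma norm_cls_sq: "f \<in> L2 \<Longrightarrow> (norm (cls f))\<^sup>2 = (\<integral>x. (norm (f x))\<^sup>2 \<partial>lborel)"
  by (simp add: norm_cls L2norm_def)

lemma inner_rp: "a \<bullet> b = (\<integral>x. rp a x \<bullet> rp b x \<partial>lborel)"
  using inner_cls[of "rp a" "rp b"] by simp

lemma norm_cls_le:
  assumes "f \<in> L2" "g \<in> L2" "0 \<le> C" "AE x in lborel. norm (f x) \<le> C * norm (g x)"
  shows "norm (cls f) \<le> C * norm (cls g)"
proof (rule power2_le_imp_le)
  have "(norm (cls f))\<^sup>2 \<le> (\<integral>x. C\<^sup>2 * (norm (g x))\<^sup>2 \<partial>lborel)"
    unfolding norm_cls_sq[OF assms(1)]
  proof (rule integral_mono_AE)
    show "AE x in lborel. (norm (f x))\<^sup>2 \<le> C\<^sup>2 * (norm (g x))\<^sup>2"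
      using assms(4) by eventually_elim (metis power_mono norm_ge_zero power_mult_distrib)
  qed (use assms in \<open>auto simp: L2_iff\<close>)
  then show "(norm (cls f))\<^sup>2 \<le> (C * norm (cls g))\<^sup>2"
    by (simp add: norm_cls_sq assms power_mult_distrib)
qed (use assms in auto)

text \<open>The bound passes to the limit, so \<open>norm (f n x - f' x)\<close> is at most
  \<open>2 * w x\<close>, and its square has the integrable majorant
  \<open>4 * (w x)\<^sup>2\<close>. Most limits in the quotient are obtained this way, the others by
  density.\<close>

lemma l2_dominated_convergence:
  fixes f :: "nat \<Rightarrow> real ^ 3 \<Rightarrow> 'b::euclidean_space" and w :: "real ^ 3 \<Rightarrow> real"
  assumes m: "\<And>n. f n \<in> borel_measurable borel" "f' \<in> borel_measurable borel"
    and w: "integrable lborel (\<lambda>x. (w x)\<^sup>2)"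
    and lim: "AE x in lborel. (\<lambda>n. f n x) \<longlonglongrightarrow> f' x"
    and bd: "\<And>n. AE x in lborel. norm (f n x) \<le> w x"
  shows "\<And>n. f n \<in> L2" "f' \<in> L2" "(\<lambda>n. cls (f n)) \<longlonglongrightarrow> cls f'"
proof -
  show fn: "f n \<in> L2" for n by (rule L2_bound[OF m(1) w bd])
  have bd': "AE x in lborel. \<forall>n. norm (f n x) \<le> w x" using bd by (simp add: AE_all_countable)
  have bf: "AE x in lborel. norm (f' x) \<le> w x"
    using bd' lim
  proof eventually_elim
    case (elim x)
    show ?case by (rule LIMSEQ_le_const2[OF tendsto_norm[OF elim(2)]]) (use elim in auto)
  qed
  show f': "f' \<in> L2" by (rule L2_bound[OF m(2) w bf])
  have "(\<lambda>n. \<integral>x. (norm (f n x - f' x))\<^sup>2 \<partial>lborel) \<longlonglongrightarrow> (\<integral>(x :: real ^ 3). 0 \<partial>lborel)"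
  proof (rule integral_dominated_convergence[where w = "\<lambda>x. 4 * (w x)\<^sup>2"])
    show "AE x in lborel. (\<lambda>n. (norm (f n x - f' x))\<^sup>2) \<longlonglongrightarrow> 0"
      using lim
    proof eventually_elim
      case (elim x)
      have "(\<lambda>n. (norm (f n x - f' x))\<^sup>2) \<longlonglongrightarrow> (norm (f' x - f' x))\<^sup>2"
        by (intro tendsto_intros elim)
      then show ?case by simp
    qed
    show "AE x in lborel. norm ((norm (f n x - f' x))\<^sup>2) \<le> 4 * (w x)\<^sup>2" for n
      using bd[of n] bf
    proof eventually_elim
      case (elim x)
      have "norm (f n x - f' x) \<le> 2 * w x" using norm_triangle_ineq4[of "f n x" "f' x"] elim by linarith
      then have "(norm (f n x - f' x))\<^sup>2 \<le> (2 * w x)\<^sup>2" by (rule power_mono) simp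
      then show ?case by (simp add: power_mult_distrib)
    qed
  qed (use w m in auto)
  then have "(\<lambda>n. (norm (cls (f n) - cls f'))\<^sup>2) \<longlonglongrightarrow> 0"
    by (simp add: norm_cls_sq fn f' L2_diff flip: cls_diff)
  then have "(\<lambda>n. sqrt ((norm (cls (f n) - cls f'))\<^sup>2)) \<longlonglongrightarrow> sqrt 0"
    by (rule tendsto_real_sqrt)
  then show "(\<lambda>n. cls (f n)) \<longlonglongrightarrow> cls f'"
    by (simp add: LIM_zero_iff tendsto_norm_zero_iff)
qed

lemma Cauchy_fast_subseq:
  fixes X :: "nat \<Rightarrow> 'a::metric_space"
  assumes "Cauchy X"
  obtains r where "strict_mono r" "\<And>k. dist (X (r (Suc k))) (X (r k)) \<le> (1/2)^k"
proof -
  have "\<forall>k. \<exists>M. \<forall>m\<ge>M. \<forall>n\<ge>M. dist (X m) (X n) < (1/2)^k"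
    by (intro allI metric_CauchyD[OF assms]) simp
  then obtain M where "\<forall>k. \<forall>m\<ge>M k. \<forall>n\<ge>M k. dist (X m) (X n) < (1/2)^k"
    by (rule choice[THEN exE])
  then have M: "dist (X m) (X n) < (1/2)^k" if "m \<ge> M k" "n \<ge> M k" for k m n
    using that by blast
  \<comment> \<open>The summand \<open>k\<close> makes \<open>r\<close> strictly increasing, the sum
    puts \<open>r k\<close> beyond \<open>M k\<close>.\<close>
  define r where "r k = k + (\<Sum>j\<le>k. M j)" for k
  have ge: "M k \<le> r k" for k
    unfolding r_def using member_le_sum[of k "{..k}" M] by auto
  have sm: "strict_mono r" by (rule strict_monoI_Suc) (simp add: r_def)
  have "dist (X (r (Suc k))) (X (r k)) \<le> (1/2)^k" for k
    using M[of k "r (Suc k)" "r k"] ge[of k] strict_monoD[OF sm, of k "Suc k"] by simp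
  with sm show ?thesis by (rule that)
qed

text \<open>Riesz--Fischer: a rapidly Cauchy subsequence converges almost everywhere, dominated by
  the sum of its increments.\<close>

instance l2 :: (euclidean_space) complete_space
proof
  fix X :: "nat \<Rightarrow> 'a l2" assume C: "Cauchy X"
  obtain r where r: "strict_mono r" and d: "\<And>k. dist (X (r (Suc k))) (X (r k)) \<le> (1/2)^k"
    using Cauchy_fast_subseq[OF C] by blast
  define F where "F k = rp (X (r k))" for k
  define D where "D k x = norm (F (Suc k) x - F k x)" for k x
  define S where "S n x = (\<Sum>k<n. D k x)" for n x
  have F2: "F k \<in> L2" for k by (simp add: F_def)
  have Fm [measurable]: "F k \<in> borel_measurable borel" for k using F2 by (rule L2_measurable)
  have D2: "D k \<in> L2" for k
    unfolding D_def by (rule L2_bound_L2[where g = "\<lambda>x. F (Suc k) x - F k x" and C = 1]) (auto simp: L2_diff[OF F2 F2])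
  have S2: "S n \<in> L2" for n unfolding S_def by (intro L2_sum D2)
  have [measurable]: "S n \<in> borel_measurable borel" for n using S2 by (rule L2_measurable)
  have nD: "norm (cls (D k)) \<le> (1/2)^k" for k
  proof -
    have "norm (cls (D k)) \<le> 1 * norm (cls (\<lambda>x. F (Suc k) x - F k x))"
      by (rule norm_cls_le[OF D2 L2_diff[OF F2 F2]]) (auto simp: D_def)
    also have "cls (\<lambda>x. F (Suc k) x - F k x) = X (r (Suc k)) - X (r k)"
      by (subst cls_diff[OF F2 F2]) (simp add: F_def)
    finally show ?thesis using d[of k] by (simp add: dist_norm)
  qed
  have nS: "norm (cls (S n)) \<le> 2" for n
  proof -
    have "norm (cls (S n)) \<le> (\<Sum>k<n. norm (cls (D k)))"
      unfolding S_def by (subst cls_sum[OF D2]) (rule norm_sum)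
    also have "\<dots> \<le> (\<Sum>k<n. (1/2)^k)" by (intro sum_mono nD)
    also have "\<dots> \<le> 2" by (simp add: geometric_sum)
    finally show ?thesis .
  qed
  have Snn: "0 \<le> S n x" for n x by (simp add: S_def D_def sum_nonneg)
  have incS: "S n x \<le> S m x" if "n \<le> m" for n m x
    unfolding S_def using that by (intro sum_mono2) (auto simp: D_def)
  have "(\<integral>\<^sup>+x. (SUP n. ennreal ((S n x)\<^sup>2)) \<partial>lborel) = (SUP n. \<integral>\<^sup>+x. ennreal ((S n x)\<^sup>2) \<partial>lborel)"
    by (rule nn_integral_monotone_convergence_SUP)
      (auto simp: incseq_def le_fun_def intro!: ennreal_leI power_mono incS Snn)
  also have "\<dots> \<le> 4"
  proof (rule SUP_least)
    fix n
    have "(\<integral>\<^sup>+x. ennreal ((S n x)\<^sup>2) \<partial>lborel) = ennreal ((norm (cls (S n)))\<^sup>2)"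
      using S2[of n] by (subst norm_cls_sq) (auto simp: L2_iff nn_integral_eq_integral)
    also have "\<dots> \<le> ennreal (2\<^sup>2)" by (intro ennreal_leI power_mono nS) simp
    finally show "(\<integral>\<^sup>+x. ennreal ((S n x)\<^sup>2) \<partial>lborel) \<le> 4" by simp
  qed
  finally have I4: "(\<integral>\<^sup>+x. (SUP n. ennreal ((S n x)\<^sup>2)) \<partial>lborel) \<le> 4" .
  \<comment> \<open>The supremum has finite integral, so the partial sums of the increments are
    bounded almost everywhere. The 4 is the square of the geometric bound 2 in
    \<open>nS\<close>.\<close>
  have "AE x in lborel. (SUP n. ennreal ((S n x)\<^sup>2)) \<noteq> \<infinity>"
    by (rule nn_integral_noteq_infinite) (use I4 in \<open>auto simp: top_unique\<close>)
  then have sumD: "AE x in lborel. summable (\<lambda>k. D k x)"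
  proof eventually_elim
    case (elim x)
    then obtain c where c: "(SUP n. ennreal ((S n x)\<^sup>2)) = ennreal c" "0 \<le> c"
      by (cases "(SUP n. ennreal ((S n x)\<^sup>2))") auto
    have Sc: "S n x \<le> sqrt c" for n
    proof (rule real_le_rsqrt)
      have "ennreal ((S n x)\<^sup>2) \<le> ennreal c" unfolding c(1)[symmetric] by (rule SUP_upper) simp
      then show "(S n x)\<^sup>2 \<le> c" using c(2) by simp
    qed
    show ?case
    proof (rule bounded_imp_summable)
      show "(\<Sum>k\<le>n. D k x) \<le> sqrt c" for n
        using Sc[of "Suc n"] by (simp only: S_def lessThan_Suc_atMost)
    qed (simp add: D_def)
  qed
  define w where "w x = norm (F 0 x) + (\<Sum>k. D k x)" for x
  have [measurable]: "D k \<in> borel_measurable borel" for k using D2 by (rule L2_measurable)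
  have "integrable lborel (\<lambda>x. (\<Sum>k. D k x)\<^sup>2)"
  proof (rule integrableI_bounded)
    have "(\<integral>\<^sup>+x. ennreal (norm ((\<Sum>k. D k x)\<^sup>2)) \<partial>lborel) \<le> (\<integral>\<^sup>+x. (SUP n. ennreal ((S n x)\<^sup>2)) \<partial>lborel)"
    proof (rule nn_integral_mono_AE, use sumD in eventually_elim)
      fix x assume "summable (\<lambda>k. D k x)"
      then have "(\<lambda>n. S n x) \<longlonglongrightarrow> (\<Sum>k. D k x)" unfolding S_def by (rule summable_LIMSEQ)
      then have "(\<lambda>n. ennreal ((S n x)\<^sup>2)) \<longlonglongrightarrow> ennreal ((\<Sum>k. D k x)\<^sup>2)" by (intro tendsto_intros)
      then have "ennreal ((\<Sum>k. D k x)\<^sup>2) \<le> (SUP n. ennreal ((S n x)\<^sup>2))"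
        by (rule LIMSEQ_le_const2) (auto intro!: exI[of _ 0] SUP_upper2[OF UNIV_I order_refl])
      then show "ennreal (norm ((\<Sum>k. D k x)\<^sup>2)) \<le> (SUP n. ennreal ((S n x)\<^sup>2))"
        by simp
    qed
    also have "\<dots> \<le> 4" by (rule I4)
    finally show "(\<integral>\<^sup>+x. ennreal (norm ((\<Sum>k. D k x)\<^sup>2)) \<partial>lborel) < \<infinity>"
      by (simp add: order.strict_trans1)
  qed measurable
  then have "(\<lambda>x. \<Sum>k. D k x) \<in> L2" by (simp add: L2_iff)
  moreover have "(\<lambda>x. norm (F 0 x)) \<in> L2"
    by (rule L2_bound_L2[where g = "F 0" and C = 1]) (auto intro: F2)
  ultimately have w2: "w \<in> L2" unfolding w_def by (intro L2_add)
  \<comment> \<open>\<open>lim\<close> is unspecified where the sequence diverges, which happens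
    only on a null set; measurability holds all the same.\<close>
  define f' where "f' x = lim (\<lambda>k. F k x)" for x
  have f'm: "f' \<in> borel_measurable borel" unfolding f'_def by measurable
  have FF: "F k x = F 0 x + (\<Sum>j<k. F (Suc j) x - F j x)" for k x
    by (induction k) auto
  have "AE x in lborel. (\<lambda>k. F k x) \<longlonglongrightarrow> f' x"
    using sumD
  proof eventually_elim
    case (elim x)
    then have "summable (\<lambda>j. F (Suc j) x - F j x)"
      unfolding D_def by (rule summable_norm_cancel)
    then have "(\<lambda>k. F 0 x + (\<Sum>j<k. F (Suc j) x - F j x)) \<longlonglongrightarrow> F 0 x + (\<Sum>j. F (Suc j) x - F j x)"
      by (intro tendsto_intros summable_LIMSEQ)
    then have "(\<lambda>k. F k x) \<longlonglongrightarrow> F 0 x + (\<Sum>j. F (Suc j) x - F j x)"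
      unfolding FF[symmetric] .
    then have "convergent (\<lambda>k. F k x)" by (auto simp: convergent_def)
    then show ?case by (simp add: f'_def convergent_LIMSEQ_iff)
  qed
  moreover have "AE x in lborel. norm (F n x) \<le> w x" for n
    using sumD
  proof eventually_elim
    case (elim x)
    have "norm (F n x) \<le> norm (F 0 x) + norm (\<Sum>j<n. F (Suc j) x - F j x)"
      unfolding FF[of n] by (rule norm_triangle_ineq)
    also have "norm (\<Sum>j<n. F (Suc j) x - F j x) \<le> (\<Sum>j<n. D j x)"
      unfolding D_def by (rule norm_sum)
    also have "\<dots> \<le> (\<Sum>j. D j x)" using elim by (rule sum_le_suminf) (auto simp: D_def)
    finally show ?case by (simp add: w_def)
  qed
  ultimately have "(\<lambda>k. cls (F k)) \<longlonglongrightarrow> cls f'"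
    using w2 by (intro l2_dominated_convergence(3)[where w = w] Fm f'm) (auto simp: L2_iff)
  then have "(X \<circ> r) \<longlonglongrightarrow> cls f'" by (simp add: F_def comp_def)
  then show "convergent X"
    using Cauchy_converges_subseq[OF C r] by (auto simp: convergent_def)
qed

subsection \<open>Smooth functions\<close>

lemma Ck_cont: "Ck k f \<Longrightarrow> continuous_on UNIV f"
  by (cases k) (auto intro!: differentiable_imp_continuous_on simp: differentiable_on_def)

lemma Ck_SucD: "Ck (Suc k) f \<Longrightarrow> Ck k f"
proof (induction k arbitrary: f)
  case 0 then show ?case using Ck_cont[of "Suc 0" f] by simp
next
  case (Suc k) then show ?case by (simp only: Ck.simps) blast
qed

text \<open>\<open>Ck\<close> refers to \<open>frechet_derivative\<close>, which is a choice; by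
  uniqueness of derivatives any explicit family \<open>f'\<close> may stand in for it.\<close>

lemma Ck_SucI:
  assumes "\<And>x. (f has_derivative f' x) (at x)" "\<And>v. Ck k (\<lambda>x. f' x v)"
  shows "Ck (Suc k) f"
proof -
  have "frechet_derivative f (at x) = f' x" for x
    using frechet_derivative_at[OF assms(1)] by metis
  then show ?thesis using assms by (auto simp: differentiable_def)
qed

lemma Ck_SucE:
  assumes "Ck (Suc k) f"
  shows "(f has_derivative frechet_derivative f (at x)) (at x)"
    and "Ck k (\<lambda>x. frechet_derivative f (at x) v)"
  using assms by (auto simp: frechet_derivative_works)

lemma Ck_const: "Ck k (\<lambda>x. c)"
proof (induction k arbitrary: c)
  case (Suc k) show ?case by (rule Ck_SucI[where f' = "\<lambda>_ _. 0"]) (auto simp: Suc)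
qed simp

lemma Ck_add:
  "Ck k f \<Longrightarrow> Ck k g \<Longrightarrow> Ck k (\<lambda>x. f x + g x)"
proof (induction k arbitrary: f g)
  case 0 then show ?case by (auto intro: continuous_on_add)
next
  case (Suc k)
  show ?case
    by (rule Ck_SucI[OF has_derivative_add[OF Ck_SucE(1)[OF Suc.prems(1)] Ck_SucE(1)[OF Suc.prems(2)]]])
      (intro Suc.IH Ck_SucE(2)[OF Suc.prems(1)] Ck_SucE(2)[OF Suc.prems(2)])
qed

lemma Ck_linear:
  assumes "bounded_linear N" "Ck k f" shows "Ck k (\<lambda>x. N (f x))"
  using assms(2)
proof (induction k arbitrary: f)
  case 0 then show ?case by (auto intro: bounded_linear.continuous_on[OF assms(1)])
next
  case (Suc k)
  show ?case
    by (rule Ck_SucI[OF bounded_linear.has_derivative[OF assms(1) Ck_SucE(1)[OF Suc.prems]]])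
      (intro Suc.IH Ck_SucE(2)[OF Suc.prems])
qed

lemma Ck_affine:
  assumes "bounded_linear L" "Ck k f" shows "Ck k (\<lambda>x. f (L x + c))"
  using assms(2)
proof (induction k arbitrary: f)
  case 0
  then show ?case
    by (auto intro!: continuous_on_compose2[of UNIV f] continuous_intros bounded_linear.continuous_on[OF assms(1)])
next
  case (Suc k)
  have L: "((\<lambda>x. L x + c) has_derivative L) (at x)" for x
    by (auto intro!: derivative_eq_intros bounded_linear_imp_has_derivative assms)
  show ?case
    by (rule Ck_SucI[OF has_derivative_compose[OF L Ck_SucE(1)[OF Suc.prems]]])
      (intro Suc.IH Ck_SucE(2)[OF Suc.prems])
qed

text \<open>The product rule leaves an undifferentiated factor in each summand. It is brought down
  to order \<open>k\<close> by \<open>Ck_SucD\<close>, so that the induction hypothesis applies to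
  both summands.\<close>

lemma Ck_scaleR:
  fixes a :: "'a::real_normed_vector \<Rightarrow> real"
  shows "Ck k a \<Longrightarrow> Ck k g \<Longrightarrow> Ck k (\<lambda>x. a x *\<^sub>R g x)"
proof (induction k arbitrary: a g)
  case 0 then show ?case by (auto intro: continuous_on_scaleR)
next
  case (Suc k)
  show ?case
    by (rule Ck_SucI[OF has_derivative_scaleR[OF Ck_SucE(1)[OF Suc.prems(1)] Ck_SucE(1)[OF Suc.prems(2)]]])
      (intro Ck_add Suc.IH Ck_SucE(2)[OF Suc.prems(1)] Ck_SucE(2)[OF Suc.prems(2)] Ck_SucD[OF Suc.prems(1)] Ck_SucD[OF Suc.prems(2)])
qed

lemma Ck_mult:
  fixes f g :: "'a::real_normed_vector \<Rightarrow> real"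
  shows "Ck k f \<Longrightarrow> Ck k g \<Longrightarrow> Ck k (\<lambda>x. f x * g x)"
  using Ck_scaleR[of k f g] by simp

lemma Ck_prod:
  fixes f :: "'i \<Rightarrow> 'a::real_normed_vector \<Rightarrow> real"
  shows "(\<And>i. i \<in> I \<Longrightarrow> Ck k (f i)) \<Longrightarrow> Ck k (\<lambda>x. \<Prod>i\<in>I. f i x)"
  by (induction I rule: infinite_finite_induct) (auto intro: Ck_const Ck_mult)

text \<open>This is y^n e^(-y) at y = 1/x, extended by 0. The power is carried along because
  differentiation maps the family into its own span, so that smoothness of all members follows by
  one induction on the order.\<close>

definition flat_exp :: "nat \<Rightarrow> real \<Rightarrow> real" where
  "flat_exp n x = (if x \<le> 0 then 0 else (1 / x) ^ n * exp (- (1 / x)))"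

lemma flat_tendsto_0: "flat_exp n \<midarrow>0\<rightarrow> 0"
proof (rule filterlim_split_at)
  show "(flat_exp n \<longlongrightarrow> 0) (at_left 0)"
    by (rule tendsto_eventually) (auto simp: flat_exp_def eventually_at_filter)
  have "((\<lambda>y. y ^ n / exp y) \<longlongrightarrow> (0 :: real)) at_top"
    by (rule tendsto_power_div_exp_0)
  moreover have "filterlim (\<lambda>x :: real. inverse x) at_top (at_right 0)"
    by (rule filterlim_inverse_at_top_right)
  ultimately have "((\<lambda>x. (inverse x) ^ n / exp (inverse x)) \<longlongrightarrow> (0 :: real)) (at_right 0)"
    by (rule filterlim_compose)
  moreover have "\<forall>\<^sub>F x in at_right 0. (inverse x) ^ n / exp (inverse x) = flat_exp n x"
    by (auto simp: flat_exp_def eventually_at_filter exp_minus field_simps)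
  ultimately show "(flat_exp n \<longlongrightarrow> 0) (at_right 0)"
    by (rule Lim_transform_eventually)
qed

lemma flat_deriv: "(flat_exp n has_real_derivative flat_exp (n + 2) x - real n * flat_exp (n + 1) x) (at x)"
proof -
  consider "x < 0" | "x = 0" | "x > 0" by linarith
  then show ?thesis
  proof cases
    case 1
    have "((\<lambda>_. 0) has_real_derivative flat_exp (n + 2) x - real n * flat_exp (n + 1) x) (at x)"
      using 1 by (simp add: flat_exp_def)
    then show ?thesis
      by (rule has_field_derivative_transform_within_open[where S = "{..<0}"])
        (use 1 in \<open>auto simp: flat_exp_def\<close>)
  next
    case 2
    \<comment> \<open>At the origin the difference quotient of \<open>flat_exp n\<close> is
      \<open>flat_exp (n + 1)\<close> itself.\<close>
    have "(\<lambda>h. flat_exp (n + 1) h) \<midarrow>0\<rightarrow> 0" by (rule flat_tendsto_0)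
    then have "(\<lambda>h. (flat_exp n (0 + h) - flat_exp n 0) / h) \<midarrow>0\<rightarrow> 0"
      by (rule Lim_transform_eventually) (auto simp: flat_exp_def eventually_at_filter)
    then show ?thesis using 2 by (simp add: DERIV_def flat_exp_def)
  next
    case 3
    define y where "y = 1 / x"
    have "((\<lambda>x. 1 / x) has_real_derivative - (y * y)) (at x)"
      using 3 by (auto intro!: derivative_eq_intros simp: y_def field_simps)
    from DERIV_mult[OF DERIV_power[OF this, of n] DERIV_fun_exp[OF DERIV_minus[OF this]]]
    have "((\<lambda>x. (1 / x) ^ n * exp (- (1 / x))) has_real_derivative flat_exp (n + 2) x - real n * flat_exp (n + 1) x) (at x)"
      by (rule DERIV_cong) (use 3 in \<open>cases n; simp add: flat_exp_def y_def[symmetric] algebra_simps\<close>)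
    then show ?thesis
      by (rule has_field_derivative_transform_within_open[where S = "{0<..}"])
        (use 3 in \<open>auto simp: flat_exp_def\<close>)
  qed
qed

lemma Ck_flat: "Ck k (flat_exp n)"
proof (induction k arbitrary: n)
  case 0
  show ?case using flat_deriv by (auto intro!: DERIV_continuous_on)
next
  case (Suc k)
  have D: "(flat_exp n has_derivative (\<lambda>v. v *\<^sub>R (flat_exp (n + 2) x + (- real n) *\<^sub>R flat_exp (n + 1) x))) (at x)" for x
    using flat_deriv[of n x] unfolding has_field_derivative_def
    by (rule back_subst[of "\<lambda>f. (_ has_derivative f) _"]) (auto simp: fun_eq_iff algebra_simps)
  show ?case
    by (rule Ck_SucI[OF D]) (intro Ck_linear[OF bounded_linear_scaleR_right] Ck_add Suc)
qed

lemma test_fun_iff: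
  fixes f :: "'a::{real_normed_vector, heine_borel} \<Rightarrow> 'b::real_normed_vector"
  shows "test_fun f \<longleftrightarrow> (\<forall>k. Ck k f) \<and> bounded {x. f x \<noteq> 0}"
  by (simp add: test_fun_def compact_closure)

lemma test_fun_cont: "test_fun f \<Longrightarrow> continuous_on UNIV f"
  by (auto simp: test_fun_def dest: Ck_cont)

text \<open>Two flat factors per coordinate make it, for positive \<open>c\<close>, nonzero exactly
  on the open box. The parameter \<open>c\<close> steepens the edges: as it grows, the bump
  approaches the indicator of the box.\<close>

definition box_bump :: "real \<Rightarrow> 'a::euclidean_space \<Rightarrow> 'a \<Rightarrow> 'a \<Rightarrow> real" where
  "box_bump c l u x = (\<Prod>b\<in>Basis. flat_exp 0 (c * (x \<bullet> b) + - (c * (l \<bullet> b))) * flat_exp 0 (- (c * (x \<bullet> b)) + c * (u \<bullet> b)))"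

lemma flat0: "0 \<le> flat_exp 0 x" "flat_exp 0 x \<le> 1" "0 < flat_exp 0 x \<longleftrightarrow> 0 < x"
  by (auto simp: flat_exp_def)

lemma box_bump_bounds: "0 \<le> box_bump c l u x" "box_bump c l u x \<le> 1"
  unfolding box_bump_def by (intro prod_nonneg prod_le_1 conjI mult_le_one mult_nonneg_nonneg flat0 ballI)+

lemma box_bump_pos_iff:
  assumes "c > 0" shows "box_bump c l u x \<noteq> 0 \<longleftrightarrow> x \<in> box l u"
proof -
  have "flat_exp 0 y \<noteq> 0 \<longleftrightarrow> 0 < y" for y by (auto simp: flat_exp_def)
  then show ?thesis
    using assms by (auto simp: box_bump_def box_def mem_box algebra_simps)
qed

lemma test_fun_box_bump:
  assumes "c > 0" shows "test_fun (\<lambda>x. box_bump c l u x *\<^sub>R v)"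
  unfolding test_fun_iff
proof
  have l: "bounded_linear (\<lambda>x. c * (x \<bullet> b))" for b :: 'a
    by (rule bounded_linear_compose[OF bounded_linear_mult_right bounded_linear_inner_left])
  show "\<forall>k. Ck k (\<lambda>x. box_bump c l u x *\<^sub>R v)"
    unfolding box_bump_def
    by (intro allI Ck_scaleR Ck_prod Ck_mult Ck_const Ck_affine[OF l Ck_flat]
        Ck_affine[OF bounded_linear_minus[OF l] Ck_flat])
  have "{x. box_bump c l u x *\<^sub>R v \<noteq> 0} \<subseteq> box l u"
    using box_bump_pos_iff[OF assms, of l u] by auto
  then show "bounded {x. box_bump c l u x *\<^sub>R v \<noteq> 0}"
    by (rule bounded_subset[OF bounded_box])
qed

lemma box_bump_tendsto: "(\<lambda>n. box_bump (real (Suc n)) l u x) \<longlonglongrightarrow> indicator (box l u) x"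
proof (cases "x \<in> box l u")
  case True
  have 1: "(\<lambda>n. flat_exp 0 (real (Suc n) * y)) \<longlonglongrightarrow> 1" if "y > 0" for y
  proof -
    have "(\<lambda>n. exp (- (1 / y * (1 / real (Suc n))))) \<longlonglongrightarrow> exp (- (1 / y * 0))"
      by (intro tendsto_intros LIMSEQ_Suc[OF lim_1_over_n])
    moreover have "flat_exp 0 (real (Suc n) * y) = exp (- (1 / y * (1 / real (Suc n))))" for n
      using that by (auto simp: flat_exp_def mult_le_0_iff mult.commute)
    ultimately show ?thesis by simp
  qed
  have "(\<lambda>n. \<Prod>b\<in>Basis. flat_exp 0 (real (Suc n) * (x \<bullet> b - l \<bullet> b)) * flat_exp 0 (real (Suc n) * (u \<bullet> b - x \<bullet> b)))
      \<longlonglongrightarrow> (\<Prod>b\<in>(Basis::'a set). 1 * 1)"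
    by (intro tendsto_intros 1) (use True in \<open>auto simp: mem_box\<close>)
  then show ?thesis using True by (simp add: box_bump_def algebra_simps)
next
  case False
  then have "box_bump (real (Suc n)) l u x = 0" for n
    using box_bump_pos_iff[of "real (Suc n)" l u x] by auto
  then show ?thesis using False by simp
qed

subsection \<open>Density of the test functions\<close>

lemma compact_support_bound:
  fixes f :: "real ^ 3 \<Rightarrow> 'b::euclidean_space"
  assumes "continuous_on UNIV f" "bounded {x. f x \<noteq> 0}"
  obtains B R where "B \<ge> 0" "R > 0" "\<And>x. norm (f x) \<le> B * indicator (cball 0 R) x"
proof -
  obtain R where R: "R > 0" "\<And>x. f x \<noteq> 0 \<Longrightarrow> norm x \<le> R"
    using assms(2) by (auto simp: bounded_pos)
  have "compact (f ` cball 0 R)"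
    by (rule compact_continuous_image[OF continuous_on_subset[OF assms(1)]]) auto
  then obtain B where B: "B > 0" "\<And>x. norm x \<le> R \<Longrightarrow> norm (f x) \<le> B"
    by (auto simp: bounded_pos dest!: compact_imp_bounded)
  have "norm (f x) \<le> B * indicator (cball 0 R) x" for x
    using R B by (cases "f x = 0") (auto simp: indicator_def)
  then show ?thesis using that R(1) B(1) by (meson less_imp_le)
qed

lemma integrable_indicator_cball [simp]:
  "integrable lborel (\<lambda>x. indicator (cball a R) x :: real)" for a :: "real ^ 3"
  using emeasure_bounded_finite[of "cball a R"] by (simp add: integrable_indicator_iff)

lemma integrable_cball_sq [simp]:
  "integrable lborel (\<lambda>x. (B * indicator (cball a R) x)\<^sup>2 :: real)" for a :: "real ^ 3"
proof -
  have "integrable lborel (\<lambda>x. B\<^sup>2 * indicator (cball a R) x :: real)" by simp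
  moreover have "(B * indicator (cball a R) x)\<^sup>2 = B\<^sup>2 * indicator (cball a R) x" for x
    by (simp add: indicator_def)
  ultimately show ?thesis by simp
qed

lemma compact_support_L2:
  fixes f :: "real ^ 3 \<Rightarrow> 'b::euclidean_space"
  assumes "continuous_on UNIV f" "bounded {x. f x \<noteq> 0}"
  shows "f \<in> L2" "integrable lborel f"
proof -
  obtain B R where BR: "B \<ge> 0" "R > 0" "\<And>x. norm (f x) \<le> B * indicator (cball 0 R) x"
    using compact_support_bound[OF assms] by blast
  have [measurable]: "f \<in> borel_measurable borel" by (rule borel_measurable_continuous_onI[OF assms(1)])
  show "f \<in> L2" by (rule L2_bound[OF _ integrable_cball_sq]) (use BR(3) in auto)
  have "integrable lborel (\<lambda>x :: real ^ 3. B * indicator (cball 0 R) x :: real)"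
    by (intro integrable_mult_right integrable_indicator_cball)
  then show "integrable lborel f"
  proof (rule Bochner_Integration.integrable_bound)
    show "AE x in lborel. norm (f x) \<le> norm (B * indicator (cball 0 R) x :: real)"
      using BR(3) by (intro AE_I2) (auto intro: order_trans[OF _ abs_ge_self])
  qed simp
qed

lemma test_fun_L2: "test_fun f \<Longrightarrow> f \<in> L2"
  and test_fun_integrable: "test_fun f \<Longrightarrow> integrable lborel f"
  for f :: "real ^ 3 \<Rightarrow> 'b::euclidean_space"
  by (auto intro!: compact_support_L2 simp: test_fun_iff dest: Ck_cont)

lemma test_fun_add:
  fixes f g :: "'a::{real_normed_vector, heine_borel} \<Rightarrow> 'b::real_normed_vector"
  assumes "test_fun f" "test_fun g" shows "test_fun (\<lambda>x. f x + g x)"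
proof -
  have "{x. f x + g x \<noteq> 0} \<subseteq> {x. f x \<noteq> 0} \<union> {x. g x \<noteq> 0}" by auto
  then show ?thesis
    using assms by (auto simp: test_fun_iff Ck_add intro: bounded_subset[OF bounded_Un[THEN iffD2]])
qed

lemma test_fun_linear:
  fixes f :: "'a::{real_normed_vector, heine_borel} \<Rightarrow> 'b::real_normed_vector"
  assumes "bounded_linear N" "test_fun f" shows "test_fun (\<lambda>x. N (f x))"
proof -
  have "{x. N (f x) \<noteq> 0} \<subseteq> {x. f x \<noteq> 0}"
    using linear_simps(3)[OF assms(1)] by auto
  then show ?thesis
    using assms by (auto simp: test_fun_iff Ck_linear intro: bounded_subset)
qed

text \<open>A closed subspace. It is shown to be everything by admitting, in turn, indicators of
  boxes, of Borel subsets of a box, of Borel sets of finite measure, and simple functions.\<close>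

definition testcl :: "'b::euclidean_space l2 set" where
  "testcl = closure (cls ` Collect test_fun)"

lemma testcl_lim: "(\<And>n. X n \<in> testcl) \<Longrightarrow> X \<longlonglongrightarrow> a \<Longrightarrow> a \<in> testcl"
  unfolding testcl_def by (rule closed_sequentially[OF closed_closure]) auto

lemma testcl_add: "a \<in> testcl \<Longrightarrow> b \<in> testcl \<Longrightarrow> a + b \<in> testcl"
proof -
  assume "a \<in> testcl" "b \<in> testcl"
  then obtain X Y where X: "\<And>n. X n \<in> cls ` Collect test_fun" "X \<longlonglongrightarrow> a"
    and Y: "\<And>n. Y n \<in> cls ` Collect test_fun" "Y \<longlonglongrightarrow> b"
    unfolding testcl_def closure_sequential by blast
  have "X n + Y n \<in> cls ` Collect test_fun" for n
  proof -
    obtain f g where "test_fun f" "test_fun g" "X n = cls f" "Y n = cls g" using X(1)[of n] Y(1)[of n] by auto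
    then show ?thesis
      by (auto simp: test_fun_add cls_add[symmetric] test_fun_L2 intro!: image_eqI[where x = "\<lambda>x. f x + g x"])
  qed
  moreover have "(\<lambda>n. X n + Y n) \<longlonglongrightarrow> a + b" by (intro tendsto_intros X Y)
  ultimately show ?thesis
    unfolding testcl_def closure_sequential by (intro exI[of _ "\<lambda>n. X n + Y n"]) auto
qed

lemma testcl_scaleR: "a \<in> testcl \<Longrightarrow> c *\<^sub>R a \<in> testcl"
proof -
  assume "a \<in> testcl"
  then obtain X where X: "\<And>n. X n \<in> cls ` Collect test_fun" "X \<longlonglongrightarrow> a"
    unfolding testcl_def closure_sequential by blast
  have "c *\<^sub>R X n \<in> cls ` Collect test_fun" for n
  proof -
    obtain f where "test_fun f" "X n = cls f" using X(1)[of n] by auto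
    then show ?thesis
      by (auto simp: test_fun_linear[OF bounded_linear_scaleR_right] cls_scaleR[symmetric] test_fun_L2
          intro!: image_eqI[where x = "\<lambda>x. c *\<^sub>R f x"])
  qed
  moreover have "(\<lambda>n. c *\<^sub>R X n) \<longlonglongrightarrow> c *\<^sub>R a" by (intro tendsto_intros X)
  ultimately show ?thesis
    unfolding testcl_def closure_sequential by (intro exI[of _ "\<lambda>n. c *\<^sub>R X n"]) auto
qed

lemma testcl_0: "(0 :: 'a::euclidean_space l2) \<in> testcl"
proof -
  have "test_fun (\<lambda>x :: real ^ 3. 0 :: 'a)" by (simp add: test_fun_iff Ck_const)
  then have "cls (\<lambda>x. 0 :: 'a) \<in> cls ` Collect test_fun" by blast
  then show ?thesis
    unfolding testcl_def cls_0 by (rule closure_subset[THEN subsetD])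
qed

lemma testcl_sum: "(\<And>i. i \<in> I \<Longrightarrow> f i \<in> testcl) \<Longrightarrow> (\<Sum>i\<in>I. f i) \<in> testcl"
  by (induction I rule: infinite_finite_induct) (auto intro: testcl_add testcl_0)

lemma ind_L2:
  fixes A :: "(real ^ 3) set"
  assumes "A \<in> sets borel" "emeasure lborel A < \<infinity>"
  shows "integrable lborel (\<lambda>x. (indicator A x * B)\<^sup>2 :: real)"
    and "(\<lambda>x. indicator A x *\<^sub>R c) \<in> L2"
proof -
  have "integrable lborel (\<lambda>x. indicator A x * B\<^sup>2 :: real)" for B
    using assms by (intro integrable_mult_left) (simp add: integrable_indicator_iff)
  moreover have "(indicator A x * B)\<^sup>2 = indicator A x * B\<^sup>2" for x and B :: real
    by (simp add: indicator_def)
  ultimately show *: "integrable lborel (\<lambda>x. (indicator A x * B)\<^sup>2 :: real)" for B by simp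
  show "(\<lambda>x. indicator A x *\<^sub>R c) \<in> L2"
    by (rule L2_bound[OF _ *[of "norm c"]]) (use assms in auto)
qed

lemma testcl_ind_lim:
  fixes A :: "nat \<Rightarrow> (real ^ 3) set"
  assumes "\<And>n. A n \<in> sets borel" "A' \<in> sets borel" "emeasure lborel B < \<infinity>" "B \<in> sets borel"
    and "\<And>n. A n \<subseteq> B" and "\<And>x. (\<lambda>n. indicator (A n) x :: real) \<longlonglongrightarrow> indicator A' x"
    and "\<And>n. cls (\<lambda>x. indicator (A n) x *\<^sub>R c) \<in> testcl"
  shows "cls (\<lambda>x. indicator A' x *\<^sub>R c) \<in> testcl"
proof (rule testcl_lim[OF assms(7)])
  show "(\<lambda>n. cls (\<lambda>x. indicator (A n) x *\<^sub>R c)) \<longlonglongrightarrow> cls (\<lambda>x. indicator A' x *\<^sub>R c)"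
  proof (rule l2_dominated_convergence(3)[where w = "\<lambda>x. indicator B x * norm c"])
    show "AE x in lborel. norm (indicator (A n) x *\<^sub>R c) \<le> indicator B x * norm c" for n
      using assms(5)[of n] by (intro AE_I2) (auto simp: indicator_def)
    show "AE x in lborel. (\<lambda>n. indicator (A n) x *\<^sub>R c) \<longlonglongrightarrow> indicator A' x *\<^sub>R c"
      by (intro AE_I2 tendsto_intros assms)
  qed (use assms in \<open>auto intro!: ind_L2\<close>)
qed

lemma testcl_box: "cls (\<lambda>x. indicator (box l u) x *\<^sub>R c) \<in> testcl"
proof (rule testcl_lim)
  show "(\<lambda>n. cls (\<lambda>x. box_bump (real (Suc n)) l u x *\<^sub>R c)) \<longlonglongrightarrow> cls (\<lambda>x. indicator (box l u) x *\<^sub>R c)"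
  proof (rule l2_dominated_convergence(3)[where w = "\<lambda>x. indicator (box l u) x * norm c"])
    show "(\<lambda>x. box_bump (real (Suc n)) l u x *\<^sub>R c) \<in> borel_measurable borel" for n
      by (rule borel_measurable_continuous_onI, rule test_fun_cont, rule test_fun_box_bump) simp
    show "AE x in lborel. norm (box_bump (real (Suc n)) l u x *\<^sub>R c) \<le> indicator (box l u) x * norm c" for n
    proof (intro AE_I2)
      fix x
      show "norm (box_bump (real (Suc n)) l u x *\<^sub>R c) \<le> indicator (box l u) x * norm c"
      proof (cases "x \<in> box l u")
        case True
        then show ?thesis using box_bump_bounds[of "real (Suc n)" l u x]
          by (simp add: mult_left_le_one_le)
      next
        case False
        then have "box_bump (real (Suc n)) l u x = 0"
          using box_bump_pos_iff[of "real (Suc n)" l u x] by auto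
        then show ?thesis by simp
      qed
    qed
    show "AE x in lborel. (\<lambda>n. box_bump (real (Suc n)) l u x *\<^sub>R c) \<longlonglongrightarrow> indicator (box l u) x *\<^sub>R c"
      by (intro AE_I2 tendsto_intros box_bump_tendsto)
    show "integrable lborel (\<lambda>x. (indicator (box l u) x * norm c)\<^sup>2)"
      by (rule ind_L2(1)) (simp_all add: emeasure_bounded_finite[OF bounded_box, unfolded infinity_ennreal_def])
  qed measurable
  show "cls (\<lambda>x. box_bump (real (Suc n)) l u x *\<^sub>R c) \<in> testcl" for n
    unfolding testcl_def
    by (rule closure_subset[THEN subsetD, OF imageI[OF CollectI]], rule test_fun_box_bump) simp
qed

text \<open>A Dynkin system argument: boxes are stable under intersection and generate the Borel
  sets. The fixed box keeps every set of finite measure, so that complements stay inside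
  \<open>L2\<close>.\<close>

lemma testcl_ind_in_box:
  fixes A :: "(real ^ 3) set"
  assumes "A \<in> sets borel"
  shows "cls (\<lambda>x. indicator (A \<inter> box l u) x *\<^sub>R c) \<in> testcl"
proof -
  let ?G = "range (\<lambda>(a, b). box a b :: (real ^ 3) set)"
  have fin: "emeasure lborel (X \<inter> box l u) < \<infinity>" if "X \<in> sets borel" for X :: "(real ^ 3) set"
    by (rule emeasure_bounded_finite) (rule bounded_subset[OF bounded_box], auto)
  have "Int_stable ?G" by (auto simp: Int_stable_def box_Int_box)
  moreover have "?G \<subseteq> Pow UNIV" by auto
  moreover have "A \<in> sigma_sets UNIV ?G" using assms unfolding borel_eq_box by simp
  ultimately show ?thesis
  proof (induction rule: sigma_sets_induct_disjoint)
    case (basic A) then show ?case by (auto simp: box_Int_box testcl_box)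
  next
    case empty show ?case by (simp add: cls_0 testcl_0)
  next
    case (compl A)
    have A: "A \<in> sets borel" using compl(1) by (simp add: borel_eq_box)
    have "(\<lambda>x. indicator ((UNIV - A) \<inter> box l u) x *\<^sub>R c)
        = (\<lambda>x. indicator (UNIV \<inter> box l u) x *\<^sub>R c + (- 1) *\<^sub>R (indicator (A \<inter> box l u) x *\<^sub>R c))"
      by (auto simp: indicator_def)
    moreover have "cls \<dots> = cls (\<lambda>x. indicator (UNIV \<inter> box l u) x *\<^sub>R c) + (- 1) *\<^sub>R cls (\<lambda>x. indicator (A \<inter> box l u) x *\<^sub>R c)"
      by (subst cls_scaleR[symmetric], (intro ind_L2 fin A, use A in measurable)[1])
        (intro cls_add L2_scaleR ind_L2 fin, use A in measurable)
    ultimately show ?case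
      using testcl_add[OF testcl_box[of l u c] testcl_scaleR[OF compl(2), of "- 1"]] by simp
  next
    case (union F)
    have F: "F i \<in> sets borel" for i using union(2) by (auto simp: borel_eq_box)
    have part: "cls (\<lambda>x. indicator ((\<Union>i<n. F i) \<inter> box l u) x *\<^sub>R c) \<in> testcl" for n :: nat
    proof (induction n)
      case 0 show ?case by (simp add: cls_0 testcl_0)
    next
      case (Suc n)
      have Un: "(\<Union>i<n. F i) \<in> sets borel" using F by blast
      have "F i \<inter> F n = {}" if "i < n" for i
        using union(1) that by (auto simp: disjoint_family_on_def)
      then have "(\<Union>i<n. F i) \<inter> F n = {}" by blast
      then have "(\<lambda>x. indicator ((\<Union>i<Suc n. F i) \<inter> box l u) x *\<^sub>R c)
          = (\<lambda>x. indicator ((\<Union>i<n. F i) \<inter> box l u) x *\<^sub>R c + indicator (F n \<inter> box l u) x *\<^sub>R c)"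
        by (intro ext) (auto simp: indicator_def less_Suc_eq)
      moreover have "cls \<dots> = cls (\<lambda>x. indicator ((\<Union>i<n. F i) \<inter> box l u) x *\<^sub>R c) + cls (\<lambda>x. indicator (F n \<inter> box l u) x *\<^sub>R c)"
        by (intro cls_add ind_L2 fin F Un) (use F Un in measurable)
      ultimately show ?case using testcl_add[OF Suc union(3)[of n]] by simp
    qed
    show ?case
    proof (rule testcl_ind_lim[OF _ _ _ _ _ _ part])
      show "(\<lambda>n. indicator ((\<Union>i<n. F i) \<inter> box l u) x :: real) \<longlonglongrightarrow> indicator ((\<Union> (range F)) \<inter> box l u) x" for x
        unfolding indicator_inter_arith
        by (intro tendsto_intros LIMSEQ_indicator_UN)
      show "emeasure lborel (UNIV \<inter> box l u) < \<infinity>" by (rule fin) simp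
    qed (use F in auto)
  qed
qed

text \<open>\<open>A\<close> is exhausted by its parts in growing cubes, all dominated by the
  indicator of \<open>A\<close>.\<close>

lemma testcl_ind:
  fixes A :: "(real ^ 3) set"
  assumes "A \<in> sets borel" "emeasure lborel A < \<infinity>"
  shows "cls (\<lambda>x. indicator A x *\<^sub>R c) \<in> testcl"
proof (rule testcl_ind_lim[OF _ _ assms(2,1) _ _ testcl_ind_in_box[OF assms(1)]])
  let ?B = "\<lambda>n. box (- (real n *\<^sub>R One)) (real n *\<^sub>R One) :: (real ^ 3) set"
  show "(\<lambda>n. indicator (A \<inter> ?B n) x :: real) \<longlonglongrightarrow> indicator A x" for x
  proof (rule tendsto_eventually)
    have "x \<in> (\<Union>n. ?B n)" unfolding UN_box_eq_UNIV by simp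
    then obtain n where n: "x \<in> ?B n" by blast
    have "x \<in> ?B m" if "m \<ge> n" for m
    proof -
      have "real n \<le> real m" using that by simp
      then show ?thesis using n by (force simp: mem_box)
    qed
    then show "\<forall>\<^sub>F n in sequentially. (indicator (A \<inter> ?B n) x :: real) = indicator A x"
      by (auto simp: eventually_sequentially indicator_def)
  qed
qed (use assms in auto)

theorem testcl_UNIV: "testcl = UNIV"
proof -
  have "a \<in> testcl" for a :: "'a l2"
  proof -
    let ?f = "rp a"
    obtain F where F: "\<And>i. simple_function lborel (F i)" "\<And>x. (\<lambda>i. F i x) \<longlonglongrightarrow> ?f x"
      and Fb: "\<And>i x. norm (F i x) \<le> 2 * norm (?f x)"
      using borel_measurable_implies_sequence_metric[of ?f lborel 0] by (auto simp: rp_measurable)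
    have Fm [measurable]: "F i \<in> borel_measurable borel" for i
      using borel_measurable_simple_function[OF F(1)[of i]] by simp
    have F2: "F i \<in> L2" for i
      by (rule L2_bound_L2[OF Fm rp_L2[of a], where C = 2]) (use Fb in auto)
    have "cls (F i) \<in> testcl" for i
    proof -
      let ?Y = "F i ` UNIV - {0}"
      have fin: "finite ?Y" using simple_functionD(1)[OF F(1)[of i]] by simp
      have meas: "F i -` {y} \<in> sets borel" for y
        using simple_functionD(2)[OF F(1)[of i], of "{y}"] by simp
      have em: "emeasure lborel (F i -` {y}) < \<infinity>" if "y \<in> ?Y" for y
      proof -
        \<comment> \<open>Chebyshev: this function is 1 on the level set of the nonzero value
          \<open>y\<close>, so the indicator of that set is integrable.\<close>
        have "integrable lborel (\<lambda>x. (norm (F i x))\<^sup>2 / (norm y)\<^sup>2)"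
          using F2[of i] by (auto simp: L2_iff)
        then have "integrable lborel (\<lambda>x. indicator (F i -` {y}) x :: real)"
          by (rule Bochner_Integration.integrable_bound) (use meas that in \<open>auto simp: indicator_def\<close>)
        then show ?thesis by (simp add: integrable_indicator_iff)
      qed
      have "F i = (\<lambda>x. \<Sum>y\<in>?Y. indicator (F i -` {y}) x *\<^sub>R y)"
      proof
        fix x
        show "F i x = (\<Sum>y\<in>?Y. indicator (F i -` {y}) x *\<^sub>R y)"
        proof (cases "F i x = 0")
          case False
          then have "(\<Sum>y\<in>?Y. indicator (F i -` {y}) x *\<^sub>R y) = (\<Sum>y\<in>{F i x}. indicator (F i -` {y}) x *\<^sub>R y)"
            by (intro sum.mono_neutral_right fin) (auto simp: indicator_def)
          then show ?thesis by simp
        next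
          case True
          then have "(\<Sum>y\<in>?Y. indicator (F i -` {y}) x *\<^sub>R y) = 0"
            by (intro sum.neutral) (auto simp: indicator_def)
          with True show ?thesis by simp
        qed
      qed
      then have "cls (F i) = cls (\<lambda>x. \<Sum>y\<in>?Y. indicator (F i -` {y}) x *\<^sub>R y)"
        by (rule arg_cong)
      also have "\<dots> = (\<Sum>y\<in>?Y. cls (\<lambda>x. indicator (F i -` {y}) x *\<^sub>R y))"
        by (intro cls_sum ind_L2(2) meas em)
      also have "\<dots> \<in> testcl" by (intro testcl_sum testcl_ind meas em)
      finally show ?thesis .
    qed
    moreover have "(\<lambda>i. cls (F i)) \<longlonglongrightarrow> cls ?f"
    proof (rule l2_dominated_convergence(3)[where w = "\<lambda>x. 2 * norm (?f x)"])
      have "integrable lborel (\<lambda>x. 4 * (norm (?f x))\<^sup>2)" using rp_L2[of a] by (auto simp: L2_iff)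
      then show "integrable lborel (\<lambda>x. (2 * norm (?f x))\<^sup>2)" by (simp add: power_mult_distrib)
    qed (use F Fb in auto)
    ultimately have "cls ?f \<in> testcl" by (rule testcl_lim)
    then show ?thesis by simp
  qed
  then show ?thesis by auto
qed

lemma test_fun_dense:
  "\<exists>f. (\<forall>n. test_fun (f n)) \<and> (\<lambda>n. cls (f n)) \<longlonglongrightarrow> a"
proof -
  have "a \<in> testcl" by (simp add: testcl_UNIV)
  then obtain X where X: "\<And>n. X n \<in> cls ` Collect test_fun" "X \<longlonglongrightarrow> a"
    unfolding testcl_def closure_sequential by blast
  define f where "f n = (SOME g. test_fun g \<and> cls g = X n)" for n
  have "\<exists>g. test_fun g \<and> cls g = X n" for n
    using X(1)[of n] by auto
  then have f: "test_fun (f n) \<and> cls (f n) = X n" for n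
    unfolding f_def by (rule someI_ex)
  then show ?thesis using X(2) by (intro exI[of _ f]) simp
qed

subsection \<open>Measure preserving changes of variables and multipliers\<close>

text \<open>Phrased through the image measure, so that integrals, integrability and null sets
  transfer directly, and translations, the reflection and the linear flows are treated
  alike.\<close>

definition mp :: "(real ^ 3 \<Rightarrow> real ^ 3) \<Rightarrow> bool" where
  "mp E \<longleftrightarrow> E \<in> borel_measurable borel \<and> distr lborel borel E = lborel"

lemma mp_measurable: "mp E \<Longrightarrow> E \<in> borel_measurable borel"
  by (simp add: mp_def)

lemma mp_integral:
  fixes f :: "real ^ 3 \<Rightarrow> 'b::{banach, second_countable_topology}"
  assumes "mp E" "f \<in> borel_measurable borel"
  shows "(\<integral>x. f (E x) \<partial>lborel) = (\<integral>x. f x \<partial>lborel)"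
  using integral_distr[of E lborel borel f] assms by (simp add: mp_def)

lemma mp_integrable:
  fixes f :: "real ^ 3 \<Rightarrow> 'b::{banach, second_countable_topology}"
  assumes "mp E" "f \<in> borel_measurable borel"
  shows "integrable lborel (\<lambda>x. f (E x)) \<longleftrightarrow> integrable lborel f"
  using integrable_distr_eq[of E lborel borel f] assms by (simp add: mp_def)

lemma mp_AE:
  assumes "mp E" "AE x in lborel. P x" shows "AE x in lborel. P (E x)"
proof (rule AE_distrD[where f = E and P = P and M' = borel])
  show "E \<in> lborel \<rightarrow>\<^sub>M borel" using assms(1) by (simp add: mp_def)
  have "distr lborel borel E = lborel" using assms(1) by (simp add: mp_def)
  with assms(2) show "AE x in distr lborel borel E. P x" by (simp only:)
qed

lemma mp_id: "mp (\<lambda>x. x)"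
  using distr_id2[of borel lborel] by (simp add: mp_def)

lemma mp_translation: "mp (\<lambda>x. c + x)"
  using lborel_distr_plus[of c] by (simp add: mp_def)

lemma borel_measurable_matrix_vector [measurable]:
  fixes M :: "real ^ 3 ^ 3" shows "(*v) M \<in> borel_measurable borel"
  by (intro borel_measurable_continuous_onI linear_continuous_on) simp

text \<open>Lebesgue measure is determined by its values on boxes. The preimage of a box under
  \<open>M\<close> is its image under the inverse \<open>N\<close>, which has the same volume
  because \<open>\<bar>det N\<bar> = 1\<close>.\<close>

lemma mp_matrix:
  fixes M N :: "real ^ 3 ^ 3"
  assumes MN: "M ** N = mat 1" and N: "\<bar>det N\<bar> = 1"
  shows "mp ((*v) M)"
proof -
  have NM: "N ** M = mat 1" using MN matrix_left_right_inverse by blast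
  have "lborel = distr lborel borel ((*v) M)"
  proof (rule lborel_eqI)
    fix l u :: "real ^ 3" assume le: "\<And>b. b \<in> Basis \<Longrightarrow> l \<bullet> b \<le> u \<bullet> b"
    have pre: "(*v) M -` box l u = (*v) N ` box l u"
    proof (intro equalityI subsetI)
      fix x assume "x \<in> (*v) M -` box l u"
      then show "x \<in> (*v) N ` box l u"
        by (intro image_eqI[of _ _ "M *v x"]) (auto simp: matrix_vector_mul_assoc NM)
    qed (auto simp: matrix_vector_mul_assoc MN)
    have lm: "(*v) N ` box l u \<in> lmeasurable"
      by (rule measurable_linear_image[OF matrix_vector_mul_linear lmeasurable_box])
    have "emeasure (distr lborel borel ((*v) M)) (box l u) = emeasure lborel ((*v) M -` box l u)"
    proof -
      have "(*v) M \<in> lborel \<rightarrow>\<^sub>M borel" using borel_measurable_matrix_vector[of M] by simp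
      from emeasure_distr[OF this, of "box l u"] show ?thesis by simp
    qed
    also have "\<dots> = emeasure lebesgue ((*v) N ` box l u)"
    proof -
      have "(*v) M -` box l u \<in> sets borel"
        using measurable_sets[OF borel_measurable_matrix_vector, of "box l u" M] by simp
      then have "emeasure lebesgue ((*v) M -` box l u) = emeasure lborel ((*v) M -` box l u)" by simp
      then show ?thesis unfolding pre by (rule sym)
    qed
    also have "\<dots> = ennreal (measure lebesgue ((*v) N ` box l u))"
      by (rule emeasure_eq_measure2[OF lm])
    also have "measure lebesgue ((*v) N ` box l u) = measure lebesgue (box l u)"
      using measure_linear_image[OF matrix_vector_mul_linear[of N] lmeasurable_box[of l u]] N by simp
    also have "\<dots> = (\<Prod>b\<in>Basis. (u - l) \<bullet> b)"
      using le by (simp add: measure_lborel_box_eq)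
    finally show "emeasure (distr lborel borel ((*v) M)) (box l u) = (\<Prod>b\<in>Basis. (u - l) \<bullet> b)" .
  qed simp
  then show ?thesis by (simp add: mp_def)
qed

lemma matrix_neg1_mult: "(- mat 1) *v x = - x" for x :: "real ^ 3"
  by (simp add: vec_eq_iff matrix_vector_mult_def mat_def sum_3 forall_3)

lemma mp_uminus: "mp uminus"
proof -
  have "det (- mat 1 :: real ^ 3 ^ 3) = - 1"
    by (simp add: det_3 mat_def)
  moreover have "(- mat 1) ** (- mat 1) = (mat 1 :: real ^ 3 ^ 3)"
    by (simp add: matrix_matrix_mult_def mat_def vec_eq_iff forall_3 sum_3)
  ultimately have "mp ((*v) (- mat 1))" by (intro mp_matrix[where N = "- mat 1"]) simp_all
  moreover have "(*v) (- mat 1) = (uminus :: real ^ 3 \<Rightarrow> _)" by (rule ext) (rule matrix_neg1_mult)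
  ultimately show ?thesis by (simp only:)
qed

text \<open>\<open>N\<close> acts on the values and \<open>E\<close> on the arguments. Translation,
  reflection, conjugation, real part, complexification and the transport factor are all instances,
  so linearity, bounds and adjoints are proved once.\<close>

definition pull :: "('b::euclidean_space \<Rightarrow> 'c::euclidean_space) \<Rightarrow> (real ^ 3 \<Rightarrow> real ^ 3) \<Rightarrow> 'b l2 \<Rightarrow> 'c l2" where
  "pull N E a = cls (\<lambda>x. N (rp a (E x)))"

lemma L2_mp:
  assumes "mp E" "f \<in> L2" shows "(\<lambda>x. f (E x)) \<in> L2"
proof -
  note [measurable] = L2_measurable[OF assms(2)] mp_measurable[OF assms(1)]
  show ?thesis
    using mp_integrable[OF assms(1), of "\<lambda>x. (norm (f x))\<^sup>2"] assms(2) by (simp add: L2_iff)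
qed

lemma pull_L2: "bounded_linear N \<Longrightarrow> mp E \<Longrightarrow> f \<in> L2 \<Longrightarrow> (\<lambda>x. N (f (E x))) \<in> L2"
  by (rule L2_linear[OF _ L2_mp])

lemma pull_cls:
  assumes "bounded_linear N" "mp E" "f \<in> L2"
  shows "pull N E (cls f) = cls (\<lambda>x. N (f (E x)))"
  unfolding pull_def
proof (rule cls_eqI)
  have "AE x in lborel. rp (cls f) (E x) = f (E x)"
    by (rule mp_AE[OF assms(2) rp_cls[OF assms(3)]])
  then show "AE x in lborel. N (rp (cls f) (E x)) = N (f (E x))" by eventually_elim simp
qed (use assms in \<open>auto intro: pull_L2\<close>)

lemma bounded_linear_pull:
  fixes N :: "'b::euclidean_space \<Rightarrow> 'c::euclidean_space"
  assumes N: "bounded_linear N" and E: "mp E"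
  shows "bounded_linear (pull N E)"
proof (rule bounded_linear_intro)
  fix a b :: "'b l2" and c :: real
  have L: "(\<lambda>x. N (rp a (E x))) \<in> L2" for a using pull_L2[OF N E rp_L2] .
  have "pull N E (a + b) = pull N E (cls (\<lambda>x. rp a x + rp b x))" by (simp add: cls_add)
  also have "\<dots> = cls (\<lambda>x. N (rp a (E x)) + N (rp b (E x)))"
    by (subst pull_cls[OF N E]) (auto simp: L2_add linear_simps[OF N])
  also have "\<dots> = pull N E a + pull N E b"
    using cls_add[OF L L] by (simp add: pull_def)
  finally show "pull N E (a + b) = pull N E a + pull N E b" .
  have "pull N E (c *\<^sub>R a) = pull N E (cls (\<lambda>x. c *\<^sub>R rp a x))" by (simp add: cls_scaleR)
  also have "\<dots> = cls (\<lambda>x. c *\<^sub>R N (rp a (E x)))"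
    by (subst pull_cls[OF N E]) (auto simp: L2_scaleR linear_simps[OF N])
  also have "\<dots> = c *\<^sub>R pull N E a"
    using cls_scaleR[OF L] by (simp add: pull_def)
  finally show "pull N E (c *\<^sub>R a) = c *\<^sub>R pull N E a" .
  have "norm (pull N E a) \<le> onorm N * norm (cls (\<lambda>x. rp a (E x)))"
    unfolding pull_def by (intro norm_cls_le L L2_mp[OF E] rp_L2 onorm_pos_le[OF N] AE_I2 onorm[OF N])
  also have "norm (cls (\<lambda>x. rp a (E x))) = norm a"
  proof -
    have "(norm (cls (\<lambda>x. rp a (E x))))\<^sup>2 = (norm (cls (rp a)))\<^sup>2"
      unfolding norm_cls_sq[OF L2_mp[OF E rp_L2]] norm_cls_sq[OF rp_L2]
      by (rule mp_integral[OF E]) measurable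
    then show ?thesis by simp
  qed
  finally show "norm (pull N E a) \<le> norm a * onorm N" by (simp add: mult.commute)
qed

lemma norm_pull_le:
  assumes N: "bounded_linear N" and E: "mp E" and C: "\<And>v. norm (N v) \<le> C * norm v" "0 \<le> C"
  shows "norm (pull N E a) \<le> C * norm a"
proof -
  have "norm (pull N E a) \<le> C * norm (cls (\<lambda>x. rp a (E x)))"
    unfolding pull_def by (intro norm_cls_le pull_L2[OF N E] L2_mp[OF E] rp_L2 C AE_I2)
  also have "(norm (cls (\<lambda>x. rp a (E x))))\<^sup>2 = (norm (cls (rp a)))\<^sup>2"
    unfolding norm_cls_sq[OF L2_mp[OF E rp_L2]] norm_cls_sq[OF rp_L2]
    by (rule mp_integral[OF E]) measurable
  then have "norm (cls (\<lambda>x. rp a (E x))) = norm a" by simp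
  finally show ?thesis .
qed

lemma pull_pull:
  assumes "bounded_linear N" "mp E" "bounded_linear N'" "mp E'"
  shows "pull N E (pull N' E' a) = pull (\<lambda>v. N (N' v)) (\<lambda>x. E' (E x)) a"
  unfolding pull_def[of N' E'] by (subst pull_cls[OF assms(1,2) pull_L2[OF assms(3,4) rp_L2]]) (simp add: pull_def)

lemma pull_id: "pull (\<lambda>v. v) (\<lambda>x. x) a = a"
  by (simp add: pull_def)

text \<open>Writing the second argument as \<open>E' (E x)\<close> and substituting
  \<open>E x\<close> turns \<open>E\<close> on the first factor into its inverse on the second;
  \<open>N\<close> becomes its transpose.\<close>

lemma inner_pull:
  assumes N: "bounded_linear N" and N': "bounded_linear N'" and NN: "\<And>v w. N v \<bullet> w = v \<bullet> N' w"
    and E: "mp E" and E': "mp E'" and inv: "\<And>x. E' (E x) = x"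
  shows "pull N E a \<bullet> b = a \<bullet> pull N' E' b"
proof -
  note [measurable] = mp_measurable[OF E] mp_measurable[OF E']
  have "pull N E a \<bullet> b = pull N E a \<bullet> cls (rp b)" by simp
  also have "\<dots> = (\<integral>x. N (rp a (E x)) \<bullet> rp b x \<partial>lborel)"
    unfolding pull_def by (rule inner_cls[OF pull_L2[OF N E rp_L2] rp_L2])
  also have "\<dots> = (\<integral>x. rp a (E x) \<bullet> N' (rp b (E' (E x))) \<partial>lborel)"
    by (simp add: NN inv)
  also have "\<dots> = (\<integral>x. rp a x \<bullet> N' (rp b (E' x)) \<partial>lborel)"
    by (rule mp_integral[OF E]) (use L2_measurable[OF pull_L2[OF N' E' rp_L2]] in measurable)
  also have "\<dots> = cls (rp a) \<bullet> pull N' E' b"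
    unfolding pull_def by (rule inner_cls[OF rp_L2 pull_L2[OF N' E' rp_L2], symmetric])
  finally show ?thesis by simp
qed

section \<open>Multiplication by bounded symbols\<close>

definition bmeas :: "(real ^ 3 \<Rightarrow> real) \<Rightarrow> bool" where
  "bmeas k \<longleftrightarrow> k \<in> borel_measurable borel \<and> (\<exists>C. \<forall>x. \<bar>k x\<bar> \<le> C)"

definition mulop :: "(real ^ 3 \<Rightarrow> real) \<Rightarrow> 'b::euclidean_space l2 \<Rightarrow> 'b l2" where
  "mulop k a = cls (\<lambda>x. k x *\<^sub>R rp a x)"

lemma bmeas_measurable: "bmeas k \<Longrightarrow> k \<in> borel_measurable borel"
  by (simp add: bmeas_def)

lemma mulop_L2:
  assumes "bmeas k" "f \<in> L2" shows "(\<lambda>x. k x *\<^sub>R f x) \<in> L2"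
proof -
  note [measurable] = bmeas_measurable[OF assms(1)] L2_measurable[OF assms(2)]
  obtain C where C: "\<And>x. \<bar>k x\<bar> \<le> C" using assms by (auto simp: bmeas_def)
  show ?thesis
    by (rule L2_bound_L2[OF _ assms(2), where C = C]) (auto intro!: mult_right_mono C)
qed

lemma mulop_cls:
  assumes "bmeas k" "f \<in> L2" shows "mulop k (cls f) = cls (\<lambda>x. k x *\<^sub>R f x)"
  unfolding mulop_def
proof (rule cls_eqI)
  show "AE x in lborel. k x *\<^sub>R rp (cls f) x = k x *\<^sub>R f x"
    using rp_cls[OF assms(2)] by eventually_elim simp
qed (use assms in \<open>auto intro: mulop_L2\<close>)

lemma norm_mulop_le:
  assumes "bmeas k" "\<And>x. \<bar>k x\<bar> \<le> C" "0 \<le> C" shows "norm (mulop k a) \<le> C * norm a"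
proof -
  have "norm (mulop k a) \<le> C * norm (cls (rp a))"
    unfolding mulop_def using assms by (intro norm_cls_le mulop_L2 rp_L2 AE_I2) (auto intro: mult_right_mono)
  then show ?thesis by simp
qed

lemma bounded_linear_mulop:
  fixes k :: "real ^ 3 \<Rightarrow> real"
  assumes k: "bmeas k" shows "bounded_linear (mulop k :: 'b::euclidean_space l2 \<Rightarrow> 'b l2)"
proof -
  obtain C where C: "\<And>x. \<bar>k x\<bar> \<le> C" using assms by (auto simp: bmeas_def)
  then have C0: "0 \<le> C" by (rule order_trans[OF abs_ge_zero])
  have L: "(\<lambda>x. k x *\<^sub>R rp a x) \<in> L2" for a :: "'b l2" by (rule mulop_L2[OF k rp_L2])
  show ?thesis
  proof (rule bounded_linear_intro)
    fix a b :: "'b l2" and c :: real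
    have "mulop k (a + b) = mulop k (cls (\<lambda>x. rp a x + rp b x))" by (simp add: cls_add)
    also have "\<dots> = cls (\<lambda>x. k x *\<^sub>R rp a x + k x *\<^sub>R rp b x)"
      by (subst mulop_cls[OF k]) (auto simp: L2_add scaleR_add_right)
    also have "\<dots> = mulop k a + mulop k b" using cls_add[OF L L] by (simp add: mulop_def)
    finally show "mulop k (a + b) = mulop k a + mulop k b" .
    have "mulop k (c *\<^sub>R a) = mulop k (cls (\<lambda>x. c *\<^sub>R rp a x))" by (simp add: cls_scaleR)
    also have "\<dots> = cls (\<lambda>x. c *\<^sub>R (k x *\<^sub>R rp a x))"
      by (subst mulop_cls[OF k]) (auto simp: L2_scaleR mult.commute)
    also have "\<dots> = c *\<^sub>R mulop k a" using cls_scaleR[OF L] by (simp add: mulop_def)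
    finally show "mulop k (c *\<^sub>R a) = c *\<^sub>R mulop k a" .
    show "norm (mulop k a) \<le> norm a * C" using norm_mulop_le[OF k C C0] by (simp add: mult.commute)
  qed
qed

lemma mulop_mulop: "bmeas k \<Longrightarrow> bmeas l \<Longrightarrow> mulop k (mulop l a) = mulop (\<lambda>x. k x * l x) a"
  unfolding mulop_def[of l] by (subst mulop_cls) (auto simp: mulop_L2 mulop_def)

lemma mulop_1: "mulop (\<lambda>x. 1) a = a"
  by (simp add: mulop_def)

lemma inner_mulop: "bmeas k \<Longrightarrow> mulop k a \<bullet> b = a \<bullet> mulop k b"
proof -
  assume k: "bmeas k"
  have "mulop k a \<bullet> cls (rp b) = cls (rp a) \<bullet> mulop k b"
    unfolding mulop_def by (simp only: inner_cls[OF mulop_L2[OF k rp_L2] rp_L2] inner_cls[OF rp_L2 mulop_L2[OF k rp_L2]])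
      simp
  then show ?thesis by simp
qed

lemma bmeas_comp: "bmeas k \<Longrightarrow> mp E \<Longrightarrow> bmeas (\<lambda>x. k (E x))"
  by (auto simp: bmeas_def mp_def)

lemma pull_mulop:
  assumes N: "bounded_linear N" and E: "mp E" and k: "bmeas k"
  shows "pull N E (mulop k a) = mulop (\<lambda>x. k (E x)) (pull N E a)"
  unfolding mulop_def[of k] pull_def[of N E a]
  by (simp add: pull_cls[OF N E mulop_L2[OF k rp_L2]] mulop_cls[OF bmeas_comp[OF k E] pull_L2[OF N E rp_L2]]
      linear_simps[OF N])

subsection \<open>The matrix exponential\<close>

definition mpow :: "real ^ 3 ^ 3 \<Rightarrow> nat \<Rightarrow> real ^ 3 ^ 3" where
  "mpow M k = (((**) M) ^^ k) (mat 1)"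

lemma mpow_0: "mpow M 0 = mat 1" and mpow_Suc: "mpow M (Suc k) = M ** mpow M k"
  by (simp_all add: mpow_def)

lemma mpow_Suc2: "mpow M (Suc k) = mpow M k ** M"
proof (induction k)
  case (Suc k)
  have "mpow M (Suc (Suc k)) = M ** (mpow M k ** M)" by (simp only: mpow_Suc[of M "Suc k"] Suc)
  then show ?case by (simp only: mpow_Suc[of M k] matrix_mul_assoc)
qed (simp add: mpow_0 mpow_Suc)

lemma mpow_scaleR: "mpow (c *\<^sub>R M) k = c ^ k *\<^sub>R mpow M k"
  by (induction k) (simp_all add: mpow_0 mpow_Suc vec_eq_iff matrix_matrix_mult_def sum_distrib_left mult_ac)

lemma mpow_transpose: "mpow (transpose M) k = transpose (mpow M k)"
proof (induction k)
  case 0 show ?case by (simp add: mpow_0 transpose_mat)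
next
  case (Suc k)
  have "transpose (mpow M (Suc k)) = transpose (mpow M k ** M)" by (simp only: mpow_Suc2)
  then show ?case by (simp add: mpow_Suc Suc matrix_transpose_mul)
qed

text \<open>A crude substitute for the operator norm: its powers bound the entries of
  \<open>mpow M k\<close>, and \<open>norm_matrix_le\<close> bounds \<open>X *v v\<close> by
  it.\<close>

definition msum :: "real ^ 3 ^ 3 \<Rightarrow> real" where
  "msum M = 1 + (\<Sum>i\<in>UNIV. \<Sum>j\<in>UNIV. \<bar>M $ i $ j\<bar>)"

lemma msum_ge1: "1 \<le> msum M"
  by (simp add: msum_def sum_nonneg)

lemma mpow_entry_bound: "\<bar>mpow M k $ i $ j\<bar> \<le> msum M ^ k"
proof (induction k arbitrary: i j)
  case 0 show ?case by (simp add: mpow_0 mat_def)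
next
  case (Suc k)
  have "\<bar>mpow M (Suc k) $ i $ j\<bar> \<le> (\<Sum>l\<in>UNIV. \<bar>M $ i $ l * mpow M k $ l $ j\<bar>)"
    by (simp add: mpow_Suc matrix_matrix_mult_def)
  also have "\<dots> \<le> (\<Sum>l\<in>UNIV. \<bar>M $ i $ l\<bar> * msum M ^ k)"
    by (intro sum_mono) (auto simp: abs_mult intro!: mult_left_mono Suc)
  also have "\<dots> = (\<Sum>l\<in>UNIV. \<bar>M $ i $ l\<bar>) * msum M ^ k" by (simp add: sum_distrib_right)
  also have "(\<Sum>l\<in>UNIV. \<bar>M $ i $ l\<bar>) \<le> (\<Sum>i\<in>UNIV. \<Sum>j\<in>UNIV. \<bar>M $ i $ j\<bar>)"
    using member_le_sum[of i UNIV "\<lambda>i. \<Sum>j\<in>UNIV. \<bar>M $ i $ j\<bar>"] by (simp add: sum_nonneg)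
  also have "\<dots> \<le> msum M" by (simp add: msum_def)
  finally show ?case using msum_ge1[of M] by (simp add: mult_right_mono)
qed

lemma mpow_entry_summable: "summable (\<lambda>k. (mpow M k $ i $ j / fact k) * y ^ k)"
proof (rule summable_comparison_test')
  show "summable (\<lambda>k. inverse (fact k) * (msum M * \<bar>y\<bar>) ^ k)" by (rule summable_exp)
  show "norm ((mpow M k $ i $ j / fact k) * y ^ k) \<le> inverse (fact k) * (msum M * \<bar>y\<bar>) ^ k" for k
    using mpow_entry_bound[of M k i j]
    by (simp add: abs_mult power_abs power_mult_distrib divide_inverse mult.assoc mult.left_commute mult_left_mono mult_right_mono)
qed

text \<open>Every entry is an everywhere convergent power series in \<open>t\<close>. This reduces
  the calculus of the matrix exponential to termwise differentiation of real series.\<close>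

lemma mexp_entry: "mexp (t *\<^sub>R M) $ i $ j = (\<Sum>k. (mpow M k $ i $ j / fact k) * t ^ k)"
proof -
  let ?X = "\<lambda>k. (1 / fact k) *\<^sub>R mpow (t *\<^sub>R M) k :: real ^ 3 ^ 3"
  have S: "summable ?X"
  proof (rule summable_comparison_test')
    let ?m = "msum (t *\<^sub>R M)"
    \<comment> \<open>The norm of a matrix is at most the sum of the moduli of its 9
      entries.\<close>
    show "summable (\<lambda>k. 9 * (inverse (fact k) * ?m ^ k))" by (intro summable_mult summable_exp)
    fix k
    have "norm (?X k) \<le> (\<Sum>i\<in>UNIV. \<Sum>j\<in>UNIV. \<bar>?X k $ i $ j\<bar>)"
      unfolding norm_vec_def[where 'b = 3 and 'a = "real ^ 3"]
      by (rule order_trans[OF L2_set_le_sum], rule norm_ge_zero, intro sum_mono norm_le_l1_cart)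
    also have "\<dots> \<le> (\<Sum>i\<in>(UNIV::3 set). \<Sum>j\<in>(UNIV::3 set). inverse (fact k) * ?m ^ k)"
      using mpow_entry_bound[of "t *\<^sub>R M" k]
      by (intro sum_mono) (auto simp: abs_mult divide_inverse intro!: mult_left_mono)
    finally show "norm (?X k) \<le> 9 * (inverse (fact k) * ?m ^ k)" by simp
  qed
  have B: "bounded_linear (\<lambda>X :: real ^ 3 ^ 3. X $ i $ j)"
    by (rule bounded_linear_compose[OF bounded_linear_vec_nth bounded_linear_vec_nth])
  have "(\<Sum>k. ?X k) $ i $ j = (\<Sum>k. ?X k $ i $ j)"
    by (rule bounded_linear.suminf[OF B S])
  then show ?thesis
    by (simp add: mexp_def mpow_def[symmetric] mpow_scaleR mult.commute)
qed

lemma mult_entry: "(X ** Y) $ i $ j = (\<Sum>l\<in>UNIV. X $ i $ l * Y $ l $ j)"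
  by (simp add: matrix_matrix_mult_def)

text \<open>Differentiation cancels one factor of the factorial and leaves
  \<open>mpow M (Suc k)\<close>, from which \<open>M\<close> can be split off on either side. Both
  forms enter the group law, where they cancel.\<close>

lemma mexp_entry_deriv:
  "((\<lambda>t. mexp (t *\<^sub>R M) $ i $ j) has_real_derivative (M ** mexp (t *\<^sub>R M)) $ i $ j) (at t)"
  "((\<lambda>t. mexp (t *\<^sub>R M) $ i $ j) has_real_derivative (mexp (t *\<^sub>R M) ** M) $ i $ j) (at t)"
proof -
  let ?c = "\<lambda>i j k. mpow M k $ i $ j / fact k"
  have D: "((\<lambda>t. mexp (t *\<^sub>R M) $ i $ j) has_real_derivative (\<Sum>k. diffs (?c i j) k * t ^ k)) (at t)"
    unfolding mexp_entry by (rule termdiffs_strong_converges_everywhere[OF mpow_entry_summable])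
  have d: "diffs (?c i j) k = mpow M (Suc k) $ i $ j / fact k" for k
    by (simp add: diffs_def del: of_nat_Suc)
  have "(\<Sum>k. diffs (?c i j) k * t ^ k) = (\<Sum>k. \<Sum>l\<in>UNIV. M $ i $ l * (?c l j k * t ^ k))"
    by (simp add: d mpow_Suc matrix_matrix_mult_def sum_divide_distrib sum_distrib_right mult.assoc)
  also have "\<dots> = (\<Sum>l\<in>UNIV. \<Sum>k. M $ i $ l * (?c l j k * t ^ k))"
    by (rule suminf_sum) (intro summable_mult mpow_entry_summable)
  also have "\<dots> = (M ** mexp (t *\<^sub>R M)) $ i $ j"
    unfolding mult_entry mexp_entry by (intro sum.cong refl suminf_mult mpow_entry_summable)
  finally show "((\<lambda>t. mexp (t *\<^sub>R M) $ i $ j) has_real_derivative (M ** mexp (t *\<^sub>R M)) $ i $ j) (at t)"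
    using D by simp
  have "(\<Sum>k. diffs (?c i j) k * t ^ k) = (\<Sum>k. \<Sum>l\<in>UNIV. M $ l $ j * (?c i l k * t ^ k))"
    by (simp add: d mpow_Suc2 matrix_matrix_mult_def sum_divide_distrib sum_distrib_left sum_distrib_right mult_ac)
  also have "\<dots> = (\<Sum>l\<in>UNIV. \<Sum>k. M $ l $ j * (?c i l k * t ^ k))"
    by (rule suminf_sum) (intro summable_mult mpow_entry_summable)
  also have "\<dots> = (mexp (t *\<^sub>R M) ** M) $ i $ j"
    unfolding mult_entry mexp_entry
    by (intro sum.cong refl) (subst suminf_mult[OF mpow_entry_summable], rule mult.commute)
  finally show "((\<lambda>t. mexp (t *\<^sub>R M) $ i $ j) has_real_derivative (mexp (t *\<^sub>R M) ** M) $ i $ j) (at t)"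
    using D by simp
qed

lemma mexp_0: "mexp 0 = mat 1"
proof -
  have "mexp (0 *\<^sub>R mat 1) $ i $ j = mat 1 $ i $ j" for i j
    unfolding mexp_entry using suminf_finite[of "{0}" "\<lambda>k. (mpow (mat 1) k $ i $ j / fact k) * 0 ^ k"]
    by (simp add: mpow_0)
  then show ?thesis by (simp add: vec_eq_iff)
qed

text \<open>With the total time \<open>c\<close> fixed, the product of the exponentials at times
  \<open>s\<close> and \<open>c - s\<close> has derivative
  \<open>E(s) M E(c - s) - E(s) M E(c - s)\<close>, hence does not depend on
  \<open>s\<close>.\<close>

lemma mexp_group: "mexp (s *\<^sub>R M) ** mexp (r *\<^sub>R M) = mexp ((s + r) *\<^sub>R M)"
proof -
  let ?E = "\<lambda>t. mexp (t *\<^sub>R M)"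
  have "(?E s ** ?E (c - s)) $ i $ j = (?E 0 ** ?E (c - 0)) $ i $ j" for c i j
  proof (rule DERIV_isconst_all[of "\<lambda>s. (?E s ** ?E (c - s)) $ i $ j" s 0], intro allI)
    fix s
    have D: "((\<lambda>s. ?E (c - s) $ l $ j) has_real_derivative - ((M ** ?E (c - s)) $ l $ j)) (at s)" for l
    proof -
      have "((\<lambda>s. c - s) has_real_derivative - 1) (at s)" by (auto intro!: derivative_eq_intros)
      from DERIV_chain2[OF mexp_entry_deriv(1) this] show ?thesis by simp
    qed
    have "((\<lambda>s. (?E s ** ?E (c - s)) $ i $ j) has_real_derivative
        (\<Sum>l\<in>UNIV. (?E s ** M) $ i $ l * ?E (c - s) $ l $ j + - ((M ** ?E (c - s)) $ l $ j) * ?E s $ i $ l)) (at s)"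
      unfolding mult_entry[of "?E _" "?E _"]
      by (intro DERIV_sum DERIV_mult mexp_entry_deriv(2) D)
    moreover have "(\<Sum>l\<in>UNIV. (?E s ** M) $ i $ l * ?E (c - s) $ l $ j + - ((M ** ?E (c - s)) $ l $ j) * ?E s $ i $ l)
        = ((?E s ** M) ** ?E (c - s)) $ i $ j - (?E s ** (M ** ?E (c - s))) $ i $ j"
      by (simp add: mult_entry[of "?E s ** M" "?E (c - s)"] mult_entry[of "?E s" "M ** ?E (c - s)"]
          sum_subtractf mult.commute)
    ultimately show "((\<lambda>s. (?E s ** ?E (c - s)) $ i $ j) has_real_derivative 0) (at s)"
      by (simp add: matrix_mul_assoc)
  qed
  from this[of "s + r"] show ?thesis by (simp add: vec_eq_iff mexp_0)
qed

lemma mexp_inverse: "mexp (t *\<^sub>R M) ** mexp ((- t) *\<^sub>R M) = mat 1"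
  using mexp_group[of t M "- t"] by (simp add: mexp_0)

lemma mexp_transpose: "mexp (t *\<^sub>R transpose M) = transpose (mexp (t *\<^sub>R M))"
  by (simp add: vec_eq_iff mexp_entry mpow_transpose) (simp add: transpose_def mexp_entry)

text \<open>Liouville's formula: the determinant has derivative \<open>trace M\<close> times itself,
  which is zero. The 3 by 3 determinant is expanded and the last diagonal entry eliminated by
  \<open>tr\<close>, which leaves a polynomial identity.\<close>

lemma det_mexp:
  assumes "trace M = 0" shows "det (mexp (t *\<^sub>R M)) = 1"
proof -
  let ?E = "\<lambda>t. mexp (t *\<^sub>R M)"
  have tr: "M $ 3 $ 3 = - M $ 1 $ 1 - M $ 2 $ 2" using assms by (simp add: trace_def sum_3)
  have "det (?E t) = det (?E 0)"
  proof (rule DERIV_isconst_all[of "\<lambda>t. det (?E t)" t 0], intro allI)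
    fix t
    note E = mexp_entry_deriv(1)[of M _ _ t, unfolded matrix_matrix_mult_def vec_lambda_beta sum_3]
    show "((\<lambda>t. det (?E t)) has_real_derivative 0) (at t)"
      unfolding det_3
      by (rule derivative_eq_intros E | rule refl)+ (simp add: tr, algebra)
  qed
  then show ?thesis by (simp add: mexp_0)
qed

lemma continuous_mexp_entry: "continuous_on S (\<lambda>t. mexp (t *\<^sub>R M) $ i $ j)"
  by (rule DERIV_continuous_on, rule has_field_derivative_at_within, rule mexp_entry_deriv(1))

lemma mp_mexp: "trace M = 0 \<Longrightarrow> mp ((*v) (mexp (t *\<^sub>R M)))"
  by (rule mp_matrix[OF mexp_inverse]) (simp add: det_mexp del: scaleR_minus_left)

subsection \<open>The Fourier transform on integrable functions\<close>

text \<open>On \<open>complex ^ 3\<close> the inner product is the real part of the Hermitian one,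
  so the real adjoint of multiplication by \<open>c\<close> is multiplication by its conjugate. This
  is what exchanges the kernels of the two Fourier transforms.\<close>

lemma vs_inner: "(c *s v) \<bullet> w = v \<bullet> (cnj c *s w)" for v w :: "complex ^ 3"
  by (simp add: inner_vec_def inner_complex_def algebra_simps)

lemma norm_vs: "norm (c *s v) = cmod c * norm v" for v :: "complex ^ 3"
  by (simp add: norm_vec_def L2_set_def norm_mult power_mult_distrib flip: sum_distrib_left)
    (simp add: real_sqrt_mult)

lemma bounded_linear_vs: "bounded_linear (\<lambda>v :: complex ^ 3. c *s v)"
  by (rule bounded_linear_intro[where K = "cmod c"])
    (auto simp: norm_vs vec_eq_iff algebra_simps scaleR_conv_of_real)

lemma of_real_vs: "complex_of_real r *s v = r *\<^sub>R v" for v :: "complex ^ 3"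
  by (simp add: vec_eq_iff scaleR_conv_of_real[where 'a = complex])

lemma measurable_vs [measurable (raw)]:
  fixes f :: "'a \<Rightarrow> complex ^ 3"
  assumes "c \<in> borel_measurable M" "f \<in> borel_measurable M"
  shows "(\<lambda>x. c x *s f x) \<in> borel_measurable M"
proof (rule borel_measurable_continuous_Pair[OF assms, where H = "\<lambda>a v. a *s v"])
  show "continuous_on UNIV (\<lambda>x. fst x *s (snd x :: complex ^ 3))"
    unfolding vector_scalar_mult_def by (intro continuous_intros)
qed

lemma measurable_cis [measurable (raw)]:
  "f \<in> borel_measurable M \<Longrightarrow> (\<lambda>x. cis (f x)) \<in> borel_measurable M"
  by (rule borel_measurable_continuous_on[of cis]) (auto intro: continuous_intros)

lemma norm_cis_vs: "norm (cis a *s v) = norm v" for v :: "complex ^ 3"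
  by (simp add: norm_vs)

lemma integrable_cis_vs:
  fixes f :: "'a \<Rightarrow> complex ^ 3"
  assumes "integrable M f" "k \<in> borel_measurable M" shows "integrable M (\<lambda>x. cis (k x) *s f x)"
  by (rule Bochner_Integration.integrable_bound[OF assms(1)]) (use assms in \<open>auto simp: norm_cis_vs\<close>)

lemma fourier_L1_measurable:
  assumes "integrable lborel f" shows "fourier_L1 f \<in> borel_measurable borel"
proof -
  have [measurable]: "f \<in> borel_measurable borel" using borel_measurable_integrable[OF assms] by simp
  show ?thesis
    unfolding fourier_L1_def[abs_def] by (intro lborel.borel_measurable_lebesgue_integral) measurable
qed

lemma inv_fourier_L1_eq: "inv_fourier_L1 f x = fourier_L1 f (- x)"
  by (simp add: inv_fourier_L1_def fourier_L1_def inner_commute)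

lemma fourier_L1_add:
  "integrable lborel f \<Longrightarrow> integrable lborel g \<Longrightarrow> fourier_L1 (\<lambda>x. f x + g x) = (\<lambda>\<xi>. fourier_L1 f \<xi> + fourier_L1 g \<xi>)"
  unfolding fourier_L1_def
  by (intro ext) (simp add: linear_simps[OF bounded_linear_vs] integrable_cis_vs)

lemma fourier_L1_linear:
  assumes "integrable lborel f" "bounded_linear N" "\<And>c v. N (c *s v) = c *s N v"
  shows "fourier_L1 (\<lambda>x. N (f x)) = (\<lambda>\<xi>. N (fourier_L1 f \<xi>))"
  unfolding fourier_L1_def assms(3)[symmetric]
  by (intro ext integral_bounded_linear[OF assms(2)] integrable_cis_vs assms(1)) measurable

lemma norm_fourier_L1: "norm (fourier_L1 f \<xi>) \<le> (\<integral>x. norm (f x) \<partial>lborel)"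
  unfolding fourier_L1_def by (rule order_trans[OF integral_norm_bound]) (simp add: norm_cis_vs)

text \<open>Supplies the hypothesis of Fubini's theorem for \<open>fourier_L1_adjoint\<close> and
  \<open>fourier_L1_mult\<close>: a product of integrable functions of separate variables is an
  integrable majorant.\<close>

lemma integrable_prod_bound:
  fixes f :: "real ^ 3 \<Rightarrow> 'b::euclidean_space" and g :: "real ^ 3 \<Rightarrow> 'c::euclidean_space"
    and H :: "real ^ 3 \<Rightarrow> real ^ 3 \<Rightarrow> 'd::euclidean_space"
  assumes f: "integrable lborel f" and g: "integrable lborel g"
    and H: "case_prod H \<in> borel_measurable (lborel \<Otimes>\<^sub>M lborel)"
    and le: "\<And>x y. norm (H x y) \<le> norm (f x) * norm (g y)"
  shows "integrable (lborel \<Otimes>\<^sub>M lborel) (case_prod H)"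
proof (rule Bochner_Integration.integrable_bound)
  note [measurable] = borel_measurable_integrable[OF f] borel_measurable_integrable[OF g]
  show "integrable (lborel \<Otimes>\<^sub>M lborel) (\<lambda>(x, y). norm (f x) * norm (g y))"
  proof (rule lborel_pair.Fubini_integrable)
    show "(\<lambda>(x, y). norm (f x) * norm (g y)) \<in> borel_measurable (lborel \<Otimes>\<^sub>M lborel)" by measurable
    show "integrable lborel (\<lambda>x. \<integral>y. norm (case (x, y) of (x, y) \<Rightarrow> norm (f x) * norm (g y)) \<partial>lborel)"
      using f g by (simp add: abs_mult)
    show "AE x in lborel. integrable lborel (\<lambda>y. case (x, y) of (x, y) \<Rightarrow> norm (f x) * norm (g y))"
      using g by simp
  qed
qed (use H le in auto)

lemma fourier_L1_adjoint:
  assumes f: "integrable lborel f" and g: "integrable lborel g"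
  shows "(\<integral>\<xi>. fourier_L1 f \<xi> \<bullet> g \<xi> \<partial>lborel) = (\<integral>x. f x \<bullet> inv_fourier_L1 g x \<partial>lborel)"
proof -
  note [measurable] = borel_measurable_integrable[OF f] borel_measurable_integrable[OF g]
  let ?H = "\<lambda>x \<xi>. (cis (- 2 * pi * (\<xi> \<bullet> x)) *s f x) \<bullet> g \<xi>"
  have i: "integrable (lborel \<Otimes>\<^sub>M lborel) (case_prod ?H)"
  proof (rule integrable_prod_bound[OF f g])
    show "norm (?H x y) \<le> norm (f x) * norm (g y)" for x y
      using Cauchy_Schwarz_ineq2[of "cis (- 2 * pi * (y \<bullet> x)) *s f x" "g y"] by (simp only: norm_cis_vs real_norm_def)
  qed measurable
  have "(\<integral>\<xi>. fourier_L1 f \<xi> \<bullet> g \<xi> \<partial>lborel) = (\<integral>\<xi>. \<integral>x. ?H x \<xi> \<partial>lborel \<partial>lborel)"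
    unfolding fourier_L1_def
    by (intro Bochner_Integration.integral_cong refl integral_inner_left[symmetric] integrable_cis_vs f) measurable
  also have "\<dots> = (\<integral>x. \<integral>\<xi>. ?H x \<xi> \<partial>lborel \<partial>lborel)"
    by (rule lborel_pair.Fubini_integral[OF i])
  also have "\<dots> = (\<integral>x. \<integral>\<xi>. f x \<bullet> (cis (2 * pi * (\<xi> \<bullet> x)) *s g \<xi>) \<partial>lborel \<partial>lborel)"
    by (simp add: vs_inner cis_cnj)
  also have "\<dots> = (\<integral>x. f x \<bullet> inv_fourier_L1 g x \<partial>lborel)"
    unfolding inv_fourier_L1_def
    by (intro Bochner_Integration.integral_cong refl integral_inner_right integrable_cis_vs g) measurable
  finally show ?thesis .
qed

text \<open>Fubini with a scalar weight. For a Gaussian times a character the inner integral on the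
  right is again a Gaussian, which gives the regularised inversion formula.\<close>

lemma fourier_L1_mult:
  fixes k :: "real ^ 3 \<Rightarrow> complex"
  assumes f: "integrable lborel f" and k: "integrable lborel k"
  shows "(\<integral>\<xi>. k \<xi> *s fourier_L1 f \<xi> \<partial>lborel) = (\<integral>y. (\<integral>\<xi>. k \<xi> * cis (- 2 * pi * (\<xi> \<bullet> y)) \<partial>lborel) *s f y \<partial>lborel)"
proof -
  note [measurable] = borel_measurable_integrable[OF f] borel_measurable_integrable[OF k]
  let ?H = "\<lambda>y \<xi>. (k \<xi> * cis (- 2 * pi * (\<xi> \<bullet> y))) *s f y"
  have i: "integrable (lborel \<Otimes>\<^sub>M lborel) (case_prod ?H)"
  proof (rule integrable_prod_bound[OF f k])
    show "norm (?H x y) \<le> norm (f x) * norm (k y)" for x y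
      by (simp add: norm_vs norm_mult)
  qed measurable
  have kc: "integrable lborel (\<lambda>\<xi>. k \<xi> * cis (- 2 * pi * (\<xi> \<bullet> y)))" for y
    by (rule Bochner_Integration.integrable_bound[OF k]) (auto simp: norm_mult)
  have "(\<integral>\<xi>. k \<xi> *s fourier_L1 f \<xi> \<partial>lborel) = (\<integral>\<xi>. \<integral>y. ?H y \<xi> \<partial>lborel \<partial>lborel)"
  proof (intro Bochner_Integration.integral_cong refl)
    fix \<xi>
    have "k \<xi> *s fourier_L1 f \<xi> = (\<integral>y. k \<xi> *s (cis (- 2 * pi * (\<xi> \<bullet> y)) *s f y) \<partial>lborel)"
      unfolding fourier_L1_def
      by (rule integral_bounded_linear[OF bounded_linear_vs integrable_cis_vs[OF f], symmetric]) measurable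
    then show "k \<xi> *s fourier_L1 f \<xi> = (\<integral>y. ?H y \<xi> \<partial>lborel)"
      by (simp add: vector_smult_assoc)
  qed
  also have "\<dots> = (\<integral>y. \<integral>\<xi>. ?H y \<xi> \<partial>lborel \<partial>lborel)"
    by (rule lborel_pair.Fubini_integral[OF i])
  also have "\<dots> = (\<integral>y. (\<integral>\<xi>. k \<xi> * cis (- 2 * pi * (\<xi> \<bullet> y)) \<partial>lborel) *s f y \<partial>lborel)"
  proof (intro Bochner_Integration.integral_cong refl)
    fix y
    have "bounded_linear (\<lambda>c. c *s f y)"
      by (rule bounded_linear_intro[where K = "norm (f y)"])
        (auto simp: norm_vs vec_eq_iff algebra_simps)
    from integral_bounded_linear[OF this kc]
    show "(\<integral>\<xi>. ?H y \<xi> \<partial>lborel) = (\<integral>\<xi>. k \<xi> * cis (- 2 * pi * (\<xi> \<bullet> y)) \<partial>lborel) *s f y" .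
  qed
  finally show ?thesis .
qed

subsection \<open>Gaussians\<close>

text \<open>Lebesgue measure on the space is the image of a product of three one-dimensional ones,
  so functions that separate over the coordinates integrate factor by factor.\<close>

lemma lborel_prod_integral:
  fixes f :: "real ^ 3 \<Rightarrow> real \<Rightarrow> complex"
  assumes f: "\<And>b. b \<in> Basis \<Longrightarrow> integrable lborel (f b)"
  shows "integrable lborel (\<lambda>x. \<Prod>b\<in>Basis. f b (x \<bullet> b))"
    and "(\<integral>x. (\<Prod>b\<in>Basis. f b (x \<bullet> b)) \<partial>lborel) = (\<Prod>b\<in>Basis. \<integral>x. f b x \<partial>lborel)"
proof -
  interpret product_sigma_finite "\<lambda>_ :: real ^ 3. lborel :: real measure" by standard
  have m [measurable]: "f b \<in> borel_measurable borel" if "b \<in> Basis" for b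
    using borel_measurable_integrable[OF f[OF that]] by simp
  let ?T = "\<lambda>g. \<Sum>b\<in>Basis. g b *\<^sub>R b :: real ^ 3"
  have T: "?T \<in> (\<Pi>\<^sub>M b\<in>Basis. lborel) \<rightarrow>\<^sub>M borel" by measurable
  have M: "(\<lambda>x. \<Prod>b\<in>Basis. f b (x \<bullet> b)) \<in> borel_measurable borel" by measurable
  have TT: "(\<Prod>b\<in>Basis. f b (?T g \<bullet> b)) = (\<Prod>b\<in>Basis. f b (g b))" for g
    by (intro prod.cong refl) (simp add: inner_sum_left inner_Basis if_distrib cong: if_cong)
  show "integrable lborel (\<lambda>x. \<Prod>b\<in>Basis. f b (x \<bullet> b))"
    unfolding lborel_eq[where 'a = "real ^ 3"] integrable_distr_eq[OF T M] TT
    by (rule product_integrable_prod[OF finite_Basis f])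
  show "(\<integral>x. (\<Prod>b\<in>Basis. f b (x \<bullet> b)) \<partial>lborel) = (\<Prod>b\<in>Basis. \<integral>x. f b x \<partial>lborel)"
    unfolding lborel_eq[where 'a = "real ^ 3"] integral_distr[OF T M] TT
    by (rule product_integral_prod[OF finite_Basis f])
qed

text \<open>This is the characteristic function of the standard normal law;
  \<open>sqrt (2 * pi)\<close> undoes the normalisation of its density.\<close>

lemma gauss_1d:
  shows "integrable lborel (\<lambda>x. complex_of_real (exp (- x\<^sup>2 / 2)) * cis (s * x))"
    and "(\<integral>x. complex_of_real (exp (- x\<^sup>2 / 2)) * cis (s * x) \<partial>lborel)
      = complex_of_real (sqrt (2 * pi) * exp (- s\<^sup>2 / 2))"
proof -
  have g: "complex_of_real (exp (- x\<^sup>2 / 2)) * cis (s * x)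
      = complex_of_real (sqrt (2 * pi)) * (std_normal_density x *\<^sub>R iexp (s * x))" for x
    by (simp add: std_normal_density_def cis_conv_exp scaleR_conv_of_real field_simps)
  have i: "integrable lborel (\<lambda>x. std_normal_density x *\<^sub>R iexp (s * x))"
    by (rule Bochner_Integration.integrable_bound[OF integrable_normal_density[of 1 0]]) auto
  then show "integrable lborel (\<lambda>x. complex_of_real (exp (- x\<^sup>2 / 2)) * cis (s * x))"
    unfolding g by (rule integrable_mult_right)
  have "complex_of_real (exp (- s\<^sup>2 / 2)) = char std_normal_distribution s"
    by (simp add: char_std_normal_distribution)
  also have "\<dots> = (\<integral>x. std_normal_density x *\<^sub>R iexp (s * x) \<partial>lborel)"
    unfolding char_def by (rule integral_density) auto
  finally have X: "(\<integral>x. std_normal_density x *\<^sub>R iexp (s * x) \<partial>lborel) = complex_of_real (exp (- s\<^sup>2 / 2))" ..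
  show "(\<integral>x. complex_of_real (exp (- x\<^sup>2 / 2)) * cis (s * x) \<partial>lborel)
      = complex_of_real (sqrt (2 * pi) * exp (- s\<^sup>2 / 2))"
    unfolding g integral_mult_right_zero X by simp
qed

definition gauss :: "real ^ 3 \<Rightarrow> real" where "gauss x = exp (- (norm x)\<^sup>2 / 2)"

lemma gauss_bounds: "0 < gauss x" "gauss x \<le> 1"
  by (auto simp: gauss_def)

lemma gauss_measurable [measurable]: "gauss \<in> borel_measurable borel"
  unfolding gauss_def[abs_def] by measurable

lemma gauss_prod: "gauss x = (\<Prod>b\<in>Basis. exp (- (x \<bullet> b)\<^sup>2 / 2))"
proof -
  have "(norm x)\<^sup>2 = (\<Sum>b\<in>Basis. (x \<bullet> b)\<^sup>2)"
    unfolding power2_norm_eq_inner by (subst euclidean_inner) (simp add: power2_eq_square)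
  then show ?thesis by (simp add: gauss_def sum_negf sum_divide_distrib flip: exp_sum)
qed

lemma cis_sum: "finite I \<Longrightarrow> cis (\<Sum>i\<in>I. f i) = (\<Prod>i\<in>I. cis (f i))"
  by (induction I rule: finite_induct) (auto simp flip: cis_mult)

lemma gauss_cis_prod:
  "complex_of_real (gauss x) * cis (z \<bullet> x) = (\<Prod>b\<in>Basis. complex_of_real (exp (- (x \<bullet> b)\<^sup>2 / 2)) * cis ((z \<bullet> b) * (x \<bullet> b)))"
  by (simp add: gauss_prod prod.distrib euclidean_inner[of z x] cis_sum)

lemma gauss_ft:
  shows "integrable lborel (\<lambda>x. complex_of_real (gauss x) * cis (z \<bullet> x))"
    and "(\<integral>x. complex_of_real (gauss x) * cis (z \<bullet> x) \<partial>lborel) = complex_of_real ((sqrt (2 * pi)) ^ 3 * gauss z)"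
proof -
  show "integrable lborel (\<lambda>x. complex_of_real (gauss x) * cis (z \<bullet> x))"
    unfolding gauss_cis_prod
    by (rule lborel_prod_integral(1)[of "\<lambda>b t. complex_of_real (exp (- t\<^sup>2 / 2)) * cis ((z \<bullet> b) * t)"]) (rule gauss_1d)
  have "(\<integral>x. complex_of_real (gauss x) * cis (z \<bullet> x) \<partial>lborel)
      = (\<Prod>b\<in>Basis. complex_of_real (sqrt (2 * pi) * exp (- (z \<bullet> b)\<^sup>2 / 2)))"
    unfolding gauss_cis_prod gauss_1d(2)[symmetric]
    by (rule lborel_prod_integral(2)[of "\<lambda>b t. complex_of_real (exp (- t\<^sup>2 / 2)) * cis ((z \<bullet> b) * t)"]) (rule gauss_1d)
  also have "\<dots> = complex_of_real ((sqrt (2 * pi)) ^ 3 * gauss z)"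
    by (simp add: prod.distrib gauss_prod)
  finally show "(\<integral>x. complex_of_real (gauss x) * cis (z \<bullet> x) \<partial>lborel) = complex_of_real ((sqrt (2 * pi)) ^ 3 * gauss z)" .
qed

lemma gauss_integral:
  shows "integrable lborel gauss" and "(\<integral>x. gauss x \<partial>lborel) = (sqrt (2 * pi)) ^ 3"
proof -
  have "integrable lborel (\<lambda>x. complex_of_real (gauss x))" using gauss_ft(1)[of 0] by simp
  then show "integrable lborel gauss" by (simp add: complex_of_real_integrable_eq)
  have "complex_of_real (\<integral>x. gauss x \<partial>lborel) = complex_of_real ((sqrt (2 * pi)) ^ 3)"
    using gauss_ft(2)[of 0] by (simp add: gauss_def)
  then show "(\<integral>x. gauss x \<partial>lborel) = (sqrt (2 * pi)) ^ 3" by (simp only: of_real_eq_iff)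
qed

lemma lborel_scale:
  fixes h :: "real ^ 3 \<Rightarrow> 'b::{banach, second_countable_topology}"
  assumes [measurable]: "h \<in> borel_measurable borel" and "s > 0"
  shows "(\<integral>x. h x \<partial>lborel) = s ^ 3 *\<^sub>R (\<integral>x. h (s *\<^sub>R x) \<partial>lborel)"
    and "integrable lborel h \<longleftrightarrow> integrable lborel (\<lambda>x. h (s *\<^sub>R x))"
proof -
  have L: "lborel = density (distr lborel borel (\<lambda>x :: real ^ 3. s *\<^sub>R x)) (\<lambda>_. ennreal (s ^ 3))"
    using lborel_affine[of s "0 :: real ^ 3"] \<open>s > 0\<close> by simp
  show "(\<integral>x. h x \<partial>lborel) = s ^ 3 *\<^sub>R (\<integral>x. h (s *\<^sub>R x) \<partial>lborel)"
    by (subst L, subst integral_density) (use \<open>s > 0\<close> in \<open>auto simp: integral_distr\<close>)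
  show "integrable lborel h \<longleftrightarrow> integrable lborel (\<lambda>x. h (s *\<^sub>R x))"
    by (subst L, subst integrable_density)
      (use \<open>s > 0\<close> integrable_scaleR_right[of "1 / s ^ 3" lborel "\<lambda>x. s ^ 3 *\<^sub>R h (s *\<^sub>R x)"]
        in \<open>auto simp: integrable_distr_eq\<close>)
qed

subsection \<open>Continuity of translations and the Plancherel theorem\<close>

text \<open>Three-term splitting: \<open>a\<close> is replaced by a nearby test function, at a cost
  controlled by the uniform bound \<open>C\<close> and by the norm of \<open>V\<close>.\<close>

lemma strong_limit_dense:
  fixes U :: "'i \<Rightarrow> 'b::euclidean_space l2 \<Rightarrow> 'c::euclidean_space l2"
  assumes U: "\<And>n. bounded_linear (U n)" and C: "\<forall>\<^sub>F n in F. \<forall>a. norm (U n a) \<le> C * norm a"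
    and V: "bounded_linear V"
    and lim: "\<And>f. test_fun f \<Longrightarrow> ((\<lambda>n. U n (cls f)) \<longlongrightarrow> V (cls f)) F"
  shows "((\<lambda>n. U n a) \<longlongrightarrow> V a) F"
proof (rule tendstoI)
  fix e :: real assume e: "e > 0"
  obtain f where f: "\<And>n. test_fun (f n)" "(\<lambda>n. cls (f n)) \<longlonglongrightarrow> a"
    using test_fun_dense[of a] by auto
  obtain K where K: "K > 0" "\<And>x. norm (V x) \<le> norm x * K" using bounded_linear.pos_bounded[OF V] by auto
  \<comment> \<open>With \<open>a\<close> approximated to within \<open>e / (2 * D)\<close>, the two
    replacement terms together cost at most \<open>e / 2\<close>.\<close>
  define D where "D = \<bar>C\<bar> + K + 1"
  have "D > 0" using K by (simp add: D_def)
  then have "e / (2 * D) > 0" using e by simp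
  then have "\<forall>\<^sub>F n in sequentially. dist (cls (f n)) a < e / (2 * D)" using f(2) by (rule tendstoD[rotated])
  then obtain n where n: "dist (cls (f n)) a < e / (2 * D)" by (auto simp: eventually_sequentially)
  let ?b = "cls (f n)"
  have nb: "norm (a - ?b) < e / (2 * D)" using n by (simp add: dist_norm norm_minus_commute)
  have "\<forall>\<^sub>F i in F. dist (U i ?b) (V ?b) < e / 2" using lim[OF f(1)[of n]] e by (intro tendstoD) auto
  then show "\<forall>\<^sub>F i in F. dist (U i a) (V a) < e"
    using C
  proof eventually_elim
    case (elim i)
    have "U i a - V a = U i (a - ?b) + (U i ?b - V ?b) - V (a - ?b)"
      by (simp add: linear_simps[OF U] linear_simps[OF V])
    then have "norm (U i a - V a) \<le> norm (U i (a - ?b)) + norm (U i ?b - V ?b) + norm (V (a - ?b))"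
      using norm_triangle_ineq[of "U i (a - ?b)" "U i ?b - V ?b"]
        norm_triangle_ineq4[of "U i (a - ?b) + (U i ?b - V ?b)" "V (a - ?b)"] by simp
    also have "\<dots> < C * norm (a - ?b) + e / 2 + K * norm (a - ?b)"
      using elim(2)[rule_format, of "a - ?b"] elim(1) K(2)[of "a - ?b"] by (simp add: dist_norm mult.commute)
    also have "\<dots> = (C + K) * norm (a - ?b) + e / 2" by (simp add: algebra_simps)
    also have "(C + K) * norm (a - ?b) \<le> D * norm (a - ?b)"
      by (intro mult_right_mono) (auto simp: D_def)
    also have "D * norm (a - ?b) \<le> D * (e / (2 * D))" using nb \<open>D > 0\<close> by (intro mult_left_mono) auto
    also have "D * (e / (2 * D)) + e / 2 = e" using \<open>D > 0\<close> by (simp add: field_simps)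
    finally show ?case by (simp add: dist_norm)
  qed
qed

definition transl :: "real ^ 3 \<Rightarrow> 'b::euclidean_space l2 \<Rightarrow> 'b l2" where
  "transl z = pull (\<lambda>v. v) (\<lambda>x. z + x)"

lemma bounded_linear_transl: "bounded_linear (transl z)"
  unfolding transl_def by (intro bounded_linear_pull bounded_linear_ident mp_translation)

lemma norm_transl_le: "norm (transl z a) \<le> norm a"
  using norm_pull_le[OF bounded_linear_ident mp_translation, of 1 z a] by (simp add: transl_def)

lemma transl_tendsto:
  assumes z: "z \<longlonglongrightarrow> 0" shows "(\<lambda>n. transl (z n) a) \<longlonglongrightarrow> a"
proof (rule strong_limit_dense[where V = "\<lambda>a. a" and C = 1])
  fix f :: "real ^ 3 \<Rightarrow> 'a" assume f: "test_fun f"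
  have cont: "continuous_on UNIV f" by (rule test_fun_cont[OF f])
  have [measurable]: "f \<in> borel_measurable borel" by (rule borel_measurable_continuous_onI[OF cont])
  obtain B R where BR: "B \<ge> 0" "R > 0" "\<And>x. norm (f x) \<le> B * indicator (cball 0 R) x"
    using compact_support_bound[OF cont] f unfolding test_fun_iff by blast
  \<comment> \<open>The shifts form a bounded sequence, so all translates are supported in one ball
    of radius \<open>R + M\<close>.\<close>
  obtain M where M: "\<And>n. norm (z n) \<le> M"
    using convergent_imp_Bseq[of z] z by (auto simp: convergent_def Bseq_def)
  have T: "transl (z n) (cls f) = cls (\<lambda>x. f (z n + x))" for n
    unfolding transl_def by (rule pull_cls[OF bounded_linear_ident mp_translation test_fun_L2[OF f]])
  show "(\<lambda>n. transl (z n) (cls f)) \<longlonglongrightarrow> cls f"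
    unfolding T
  proof (rule l2_dominated_convergence(3)[where w = "\<lambda>x. B * indicator (cball 0 (R + M)) x"])
    show "AE x in lborel. (\<lambda>n. f (z n + x)) \<longlonglongrightarrow> f x"
    proof (intro AE_I2)
      fix x
      have "(\<lambda>n. f (z n + x)) \<longlonglongrightarrow> f (0 + x)"
        by (intro continuous_on_tendsto_compose[OF cont] tendsto_intros z) auto
      then show "(\<lambda>n. f (z n + x)) \<longlonglongrightarrow> f x" by simp
    qed
    show "AE x in lborel. norm (f (z n + x)) \<le> B * indicator (cball 0 (R + M)) x" for n
    proof (intro AE_I2)
      fix x
      show "norm (f (z n + x)) \<le> B * indicator (cball 0 (R + M)) x"
      proof (cases "norm x \<le> R + M")
        case True
        have "B * indicator (cball 0 R) (z n + x) \<le> B"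
          using BR(1) by (simp add: indicator_def)
        then show ?thesis using BR(3)[of "z n + x"] True by simp
      next
        case False
        have "norm x \<le> norm (z n + x) + norm (z n)" using norm_triangle_ineq4[of "z n + x" "z n"] by simp
        then have "\<not> norm (z n + x) \<le> R" using False M[of n] by linarith
        then show ?thesis using BR(3)[of "z n + x"] False by simp
      qed
    qed
  qed simp_all
qed (auto simp: bounded_linear_transl norm_transl_le)

lemma gauss_scale_mono: "0 \<le> a \<Longrightarrow> a \<le> b \<Longrightarrow> gauss (b *\<^sub>R x) \<le> gauss (a *\<^sub>R x)"
  by (auto simp: gauss_def power_mult_distrib intro!: mult_right_mono power_mono)

text \<open>Plancherel by Gaussian regularisation: for the transform \<open>F\<close> of \<open>f\<close>,
  \<open>\<integral> gauss (s \<xi>) |F(\<xi>)|\<^sup>2 d\<xi>\<close> is a Gaussian average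
  of the autocorrelation of \<open>f\<close>, concentrating at \<open>0\<close> as \<open>s\<close> tends to \<open>0\<close>.\<close>

lemma gauss_regularised:
  fixes f :: "real ^ 3 \<Rightarrow> complex ^ 3"
  assumes f: "integrable lborel f" "f \<in> L2" and s: "s > 0"
  shows "(\<integral>\<xi>. gauss (s *\<^sub>R \<xi>) * (norm (fourier_L1 f \<xi>))\<^sup>2 \<partial>lborel)
    = (1 / (sqrt (2 * pi)) ^ 3) * (\<integral>z. gauss z * (cls f \<bullet> transl ((s / (2 * pi)) *\<^sub>R z) (cls f)) \<partial>lborel)"
    and "integrable lborel (\<lambda>\<xi>. gauss (s *\<^sub>R \<xi>) * (norm (fourier_L1 f \<xi>))\<^sup>2)"
proof -
  let ?F = "fourier_L1 f" and ?c = "(sqrt (2 * pi)) ^ 3"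
  \<comment> \<open>The inverse transform of the damping factor
    \<open>gauss (s *\<^sub>R \<xi>)\<close>, as \<open>kern\<close> shows: a Gaussian of width
    \<open>s / (2 * pi)\<close>.\<close>
  define P where "P u = inverse (s ^ 3) * (?c * gauss ((2 * pi / s) *\<^sub>R u))" for u :: "real ^ 3"
  have [measurable]: "f \<in> borel_measurable borel" using f(2) by (rule L2_measurable)
  have [measurable]: "?F \<in> borel_measurable borel" by (rule fourier_L1_measurable[OF f(1)])
  have [measurable]: "P \<in> borel_measurable borel" unfolding P_def by measurable
  have gs: "integrable lborel (\<lambda>\<xi>. gauss (s *\<^sub>R \<xi>))"
    using lborel_scale(2)[OF gauss_measurable s] gauss_integral(1) by simp
  define K where "K = (\<integral>x. norm (f x) \<partial>lborel)"
  have FK: "norm (?F \<xi>) \<le> K" for \<xi> unfolding K_def by (rule norm_fourier_L1)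
  then have K0: "0 \<le> K" by (rule order_trans[OF norm_ge_zero])
  have gF: "integrable lborel (\<lambda>\<xi>. gauss (s *\<^sub>R \<xi>) *\<^sub>R ?F \<xi>)"
  proof (rule Bochner_Integration.integrable_bound)
    show "integrable lborel (\<lambda>\<xi>. gauss (s *\<^sub>R \<xi>) * K)" using gs by simp
    show "AE \<xi> in lborel. norm (gauss (s *\<^sub>R \<xi>) *\<^sub>R ?F \<xi>) \<le> norm (gauss (s *\<^sub>R \<xi>) * K)"
    proof (intro AE_I2)
      fix \<xi>
      show "norm (gauss (s *\<^sub>R \<xi>) *\<^sub>R ?F \<xi>) \<le> norm (gauss (s *\<^sub>R \<xi>) * K)"
        using FK[of \<xi>] K0 gauss_bounds(1)[of "s *\<^sub>R \<xi>"] by (simp add: abs_mult mult_left_mono)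
    qed
  qed measurable
  show "integrable lborel (\<lambda>\<xi>. gauss (s *\<^sub>R \<xi>) * (norm (?F \<xi>))\<^sup>2)"
  proof (rule Bochner_Integration.integrable_bound)
    show "integrable lborel (\<lambda>\<xi>. gauss (s *\<^sub>R \<xi>) * K\<^sup>2)" using gs by simp
    show "AE \<xi> in lborel. norm (gauss (s *\<^sub>R \<xi>) * (norm (?F \<xi>))\<^sup>2) \<le> norm (gauss (s *\<^sub>R \<xi>) * K\<^sup>2)"
    proof (intro AE_I2)
      fix \<xi>
      show "norm (gauss (s *\<^sub>R \<xi>) * (norm (?F \<xi>))\<^sup>2) \<le> norm (gauss (s *\<^sub>R \<xi>) * K\<^sup>2)"
        using power_mono[OF FK[of \<xi>] norm_ge_zero, of 2] gauss_bounds(1)[of "s *\<^sub>R \<xi>"]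
        by (simp add: abs_mult mult_left_mono)
    qed
  qed measurable
  have kern: "(\<integral>\<xi>. complex_of_real (gauss (s *\<^sub>R \<xi>)) * cis (2 * pi * (\<xi> \<bullet> u)) \<partial>lborel) = complex_of_real (P u)" for u
  proof -
    let ?h = "\<lambda>x. complex_of_real (gauss x) * cis (((2 * pi / s) *\<^sub>R u) \<bullet> x)"
    have "(\<integral>x. ?h x \<partial>lborel) = s ^ 3 *\<^sub>R (\<integral>x. ?h (s *\<^sub>R x) \<partial>lborel)"
      by (rule lborel_scale(1)) (use s in measurable)
    moreover have "?h (s *\<^sub>R x) = complex_of_real (gauss (s *\<^sub>R x)) * cis (2 * pi * (x \<bullet> u))" for x
      using s by (simp add: inner_commute mult.assoc)
    ultimately have "complex_of_real (?c * gauss ((2 * pi / s) *\<^sub>R u))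
        = s ^ 3 *\<^sub>R (\<integral>\<xi>. complex_of_real (gauss (s *\<^sub>R \<xi>)) * cis (2 * pi * (\<xi> \<bullet> u)) \<partial>lborel)"
      unfolding gauss_ft(2) by (simp only:)
    then have "(\<integral>\<xi>. complex_of_real (gauss (s *\<^sub>R \<xi>)) * cis (2 * pi * (\<xi> \<bullet> u)) \<partial>lborel)
        = inverse (s ^ 3) *\<^sub>R complex_of_real (?c * gauss ((2 * pi / s) *\<^sub>R u))"
      using s by simp
    then show ?thesis by (simp only: P_def scaleR_conv_of_real of_real_mult)
  qed
  have kint: "integrable lborel (\<lambda>\<xi>. complex_of_real (gauss (s *\<^sub>R \<xi>)) * cis (2 * pi * (\<xi> \<bullet> x)))" for x :: "real ^ 3"
    by (rule Bochner_Integration.integrable_bound[OF gs]) (auto simp: norm_mult)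
  \<comment> \<open>Inverting the transform after damping it averages the translates of
    \<open>f\<close> with weight \<open>P\<close>.\<close>
  have inv: "inv_fourier_L1 (\<lambda>\<xi>. gauss (s *\<^sub>R \<xi>) *\<^sub>R ?F \<xi>) x = (\<integral>z. P z *\<^sub>R f (z + x) \<partial>lborel)" for x
  proof -
    have "inv_fourier_L1 (\<lambda>\<xi>. gauss (s *\<^sub>R \<xi>) *\<^sub>R ?F \<xi>) x
        = (\<integral>\<xi>. (complex_of_real (gauss (s *\<^sub>R \<xi>)) * cis (2 * pi * (\<xi> \<bullet> x))) *s ?F \<xi> \<partial>lborel)"
      unfolding inv_fourier_L1_def
      by (intro Bochner_Integration.integral_cong refl) (simp add: vec_eq_iff scaleR_conv_of_real[where 'a = complex] mult_ac)
    also have "\<dots> = (\<integral>y. (\<integral>\<xi>. (complex_of_real (gauss (s *\<^sub>R \<xi>)) * cis (2 * pi * (\<xi> \<bullet> x))) * cis (- 2 * pi * (\<xi> \<bullet> y)) \<partial>lborel) *s f y \<partial>lborel)"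
      by (rule fourier_L1_mult[OF f(1) kint])
    also have "\<dots> = (\<integral>y. (\<integral>\<xi>. complex_of_real (gauss (s *\<^sub>R \<xi>)) * cis (2 * pi * (\<xi> \<bullet> (x - y))) \<partial>lborel) *s f y \<partial>lborel)"
      by (simp add: mult.assoc cis_mult inner_diff_right right_diff_distrib)
    also have "\<dots> = (\<integral>y. P (x - y) *\<^sub>R f y \<partial>lborel)"
      unfolding kern of_real_vs ..
    also have "\<dots> = (\<integral>z. P (x - (x + z)) *\<^sub>R f (x + z) \<partial>lborel)"
      by (rule mp_integral[OF mp_translation, symmetric]) measurable
    also have "\<dots> = (\<integral>z. P z *\<^sub>R f (z + x) \<partial>lborel)"
      by (simp add: P_def gauss_def add.commute)
    finally show ?thesis .
  qed
  have Pb: "\<bar>P z\<bar> \<le> inverse (s ^ 3) * ?c" for z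
  proof -
    have "0 \<le> inverse (s ^ 3) * ?c" using s by simp
    from mult_left_mono[OF gauss_bounds(2)[of "(2 * pi / s) *\<^sub>R z"] this]
    show ?thesis using gauss_bounds(1)[of "(2 * pi / s) *\<^sub>R z"] s by (simp add: P_def abs_mult)
  qed
  have R: "(\<integral>x. f x \<bullet> f (z + x) \<partial>lborel) = cls f \<bullet> transl z (cls f)" for z
    unfolding transl_def pull_cls[OF bounded_linear_ident mp_translation f(2)]
    by (rule inner_cls[symmetric, OF f(2) L2_mp[OF mp_translation f(2)]])
  have fz: "integrable lborel (\<lambda>z. f (z + x))" for x
  proof -
    have "integrable lborel (\<lambda>z. f (x + z)) \<longleftrightarrow> integrable lborel f"
      by (rule mp_integrable[OF mp_translation]) measurable
    then show ?thesis using f(1) by (simp add: add.commute)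
  qed
  have Pf: "integrable lborel (\<lambda>z. P z *\<^sub>R f (z + x))" for x
  proof (rule Bochner_Integration.integrable_bound)
    show "integrable lborel (\<lambda>z. (inverse (s ^ 3) * ?c) *\<^sub>R f (z + x))" by (intro integrable_scaleR_right fz)
    show "AE z in lborel. norm (P z *\<^sub>R f (z + x)) \<le> norm ((inverse (s ^ 3) * ?c) *\<^sub>R f (z + x))"
      using s by (intro AE_I2) (auto simp: abs_mult intro!: mult_right_mono order_trans[OF Pb])
  qed measurable
  let ?H = "\<lambda>x z. P z * (f x \<bullet> f (z + x))"
  have Hi: "integrable (lborel \<Otimes>\<^sub>M lborel) (case_prod ?H)"
  proof (rule Bochner_Integration.integrable_bound)
    show "integrable (lborel \<Otimes>\<^sub>M lborel) (\<lambda>(x, z). (inverse (s ^ 3) * ?c) * (norm (f x) * norm (f (z + x))))"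
    proof (rule lborel_pair.Fubini_integrable)
      have nf: "(\<integral>z. norm (f (z + x)) \<partial>lborel) = K" for x
        unfolding K_def using mp_integral[OF mp_translation[of x], of "\<lambda>y. norm (f y)"] by (simp add: add.commute)
      show "integrable lborel (\<lambda>x. \<integral>z. norm (case (x, z) of (x, z) \<Rightarrow> (inverse (s ^ 3) * ?c) * (norm (f x) * norm (f (z + x)))) \<partial>lborel)"
        using f(1) by (simp add: abs_mult nf)
      show "AE x in lborel. integrable lborel (\<lambda>z. case (x, z) of (x, z) \<Rightarrow> (inverse (s ^ 3) * ?c) * (norm (f x) * norm (f (z + x))))"
        using fz by simp
    qed measurable
    have "norm (?H x z) \<le> norm ((inverse (s ^ 3) * ?c) * (norm (f x) * norm (f (z + x))))" for x z
    proof -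
      have "norm (?H x z) \<le> (inverse (s ^ 3) * ?c) * (norm (f x) * norm (f (z + x)))"
        unfolding real_norm_def abs_mult[of "P z"]
        by (rule mult_mono[OF Pb Cauchy_Schwarz_ineq2]) (use s in auto)
      then show ?thesis by simp
    qed
    then show "AE p in lborel \<Otimes>\<^sub>M lborel. norm (case p of (x, z) \<Rightarrow> ?H x z) \<le> norm (case p of (x, z) \<Rightarrow> (inverse (s ^ 3) * ?c) * (norm (f x) * norm (f (z + x))))"
      by (intro AE_I2) auto
  qed measurable
  have "(\<integral>\<xi>. gauss (s *\<^sub>R \<xi>) * (norm (?F \<xi>))\<^sup>2 \<partial>lborel) = (\<integral>\<xi>. ?F \<xi> \<bullet> (gauss (s *\<^sub>R \<xi>) *\<^sub>R ?F \<xi>) \<partial>lborel)"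
    by (simp add: power2_norm_eq_inner)
  also have "\<dots> = (\<integral>x. f x \<bullet> (\<integral>z. P z *\<^sub>R f (z + x) \<partial>lborel) \<partial>lborel)"
    unfolding inv[symmetric] by (rule fourier_L1_adjoint[OF f(1) gF])
  also have "\<dots> = (\<integral>x. \<integral>z. ?H x z \<partial>lborel \<partial>lborel)"
    by (intro Bochner_Integration.integral_cong refl, subst integral_inner_right[symmetric]) (auto intro: Pf)
  also have "\<dots> = (\<integral>z. \<integral>x. ?H x z \<partial>lborel \<partial>lborel)"
    by (rule lborel_pair.Fubini_integral[OF Hi, symmetric])
  also have "\<dots> = (\<integral>z. P z * (cls f \<bullet> transl z (cls f)) \<partial>lborel)"
    by (simp add: R)
  \<comment> \<open>Rescaling to unit width. The constants combine to \<open>1 / ?c\<close> because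
    \<open>?c * ?c = (2 * pi) ^ 3\<close>.\<close>
  also have "\<dots> = (s / (2 * pi)) ^ 3 *\<^sub>R (\<integral>z. P ((s / (2 * pi)) *\<^sub>R z) * (cls f \<bullet> transl ((s / (2 * pi)) *\<^sub>R z) (cls f)) \<partial>lborel)"
  proof (rule lborel_scale(1))
    have "(\<lambda>z. \<integral>x. f x \<bullet> f (z + x) \<partial>lborel) \<in> borel_measurable borel"
      by (intro lborel.borel_measurable_lebesgue_integral) measurable
    then show "(\<lambda>z. P z * (cls f \<bullet> transl z (cls f))) \<in> borel_measurable borel"
      unfolding R by measurable
  qed (use s in simp)
  also have "\<dots> = (1 / ?c) * (\<integral>z. gauss z * (cls f \<bullet> transl ((s / (2 * pi)) *\<^sub>R z) (cls f)) \<partial>lborel)"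
  proof -
    have "P ((s / (2 * pi)) *\<^sub>R z) = inverse (s ^ 3) * ?c * gauss z" for z using s by (simp add: P_def)
    moreover have "(s / (2 * pi)) ^ 3 * (inverse (s ^ 3) * ?c) = 1 / ?c"
    proof -
      have "?c * ?c = (2 * pi) ^ 3" by (simp flip: power_mult_distrib)
      then show ?thesis using s by (simp add: power_divide field_simps)
    qed
    ultimately show ?thesis by (simp add: mult.assoc) (simp flip: mult.assoc)
  qed
  finally show "(\<integral>\<xi>. gauss (s *\<^sub>R \<xi>) * (norm (?F \<xi>))\<^sup>2 \<partial>lborel)
    = (1 / ?c) * (\<integral>z. gauss z * (cls f \<bullet> transl ((s / (2 * pi)) *\<^sub>R z) (cls f)) \<partial>lborel)" .
qed

text \<open>As \<open>s\<close> decreases to 0, the left side of \<open>gauss_regularised\<close>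
  increases to the integral of the squared modulus of the transform. Continuity of translations
  makes the right side converge to the squared norm of \<open>f\<close>, the mass of
  \<open>gauss\<close> cancelling the constant. Monotone convergence yields integrability and the
  value together.\<close>

theorem plancherel_L1:
  fixes f :: "real ^ 3 \<Rightarrow> complex ^ 3"
  assumes f: "integrable lborel f" "f \<in> L2"
  shows "fourier_L1 f \<in> L2" and "norm (cls (fourier_L1 f)) = norm (cls f)"
proof -
  let ?F = "fourier_L1 f" and ?c = "(sqrt (2 * pi)) ^ 3" and ?s = "\<lambda>n. 1 / real (Suc n)"
  let ?R = "\<lambda>n z. cls f \<bullet> transl ((?s n / (2 * pi)) *\<^sub>R z) (cls f)"
  have [measurable]: "?F \<in> borel_measurable borel" by (rule fourier_L1_measurable[OF f(1)])
  have [measurable]: "f \<in> borel_measurable borel" using f(2) by (rule L2_measurable)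
  have R: "(\<integral>x. f x \<bullet> f (z + x) \<partial>lborel) = cls f \<bullet> transl z (cls f)" for z
    unfolding transl_def pull_cls[OF bounded_linear_ident mp_translation f(2)]
    by (rule inner_cls[symmetric, OF f(2) L2_mp[OF mp_translation f(2)]])
  have "(\<lambda>z. \<integral>x. f x \<bullet> f (z + x) \<partial>lborel) \<in> borel_measurable borel"
    by (intro lborel.borel_measurable_lebesgue_integral) measurable
  then have [measurable]: "(\<lambda>z. cls f \<bullet> transl z (cls f)) \<in> borel_measurable borel"
    unfolding R .
  have s0: "?s \<longlonglongrightarrow> 0" by (rule LIMSEQ_Suc[OF lim_1_over_n])
  have "(\<lambda>n. \<integral>z. gauss z * ?R n z \<partial>lborel) \<longlonglongrightarrow> (\<integral>z. gauss z * (cls f \<bullet> cls f) \<partial>lborel)"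
  proof (rule integral_dominated_convergence[where w = "\<lambda>z. gauss z * (norm (cls f))\<^sup>2"])
    show "AE z in lborel. (\<lambda>n. gauss z * ?R n z) \<longlonglongrightarrow> gauss z * (cls f \<bullet> cls f)"
    proof (intro AE_I2 tendsto_intros transl_tendsto)
      fix z :: "real ^ 3"
      have "(\<lambda>n. (?s n / (2 * pi)) *\<^sub>R z) \<longlonglongrightarrow> (0 / (2 * pi)) *\<^sub>R z"
        by (intro tendsto_intros s0) simp
      then show "(\<lambda>n. (?s n / (2 * pi)) *\<^sub>R z) \<longlonglongrightarrow> 0" by simp
    qed
    show "AE z in lborel. norm (gauss z * ?R n z) \<le> gauss z * (norm (cls f))\<^sup>2" for n
    proof (intro AE_I2)
      fix z
      have "\<bar>?R n z\<bar> \<le> norm (cls f) * norm (transl ((?s n / (2 * pi)) *\<^sub>R z) (cls f))"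
        by (rule Cauchy_Schwarz_ineq2)
      also have "\<dots> \<le> norm (cls f) * norm (cls f)" by (intro mult_left_mono norm_transl_le) simp
      finally show "norm (gauss z * ?R n z) \<le> gauss z * (norm (cls f))\<^sup>2"
        using gauss_bounds(1)[of z] by (simp add: abs_mult power2_eq_square)
    qed
    show "integrable lborel (\<lambda>z. gauss z * (norm (cls f))\<^sup>2)" using gauss_integral(1) by simp
    show "(\<lambda>z. gauss z * ?R n z) \<in> borel_measurable lborel" for n
    proof -
      have "(\<lambda>z. (?s n / (2 * pi)) *\<^sub>R z) \<in> borel \<rightarrow>\<^sub>M (borel :: (real ^ 3) measure)" by measurable
      from measurable_compose[OF this \<open>(\<lambda>z. cls f \<bullet> transl z (cls f)) \<in> borel_measurable borel\<close>]
      show ?thesis by measurable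
    qed
  qed measurable
  then have "(\<lambda>n. (1 / ?c) * (\<integral>z. gauss z * ?R n z \<partial>lborel)) \<longlonglongrightarrow> (1 / ?c) * (\<integral>z. gauss z * (cls f \<bullet> cls f) \<partial>lborel)"
    by (rule tendsto_mult_left)
  moreover have "(1 / ?c) * (\<integral>z. gauss z * (cls f \<bullet> cls f) \<partial>lborel) = (norm (cls f))\<^sup>2"
    by (simp add: gauss_integral(2) power2_norm_eq_inner)
  ultimately have lim: "(\<lambda>n. \<integral>\<xi>. gauss (?s n *\<^sub>R \<xi>) * (norm (?F \<xi>))\<^sup>2 \<partial>lborel) \<longlonglongrightarrow> (norm (cls f))\<^sup>2"
    by (subst gauss_regularised(1)[OF f]) simp_all
  have mono: "AE \<xi> in lborel. mono (\<lambda>n. gauss (?s n *\<^sub>R \<xi>) * (norm (?F \<xi>))\<^sup>2)"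
    by (intro AE_I2 monoI mult_right_mono gauss_scale_mono) (auto simp: field_simps)
  have pt: "AE \<xi> in lborel. (\<lambda>n. gauss (?s n *\<^sub>R \<xi>) * (norm (?F \<xi>))\<^sup>2) \<longlonglongrightarrow> (norm (?F \<xi>))\<^sup>2"
  proof (intro AE_I2)
    fix \<xi>
    have "(\<lambda>n. gauss (?s n *\<^sub>R \<xi>) * (norm (?F \<xi>))\<^sup>2) \<longlonglongrightarrow> exp (- (norm ((0 :: real) *\<^sub>R \<xi>))\<^sup>2 / 2) * (norm (?F \<xi>))\<^sup>2"
      unfolding gauss_def by (intro tendsto_intros s0) simp
    then show "(\<lambda>n. gauss (?s n *\<^sub>R \<xi>) * (norm (?F \<xi>))\<^sup>2) \<longlonglongrightarrow> (norm (?F \<xi>))\<^sup>2" by simp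
  qed
  have int: "integrable lborel (\<lambda>\<xi>. gauss (?s n *\<^sub>R \<xi>) * (norm (?F \<xi>))\<^sup>2)" for n
    by (rule gauss_regularised(2)[OF f]) simp
  have "integrable lborel (\<lambda>\<xi>. (norm (?F \<xi>))\<^sup>2)"
    by (rule integrable_monotone_convergence[OF int mono pt lim]) measurable
  then show F2: "?F \<in> L2" by (simp add: L2_iff)
  have "(\<integral>\<xi>. (norm (?F \<xi>))\<^sup>2 \<partial>lborel) = (norm (cls f))\<^sup>2"
    by (rule integral_monotone_convergence[OF int mono pt lim]) measurable
  then have "(norm (cls ?F))\<^sup>2 = (norm (cls f))\<^sup>2" by (simp only: norm_cls_sq[OF F2])
  then show "norm (cls ?F) = norm (cls f)" by simp
qed

subsection \<open>The Fourier transform on square-integrable functions\<close>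

lemma L2_lim_iff:
  "L2_lim fs g \<longleftrightarrow> (\<forall>n. fs n \<in> L2) \<and> g \<in> L2 \<and> (\<lambda>n. cls (fs n)) \<longlonglongrightarrow> cls g"
proof (cases "(\<forall>n. fs n \<in> L2) \<and> g \<in> L2")
  case True
  then have "L2norm (\<lambda>x. fs n x - g x) = norm (cls (fs n) - cls g)" for n
    by (simp add: L2_diff flip: norm_cls cls_diff)
  then show ?thesis
    unfolding L2_lim_def by (simp add: tendsto_norm_zero_iff LIM_zero_iff)
qed (auto simp: L2_lim_def)

text \<open>Collects what extension by density uses, so that both Fourier transforms are extended by
  one argument. Only real scalars occur, since \<open>l2\<close> is a real vector space.\<close>

locale L2_isometry =
  fixes T :: "(real ^ 3 \<Rightarrow> complex ^ 3) \<Rightarrow> real ^ 3 \<Rightarrow> complex ^ 3"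
  assumes T_add: "\<And>f g. integrable lborel f \<Longrightarrow> integrable lborel g \<Longrightarrow> T (\<lambda>x. f x + g x) = (\<lambda>\<xi>. T f \<xi> + T g \<xi>)"
    and T_scaleR: "\<And>f c. integrable lborel f \<Longrightarrow> T (\<lambda>x. c *\<^sub>R f x) = (\<lambda>\<xi>. c *\<^sub>R T f \<xi>)"
    and T_L2: "\<And>f. integrable lborel f \<Longrightarrow> f \<in> L2 \<Longrightarrow> T f \<in> L2"
    and T_norm: "\<And>f. integrable lborel f \<Longrightarrow> f \<in> L2 \<Longrightarrow> norm (cls (T f)) = norm (cls f)"
begin

lemma T_dist:
  assumes "integrable lborel f" "f \<in> L2" "integrable lborel g" "g \<in> L2"
  shows "norm (cls (T f) - cls (T g)) = norm (cls f - cls g)"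
proof -
  let ?g = "\<lambda>x. (- 1) *\<^sub>R g x"
  have g: "integrable lborel ?g" "?g \<in> L2" using assms by (auto intro!: L2_minus)
  have "cls f - cls g = cls (\<lambda>x. f x + ?g x)" by (subst cls_diff[symmetric]) (use assms in auto)
  moreover have "T (\<lambda>x. f x + ?g x) = (\<lambda>\<xi>. T f \<xi> - T g \<xi>)"
    unfolding T_add[OF assms(1) g(1)] T_scaleR[OF assms(3)] by simp
  then have "cls (T f) - cls (T g) = cls (T (\<lambda>x. f x + ?g x))"
    using cls_diff[OF T_L2[OF assms(1,2)] T_L2[OF assms(3,4)]] by simp
  ultimately show ?thesis
    using T_norm[OF Bochner_Integration.integrable_add[OF assms(1) g(1)] L2_add[OF assms(2) g(2)]] by simp
qed

lemma extend_ex: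
  assumes "f \<in> L2"
  shows "\<exists>g fs. (\<forall>n. integrable lborel (fs n)) \<and> L2_lim fs f \<and> L2_lim (\<lambda>n. T (fs n)) g"
proof -
  obtain fs where fs: "\<And>n. test_fun (fs n)" "(\<lambda>n. cls (fs n)) \<longlonglongrightarrow> cls f"
    using test_fun_dense[of "cls f"] by auto
  have i: "integrable lborel (fs n)" "fs n \<in> L2" for n
    using test_fun_integrable[OF fs(1)] test_fun_L2[OF fs(1)] by auto
  have "Cauchy (\<lambda>n. cls (T (fs n)))"
  proof (rule CauchyI)
    fix e :: real assume "0 < e"
    then show "\<exists>M. \<forall>m\<ge>M. \<forall>n\<ge>M. norm (cls (T (fs m)) - cls (T (fs n))) < e"
      using CauchyD[OF LIMSEQ_imp_Cauchy[OF fs(2)], of e] by (simp add: T_dist i)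
  qed
  then obtain a where "(\<lambda>n. cls (T (fs n))) \<longlonglongrightarrow> a"
    by (auto dest!: Cauchy_convergent simp: convergent_def)
  then have "L2_lim (\<lambda>n. T (fs n)) (rp a)" by (simp add: L2_lim_iff T_L2 i)
  moreover have "L2_lim fs f" using fs i assms by (simp add: L2_lim_iff)
  ultimately show ?thesis using i by blast
qed

lemma extend_spec:
  assumes "f \<in> L2"
  obtains fs where "\<And>n. integrable lborel (fs n)" "L2_lim fs f" "L2_lim (\<lambda>n. T (fs n)) (extend_L2 T f)"
  using someI_ex[OF extend_ex[OF assms]] unfolding extend_L2_def by blast

lemma extend_L2: "f \<in> L2 \<Longrightarrow> extend_L2 T f \<in> L2"
  by (rule extend_spec[of f]) (auto simp: L2_lim_iff)

text \<open>If two sequences approach the same function, their difference tends to 0, and by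
  isometry so does the difference of the images. Hence the class of the function selected by
  \<open>SOME\<close> does not depend on the sequence behind it.\<close>

lemma extend_unique:
  assumes fs: "\<And>n. integrable lborel (fs n)" "\<And>n. fs n \<in> L2" "(\<lambda>n. cls (fs n)) \<longlonglongrightarrow> cls f" and f: "f \<in> L2"
  shows "(\<lambda>n. cls (T (fs n))) \<longlonglongrightarrow> cls (extend_L2 T f)"
proof -
  obtain gs where gs: "\<And>n. integrable lborel (gs n)" "L2_lim gs f" "L2_lim (\<lambda>n. T (gs n)) (extend_L2 T f)"
    using extend_spec[OF f] by blast
  have "(\<lambda>n. cls (fs n) - cls (gs n)) \<longlonglongrightarrow> cls f - cls f"
    by (intro tendsto_diff fs(3)) (use gs in \<open>simp add: L2_lim_iff\<close>)
  then have "(\<lambda>n. norm (cls (fs n) - cls (gs n))) \<longlonglongrightarrow> 0" by (simp add: tendsto_norm_zero)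
  moreover have "norm (cls (T (fs n)) - cls (T (gs n))) = norm (cls (fs n) - cls (gs n))" for n
    using gs by (intro T_dist fs) (auto simp: L2_lim_iff)
  ultimately have "(\<lambda>n. norm (cls (T (fs n)) - cls (T (gs n)))) \<longlonglongrightarrow> 0" by simp
  then have "(\<lambda>n. cls (T (fs n)) - cls (T (gs n))) \<longlonglongrightarrow> 0" by (simp add: tendsto_norm_zero_iff)
  moreover have "(\<lambda>n. cls (T (gs n))) \<longlonglongrightarrow> cls (extend_L2 T f)" using gs by (simp add: L2_lim_iff)
  ultimately show ?thesis using tendsto_add by fastforce
qed

definition ext :: "(complex ^ 3) l2 \<Rightarrow> (complex ^ 3) l2" where "ext a = cls (extend_L2 T (rp a))"

lemma ext_cls: "f \<in> L2 \<Longrightarrow> cls (extend_L2 T f) = ext (cls f)"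
proof -
  assume f: "f \<in> L2"
  obtain fs where fs: "\<And>n. test_fun (fs n)" "(\<lambda>n. cls (fs n)) \<longlonglongrightarrow> cls f"
    using test_fun_dense[of "cls f"] by auto
  note i = test_fun_integrable[OF fs(1)] test_fun_L2[OF fs(1)]
  have "(\<lambda>n. cls (T (fs n))) \<longlonglongrightarrow> cls (extend_L2 T f)" by (rule extend_unique[OF i fs(2) f])
  moreover have "(\<lambda>n. cls (T (fs n))) \<longlonglongrightarrow> ext (cls f)"
    unfolding ext_def by (rule extend_unique[OF i]) (use fs(2) in simp_all)
  ultimately show ?thesis by (rule LIMSEQ_unique)
qed

lemma ext_lim:
  assumes "\<And>n. integrable lborel (fs n)" "\<And>n. fs n \<in> L2" "(\<lambda>n. cls (fs n)) \<longlonglongrightarrow> a"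
  shows "(\<lambda>n. cls (T (fs n))) \<longlonglongrightarrow> ext a"
  unfolding ext_def by (rule extend_unique[OF assms(1,2)]) (use assms(3) in simp_all)

lemma ext_L1: "integrable lborel f \<Longrightarrow> f \<in> L2 \<Longrightarrow> ext (cls f) = cls (T f)"
  using ext_lim[of "\<lambda>_. f" "cls f"] by (simp add: LIMSEQ_const_iff)

lemma norm_ext: "norm (ext a) = norm a"
proof -
  obtain fs where fs: "\<And>n. test_fun (fs n)" "(\<lambda>n. cls (fs n)) \<longlonglongrightarrow> a"
    using test_fun_dense[of a] by auto
  note i = test_fun_integrable[OF fs(1)] test_fun_L2[OF fs(1)]
  have "(\<lambda>n. norm (cls (T (fs n)))) \<longlonglongrightarrow> norm (ext a)" by (rule tendsto_norm[OF ext_lim[OF i fs(2)]])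
  moreover have "(\<lambda>n. norm (cls (T (fs n)))) \<longlonglongrightarrow> norm a" by (simp add: T_norm i tendsto_norm fs(2))
  ultimately show ?thesis by (rule LIMSEQ_unique)
qed

lemma bounded_linear_ext: "bounded_linear ext"
proof (rule bounded_linear_intro[where K = 1])
  fix a b :: "(complex ^ 3) l2" and c :: real
  obtain fs where fs: "\<And>n. test_fun (fs n)" "(\<lambda>n. cls (fs n)) \<longlonglongrightarrow> a"
    using test_fun_dense[of a] by auto
  obtain gs where gs: "\<And>n. test_fun (gs n)" "(\<lambda>n. cls (gs n)) \<longlonglongrightarrow> b"
    using test_fun_dense[of b] by auto
  note i = test_fun_integrable[OF fs(1)] test_fun_L2[OF fs(1)] test_fun_integrable[OF gs(1)] test_fun_L2[OF gs(1)]
  have "(\<lambda>n. cls (\<lambda>x. fs n x + gs n x)) \<longlonglongrightarrow> a + b"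
    by (simp add: cls_add i tendsto_add fs gs)
  then have "(\<lambda>n. cls (T (\<lambda>x. fs n x + gs n x))) \<longlonglongrightarrow> ext (a + b)"
    by (intro ext_lim) (auto intro: L2_add[OF i(2,4)] Bochner_Integration.integrable_add i)
  moreover have "(\<lambda>n. cls (T (\<lambda>x. fs n x + gs n x))) \<longlonglongrightarrow> ext a + ext b"
    by (simp add: T_add i cls_add T_L2 tendsto_add ext_lim fs gs)
  ultimately show "ext (a + b) = ext a + ext b" by (rule LIMSEQ_unique)
  have "(\<lambda>n. cls (\<lambda>x. c *\<^sub>R fs n x)) \<longlonglongrightarrow> c *\<^sub>R a"
    by (simp add: cls_scaleR i tendsto_scaleR fs)
  then have "(\<lambda>n. cls (T (\<lambda>x. c *\<^sub>R fs n x))) \<longlonglongrightarrow> ext (c *\<^sub>R a)"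
    by (intro ext_lim) (auto intro: L2_scaleR[OF i(2)] integrable_scaleR_right i)
  moreover have "(\<lambda>n. cls (T (\<lambda>x. c *\<^sub>R fs n x))) \<longlonglongrightarrow> c *\<^sub>R ext a"
    by (simp add: T_scaleR i cls_scaleR T_L2 tendsto_scaleR ext_lim fs)
  ultimately show "ext (c *\<^sub>R a) = c *\<^sub>R ext a" by (rule LIMSEQ_unique)
qed (simp add: norm_ext)

text \<open>Polarisation of \<open>norm_ext\<close>.\<close>

lemma inner_ext: "ext a \<bullet> ext b = a \<bullet> b"
  by (simp add: dot_norm norm_ext flip: linear_simps(1)[OF bounded_linear_ext])

end

interpretation four: L2_isometry fourier_L1
  rewrites "extend_L2 fourier_L1 = fourier"
proof -
  show "L2_isometry fourier_L1"
  proof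
    fix f :: "real ^ 3 \<Rightarrow> complex ^ 3" and c :: real
    assume "integrable lborel f"
    then show "fourier_L1 (\<lambda>x. c *\<^sub>R f x) = (\<lambda>\<xi>. c *\<^sub>R fourier_L1 f \<xi>)"
      by (rule fourier_L1_linear) (auto simp: bounded_linear_scaleR_right vec_eq_iff)
  qed (auto simp: fourier_L1_add plancherel_L1)
  show "extend_L2 fourier_L1 = fourier" by (simp add: fourier_def)
qed

interpretation ifour: L2_isometry inv_fourier_L1
  rewrites "extend_L2 inv_fourier_L1 = inv_fourier"
proof -
  show "L2_isometry inv_fourier_L1"
  proof
    fix f g :: "real ^ 3 \<Rightarrow> complex ^ 3" and c :: real
    assume f: "integrable lborel f"
    show "inv_fourier_L1 (\<lambda>x. c *\<^sub>R f x) = (\<lambda>\<xi>. c *\<^sub>R inv_fourier_L1 f \<xi>)"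
      by (simp add: inv_fourier_L1_eq[abs_def] four.T_scaleR f)
    show "inv_fourier_L1 (\<lambda>x. f x + g x) = (\<lambda>\<xi>. inv_fourier_L1 f \<xi> + inv_fourier_L1 g \<xi>)" if "integrable lborel g"
      by (simp add: inv_fourier_L1_eq[abs_def] four.T_add f that)
    assume f2: "f \<in> L2"
    have F: "fourier_L1 f \<in> L2" by (rule plancherel_L1(1)[OF f f2])
    show "inv_fourier_L1 f \<in> L2"
      unfolding inv_fourier_L1_eq[abs_def] by (rule L2_mp[OF mp_uminus F])
    have "norm (cls (\<lambda>x. fourier_L1 f (- x))) = norm (cls (fourier_L1 f))"
    proof -
      have "(norm (cls (\<lambda>x. fourier_L1 f (- x))))\<^sup>2 = (norm (cls (fourier_L1 f)))\<^sup>2"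
        unfolding norm_cls_sq[OF L2_mp[OF mp_uminus F]] norm_cls_sq[OF F]
        by (rule mp_integral[OF mp_uminus]) (use L2_measurable[OF F] in measurable)
      then show ?thesis by simp
    qed
    then show "norm (cls (inv_fourier_L1 f)) = norm (cls f)"
      unfolding inv_fourier_L1_eq[abs_def] plancherel_L1(2)[OF f f2] .
  qed
  show "extend_L2 inv_fourier_L1 = inv_fourier" by (simp add: inv_fourier_def)
qed

section \<open>The Fourier transforms as unitary operators and their symmetries\<close>

abbreviation "FT \<equiv> four.ext"
abbreviation "IFT \<equiv> ifour.ext"

lemma FT_adjoint: "FT a \<bullet> b = a \<bullet> IFT b"
proof -
  obtain fs where fs: "\<And>n. test_fun (fs n)" "(\<lambda>n. cls (fs n)) \<longlonglongrightarrow> a"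
    using test_fun_dense[of a] by auto
  obtain gs where gs: "\<And>n. test_fun (gs n)" "(\<lambda>n. cls (gs n)) \<longlonglongrightarrow> b"
    using test_fun_dense[of b] by auto
  note f = test_fun_integrable[OF fs(1)] test_fun_L2[OF fs(1)]
  note g = test_fun_integrable[OF gs(1)] test_fun_L2[OF gs(1)]
  have "cls (fourier_L1 (fs n)) \<bullet> cls (gs n) = cls (fs n) \<bullet> cls (inv_fourier_L1 (gs n))" for n
    by (simp add: inner_cls f g four.T_L2 ifour.T_L2 fourier_L1_adjoint)
  moreover have "(\<lambda>n. cls (fourier_L1 (fs n)) \<bullet> cls (gs n)) \<longlonglongrightarrow> FT a \<bullet> b"
    by (intro tendsto_inner four.ext_lim f g fs gs)
  moreover have "(\<lambda>n. cls (fs n) \<bullet> cls (inv_fourier_L1 (gs n))) \<longlonglongrightarrow> a \<bullet> IFT b"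
    by (intro tendsto_inner ifour.ext_lim f g fs gs)
  ultimately show ?thesis using LIMSEQ_unique by fastforce
qed

text \<open>The adjoint of an isometry is a left inverse of it. The inversion theorem is thus a
  consequence of Plancherel and \<open>FT_adjoint\<close>; the opposite order uses that
  \<open>IFT\<close> is an isometry as well.\<close>

lemma IFT_FT: "IFT (FT a) = a"
proof -
  have "b \<bullet> IFT (FT a) = b \<bullet> a" for b by (simp add: four.inner_ext flip: FT_adjoint)
  then show ?thesis using vector_eq_ldot by blast
qed

lemma FT_IFT: "FT (IFT a) = a"
proof -
  have "FT (IFT a) \<bullet> b = a \<bullet> b" for b by (simp add: ifour.inner_ext FT_adjoint)
  then show ?thesis using vector_eq_rdot by blast
qed

lemma IFT_adjoint: "IFT a \<bullet> b = a \<bullet> FT b"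
  using FT_adjoint[of b a] by (simp add: inner_commute)

lemma l2_eq_on_test:
  fixes U V :: "'b::euclidean_space l2 \<Rightarrow> 'c::euclidean_space l2"
  assumes "bounded_linear U" "bounded_linear V" "\<And>f. test_fun f \<Longrightarrow> U (cls f) = V (cls f)"
  shows "U a = V a"
proof -
  obtain fs where fs: "\<And>n. test_fun (fs n)" "(\<lambda>n. cls (fs n)) \<longlonglongrightarrow> a"
    using test_fun_dense[of a] by auto
  have "(\<lambda>n. U (cls (fs n))) \<longlonglongrightarrow> U a" by (rule bounded_linear.tendsto[OF assms(1) fs(2)])
  moreover have "(\<lambda>n. U (cls (fs n))) \<longlonglongrightarrow> V a"
    unfolding assms(3)[OF fs(1)] by (rule bounded_linear.tendsto[OF assms(2) fs(2)])
  ultimately show ?thesis by (rule LIMSEQ_unique)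
qed

text \<open>Writing the phase as \<open>E' \<xi> \<bullet> E x\<close> and substituting
  \<open>E x\<close> moves the change of variables to the frequency side; for a linear
  \<open>E\<close>, the map \<open>E'\<close> is its inverse transpose. \<open>N\<close> has to
  commute with complex scalars in order to pass the kernel.\<close>

lemma FT_pull:
  assumes N: "bounded_linear N" "\<And>c v. N (c *s v) = c *s N v"
    and E: "mp E" "mp E'" "\<And>x \<xi>. E' \<xi> \<bullet> E x = \<xi> \<bullet> x"
  shows "FT (pull N E a) = pull N E' (FT a)"
proof (rule l2_eq_on_test[where U = "\<lambda>a. FT (pull N E a)" and V = "\<lambda>a. pull N E' (FT a)"])
  show "bounded_linear (\<lambda>a. FT (pull N E a))"
    by (rule bounded_linear_compose[OF four.bounded_linear_ext bounded_linear_pull[OF N(1) E(1)]])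
  show "bounded_linear (\<lambda>a. pull N E' (FT a))"
    by (rule bounded_linear_compose[OF bounded_linear_pull[OF N(1) E(2)] four.bounded_linear_ext])
  fix f :: "real ^ 3 \<Rightarrow> complex ^ 3" assume "test_fun f"
  then have f: "integrable lborel f" "f \<in> L2" by (rule test_fun_integrable, rule test_fun_L2)
  have [measurable]: "f \<in> borel_measurable borel" using f(2) by (rule L2_measurable)
  have fE: "integrable lborel (\<lambda>x. f (E x))" using mp_integrable[OF E(1), of f] f by simp
  have "FT (pull N E (cls f)) = cls (fourier_L1 (\<lambda>x. N (f (E x))))"
    unfolding pull_cls[OF N(1) E(1) f(2)]
    by (rule four.ext_L1[OF integrable_bounded_linear[OF N(1) fE] pull_L2[OF N(1) E(1) f(2)]])
  also have "fourier_L1 (\<lambda>x. N (f (E x))) = (\<lambda>\<xi>. N (fourier_L1 (\<lambda>x. f (E x)) \<xi>))"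
    by (rule fourier_L1_linear[OF fE N])
  also have "\<dots> = (\<lambda>\<xi>. N (fourier_L1 f (E' \<xi>)))"
  proof
    fix \<xi>
    have "fourier_L1 (\<lambda>x. f (E x)) \<xi> = (\<integral>x. cis (- 2 * pi * (E' \<xi> \<bullet> E x)) *s f (E x) \<partial>lborel)"
      by (simp add: fourier_L1_def E(3))
    also have "\<dots> = fourier_L1 f (E' \<xi>)"
      unfolding fourier_L1_def by (rule mp_integral[OF E(1)]) measurable
    finally show "N (fourier_L1 (\<lambda>x. f (E x)) \<xi>) = N (fourier_L1 f (E' \<xi>))" by simp
  qed
  also have "cls \<dots> = pull N E' (FT (cls f))"
    unfolding four.ext_L1[OF f] by (rule pull_cls[OF N(1) E(2) four.T_L2[OF f], symmetric])
  finally show "FT (pull N E (cls f)) = pull N E' (FT (cls f))" .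
qed

lemma IFT_pull:
  assumes N: "bounded_linear N" "\<And>c v. N (c *s v) = c *s N v"
    and E: "mp E" "mp E'" "\<And>x \<xi>. E' \<xi> \<bullet> E x = \<xi> \<bullet> x"
  shows "IFT (pull N E' a) = pull N E (IFT a)"
  using FT_pull[OF assms, of "IFT a"] IFT_FT[of "pull N E (IFT a)"] by (simp add: FT_IFT)

definition vcnj :: "complex ^ 3 \<Rightarrow> complex ^ 3" where "vcnj v = (\<chi> i. cnj (v $ i))"

lemma bounded_linear_vcnj: "bounded_linear vcnj"
  by (rule bounded_linear_intro[where K = 1]) (auto simp: vcnj_def vec_eq_iff norm_vec_def)

lemma vcnj_vs: "vcnj (c *s v) = cnj c *s vcnj v"
  by (simp add: vcnj_def vec_eq_iff)

text \<open>Conjugation does not commute with complex scalars, so \<open>FT_pull\<close> does not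
  cover it. It conjugates the kernel, which reflects the frequency; together with an even real
  symbol this keeps real functions real.\<close>

lemma FT_vcnj: "FT (pull vcnj (\<lambda>x. x) a) = pull vcnj uminus (FT a)"
proof (rule l2_eq_on_test[where U = "\<lambda>a. FT (pull vcnj (\<lambda>x. x) a)" and V = "\<lambda>a. pull vcnj uminus (FT a)"])
  show "bounded_linear (\<lambda>a. FT (pull vcnj (\<lambda>x. x) a))"
    by (rule bounded_linear_compose[OF four.bounded_linear_ext bounded_linear_pull[OF bounded_linear_vcnj mp_id]])
  show "bounded_linear (\<lambda>a. pull vcnj uminus (FT a))"
    by (rule bounded_linear_compose[OF bounded_linear_pull[OF bounded_linear_vcnj mp_uminus] four.bounded_linear_ext])
  fix f :: "real ^ 3 \<Rightarrow> complex ^ 3" assume "test_fun f"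
  then have f: "integrable lborel f" "f \<in> L2" by (rule test_fun_integrable, rule test_fun_L2)
  have [measurable]: "f \<in> borel_measurable borel" using f(2) by (rule L2_measurable)
  have "FT (pull vcnj (\<lambda>x. x) (cls f)) = cls (fourier_L1 (\<lambda>x. vcnj (f x)))"
    unfolding pull_cls[OF bounded_linear_vcnj mp_id f(2)]
    by (rule four.ext_L1[OF integrable_bounded_linear[OF bounded_linear_vcnj f(1)] L2_linear[OF bounded_linear_vcnj f(2)]])
  also have "fourier_L1 (\<lambda>x. vcnj (f x)) = (\<lambda>\<xi>. vcnj (fourier_L1 f (- \<xi>)))"
  proof
    fix \<xi>
    have "fourier_L1 (\<lambda>x. vcnj (f x)) \<xi> = (\<integral>x. vcnj (cis (- 2 * pi * (- \<xi> \<bullet> x)) *s f x) \<partial>lborel)"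
      by (simp add: fourier_L1_def vcnj_vs cis_cnj)
    also have "\<dots> = vcnj (fourier_L1 f (- \<xi>))"
      unfolding fourier_L1_def
      by (rule integral_bounded_linear[OF bounded_linear_vcnj integrable_cis_vs[OF f(1)]]) measurable
    finally show "fourier_L1 (\<lambda>x. vcnj (f x)) \<xi> = vcnj (fourier_L1 f (- \<xi>))" .
  qed
  also have "cls \<dots> = pull vcnj uminus (FT (cls f))"
    unfolding four.ext_L1[OF f] by (rule pull_cls[OF bounded_linear_vcnj mp_uminus four.T_L2[OF f], symmetric])
  finally show "FT (pull vcnj (\<lambda>x. x) (cls f)) = pull vcnj uminus (FT (cls f))" .
qed

lemma IFT_vcnj: "IFT (pull vcnj uminus a) = pull vcnj (\<lambda>x. x) (IFT a)"
  using FT_vcnj[of "IFT a"] IFT_FT[of "pull vcnj (\<lambda>x. x) (IFT a)"] by (simp add: FT_IFT)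

lemma IFT_eq_FT: "IFT a = FT (pull (\<lambda>v. v) uminus a)"
proof (rule l2_eq_on_test[OF ifour.bounded_linear_ext])
  show "bounded_linear (\<lambda>a. FT (pull (\<lambda>v. v) uminus a))"
    by (rule bounded_linear_compose[OF four.bounded_linear_ext bounded_linear_pull[OF bounded_linear_ident mp_uminus]])
  fix f :: "real ^ 3 \<Rightarrow> complex ^ 3" assume "test_fun f"
  then have f: "integrable lborel f" "f \<in> L2" by (rule test_fun_integrable, rule test_fun_L2)
  have "FT (pull (\<lambda>v. v) uminus (cls f)) = pull (\<lambda>v. v) uminus (FT (cls f))"
    by (rule FT_pull) (auto simp: bounded_linear_ident mp_uminus)
  also have "\<dots> = cls (\<lambda>x. fourier_L1 f (- x))"
    unfolding four.ext_L1[OF f] by (rule pull_cls[OF bounded_linear_ident mp_uminus four.T_L2[OF f]])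
  finally show "IFT (cls f) = FT (pull (\<lambda>v. v) uminus (cls f))"
    unfolding ifour.ext_L1[OF f] by (simp add: inv_fourier_L1_eq[abs_def])
qed

subsection \<open>Fourier multipliers with even real symbols\<close>

definition fmult :: "(real ^ 3 \<Rightarrow> real) \<Rightarrow> (complex ^ 3) l2 \<Rightarrow> (complex ^ 3) l2" where
  "fmult k a = IFT (mulop k (FT a))"

lemma bounded_linear_fmult: "bmeas k \<Longrightarrow> bounded_linear (fmult k)"
  unfolding fmult_def[abs_def]
  by (intro bounded_linear_compose[OF ifour.bounded_linear_ext] bounded_linear_compose[OF bounded_linear_mulop]
      four.bounded_linear_ext)

lemma fmult_fmult: "bmeas k \<Longrightarrow> bmeas l \<Longrightarrow> fmult k (fmult l a) = fmult (\<lambda>x. k x * l x) a"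
  by (simp add: fmult_def FT_IFT mulop_mulop)

lemma fmult_1: "fmult (\<lambda>x. 1) a = a"
  by (simp add: fmult_def mulop_1 IFT_FT)

lemma inner_fmult: "bmeas k \<Longrightarrow> fmult k a \<bullet> b = a \<bullet> fmult k b"
  by (simp add: fmult_def IFT_adjoint inner_mulop FT_adjoint)

text \<open>Follows from \<open>FT_pull\<close>: conjugating a multiplier by a substitution yields
  the multiplier whose symbol is moved along \<open>E'\<close>.\<close>

lemma pull_fmult:
  assumes N: "bounded_linear N" "\<And>c v. N (c *s v) = c *s N v"
    and E: "mp E" "mp E'" "\<And>x \<xi>. E' \<xi> \<bullet> E x = \<xi> \<bullet> x" and k: "bmeas k"
  shows "pull N E (fmult k a) = fmult (\<lambda>\<xi>. k (E' \<xi>)) (pull N E a)"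
  unfolding fmult_def FT_pull[OF N E] IFT_pull[OF N E, symmetric] by (simp add: pull_mulop[OF N(1) E(2) k])

lemma fmult_vcnj:
  assumes k: "bmeas k" and even: "\<And>x. k (- x) = k x"
  shows "fmult k (pull vcnj (\<lambda>x. x) a) = pull vcnj (\<lambda>x. x) (fmult k a)"
proof -
  have "mulop k (pull vcnj uminus b) = pull vcnj uminus (mulop k b)" for b
    by (simp add: pull_mulop[OF bounded_linear_vcnj mp_uminus k] even)
  then show ?thesis by (simp add: fmult_def FT_vcnj IFT_vcnj)
qed

text \<open>The weak formulation contains the multiplier conjugated the other way round. Reflecting
  the frequency exchanges the two transforms and leaves an even symbol unchanged.\<close>

lemma fmult_swap:
  assumes k: "bmeas k" and even: "\<And>x. k (- x) = k x"
  shows "FT (mulop k (IFT a)) = fmult k a"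
proof -
  let ?R = "pull (\<lambda>v :: complex ^ 3. v) uminus"
  have RR: "?R (?R b) = b" for b
    by (simp add: pull_pull bounded_linear_ident mp_uminus pull_id)
  have "FT b = IFT (?R b)" for b by (simp add: IFT_eq_FT RR)
  moreover have "?R (mulop k b) = mulop k (?R b)" for b
    by (simp add: pull_mulop[OF bounded_linear_ident mp_uminus k] even)
  moreover have "?R (FT b) = FT (?R b)" for b
    by (rule FT_pull[symmetric]) (auto simp: bounded_linear_ident mp_uminus)
  ultimately show ?thesis
    unfolding fmult_def IFT_eq_FT[of a] by (metis RR)
qed

subsection \<open>Real and complex vectors\<close>

lemma cvec_Re_vec: "Re_vec (cvec v) = v"
  by (simp add: cvec_def Re_vec_def)

lemma vcnj_eq_iff: "vcnj v = v \<longleftrightarrow> v = cvec (Re_vec v)"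
  by (auto simp: vcnj_def cvec_def Re_vec_def vec_eq_iff complex_eq_iff)

lemma vcnj_cvec: "vcnj (cvec v) = cvec v"
  by (simp add: vcnj_eq_iff cvec_Re_vec)

lemma cvec_inner: "cvec v \<bullet> cvec w = v \<bullet> w"
  by (simp add: cvec_def inner_vec_def inner_complex_def)

lemma norm_cvec: "norm (cvec v) = norm v"
  by (simp add: norm_eq_sqrt_inner cvec_inner)

lemma bounded_linear_cvec: "bounded_linear cvec"
  by (rule bounded_linear_intro[where K = 1]) (auto simp: norm_cvec, auto simp: cvec_def vec_eq_iff scaleR_conv_of_real[where 'a = complex])

lemma norm_Re_vec_le: "norm (Re_vec v) \<le> norm v"
  by (auto simp: Re_vec_def norm_vec_def intro!: L2_set_mono abs_Re_le_cmod)

lemma bounded_linear_Re_vec: "bounded_linear Re_vec"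
  by (rule bounded_linear_intro[where K = 1]) (auto simp: norm_Re_vec_le, auto simp: Re_vec_def vec_eq_iff)

lemma cmat_mult: "cmat (X ** Y) = cmat X ** cmat Y"
  by (simp add: cmat_def matrix_matrix_mult_def vec_eq_iff)

lemma cmat_1: "cmat (mat 1) = mat 1"
  by (simp add: cmat_def mat_def vec_eq_iff)

lemma vcnj_cmat: "vcnj (cmat X *v v) = cmat X *v vcnj v"
  by (simp add: vcnj_def cmat_def matrix_vector_mult_def vec_eq_iff)

lemma cmat_vs: "cmat X *v (c *s v) = c *s (cmat X *v v)"
  by (simp add: cmat_def matrix_vector_mult_def vec_eq_iff sum_distrib_left mult_ac)

lemma cmat_cvec: "cmat X *v cvec v = cvec (X *v v)"
  by (simp add: cmat_def cvec_def matrix_vector_mult_def vec_eq_iff)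

lemma cmat_inner: "(cmat X *v v) \<bullet> w = v \<bullet> (cmat (transpose X) *v w)"
proof -
  have r: "(complex_of_real r * a) \<bullet> b = r * (a \<bullet> b)" "b \<bullet> (complex_of_real r * a) = r * (b \<bullet> a)" for r a b
    by (simp_all add: inner_complex_def algebra_simps)
  show ?thesis
    unfolding inner_vec_def
    by (simp add: cmat_def transpose_def matrix_vector_mult_def inner_sum_left inner_sum_right r) (rule sum.swap)
qed

lemma norm_cmat_le: "norm (cmat X *v v) \<le> msum X * norm v"
proof -
  have "norm (cmat X *v v) \<le> (\<Sum>i\<in>UNIV. norm ((cmat X *v v) $ i))"
    unfolding norm_vec_def by (rule L2_set_le_sum) simp
  also have "\<dots> \<le> (\<Sum>i\<in>UNIV. \<Sum>j\<in>UNIV. \<bar>X $ i $ j\<bar> * norm v)"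
  proof (rule sum_mono)
    fix i :: 3
    have "norm ((cmat X *v v) $ i) \<le> (\<Sum>j\<in>UNIV. norm (complex_of_real (X $ i $ j) * v $ j))"
      unfolding matrix_vector_mult_def cmat_def by (simp del: norm_mult) (rule norm_sum)
    also have "\<dots> \<le> (\<Sum>j\<in>UNIV. \<bar>X $ i $ j\<bar> * norm v)"
      by (intro sum_mono) (auto simp: norm_mult intro!: mult_left_mono Finite_Cartesian_Product.norm_nth_le)
    finally show "norm ((cmat X *v v) $ i) \<le> (\<Sum>j\<in>UNIV. \<bar>X $ i $ j\<bar> * norm v)" .
  qed
  also have "\<dots> = (\<Sum>i\<in>UNIV. \<Sum>j\<in>UNIV. \<bar>X $ i $ j\<bar>) * norm v" by (simp add: sum_distrib_right)
  also have "\<dots> \<le> msum X * norm v" by (intro mult_right_mono) (auto simp: msum_def)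
  finally show ?thesis .
qed

lemma matrix_vector_minus: "X *v (- v) = - (X *v v)" for X :: "real ^ 3 ^ 3"
  by (rule linear_neg[OF matrix_vector_mul_linear])

lemma norm_matrix_le: "norm (X *v v) \<le> msum X * norm v" for X :: "real ^ 3 ^ 3"
  using norm_cmat_le[of X "cvec v"] by (simp add: cmat_cvec norm_cvec)

lemma msum_transpose: "msum (transpose X) = msum X"
  unfolding msum_def transpose_def vec_lambda_beta by (subst sum.swap) (rule refl)

text \<open>Real classes are the fixed points of conjugation. In this form reality is inherited
  through every operator that commutes with \<open>vcnj\<close>, with no pointwise argument.\<close>

definition is_real :: "(complex ^ 3) l2 \<Rightarrow> bool" where
  "is_real a \<longleftrightarrow> pull vcnj (\<lambda>x. x) a = a"

definition cv :: "(real ^ 3) l2 \<Rightarrow> (complex ^ 3) l2" where "cv = pull cvec (\<lambda>x. x)"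
definition re :: "(complex ^ 3) l2 \<Rightarrow> (real ^ 3) l2" where "re = pull Re_vec (\<lambda>x. x)"

lemma bounded_linear_cv: "bounded_linear cv" and bounded_linear_re: "bounded_linear re"
  unfolding cv_def re_def by (intro bounded_linear_pull bounded_linear_cvec bounded_linear_Re_vec mp_id)+

lemma cv_cls: "f \<in> L2 \<Longrightarrow> cv (cls f) = cls (\<lambda>x. cvec (f x))"
  unfolding cv_def by (rule pull_cls[OF bounded_linear_cvec mp_id])

lemma re_cls: "f \<in> L2 \<Longrightarrow> re (cls f) = cls (\<lambda>x. Re_vec (f x))"
  unfolding re_def by (rule pull_cls[OF bounded_linear_Re_vec mp_id])

lemma cvec_L2: "f \<in> L2 \<Longrightarrow> (\<lambda>x. cvec (f x)) \<in> L2"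
  by (rule L2_linear[OF bounded_linear_cvec])

lemma Re_vec_L2: "f \<in> L2 \<Longrightarrow> (\<lambda>x. Re_vec (f x)) \<in> L2"
  by (rule L2_linear[OF bounded_linear_Re_vec])

lemma re_cv: "re (cv a) = a"
  unfolding re_def cv_def
  by (simp add: pull_pull bounded_linear_cvec bounded_linear_Re_vec mp_id cvec_Re_vec pull_id)

lemma inner_cv: "cv a \<bullet> cv b = a \<bullet> b"
proof -
  have "cv a \<bullet> cv b = (\<integral>x. cvec (rp a x) \<bullet> cvec (rp b x) \<partial>lborel)"
    unfolding cv_def pull_def by (rule inner_cls[OF cvec_L2[OF rp_L2] cvec_L2[OF rp_L2]])
  then show ?thesis by (simp add: cvec_inner inner_rp)
qed

lemma norm_cv: "norm (cv a) = norm a"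
  by (simp add: norm_eq_sqrt_inner inner_cv)

lemma is_real_cv: "is_real (cv a)"
  unfolding is_real_def cv_def
  by (simp add: pull_pull bounded_linear_cvec bounded_linear_vcnj mp_id vcnj_cvec)

lemma is_real_iff: "f \<in> L2 \<Longrightarrow> is_real (cls f) \<longleftrightarrow> (AE x in lborel. f x = cvec (Re_vec (f x)))"
  unfolding is_real_def pull_cls[OF bounded_linear_vcnj mp_id]
  by (subst cls_eq_iff) (auto simp: L2_linear[OF bounded_linear_vcnj] vcnj_eq_iff)

lemma cv_re: "is_real a \<Longrightarrow> cv (re a) = a"
proof -
  assume "is_real a"
  then have "AE x in lborel. rp a x = cvec (Re_vec (rp a x))" using is_real_iff[OF rp_L2, of a] by simp
  then have "cls (rp a) = cls (\<lambda>x. cvec (Re_vec (rp a x)))"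
    by (rule cls_eqI[OF rp_L2 cvec_L2[OF Re_vec_L2[OF rp_L2]]])
  also have "\<dots> = cv (re a)"
    using cv_cls[OF Re_vec_L2[OF rp_L2], of a] re_cls[OF rp_L2, of a] by simp
  finally show ?thesis by simp
qed

lemma is_real_add: "is_real a \<Longrightarrow> is_real b \<Longrightarrow> is_real (a + b)"
  and is_real_diff: "is_real a \<Longrightarrow> is_real b \<Longrightarrow> is_real (a - b)"
  and is_real_scaleR: "is_real a \<Longrightarrow> is_real (c *\<^sub>R a)"
  by (simp_all add: is_real_def linear_simps[OF bounded_linear_pull[OF bounded_linear_vcnj mp_id]])

subsection \<open>The linear flow and the symbol\<close>

locale linear_flow =
  fixes A :: "real ^ 3 ^ 3"
  assumes symmetric: "transpose A = A"
    and pos_def: "\<And>x :: real ^ 3. x \<noteq> 0 \<Longrightarrow> x \<bullet> (A *v x) > 0"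
begin

abbreviation "B \<equiv> matrix_inv A"
abbreviation "S \<equiv> S_mat A"

lemma invertible_A: "invertible A"
proof -
  have "\<forall>x. A *v x = 0 \<longrightarrow> x = 0" using pos_def by force
  then show ?thesis using matrix_left_invertible_ker[of A] invertible_left_inverse[of A] by blast
qed

lemma AB: "A ** B = mat 1"
proof -
  have "A ** B = mat 1 \<and> B ** A = mat 1"
    unfolding matrix_inv_def using invertible_A unfolding invertible_def by (rule someI_ex)
  then show ?thesis by simp
qed

lemma B_sym: "transpose B = B"
proof -
  have "transpose B ** A = mat 1"
    using arg_cong[OF AB, of transpose] by (simp add: matrix_transpose_mul symmetric transpose_mat)
  then have "transpose B ** (A ** B) = B" by (simp add: matrix_mul_assoc)
  then show ?thesis by (simp add: AB)
qed

text \<open>With y = Bx the form becomes y \<bullet> Ay.\<close>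

lemma B_pos: "x \<noteq> 0 \<Longrightarrow> x \<bullet> (B *v x) > 0"
proof -
  assume x: "x \<noteq> 0"
  have Ay: "A *v (B *v x) = x" by (simp add: matrix_vector_mul_assoc AB)
  then have "B *v x \<noteq> 0" using x by auto
  from pos_def[OF this] show ?thesis by (simp add: Ay inner_commute)
qed

text \<open>\<open>S = B J A - B J\<close> with \<open>B\<close> the inverse of \<open>A\<close>. By
  cyclicity the first term has the trace of \<open>J\<close>; the second is the product of a
  symmetric and an antisymmetric matrix. This is why the flow preserves volume.\<close>

lemma trace_S: "trace S = 0"
proof -
  have J: "transpose J_mat = - J_mat"
    by (simp add: vec_eq_iff transpose_def J_mat_def forall_3)
  have neg: "(- X) ** Y = - (X ** Y)" "trace (- X) = - trace X" for X Y :: "real ^ 3 ^ 3"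
    by (simp_all add: matrix_matrix_mult_def vec_eq_iff sum_negf trace_def)
  have tt: "trace (transpose X) = trace X" for X :: "real ^ 3 ^ 3" by (simp add: trace_def transpose_def)
  have "trace (B ** J_mat) = trace (transpose (B ** J_mat))" by (simp only: tt)
  also have "\<dots> = - trace (J_mat ** B)" by (simp only: matrix_transpose_mul J B_sym neg)
  also have "trace (J_mat ** B) = trace (B ** J_mat)" by (rule trace_mul_sym)
  finally have 1: "trace (B ** J_mat) = 0" by simp
  have "trace (B ** J_mat ** A) = trace (A ** (B ** J_mat))" by (rule trace_mul_sym)
  also have "\<dots> = trace J_mat" by (simp add: matrix_mul_assoc AB)
  also have "\<dots> = 0" by (simp add: trace_def J_mat_def sum_3)
  finally have 2: "trace (B ** J_mat ** A) = 0" .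
  have "S = B ** J_mat ** A - B ** J_mat"
    by (simp add: S_mat_def vec_eq_iff matrix_matrix_mult_def[of "B ** J_mat"] mat_def right_diff_distrib sum_subtractf
        if_distrib[of "\<lambda>x. _ * x"] cong: if_cong)
  then show ?thesis using 1 2 by (simp add: trace_sub)
qed

text \<open>\<open>Et\<close> moves points and \<open>Qt\<close> moves frequencies. They are dual:
  \<open>(Qt t *v \<xi>) \<bullet> (Et t *v x) = \<xi> \<bullet> x\<close>, which is the relation
  between \<open>E'\<close> and \<open>E\<close> in \<open>FT_pull\<close>.\<close>

definition Et :: "real \<Rightarrow> real ^ 3 ^ 3" where "Et t = mexp (t *\<^sub>R S)"
definition Qt :: "real \<Rightarrow> real ^ 3 ^ 3" where "Qt t = mexp ((- t) *\<^sub>R transpose S)"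

lemma Qt_eq: "Qt t = transpose (Et (- t))"
  unfolding Qt_def Et_def by (rule mexp_transpose)

lemma Et_0: "Et 0 = mat 1" by (simp add: Et_def mexp_0)
lemma Et_add: "Et s ** Et t = Et (s + t)" unfolding Et_def by (rule mexp_group)
lemma Et_Et: "Et s *v (Et t *v x) = Et (s + t) *v x" by (simp add: matrix_vector_mul_assoc Et_add)
lemma Et_inv: "Et t *v (Et (- t) *v x) = x" "Et (- t) *v (Et t *v x) = x" by (simp_all add: Et_Et Et_0)
lemma Qt_0: "Qt 0 = mat 1" by (simp add: Qt_def mexp_0)
lemma Qt_add: "Qt s ** Qt t = Qt (s + t)" unfolding Qt_def by (subst mexp_group) simp
lemma Qt_Qt: "Qt s *v (Qt t *v x) = Qt (s + t) *v x" by (simp add: matrix_vector_mul_assoc Qt_add)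

lemma mp_Et: "mp ((*v) (Et t))" unfolding Et_def by (rule mp_mexp[OF trace_S])

lemma mp_Qt: "mp ((*v) (Qt t))"
proof -
  have "trace (transpose S) = 0" using trace_S by (simp add: trace_def transpose_def)
  then show ?thesis unfolding Qt_def by (rule mp_mexp)
qed

lemma Qt_inner: "(Qt t *v x) \<bullet> y = x \<bullet> (Et (- t) *v y)"
  unfolding Qt_eq by (simp add: dot_lmul_matrix)

lemma Et_cont: "continuous_on X (\<lambda>t. Et (c * t + d) $ i $ j)"
proof -
  have "continuous_on UNIV (\<lambda>t. Et t $ i $ j)" unfolding Et_def by (rule continuous_mexp_entry)
  then show ?thesis by (rule continuous_on_compose2) (auto intro!: continuous_intros)
qed

lemma Et_mv_cont:
  assumes "continuous_on X f" "continuous_on X g"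
  shows "continuous_on X (\<lambda>p. Et (f p) *v g p)"
proof -
  have "continuous_on X (\<lambda>p. Et (f p) $ i $ j)" for i j
  proof -
    have "continuous_on UNIV (\<lambda>t. Et t $ i $ j)" using Et_cont[of UNIV 1 0] by simp
    then show ?thesis by (rule continuous_on_compose2[OF _ assms(1)]) simp
  qed
  then have "continuous_on X (\<lambda>p. Et (f p) $ i $ j * g p $ j)" for i j
    by (rule continuous_on_mult[OF _ continuous_on_component[OF assms(2)]])
  then show ?thesis
    unfolding matrix_vector_mult_def by (intro continuous_on_vec_lambda continuous_on_sum)
qed

lemma Qt_entry: "Qt t $ i $ j = Et (- t) $ j $ i"
  by (simp add: Qt_eq transpose_def)

lemma Qt_mv_cont:
  assumes "continuous_on X f" "continuous_on X g"
  shows "continuous_on X (\<lambda>p. Qt (f p) *v g p)"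
proof -
  have "continuous_on X (\<lambda>p. Et (- f p) $ j $ i)" for i j
  proof -
    have "continuous_on UNIV (\<lambda>t. Et (- t) $ j $ i)" using Et_cont[of UNIV "- 1" 0] by simp
    then show ?thesis by (rule continuous_on_compose2[OF _ assms(1)]) simp
  qed
  then have "continuous_on X (\<lambda>p. Et (- f p) $ j $ i * g p $ j)" for i j
    by (rule continuous_on_mult[OF _ continuous_on_component[OF assms(2)]])
  then show ?thesis
    unfolding matrix_vector_mult_def Qt_entry by (intro continuous_on_vec_lambda continuous_on_sum)
qed

lemma Et_bound:
  obtains K where "K \<ge> 1" "\<And>t. \<bar>t\<bar> \<le> M \<Longrightarrow> msum (Et t) \<le> K"
proof -
  have "continuous_on {- M..M} (\<lambda>t. msum (Et t))"
    unfolding msum_def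
    by (intro continuous_on_add continuous_on_const continuous_on_sum continuous_on_rabs)
      (use Et_cont[of "{- M..M}" 1 0] in simp)
  then have "compact ((\<lambda>t. msum (Et t)) ` {- M..M})" by (intro compact_continuous_image) auto
  then obtain K where "\<forall>t\<in>{- M..M}. \<bar>msum (Et t)\<bar> \<le> K"
    by (auto simp: bounded_iff dest!: compact_imp_bounded)
  then have K: "\<bar>msum (Et t)\<bar> \<le> K" if "\<bar>t\<bar> \<le> M" for t
  proof -
    have "t \<in> {- M..M}" using that by (simp add: abs_le_iff)
    then show ?thesis using \<open>\<forall>t\<in>{- M..M}. \<bar>msum (Et t)\<bar> \<le> K\<close> by blast
  qed
  show ?thesis
  proof
    show "max 1 K \<ge> 1" by simp
    show "msum (Et t) \<le> max 1 K" if "\<bar>t\<bar> \<le> M" for t using K[OF that] by linarith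
  qed
qed

section \<open>The symbol, its integral along the frequency flow, and the multiplier\<close>

abbreviation "m \<equiv> m_symb A"

lemma m_even: "m (- x) = m x"
  by (simp add: m_symb_def matrix_vector_minus)

lemma m_measurable [measurable]: "m \<in> borel_measurable borel"
  unfolding m_symb_def[abs_def] by measurable

lemma m_cont: "continuous_on (- {0}) m"
  unfolding m_symb_def[abs_def]
  by (intro continuous_intros linear_continuous_on) (use B_pos in force)+

lemma m_scale: "c \<noteq> 0 \<Longrightarrow> m (c *\<^sub>R x) = m x"
  by (simp add: m_symb_def linear_simps[OF matrix_vector_mul_bounded_linear])

text \<open>\<open>m\<close> is homogeneous of degree 0, so its bound on the compact unit sphere,
  where it is continuous, holds everywhere off the origin; at the origin the quotient is
  \<open>0 / 0 = 0\<close>.\<close>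

lemma m_bounded: obtains C where "C > 0" "\<And>x. \<bar>m x\<bar> \<le> C"
proof -
  have "compact (m ` sphere 0 1)"
    by (rule compact_continuous_image[OF continuous_on_subset[OF m_cont]]) auto
  then obtain C where C: "C > 0" "\<And>x. norm x = 1 \<Longrightarrow> \<bar>m x\<bar> \<le> C"
    by (auto simp: bounded_pos dest!: compact_imp_bounded)
  have "\<bar>m x\<bar> \<le> C" for x
  proof (cases "x = 0")
    case True
    then show ?thesis using C(1) by (simp add: m_symb_def)
  next
    case False
    then have "norm ((1 / norm x) *\<^sub>R x) = 1" by simp
    from C(2)[OF this] show ?thesis using m_scale[of "1 / norm x" x] False by simp
  qed
  then show ?thesis using C(1) that by blast
qed

lemma bmeas_m: "bmeas m"
  unfolding bmeas_def using m_bounded m_measurable by metis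

lemma m_tilde_eq: "m_tilde A t \<xi> = m (Qt t *v \<xi>)"
  by (simp add: m_tilde_def Qt_def)

lemma m_tilde_cont: "continuous_on X (\<lambda>t. m (Qt t *v \<xi>))"
proof (cases "\<xi> = 0")
  case False
  have nz: "Qt t *v \<xi> \<noteq> 0" for t
  proof
    assume "Qt t *v \<xi> = 0"
    then have "Qt (- t) *v (Qt t *v \<xi>) = 0" by simp
    then show False using False by (simp add: Qt_Qt Qt_0)
  qed
  show ?thesis
    by (rule continuous_on_compose2[OF m_cont Qt_mv_cont]) (use nz in \<open>auto intro: continuous_intros\<close>)
qed simp

text \<open>The logarithm of \<open>M_tilde\<close>; additive identities for it become
  multiplicative ones for the multiplier.\<close>

definition phase :: "real \<Rightarrow> real ^ 3 \<Rightarrow> real" where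
  "phase t \<xi> = (LBINT r=ereal 0..ereal t. m (Qt r *v \<xi>))"

lemma M_tilde_eq: "M_tilde A t \<xi> = exp (phase t \<xi>)"
  by (simp add: M_tilde_def phase_def m_tilde_eq)

lemma phase_0: "phase 0 \<xi> = 0"
  by (simp add: phase_def)

lemma phase_deriv: "((\<lambda>t. phase t \<xi>) has_real_derivative m (Qt t *v \<xi>)) (at t)"
proof -
  \<comment> \<open>The interval contains 0, where the integral starts, and has \<open>t\<close> in
    its interior, so that the derivative within it is two-sided.\<close>
  define a where "a = - (\<bar>t\<bar> + 1)"
  define b where "b = \<bar>t\<bar> + 1"
  have ab: "a \<le> 0" "0 \<le> b" "a < t" "t < b" unfolding a_def b_def by linarith+
  have "((\<lambda>u. LBINT y=ereal 0..ereal u. m (Qt y *v \<xi>)) has_vector_derivative m (Qt t *v \<xi>)) (at t within {a..b})"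
    by (rule interval_integral_FTC2[OF ab(1,2) m_tilde_cont]) (use ab in auto)
  then have "((\<lambda>t. phase t \<xi>) has_real_derivative m (Qt t *v \<xi>)) (at t within {a..b})"
    by (simp add: phase_def has_real_derivative_iff_has_vector_derivative)
  then show ?thesis by (simp only: at_within_Icc_at[OF ab(3,4)])
qed

lemma phase_bound: "\<bar>phase t \<xi>\<bar> \<le> C * \<bar>t\<bar>" if C: "\<And>x. \<bar>m x\<bar> \<le> C"
proof -
  have "norm (phase t \<xi> - phase 0 \<xi>) \<le> C * norm (t - 0)"
    by (rule field_differentiable_bound[of UNIV "\<lambda>t. phase t \<xi>"])
      (auto intro: phase_deriv C)
  then show ?thesis by (simp add: phase_0)
qed

text \<open>As functions of \<open>s\<close> both sides have derivative
  \<open>m (Qt (t + s) *v \<xi>)\<close>, and they agree at \<open>s = 0\<close>.\<close>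

lemma phase_cocycle: "phase (t + s) \<xi> = phase t \<xi> + phase s (Qt t *v \<xi>)"
proof -
  let ?h = "\<lambda>s. phase (t + s) \<xi> - phase s (Qt t *v \<xi>)"
  have "?h s = ?h 0"
  proof (rule DERIV_isconst_all[of ?h s 0], intro allI)
    fix s
    have "((\<lambda>s. t + s) has_real_derivative 1) (at s)" by (auto intro!: derivative_eq_intros)
    from DERIV_chain2[OF phase_deriv this]
    have "((\<lambda>s. phase (t + s) \<xi>) has_real_derivative m (Qt (t + s) *v \<xi>)) (at s)" by simp
    from DERIV_diff[OF this phase_deriv[of "Qt t *v \<xi>" s]]
    show "(?h has_real_derivative 0) (at s)" by (simp add: Qt_Qt add.commute)
  qed
  then show ?thesis by (simp add: phase_0)
qed

lemma phase_even: "phase t (- \<xi>) = phase t \<xi>"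
  by (simp add: phase_def matrix_vector_minus m_even)

lemma phase_measurable [measurable]: "phase t \<in> borel_measurable borel"
proof -
  have "(\<lambda>p :: (real ^ 3) \<times> real. Qt (snd p) *v fst p) \<in> borel_measurable borel"
    by (intro borel_measurable_continuous_onI Qt_mv_cont continuous_intros)
  then have [measurable]: "(\<lambda>p :: (real ^ 3) \<times> real. Qt (snd p) *v fst p) \<in> borel \<Otimes>\<^sub>M borel \<rightarrow>\<^sub>M borel"
    by (simp add: borel_prod)
  have [measurable]: "(\<lambda>p. m (Qt (snd p) *v fst p)) \<in> borel_measurable (borel \<Otimes>\<^sub>M borel)"
    by (rule measurable_compose[OF _ m_measurable]) measurable
  have "(\<lambda>\<xi>. \<integral>r. indicator X r *\<^sub>R m (Qt r *v \<xi>) \<partial>lborel) \<in> borel_measurable borel" if "X \<in> sets borel" for X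
  proof (rule lborel.borel_measurable_lebesgue_integral)
    have "(\<lambda>p. indicator X (snd p) *\<^sub>R m (Qt (snd p) *v fst p)) \<in> borel_measurable (borel \<Otimes>\<^sub>M borel)"
      using that by measurable
    then show "(\<lambda>(\<xi>, r). indicator X r *\<^sub>R m (Qt r *v \<xi>)) \<in> borel_measurable (borel \<Otimes>\<^sub>M lborel)"
      by (simp add: split_beta')
  qed
  then show ?thesis
    unfolding phase_def[abs_def] interval_lebesgue_integral_def set_lebesgue_integral_def by auto
qed

definition Mt :: "real \<Rightarrow> real ^ 3 \<Rightarrow> real" where "Mt t \<xi> = exp (phase t \<xi>)"

lemma M_tilde_Mt: "M_tilde A t = Mt t" by (simp add: fun_eq_iff M_tilde_eq Mt_def)

lemma Mt_bound: "\<bar>Mt t \<xi>\<bar> \<le> exp (C * \<bar>t\<bar>)" if "\<And>x. \<bar>m x\<bar> \<le> C"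
  using phase_bound[OF that, of t \<xi>] by (simp add: Mt_def)

lemma bmeas_Mt: "bmeas (Mt t)"
proof -
  obtain C where C: "C > 0" "\<And>x. \<bar>m x\<bar> \<le> C" using m_bounded by blast
  have "Mt t \<in> borel_measurable borel" unfolding Mt_def[abs_def] by measurable
  then show ?thesis
    unfolding bmeas_def by (intro conjI exI[of _ "exp (C * \<bar>t\<bar>)"] allI Mt_bound C(2))
qed

lemma Mt_even: "Mt t (- \<xi>) = Mt t \<xi>" by (simp add: Mt_def phase_even)
lemma Mt_0: "Mt 0 \<xi> = 1" by (simp add: Mt_def phase_0)
lemma Mt_cocycle: "Mt (t + s) \<xi> = Mt s (Qt t *v \<xi>) * Mt t \<xi>"
  by (simp add: Mt_def phase_cocycle exp_add mult.commute)

subsection \<open>The solution group\<close>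

definition Tm :: "real \<Rightarrow> (complex ^ 3) l2 \<Rightarrow> (complex ^ 3) l2" where
  "Tm t = pull ((*v) (cmat (Qt t))) ((*v) (Et (- t)))"

text \<open>Since the flow preserves volume, the adjoint of \<open>Tm t\<close> uses the inverse
  substitution and the transposed matrix. A test function \<open>f\<close> is sent to
  \<open>Et (- t) *v f (Et t *v x)\<close>, which is again a test function.\<close>

definition Tadj :: "real \<Rightarrow> (complex ^ 3) l2 \<Rightarrow> (complex ^ 3) l2" where
  "Tadj t = pull ((*v) (cmat (Et (- t)))) ((*v) (Et t))"

definition Gt :: "real \<Rightarrow> (complex ^ 3) l2 \<Rightarrow> (complex ^ 3) l2" where
  "Gt t a = Tm t (fmult (Mt t) a)"

lemma bounded_linear_Tm: "bounded_linear (Tm t)"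
  unfolding Tm_def by (intro bounded_linear_pull matrix_vector_mul_bounded_linear mp_Et)

lemma bounded_linear_Gt: "bounded_linear (Gt t)"
  unfolding Gt_def[abs_def] by (intro bounded_linear_compose[OF bounded_linear_Tm] bounded_linear_fmult bmeas_Mt)

lemma Tm_add: "Tm s (Tm t a) = Tm (s + t) a"
  unfolding Tm_def
  by (subst pull_pull) (auto intro: mp_Et simp: matrix_vector_mul_assoc Et_add add.commute simp flip: cmat_mult Qt_add)

lemma Tm_0: "Tm 0 a = a"
  by (simp add: Tm_def pull_def Et_0 Qt_0 cmat_1)

lemma Tm_inner: "Tm t a \<bullet> b = a \<bullet> Tadj t b"
  unfolding Tm_def Tadj_def
proof (rule inner_pull)
  show "(cmat (Qt t) *v v) \<bullet> w = v \<bullet> (cmat (Et (- t)) *v w)" for v w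
    by (simp add: cmat_inner Qt_eq)
qed (auto simp: mp_Et Et_inv)

lemma Tm_fmult: "bmeas k \<Longrightarrow> Tm t (fmult k a) = fmult (\<lambda>\<xi>. k (Qt (- t) *v \<xi>)) (Tm t a)"
  unfolding Tm_def
  by (rule pull_fmult) (auto simp: mp_Et mp_Qt cmat_vs Qt_inner Et_inv)

text \<open>Moving the multiplier inside the transport factor evaluates its symbol along the
  frequency flow, exactly as the cocycle identity of \<open>Mt\<close> requires.\<close>

lemma fmult_Tm: "bmeas k \<Longrightarrow> fmult k (Tm t a) = Tm t (fmult (\<lambda>\<xi>. k (Qt t *v \<xi>)) a)"
  by (subst Tm_fmult) (auto simp: bmeas_comp mp_Qt Qt_Qt Qt_0)

lemma Gt_add: "Gt s (Gt t a) = Gt (s + t) a"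
proof -
  have "Gt s (Gt t a) = Tm (s + t) (fmult (\<lambda>\<xi>. Mt s (Qt t *v \<xi>) * Mt t \<xi>) a)"
    by (simp add: Gt_def fmult_Tm bmeas_Mt fmult_fmult bmeas_comp mp_Qt Tm_add)
  also have "(\<lambda>\<xi>. Mt s (Qt t *v \<xi>) * Mt t \<xi>) = Mt (s + t)"
    by (simp add: fun_eq_iff Mt_cocycle[symmetric] add.commute)
  finally show ?thesis by (simp add: Gt_def)
qed

lemma Gt_0: "Gt 0 a = a"
proof -
  have "Mt 0 = (\<lambda>x. 1)" by (simp add: fun_eq_iff Mt_0)
  then show ?thesis by (simp add: Gt_def Tm_0 fmult_1)
qed

lemma is_real_Tm: "is_real a \<Longrightarrow> is_real (Tm t a)"
proof -
  have "pull vcnj (\<lambda>x. x) (Tm t a) = Tm t (pull vcnj (\<lambda>x. x) a)" for a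
    unfolding Tm_def by (simp add: pull_pull bounded_linear_vcnj mp_id mp_Et vcnj_cmat)
  then show "is_real a \<Longrightarrow> is_real (Tm t a)" by (simp add: is_real_def)
qed

lemma is_real_fmult: "bmeas k \<Longrightarrow> (\<And>x. k (- x) = k x) \<Longrightarrow> is_real a \<Longrightarrow> is_real (fmult k a)"
  by (simp add: is_real_def fmult_vcnj[symmetric])

lemma is_real_Gt: "is_real a \<Longrightarrow> is_real (Gt t a)"
  by (simp add: Gt_def is_real_Tm is_real_fmult bmeas_Mt Mt_even)

lemma Tm_cls: "f \<in> L2 \<Longrightarrow> Tm t (cls f) = cls (\<lambda>x. cmat (Qt t) *v f (Et (- t) *v x))"
  unfolding Tm_def by (rule pull_cls[OF matrix_vector_mul_bounded_linear mp_Et])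

text \<open>The representatives selected inside \<open>fourier\<close> and
  \<open>inv_fourier\<close> become irrelevant on passing to classes: almost-everywhere equality
  survives the multiplication by \<open>Mt t\<close> and the volume-preserving substitution.\<close>

lemma G_op_Gt:
  assumes "\<phi> \<in> L2"
  shows "G_op A t \<phi> \<in> L2" and "cls (G_op A t \<phi>) = Gt t (cv (cls \<phi>))"
proof -
  let ?f = "\<lambda>y. cvec (\<phi> y)"
  have f: "?f \<in> L2" by (rule cvec_L2[OF assms])
  have Ff: "fourier ?f \<in> L2" using four.extend_L2[OF f] by simp
  have MF: "(\<lambda>\<xi>. Mt t \<xi> *\<^sub>R fourier ?f \<xi>) \<in> L2" by (rule mulop_L2[OF bmeas_Mt Ff])
  let ?g = "inv_fourier (\<lambda>\<xi>. Mt t \<xi> *\<^sub>R fourier ?f \<xi>)"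
  have g: "?g \<in> L2" using ifour.extend_L2[OF MF] by simp
  have G: "G_op A t \<phi> = (\<lambda>x. cmat (Qt t) *v ?g (Et (- t) *v x))"
    by (simp add: fun_eq_iff G_op_def M_tilde_Mt Qt_def Et_def)
  show "G_op A t \<phi> \<in> L2" unfolding G by (rule pull_L2[OF matrix_vector_mul_bounded_linear mp_Et g])
  have "cls ?g = IFT (mulop (Mt t) (FT (cls ?f)))"
    using ifour.ext_cls[OF MF] mulop_cls[OF bmeas_Mt Ff] four.ext_cls[OF f] by simp
  then show "cls (G_op A t \<phi>) = Gt t (cv (cls \<phi>))"
    unfolding G Tm_cls[OF g, symmetric] by (simp add: Gt_def fmult_def cv_cls assms)
qed

text \<open>Dominated convergence is sequential, and the bounds on the flow are uniform only on
  bounded time intervals; hence the restriction to sequences in \<open>{-1..1}\<close>.\<close>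

lemma tendsto_at_0I:
  fixes X :: "real \<Rightarrow> 'b::metric_space"
  assumes "\<And>r. r \<longlonglongrightarrow> 0 \<Longrightarrow> (\<And>n. r n \<noteq> 0) \<Longrightarrow> (\<And>n. \<bar>r n\<bar> \<le> 1) \<Longrightarrow> (\<lambda>n. X (r n)) \<longlonglongrightarrow> a"
  shows "(X \<longlongrightarrow> a) (at 0)"
proof -
  have "(X \<longlongrightarrow> a) (at 0 within {-1..1})"
    unfolding tendsto_at_iff_sequentially comp_def using assms by (auto simp: abs_le_iff)
  then show ?thesis by (subst (asm) at_within_Icc_at) simp_all
qed

lemma norm_Tm_le:
  obtains K where "K \<ge> 1" "\<And>t a. \<bar>t\<bar> \<le> 1 \<Longrightarrow> norm (Tm t a) \<le> K * norm a"
proof -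
  obtain K where K: "K \<ge> 1" "\<And>t. \<bar>t\<bar> \<le> 1 \<Longrightarrow> msum (Et t) \<le> K" using Et_bound[of 1] by blast
  have "norm (Tm t a) \<le> K * norm a" if "\<bar>t\<bar> \<le> 1" for t a
    unfolding Tm_def
  proof (rule norm_pull_le[OF matrix_vector_mul_bounded_linear mp_Et])
    fix v
    have "norm (cmat (Qt t) *v v) \<le> msum (Qt t) * norm v" by (rule norm_cmat_le)
    also have "msum (Qt t) \<le> K" using K(2)[of "- t"] that by (simp add: Qt_eq msum_transpose)
    finally show "norm (cmat (Qt t) *v v) \<le> K * norm v" by (simp add: mult_right_mono)
  qed (use K in simp)
  then show ?thesis using K(1) that by blast
qed

lemma cmat_Qt_tendsto:
  assumes "r \<longlonglongrightarrow> 0" "v \<longlonglongrightarrow> w"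
  shows "(\<lambda>n. cmat (Qt (r n)) *v v n) \<longlonglongrightarrow> w"
proof -
  have "(\<lambda>n. Et (- r n) $ j $ i) \<longlonglongrightarrow> Et (- 0) $ j $ i" for i j
  proof -
    have "continuous_on UNIV (\<lambda>t. Et (- t) $ j $ i)" using Et_cont[of UNIV "- 1" 0] by simp
    from continuous_on_tendsto_compose[OF this assms(1)] show ?thesis by simp
  qed
  from tendsto_mult[OF tendsto_of_real[OF this] tendsto_vec_nth[OF assms(2)]]
  have "(\<lambda>n. complex_of_real (Et (- r n) $ j $ i) * v n $ j) \<longlonglongrightarrow> complex_of_real (Et (- 0) $ j $ i) * w $ j" for i j .
  then have "(\<lambda>n. (cmat (Qt (r n)) *v v n) $ i) \<longlonglongrightarrow> (cmat (Qt 0) *v w) $ i" for i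
    unfolding matrix_vector_mult_def cmat_def vec_lambda_beta Qt_entry by (rule tendsto_sum)
  then show ?thesis by (intro vec_tendstoI) (simp add: Qt_0 cmat_1)
qed

lemma Tm_tendsto: "((\<lambda>t. Tm t a) \<longlongrightarrow> a) (at 0)"
proof (rule tendsto_at_0I)
  fix r :: "nat \<Rightarrow> real" assume r: "r \<longlonglongrightarrow> 0" "\<And>n. \<bar>r n\<bar> \<le> 1"
  obtain K where K: "K \<ge> 1" "\<And>t a. \<bar>t\<bar> \<le> 1 \<Longrightarrow> norm (Tm t a) \<le> K * norm a" using norm_Tm_le by blast
  obtain M where M: "M \<ge> 1" "\<And>t. \<bar>t\<bar> \<le> 1 \<Longrightarrow> msum (Et t) \<le> M" using Et_bound[of 1] by blast
  show "(\<lambda>n. Tm (r n) a) \<longlonglongrightarrow> a"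
  proof (rule strong_limit_dense[where V = "\<lambda>a. a" and C = K])
    fix f :: "real ^ 3 \<Rightarrow> complex ^ 3" assume f: "test_fun f"
    have cont: "continuous_on UNIV f" by (rule test_fun_cont[OF f])
    obtain b R where BR: "b \<ge> 0" "R > 0" "\<And>x. norm (f x) \<le> b * indicator (cball 0 R) x"
      using compact_support_bound[OF cont] f unfolding test_fun_iff by blast
    have f2: "f \<in> L2" by (rule test_fun_L2[OF f])
    show "(\<lambda>n. Tm (r n) (cls f)) \<longlonglongrightarrow> cls f"
      unfolding Tm_cls[OF f2]
    proof (rule l2_dominated_convergence(3)[where w = "\<lambda>x. (M * b) * indicator (cball 0 (M * R)) x"])
      show "(\<lambda>x. cmat (Qt (r n)) *v f (Et (- r n) *v x)) \<in> borel_measurable borel" for n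
        by (rule L2_measurable[OF pull_L2[OF matrix_vector_mul_bounded_linear mp_Et f2]])
      show "AE x in lborel. (\<lambda>n. cmat (Qt (r n)) *v f (Et (- r n) *v x)) \<longlonglongrightarrow> f x"
      proof (intro AE_I2 cmat_Qt_tendsto r(1))
        fix x
        have "continuous_on UNIV (\<lambda>t. Et (- t) *v x)" by (intro Et_mv_cont continuous_intros)
        from continuous_on_tendsto_compose[OF this r(1)]
        have "(\<lambda>n. Et (- r n) *v x) \<longlonglongrightarrow> x" by (simp add: Et_0)
        then show "(\<lambda>n. f (Et (- r n) *v x)) \<longlonglongrightarrow> f x"
          by (rule continuous_on_tendsto_compose[OF cont]) auto
      qed
      show "AE x in lborel. norm (cmat (Qt (r n)) *v f (Et (- r n) *v x)) \<le> (M * b) * indicator (cball 0 (M * R)) x" for n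
      proof (intro AE_I2)
        fix x
        let ?y = "Et (- r n) *v x"
        have 1: "norm (cmat (Qt (r n)) *v f ?y) \<le> M * norm (f ?y)"
          using norm_cmat_le[of "Qt (r n)" "f ?y"] M(2)[of "- r n"] r(2)[of n]
          by (smt (verit) Qt_eq msum_transpose abs_minus_cancel mult_right_mono norm_ge_zero)
        \<comment> \<open>The flow cannot shrink \<open>x\<close> by more than the factor
          \<open>M\<close>, since flowing back recovers \<open>x\<close>. So the transported
          function lives in the ball of radius \<open>M * R\<close>.\<close>
        have 2: "norm x \<le> M * norm ?y"
          using norm_matrix_le[of "Et (r n)" ?y] M(2)[of "r n"] r(2)[of n]
          by (smt (verit) Et_inv(1) mult_right_mono norm_ge_zero)
        show "norm (cmat (Qt (r n)) *v f ?y) \<le> (M * b) * indicator (cball 0 (M * R)) x"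
        proof (cases "norm ?y \<le> R")
          case True
          then have "norm x \<le> M * R" using 2 M(1) by (smt (verit) mult_left_mono)
          moreover have "M * norm (f ?y) \<le> M * b" using BR(3)[of ?y] True M(1) by (intro mult_left_mono) auto
          ultimately show ?thesis using 1 by simp
        next
          case False
          then have "norm (f ?y) \<le> 0" using BR(3)[of ?y] by simp
          then show ?thesis using M(1) BR(1) by simp
        qed
      qed
    qed (use L2_measurable[OF f2] in simp_all)
  qed (use K r(2) in \<open>auto simp: bounded_linear_Tm\<close>)
qed

text \<open>The operators \<open>Tm t\<close> are uniformly bounded near 0, so strong continuity
  tolerates a moving argument. This is what the product rule for \<open>Gt\<close> needs.\<close>

lemma Tm_tendsto2:
  assumes "(c \<longlongrightarrow> a) (at 0)" shows "((\<lambda>t. Tm t (c t)) \<longlongrightarrow> a) (at 0)"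
proof -
  obtain K where K: "K \<ge> 1" "\<And>t a. \<bar>t\<bar> \<le> 1 \<Longrightarrow> norm (Tm t a) \<le> K * norm a" using norm_Tm_le by blast
  have "((\<lambda>t. K * norm (c t - a)) \<longlongrightarrow> K * 0) (at 0)"
    using assms by (intro tendsto_mult_left) (simp add: tendsto_norm_zero LIM_zero)
  then have z: "((\<lambda>t. K * norm (c t - a)) \<longlongrightarrow> 0) (at 0)" by simp
  have "\<forall>\<^sub>F t in at 0. \<bar>t\<bar> \<le> (1 :: real)"
    unfolding eventually_at by (rule exI[of _ 1]) auto
  then have "\<forall>\<^sub>F t in at 0. norm (Tm t (c t - a)) \<le> K * norm (c t - a)"
    by eventually_elim (rule K(2))
  then have "((\<lambda>t. Tm t (c t - a)) \<longlongrightarrow> 0) (at 0)" by (rule Lim_null_comparison[OF _ z])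
  from tendsto_add[OF this Tm_tendsto[of a]]
  show ?thesis by (simp add: linear_simps[OF bounded_linear_Tm])
qed

lemma fmult_Mt_deriv: "((\<lambda>s. (1 / s) *\<^sub>R (fmult (Mt s) a - a)) \<longlongrightarrow> fmult m a) (at 0)"
proof (rule tendsto_at_0I)
  fix r :: "nat \<Rightarrow> real" assume r: "r \<longlonglongrightarrow> 0" "\<And>n. r n \<noteq> 0" "\<And>n. \<bar>r n\<bar> \<le> 1"
  obtain C where C: "C > 0" "\<And>x. \<bar>m x\<bar> \<le> C" using m_bounded by blast
  let ?b = "FT a"
  let ?k = "\<lambda>n x. (Mt (r n) x - 1) / r n"
  have D: "((\<lambda>s. Mt s x) has_real_derivative Mt s x * m (Qt s *v x)) (at s)" for s x
    unfolding Mt_def by (rule DERIV_fun_exp[OF phase_deriv])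
  \<comment> \<open>Mean value theorem: for times in \<open>{-1..1}\<close> the symbol is at most
    \<open>exp C\<close> and its logarithmic derivative at most \<open>C\<close>, which bounds its
    difference quotients uniformly.\<close>
  have kb: "\<bar>?k n x\<bar> \<le> exp C * C" for n x
  proof -
    have "norm (Mt (r n) x - Mt 0 x) \<le> exp C * C * norm (r n - 0)"
    proof (rule field_differentiable_bound[of "{-1..1}" "\<lambda>s. Mt s x"])
      fix s :: real assume "s \<in> {-1..1}"
      then have "C * \<bar>s\<bar> \<le> C * 1" using C(1) by (intro mult_left_mono) auto
      then have "\<bar>Mt s x\<bar> \<le> exp C" using Mt_bound[OF C(2), of s x] by (smt (verit) exp_le_cancel_iff)
      then show "norm (Mt s x * m (Qt s *v x)) \<le> exp C * C"
        using C by (simp add: abs_mult mult_mono)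
      show "((\<lambda>s. Mt s x) has_field_derivative Mt s x * m (Qt s *v x)) (at s within {-1..1})"
        by (rule has_field_derivative_at_within[OF D])
    qed (use r(3)[of n] in auto)
    then show ?thesis using r(2)[of n] by (simp add: Mt_0 abs_divide divide_le_eq mult.commute)
  qed
  have Mm: "Mt s \<in> borel_measurable borel" for s using bmeas_Mt by (rule bmeas_measurable)
  have bk: "bmeas (?k n)" for n unfolding bmeas_def using kb Mm by auto
  have "(\<lambda>n. cls (\<lambda>x. ?k n x *\<^sub>R rp ?b x)) \<longlonglongrightarrow> cls (\<lambda>x. m x *\<^sub>R rp ?b x)"
  proof (rule l2_dominated_convergence(3)[where w = "\<lambda>x. (exp C * C) * norm (rp ?b x)"])
    have "integrable lborel (\<lambda>x. (exp C * C)\<^sup>2 * (norm (rp ?b x))\<^sup>2)"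
      using rp_L2[of ?b] by (auto simp: L2_iff)
    then show "integrable lborel (\<lambda>x. ((exp C * C) * norm (rp ?b x))\<^sup>2)" by (simp only: power_mult_distrib)
    show "AE x in lborel. (\<lambda>n. ?k n x *\<^sub>R rp ?b x) \<longlonglongrightarrow> m x *\<^sub>R rp ?b x"
    proof (intro AE_I2 tendsto_intros)
      fix x
      have "(\<lambda>h. (Mt (0 + h) x - Mt 0 x) / h) \<midarrow>0\<rightarrow> Mt 0 x * m (Qt 0 *v x)"
        using D[of x 0] by (simp add: DERIV_def)
      then have "(\<lambda>h. (Mt h x - 1) / h) \<midarrow>0\<rightarrow> m x" by (simp add: Mt_0 Qt_0)
      moreover have "filterlim r (at 0) sequentially" using r(1,2) by (simp add: filterlim_at)
      ultimately show "(\<lambda>n. ?k n x) \<longlonglongrightarrow> m x" by (rule filterlim_compose)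
    qed
    show "AE x in lborel. norm (?k n x *\<^sub>R rp ?b x) \<le> exp C * C * norm (rp ?b x)" for n
      unfolding norm_scaleR by (intro AE_I2 mult_right_mono kb norm_ge_zero)
  qed (use Mm in auto)
  then have "(\<lambda>n. mulop (?k n) ?b) \<longlonglongrightarrow> mulop m ?b" by (simp only: mulop_def)
  then have "(\<lambda>n. IFT (mulop (?k n) ?b)) \<longlonglongrightarrow> IFT (mulop m ?b)"
    by (rule bounded_linear.tendsto[OF ifour.bounded_linear_ext])
  moreover have "IFT (mulop (?k n) ?b) = (1 / r n) *\<^sub>R (fmult (Mt (r n)) a - a)" for n
  proof -
    have "mulop (?k n) ?b = cls (\<lambda>x. (1 / r n) *\<^sub>R (Mt (r n) x *\<^sub>R rp ?b x - rp ?b x))"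
      unfolding mulop_def by (rule arg_cong[of _ _ cls]) (simp add: fun_eq_iff algebra_simps diff_divide_distrib)
    also have "\<dots> = (1 / r n) *\<^sub>R (mulop (Mt (r n)) ?b - ?b)"
      by (simp add: cls_scaleR L2_diff mulop_L2 bmeas_Mt cls_diff mulop_def)
    finally show ?thesis
      by (simp add: linear_simps[OF ifour.bounded_linear_ext] fmult_def IFT_FT)
  qed
  ultimately show "(\<lambda>n. (1 / r n) *\<^sub>R (fmult (Mt (r n)) a - a)) \<longlonglongrightarrow> fmult m a"
    by (simp add: fmult_def[of m])
qed

lemma tendsto_from_quotient:
  fixes c :: "real \<Rightarrow> 'b::real_normed_vector"
  assumes "((\<lambda>s. (1 / s) *\<^sub>R (c s - a)) \<longlongrightarrow> d) (at 0)"
  shows "(c \<longlongrightarrow> a) (at 0)"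
proof -
  have "((\<lambda>s. s *\<^sub>R ((1 / s) *\<^sub>R (c s - a))) \<longlongrightarrow> 0 *\<^sub>R d) (at 0)"
    by (intro tendsto_scaleR assms tendsto_ident_at)
  moreover have "\<forall>\<^sub>F s in at 0. s *\<^sub>R ((1 / s) *\<^sub>R (c s - a)) = c s - a"
    by (auto simp: eventually_at_filter)
  ultimately have "((\<lambda>s. c s - a) \<longlongrightarrow> 0) (at 0)" by (simp add: tendsto_cong)
  then show ?thesis by (simp add: LIM_zero_iff)
qed

lemma Gt_tendsto_0: "((\<lambda>t. Gt t a) \<longlongrightarrow> a) (at 0)"
  unfolding Gt_def by (rule Tm_tendsto2[OF tendsto_from_quotient[OF fmult_Mt_deriv]])

text \<open>The group law shifts continuity at 0 to time \<open>t\<close>.\<close>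

lemma Gt_tendsto: "((\<lambda>s. Gt s a) \<longlongrightarrow> Gt t a) (at t)"
proof -
  have "((\<lambda>h. Gt t (Gt h a)) \<longlongrightarrow> Gt t a) (at 0)"
    by (rule bounded_linear.tendsto[OF bounded_linear_Gt Gt_tendsto_0])
  then have "((\<lambda>h. Gt (t + h) a) \<longlongrightarrow> Gt t a) (at 0)" by (simp add: Gt_add)
  then show ?thesis using LIM_offset_zero_cancel[of "\<lambda>s. Gt s a" t] by simp
qed

end

subsection \<open>Difference quotients\<close>

lemma vd_iff_quotient:
  fixes F :: "real \<Rightarrow> 'b::real_normed_vector"
  shows "(F has_vector_derivative d) (at t) \<longleftrightarrow> ((\<lambda>h. (1 / h) *\<^sub>R (F (t + h) - F t)) \<longlongrightarrow> d) (at 0)"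
proof -
  have "(F has_vector_derivative d) (at t) \<longleftrightarrow> (\<lambda>h. norm (F (t + h) - F t - h *\<^sub>R d) / norm h) \<midarrow>0\<rightarrow> 0"
    by (simp add: has_vector_derivative_def has_derivative_at bounded_linear_scaleR_left)
  also have "\<dots> \<longleftrightarrow> (\<lambda>h. norm ((1 / h) *\<^sub>R (F (t + h) - F t) - d)) \<midarrow>0\<rightarrow> 0"
  proof (rule tendsto_cong)
    have "norm (F (t + h) - F t - h *\<^sub>R d) / norm h = norm ((1 / h) *\<^sub>R (F (t + h) - F t) - d)" if "h \<noteq> 0" for h
    proof -
      have "(1 / h) *\<^sub>R (F (t + h) - F t) - d = (1 / h) *\<^sub>R (F (t + h) - F t - h *\<^sub>R d)"
        using that by (simp add: scaleR_diff_right)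
      then show ?thesis by simp
    qed
    then show "\<forall>\<^sub>F h in at 0. norm (F (t + h) - F t - h *\<^sub>R d) / norm h = norm ((1 / h) *\<^sub>R (F (t + h) - F t) - d)"
      by (auto simp: eventually_at_filter)
  qed
  also have "\<dots> \<longleftrightarrow> ((\<lambda>h. (1 / h) *\<^sub>R (F (t + h) - F t)) \<longlongrightarrow> d) (at 0)"
    by (simp add: tendsto_norm_zero_iff LIM_zero_iff)
  finally show ?thesis .
qed

lemma vd_componentwise:
  fixes F :: "real \<Rightarrow> real ^ 3"
  assumes "\<And>i. ((\<lambda>s. F s $ i) has_real_derivative d $ i) (at s)"
  shows "(F has_vector_derivative d) (at s)"
  unfolding has_vector_derivative_def
proof (subst has_derivative_componentwise_within, intro ballI)
  fix b :: "real ^ 3" assume "b \<in> Basis"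
  then obtain i where b: "b = axis i 1" by (auto simp: Basis_vec_def)
  show "((\<lambda>x. F x \<bullet> b) has_derivative (\<lambda>x. (x *\<^sub>R d) \<bullet> b)) (at s)"
    using assms[of i] by (simp add: b inner_axis has_real_derivative_iff_has_vector_derivative has_vector_derivative_def)
qed

lemma vector_deriv_bound:
  fixes F :: "real \<Rightarrow> 'b::real_normed_vector"
  assumes "\<And>s. \<bar>s\<bar> \<le> 1 \<Longrightarrow> (F has_vector_derivative F' s) (at s)" "\<And>s. \<bar>s\<bar> \<le> 1 \<Longrightarrow> norm (F' s) \<le> K" "\<bar>r\<bar> \<le> 1"
  shows "norm (F r - F 0) \<le> K * \<bar>r\<bar>"
proof -
  have "norm (F r - F 0) \<le> K * norm (r - 0)"
  proof (rule differentiable_bound[of "{-1..1}" F "\<lambda>s h. h *\<^sub>R F' s"])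
    fix s :: real assume s: "s \<in> {-1..1}"
    then have s1: "\<bar>s\<bar> \<le> 1" by (auto simp: abs_le_iff)
    show "(F has_derivative (\<lambda>h. h *\<^sub>R F' s)) (at s within {-1..1})"
      using assms(1)[OF s1] by (auto simp: has_vector_derivative_def intro: has_derivative_at_withinI)
    show "onorm (\<lambda>h. h *\<^sub>R F' s) \<le> K"
      by (rule onorm_bound) (use assms(2)[OF s1] order_trans[OF norm_ge_zero assms(2)[OF s1]] in
          \<open>simp_all add: mult.commute[of K] mult_left_mono\<close>)
  qed (use assms(3) in auto)
  then show ?thesis by simp
qed

context linear_flow
begin

subsection \<open>Curves of test functions\<close>

text \<open>Wider than the class of test functions on space-time: functions constant in \<open>t\<close> are allowed, so that
  the same differentiation lemma serves the strong and the weak formulation.\<close>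

definition adm :: "((real ^ 3) \<times> real \<Rightarrow> real ^ 3) \<Rightarrow> bool" where
  "adm f \<longleftrightarrow> (\<forall>p. f differentiable (at p)) \<and> (\<forall>v. continuous_on UNIV (\<lambda>p. frechet_derivative f (at p) v)) \<and>
     (\<exists>R>0. \<forall>x t. norm x > R \<longrightarrow> f (x, t) = 0)"

text \<open>The differential part of the adjoint expression in the weak formulation. The direction
  \<open>(S *v fst p, 1)\<close> is the velocity of the space-time curve
  \<open>(Et s *v x, t + s)\<close>, so one derivative holds both the time derivative and the
  transport.\<close>

definition Lf :: "((real ^ 3) \<times> real \<Rightarrow> real ^ 3) \<Rightarrow> (real ^ 3) \<times> real \<Rightarrow> real ^ 3" where
  "Lf f p = frechet_derivative f (at p) (S *v fst p, 1) - S *v f p"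

lemma adm_test:
  assumes "test_fun f" shows "adm f"
proof -
  have "Ck (Suc 0) f" "bounded {p. f p \<noteq> 0}" using assms by (auto simp: test_fun_iff)
  then obtain R where R: "R > 0" "\<And>p. f p \<noteq> 0 \<Longrightarrow> norm p \<le> R" by (auto simp: bounded_pos)
  have "f (x, t) = 0" if "norm x > R" for x t
  proof (rule ccontr)
    assume "f (x, t) \<noteq> 0"
    then have "norm (x, t) \<le> R" by (rule R(2))
    then show False using that norm_fst_le[of x t] by linarith
  qed
  then show ?thesis using \<open>Ck (Suc 0) f\<close> R(1) unfolding adm_def by auto
qed

lemma adm_D:
  assumes "adm f"
  shows "(f has_derivative frechet_derivative f (at p)) (at p)" "continuous_on UNIV f"
proof -
  have d: "f differentiable (at p)" for p using assms unfolding adm_def by blast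
  then show "(f has_derivative frechet_derivative f (at p)) (at p)" by (simp add: frechet_derivative_works)
  show "continuous_on UNIV f"
    by (rule differentiable_imp_continuous_on) (simp add: differentiable_on_def d)
qed

lemma frechet_fst:
  assumes "test_fun g"
  shows "frechet_derivative (\<lambda>p :: (real ^ 3) \<times> real. g (fst p)) (at p) v = frechet_derivative g (at (fst p)) (fst v)"
    and "((\<lambda>p :: (real ^ 3) \<times> real. g (fst p)) has_derivative (\<lambda>v. frechet_derivative g (at (fst p)) (fst v))) (at p)"
proof -
  have "Ck (Suc 0) g" using assms by (simp add: test_fun_def)
  from Ck_SucE(1)[OF this, of "fst p"]
  show D: "((\<lambda>p :: (real ^ 3) \<times> real. g (fst p)) has_derivative (\<lambda>v. frechet_derivative g (at (fst p)) (fst v))) (at p)"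
    by (rule has_derivative_compose[OF has_derivative_fst[OF has_derivative_ident]])
  show "frechet_derivative (\<lambda>p :: (real ^ 3) \<times> real. g (fst p)) (at p) v = frechet_derivative g (at (fst p)) (fst v)"
    using fun_cong[OF frechet_derivative_at[OF D], of v] by simp
qed

lemma adm_fst:
  assumes g: "test_fun g" shows "adm (\<lambda>p. g (fst p))"
  unfolding adm_def
proof (intro conjI allI)
  show "(\<lambda>p. g (fst p)) differentiable (at p)" for p :: "(real ^ 3) \<times> real"
    unfolding differentiable_def by (rule exI, rule frechet_fst(2)[OF g])
  have "Ck (Suc 0) g" "bounded {x. g x \<noteq> 0}" using g by (auto simp: test_fun_iff)
  then have c: "continuous_on UNIV (\<lambda>x. frechet_derivative g (at x) w)" for w by simp
  show "continuous_on UNIV (\<lambda>p :: (real ^ 3) \<times> real. frechet_derivative (\<lambda>p. g (fst p)) (at p) v)" for v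
    unfolding frechet_fst(1)[OF g]
    by (rule continuous_on_compose2[OF c continuous_on_fst[OF continuous_on_id]]) simp
  obtain R where "R > 0" "\<forall>x\<in>{x. g x \<noteq> 0}. norm x \<le> R"
    using \<open>bounded {x. g x \<noteq> 0}\<close> unfolding bounded_pos by blast
  then show "\<exists>R>0. \<forall>x (t :: real). norm x > R \<longrightarrow> g (fst (x, t)) = 0"
    by (intro exI[of _ R]) (auto simp: not_le[symmetric])
qed

text \<open>Admissibility gives continuity of the derivative only in fixed directions. Expanding in
  a basis extends it to the direction \<open>(S *v fst p, 1)\<close>, which varies with the
  point.\<close>

lemma frechet_sum_Basis:
  fixes f :: "'a::euclidean_space \<Rightarrow> 'b::real_normed_vector"
  assumes "f differentiable (at p)"
  shows "frechet_derivative f (at p) v = (\<Sum>b\<in>Basis. (v \<bullet> b) *\<^sub>R frechet_derivative f (at p) b)"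
proof -
  have l: "linear (frechet_derivative f (at p))"
    using assms by (simp add: linear_frechet_derivative)
  have "frechet_derivative f (at p) (\<Sum>b\<in>Basis. (v \<bullet> b) *\<^sub>R b) = (\<Sum>b\<in>Basis. (v \<bullet> b) *\<^sub>R frechet_derivative f (at p) b)"
    by (simp add: linear_sum[OF l] linear_cmul[OF l])
  then show ?thesis by (simp add: euclidean_representation)
qed

lemma Lf_cont: "adm f \<Longrightarrow> continuous_on UNIV (Lf f)"
proof -
  assume f: "adm f"
  have l: "continuous_on UNIV (\<lambda>p :: (real ^ 3) \<times> real. S *v fst p)"
    by (rule continuous_on_compose2[OF linear_continuous_on[OF matrix_vector_mul_bounded_linear, of UNIV S]])
      (auto intro: continuous_intros)
  have fc: "continuous_on UNIV (\<lambda>p. S *v f p)"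
    by (rule continuous_on_compose2[OF linear_continuous_on[OF matrix_vector_mul_bounded_linear, of UNIV S] adm_D(2)[OF f]]) simp
  have "Lf f = (\<lambda>p. (\<Sum>b\<in>Basis. ((S *v fst p, 1) \<bullet> b) *\<^sub>R frechet_derivative f (at p) b) - S *v f p)"
    unfolding Lf_def fun_eq_iff using f by (subst frechet_sum_Basis) (auto simp: adm_def)
  moreover have "continuous_on UNIV (\<lambda>p. (\<Sum>b\<in>Basis. ((S *v fst p, 1) \<bullet> b) *\<^sub>R frechet_derivative f (at p) b) - S *v f p)"
    by (intro continuous_on_diff continuous_on_sum continuous_on_scaleR continuous_on_inner continuous_on_Pair
        continuous_on_const l fc) (use f in \<open>unfold adm_def, blast\<close>)
  ultimately show ?thesis by simp
qed

lemma Lf_zero: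
  assumes f: "adm f" and R: "\<forall>x t. norm x > R \<longrightarrow> f (x, t) = 0" and x: "norm x > R"
  shows "Lf f (x, t) = 0"
proof -
  have op: "open {p :: (real ^ 3) \<times> real. R < norm (fst p)}"
    by (intro open_Collect_less continuous_intros)
  have "((\<lambda>_. 0) has_derivative (\<lambda>_. 0)) (at (x, t))" by (rule has_derivative_const)
  then have "(f has_derivative (\<lambda>_. 0)) (at (x, t))"
    by (rule has_derivative_transform_within_open[OF _ op]) (use R x in auto)
  then have "frechet_derivative f (at (x, t)) = (\<lambda>_. 0)" using frechet_derivative_at by metis
  then show ?thesis using R x by (simp add: Lf_def)
qed

lemma slice_L2:
  fixes g :: "(real ^ 3) \<times> real \<Rightarrow> real ^ 3"
  assumes g: "continuous_on UNIV g" and R: "\<forall>x t. norm x > R \<longrightarrow> g (x, t) = 0"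
  shows "continuous_on UNIV (\<lambda>x. g (x, t))" "(\<lambda>x. g (x, t)) \<in> L2"
proof -
  show c: "continuous_on UNIV (\<lambda>x. g (x, t))"
    by (rule continuous_on_compose2[OF g]) (auto intro!: continuous_intros)
  have "{x. g (x, t) \<noteq> 0} \<subseteq> cball 0 R" using R by (force simp: not_le[symmetric])
  then show "(\<lambda>x. g (x, t)) \<in> L2" by (intro compact_support_L2(1)[OF c] bounded_subset[OF bounded_cball])
qed

lemma slice_bound:
  fixes g :: "(real ^ 3) \<times> real \<Rightarrow> real ^ 3"
  assumes g: "continuous_on UNIV g" and R: "\<forall>x t. norm x > R \<longrightarrow> g (x, t) = 0"
  shows "\<exists>K\<ge>0. \<forall>x s. \<bar>s - t\<bar> \<le> 1 \<longrightarrow> norm (g (x, s)) \<le> K"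
proof -
  have "compact (g ` (cball 0 R \<times> {t - 1..t + 1}))"
    by (intro compact_continuous_image continuous_on_subset[OF g] compact_Times compact_cball compact_Icc) simp
  then obtain K where K: "K > 0" "\<forall>y\<in>g ` (cball 0 R \<times> {t - 1..t + 1}). norm y \<le> K"
    by (auto simp: bounded_pos dest!: compact_imp_bounded)
  have "norm (g (x, s)) \<le> K" if "\<bar>s - t\<bar> \<le> 1" for x s
  proof (cases "norm x > R")
    case True then show ?thesis using R K(1) by simp
  next
    case False
    then have "(x, s) \<in> cball 0 R \<times> {t - 1..t + 1}" using that by (auto simp: abs_le_iff)
    then show ?thesis using K(2) by blast
  qed
  then show ?thesis using K(1) by (intro exI[of _ K]) auto
qed

lemma slice_curve_cont:
  fixes g :: "(real ^ 3) \<times> real \<Rightarrow> real ^ 3"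
  assumes g: "continuous_on UNIV g" and R: "\<forall>x t. norm x > R \<longrightarrow> g (x, t) = 0"
  shows "isCont (\<lambda>t. cls (\<lambda>x. cvec (g (x, t)))) t"
proof -
  obtain K where K: "K \<ge> 0" "\<And>x s. \<bar>s - t\<bar> \<le> 1 \<Longrightarrow> norm (g (x, s)) \<le> K"
    using slice_bound[OF g R] by blast
  have "((\<lambda>h. cls (\<lambda>x. cvec (g (x, t + h)))) \<longlongrightarrow> cls (\<lambda>x. cvec (g (x, t)))) (at 0)"
  proof (rule tendsto_at_0I)
    fix r :: "nat \<Rightarrow> real" assume r: "r \<longlonglongrightarrow> 0" "\<And>n. \<bar>r n\<bar> \<le> 1"
    show "(\<lambda>n. cls (\<lambda>x. cvec (g (x, t + r n)))) \<longlonglongrightarrow> cls (\<lambda>x. cvec (g (x, t)))"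
    proof (rule l2_dominated_convergence(3)[where w = "\<lambda>x. K * indicator (cball 0 R) x"])
      show "(\<lambda>x. cvec (g (x, t + r n))) \<in> borel_measurable borel" for n
        by (rule L2_measurable[OF cvec_L2[OF slice_L2(2)[OF g R]]])
      show "(\<lambda>x. cvec (g (x, t))) \<in> borel_measurable borel"
        by (rule L2_measurable[OF cvec_L2[OF slice_L2(2)[OF g R]]])
      show "AE x in lborel. (\<lambda>n. cvec (g (x, t + r n))) \<longlonglongrightarrow> cvec (g (x, t))"
      proof (intro AE_I2 bounded_linear.tendsto[OF bounded_linear_cvec])
        fix x :: "real ^ 3"
        have "(\<lambda>n. (x, t + r n)) \<longlonglongrightarrow> (x, t + 0)" by (intro tendsto_intros r(1))
        then show "(\<lambda>n. g (x, t + r n)) \<longlonglongrightarrow> g (x, t)"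
          by (intro continuous_on_tendsto_compose[OF g]) auto
      qed
      show "AE x in lborel. norm (cvec (g (x, t + r n))) \<le> K * indicator (cball 0 R) x" for n
        using K(2)[of "t + r n"] r(2)[of n] R by (intro AE_I2) (auto simp: norm_cvec indicator_def not_le)
    qed simp
  qed
  then show ?thesis unfolding isCont_def by (rule LIM_offset_zero_cancel)
qed

lemma Et_deriv: "((\<lambda>s. Et s *v x) has_vector_derivative S *v (Et s *v x)) (at s)"
proof (rule vd_componentwise)
  fix i
  have "((\<lambda>s. \<Sum>j\<in>UNIV. Et s $ i $ j * x $ j) has_real_derivative (\<Sum>j\<in>UNIV. (S ** Et s) $ i $ j * x $ j)) (at s)"
    unfolding Et_def by (intro DERIV_sum DERIV_cmult_right mexp_entry_deriv(1))
  then show "((\<lambda>s. (Et s *v x) $ i) has_real_derivative (S *v (Et s *v x)) $ i) (at s)"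
    by (simp add: matrix_vector_mul_assoc) (simp add: matrix_vector_mult_def)
qed

lemma Et_mv_deriv:
  assumes "(v has_vector_derivative v') (at s)"
  shows "((\<lambda>s. Et (- s) *v v s) has_vector_derivative Et (- s) *v (v' - S *v v s)) (at s)"
proof (rule vd_componentwise)
  fix i
  have E: "((\<lambda>s. Et (- s) $ i $ j) has_real_derivative - (Et (- s) ** S) $ i $ j) (at s)" for j
  proof -
    have "(uminus has_real_derivative - 1) (at s)" by (auto intro!: derivative_eq_intros)
    from DERIV_chain2[OF mexp_entry_deriv(2)[of S i j "- s"] this]
    show ?thesis unfolding Et_def by simp
  qed
  have V: "((\<lambda>s. v s $ j) has_real_derivative v' $ j) (at s)" for j
    using bounded_linear.has_vector_derivative[OF bounded_linear_vec_nth assms]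
    by (simp add: has_real_derivative_iff_has_vector_derivative)
  have "((\<lambda>s. \<Sum>j\<in>UNIV. Et (- s) $ i $ j * v s $ j) has_real_derivative
      (\<Sum>j\<in>UNIV. - (Et (- s) ** S) $ i $ j * v s $ j + v' $ j * Et (- s) $ i $ j)) (at s)"
    by (intro DERIV_sum DERIV_mult E V)
  moreover have "(\<Sum>j\<in>UNIV. - (Et (- s) ** S) $ i $ j * v s $ j + v' $ j * Et (- s) $ i $ j)
      = (Et (- s) *v (v' - S *v v s)) $ i"
    unfolding matrix_vector_mult_diff_distrib matrix_vector_mul_assoc
    by (simp add: matrix_vector_mult_def sum.distrib sum_negf sum_subtractf mult.commute)
  ultimately show "((\<lambda>s. (Et (- s) *v v s) $ i) has_real_derivative (Et (- s) *v (v' - S *v v s)) $ i) (at s)"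
    by (simp add: matrix_vector_mult_def)
qed

text \<open>Chain rule along characteristics: the moving argument supplies the transport and time
  derivatives, the factor \<open>Et (- s)\<close> the term with \<open>S\<close>.\<close>

lemma curve_deriv:
  assumes f: "adm f"
  shows "((\<lambda>s. Et (- s) *v f (Et s *v x, t + s)) has_vector_derivative Et (- s) *v Lf f (Et s *v x, t + s)) (at s)"
proof -
  let ?y = "Et s *v x" and ?D = "frechet_derivative f (at (Et s *v x, t + s))"
  have "((\<lambda>s. t + s) has_vector_derivative 1) (at s)" by (auto intro!: derivative_eq_intros)
  from has_vector_derivative_Pair[OF Et_deriv this]
  have "((\<lambda>s. (Et s *v x, t + s)) has_derivative (\<lambda>h. h *\<^sub>R (S *v ?y, 1))) (at s)"
    by (simp add: has_vector_derivative_def)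
  from has_derivative_compose[OF this adm_D(1)[OF f]]
  have "((\<lambda>s. f (Et s *v x, t + s)) has_derivative (\<lambda>h. ?D (h *\<^sub>R (S *v ?y, 1)))) (at s)" .
  moreover have "linear ?D" using f by (simp add: adm_def linear_frechet_derivative)
  then have "(\<lambda>h. ?D (h *\<^sub>R (S *v ?y, 1))) = (\<lambda>h. h *\<^sub>R ?D (S *v ?y, 1))"
    by (intro ext linear_cmul)
  ultimately have "((\<lambda>s. f (Et s *v x, t + s)) has_vector_derivative ?D (S *v ?y, 1)) (at s)"
    by (simp only: has_vector_derivative_def)
  from Et_mv_deriv[OF this] show ?thesis by (simp add: Lf_def)
qed

lemma Tadj_cvec:
  assumes "f \<in> L2"
  shows "Tadj s (cls (\<lambda>x. cvec (f x))) = cls (\<lambda>x. cvec (Et (- s) *v f (Et s *v x)))"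
  unfolding Tadj_def
  by (subst pull_cls[OF matrix_vector_mul_bounded_linear mp_Et cvec_L2[OF assms]]) (simp add: cmat_cvec)

text \<open>Pointwise this is \<open>curve_deriv\<close> at \<open>s = 0\<close>. The mean value
  bound \<open>M * K\<close> on the ball of radius \<open>M * R\<close>, outside which the quotients
  vanish, upgrades it to convergence in \<open>L2\<close>.\<close>

lemma Tadj_curve_deriv:
  assumes f: "adm f"
  shows "((\<lambda>s. (1 / s) *\<^sub>R (Tadj s (cls (\<lambda>x. cvec (f (x, t + s)))) - cls (\<lambda>x. cvec (f (x, t)))))
    \<longlongrightarrow> cls (\<lambda>x. cvec (Lf f (x, t)))) (at 0)"
proof (rule tendsto_at_0I)
  fix r :: "nat \<Rightarrow> real" assume r: "r \<longlonglongrightarrow> 0" "\<And>n. r n \<noteq> 0" "\<And>n. \<bar>r n\<bar> \<le> 1"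
  obtain R where R: "R > 0" "\<forall>x t. norm x > R \<longrightarrow> f (x, t) = 0" using f unfolding adm_def by blast
  have LR: "\<forall>x t. norm x > R \<longrightarrow> Lf f (x, t) = 0" using Lf_zero[OF f R(2)] by blast
  obtain K where K: "K \<ge> 0" "\<And>x s. \<bar>s - t\<bar> \<le> 1 \<Longrightarrow> norm (Lf f (x, s)) \<le> K"
    using slice_bound[OF Lf_cont[OF f] LR] by blast
  obtain M where M: "M \<ge> 1" "\<And>t. \<bar>t\<bar> \<le> 1 \<Longrightarrow> msum (Et t) \<le> M" using Et_bound[of 1] by blast
  have MM: "norm (Et s *v y) \<le> M * norm y" if "\<bar>s\<bar> \<le> 1" for s y
    using order_trans[OF norm_matrix_le mult_right_mono[OF M(2)[OF that] norm_ge_zero]] .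
  define F where "F s x = Et (- s) *v f (Et s *v x, t + s)" for s x
  have F0: "F 0 x = f (x, t)" for x by (simp add: F_def Et_0)
  have FD: "((\<lambda>s. F s x) has_vector_derivative Et (- s) *v Lf f (Et s *v x, t + s)) (at s)" for s x
    unfolding F_def by (rule curve_deriv[OF f])
  have f2: "(\<lambda>x. f (x, s)) \<in> L2" for s by (rule slice_L2(2)[OF adm_D(2)[OF f] R(2)])
  have F2: "F s \<in> L2" for s
    unfolding F_def by (rule pull_L2[OF matrix_vector_mul_bounded_linear mp_Et f2])
  have T: "Tadj s (cls (\<lambda>x. cvec (f (x, t + s)))) = cls (\<lambda>x. cvec (F s x))" for s
    unfolding F_def by (rule Tadj_cvec[OF f2])
  let ?q = "\<lambda>n x. (1 / r n) *\<^sub>R (F (r n) x - F 0 x)"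
  have q2: "?q n \<in> L2" for n by (intro L2_scaleR L2_diff[OF F2 F2])
  have Lf2: "(\<lambda>x. Lf f (x, t)) \<in> L2" by (rule slice_L2(2)[OF Lf_cont[OF f] LR])
  have "(\<lambda>n. cls (\<lambda>x. cvec (?q n x))) \<longlonglongrightarrow> cls (\<lambda>x. cvec (Lf f (x, t)))"
  proof (rule l2_dominated_convergence(3)[where w = "\<lambda>x. (M * K) * indicator (cball 0 (M * R)) x"])
    show "(\<lambda>x. cvec (?q n x)) \<in> borel_measurable borel" for n by (rule L2_measurable[OF cvec_L2[OF q2]])
    show "(\<lambda>x. cvec (Lf f (x, t))) \<in> borel_measurable borel" by (rule L2_measurable[OF cvec_L2[OF Lf2]])
    show "AE x in lborel. (\<lambda>n. cvec (?q n x)) \<longlonglongrightarrow> cvec (Lf f (x, t))"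
    proof (intro AE_I2 bounded_linear.tendsto[OF bounded_linear_cvec])
      fix x
      have "((\<lambda>h. (1 / h) *\<^sub>R (F (0 + h) x - F 0 x)) \<longlongrightarrow> Et (- 0) *v Lf f (Et 0 *v x, t + 0)) (at 0)"
        using FD[of x 0] by (simp only: vd_iff_quotient)
      then have "((\<lambda>h. (1 / h) *\<^sub>R (F h x - F 0 x)) \<longlongrightarrow> Lf f (x, t)) (at 0)" by (simp add: Et_0)
      moreover have "filterlim r (at 0) sequentially" using r(1,2) by (simp add: filterlim_at)
      ultimately show "(\<lambda>n. ?q n x) \<longlonglongrightarrow> Lf f (x, t)" by (rule filterlim_compose)
    qed
    show "AE x in lborel. norm (cvec (?q n x)) \<le> (M * K) * indicator (cball 0 (M * R)) x" for n
    proof (intro AE_I2)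
      fix x
      show "norm (cvec (?q n x)) \<le> (M * K) * indicator (cball 0 (M * R)) x"
      proof (cases "norm x \<le> M * R")
        case True
        have "norm (F (r n) x - F 0 x) \<le> (M * K) * \<bar>r n\<bar>"
        proof (rule vector_deriv_bound[OF FD _ r(3)])
          fix s :: real assume s: "\<bar>s\<bar> \<le> 1"
          have "norm (Et (- s) *v Lf f (Et s *v x, t + s)) \<le> M * norm (Lf f (Et s *v x, t + s))"
            by (rule MM) (use s in simp)
          also have "\<dots> \<le> M * K" using M(1) s by (intro mult_left_mono K(2)) auto
          finally show "norm (Et (- s) *v Lf f (Et s *v x, t + s)) \<le> M * K" .
        qed
        then show ?thesis using True r(2)[of n] by (simp add: norm_cvec divide_le_eq mult.commute)
      next
        case False
        have z: "F s x = 0" if s: "\<bar>s\<bar> \<le> 1" for s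
        proof -
          have "norm x \<le> M * norm (Et s *v x)" using MM[of "- s" "Et s *v x"] s by (simp add: Et_inv)
          then have "M * R < M * norm (Et s *v x)" using False by linarith
          then have "R < norm (Et s *v x)" using M(1) by simp
          then show ?thesis using R(2) by (simp add: F_def)
        qed
        show ?thesis using z[OF r(3)] z[of 0] M(1) K(1) False by (simp add: norm_cvec)
      qed
    qed
  qed simp
  moreover have "cls (\<lambda>x. cvec (?q n x)) = (1 / r n) *\<^sub>R (Tadj (r n) (cls (\<lambda>x. cvec (f (x, t + r n)))) - cls (\<lambda>x. cvec (f (x, t))))" for n
    unfolding T cv_cls[OF q2, symmetric] F0[symmetric]
    by (simp add: cls_scaleR cls_diff F2 L2_diff linear_simps[OF bounded_linear_cv] cv_cls[OF F2])
  ultimately show "(\<lambda>n. (1 / r n) *\<^sub>R (Tadj (r n) (cls (\<lambda>x. cvec (f (x, t + r n)))) - cls (\<lambda>x. cvec (f (x, t)))))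
    \<longlonglongrightarrow> cls (\<lambda>x. cvec (Lf f (x, t)))" by simp
qed


subsection \<open>The transport term\<close>

definition L0 :: "(real ^ 3 \<Rightarrow> real ^ 3) \<Rightarrow> real ^ 3 \<Rightarrow> real ^ 3" where
  "L0 f x = frechet_derivative f (at x) (S *v x) - S *v f x"

lemma Lf_fst: "test_fun f \<Longrightarrow> Lf (\<lambda>p. f (fst p)) (x, t) = L0 f x"
  by (simp add: Lf_def L0_def frechet_fst(1))

lemma Tadj_test_deriv:
  assumes f: "test_fun f"
  shows "((\<lambda>s. (1 / s) *\<^sub>R (Tadj s (cls (\<lambda>x. cvec (f x))) - cls (\<lambda>x. cvec (f x)))) \<longlongrightarrow> cls (\<lambda>x. cvec (L0 f x))) (at 0)"
  using Tadj_curve_deriv[OF adm_fst[OF f], of 0] by (simp add: Lf_fst[OF f])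

lemma L0_L2: assumes f: "test_fun f" shows "L0 f \<in> L2"
proof -
  obtain R where R: "\<forall>x t. norm x > R \<longrightarrow> (\<lambda>p. f (fst p)) (x, t :: real) = 0"
    using adm_fst[OF f] unfolding adm_def by blast
  have "\<forall>x t. norm x > R \<longrightarrow> Lf (\<lambda>p. f (fst p)) (x, t) = 0"
    using Lf_zero[OF adm_fst[OF f] R] by blast
  from slice_L2(2)[OF Lf_cont[OF adm_fst[OF f]] this, of 0]
  show ?thesis by (simp add: Lf_fst[OF f] eta_contract_eq)
qed

lemma matrix_axis_entry: "(X *v axis j 1) $ i = X $ i $ j" for X :: "real ^ 3 ^ 3"
  by (simp add: matrix_vector_mult_def axis_def if_distrib cong: if_cong)

text \<open>The product rule produces an extra term \<open>trace S *\<^sub>R f x\<close>, which is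
  zero; thus the divergence form used in \<open>weak_transport\<close> is a plain directional
  derivative.\<close>

lemma divergence_form:
  assumes f: "test_fun f"
  shows "(\<Sum>j\<in>UNIV. partial_deriv j (\<lambda>y. u_bar A y $ j *\<^sub>R f y) x) = frechet_derivative f (at x) (S *v x)"
proof -
  let ?D = "frechet_derivative f (at x)"
  have D: "(f has_derivative ?D) (at x)"
    using Ck_SucE(1)[of 0 f x] f by (simp only: test_fun_def)
  have "partial_deriv j (\<lambda>y. u_bar A y $ j *\<^sub>R f y) x = (S *v x) $ j *\<^sub>R ?D (axis j 1) + S $ j $ j *\<^sub>R f x" for j
  proof -
    have "bounded_linear (\<lambda>y. (S *v y) $ j)"
      by (rule bounded_linear_compose[OF bounded_linear_vec_nth matrix_vector_mul_bounded_linear])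
    then have "((\<lambda>y. (S *v y) $ j) has_derivative (\<lambda>y. (S *v y) $ j)) (at x)"
      by (rule bounded_linear_imp_has_derivative)
    from has_derivative_scaleR[OF this D]
    have "((\<lambda>y. u_bar A y $ j *\<^sub>R f y) has_derivative (\<lambda>h. (S *v x) $ j *\<^sub>R ?D h + (S *v h) $ j *\<^sub>R f x)) (at x)"
      by (simp add: u_bar_def)
    from fun_cong[OF frechet_derivative_at[OF this], of "axis j 1"]
    show ?thesis by (simp add: partial_deriv_def matrix_axis_entry)
  qed
  then have "(\<Sum>j\<in>UNIV. partial_deriv j (\<lambda>y. u_bar A y $ j *\<^sub>R f y) x)
      = (\<Sum>j\<in>UNIV. (S *v x) $ j *\<^sub>R ?D (axis j 1)) + trace S *\<^sub>R f x"
    by (simp add: sum.distrib trace_def scaleR_sum_left)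
  also have "(\<Sum>j\<in>UNIV. (S *v x) $ j *\<^sub>R ?D (axis j 1)) = ?D (\<Sum>j\<in>UNIV. (S *v x) $ j *\<^sub>R axis j 1)"
    using has_derivative_linear[OF D] by (simp add: linear_sum linear_cmul)
  also have "(\<Sum>j\<in>UNIV. (S *v x) $ j *\<^sub>R axis j 1) = S *v x"
    using basis_expansion[of "S *v x"] by (simp add: scalar_mult_eq_scaleR)
  finally show ?thesis by (simp add: trace_S)
qed

text \<open>Subtracting the pairing of \<open>\<phi>\<close> with \<open>S *v f x\<close> on both
  sides exhibits \<open>L0\<close> as the formal adjoint of the generator of the transport factor,
  which sends \<open>\<phi>\<close> to \<open>- g - transpose S *v \<phi>\<close>.\<close>

lemma weak_transport_iff:
  assumes \<phi>: "\<phi> \<in> L2" and g: "g \<in> L2"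
  shows "weak_transport (u_bar A) \<phi> g \<longleftrightarrow>
    (\<forall>f. test_fun f \<longrightarrow> cls \<phi> \<bullet> cls (L0 f) = cls (\<lambda>x. - g x - transpose S *v \<phi> x) \<bullet> cls f)"
proof -
  have St: "(\<lambda>x. transpose S *v \<phi> x) \<in> L2"
    by (rule L2_linear[OF matrix_vector_mul_bounded_linear \<phi>])
  have "((\<integral>x. g x \<bullet> f x \<partial>lborel) = - (\<integral>x. \<phi> x \<bullet> frechet_derivative f (at x) (S *v x) \<partial>lborel)) \<longleftrightarrow>
      cls \<phi> \<bullet> cls (L0 f) = cls (\<lambda>x. - g x - transpose S *v \<phi> x) \<bullet> cls f" if f: "test_fun f" for f
  proof -
    note f2 = test_fun_L2[OF f]
    have Sf: "(\<lambda>x. S *v f x) \<in> L2" by (rule L2_linear[OF matrix_vector_mul_bounded_linear f2])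
    have D: "(\<lambda>x. frechet_derivative f (at x) (S *v x)) \<in> L2"
      using L2_add[OF L0_L2[OF f] Sf] by (simp add: L0_def)
    have 1: "cls \<phi> \<bullet> cls (L0 f) = (\<integral>x. \<phi> x \<bullet> frechet_derivative f (at x) (S *v x) \<partial>lborel) - (\<integral>x. \<phi> x \<bullet> (S *v f x) \<partial>lborel)"
      using cls_diff[OF D Sf] by (simp add: L0_def[abs_def] inner_diff_right inner_cls \<phi> D Sf)
    have "cls (\<lambda>x. - g x - transpose S *v \<phi> x) = - cls g - cls (\<lambda>x. transpose S *v \<phi> x)"
      using cls_diff[OF L2_minus[OF g] St] by (simp only: cls_minus[OF g])
    then have "cls (\<lambda>x. - g x - transpose S *v \<phi> x) \<bullet> cls f
        = - (\<integral>x. g x \<bullet> f x \<partial>lborel) - (\<integral>x. (transpose S *v \<phi> x) \<bullet> f x \<partial>lborel)"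
      by (simp only: inner_diff_left inner_minus_left inner_cls[OF g f2] inner_cls[OF St f2])
    then have 2: "cls (\<lambda>x. - g x - transpose S *v \<phi> x) \<bullet> cls f
        = - (\<integral>x. g x \<bullet> f x \<partial>lborel) - (\<integral>x. \<phi> x \<bullet> (S *v f x) \<partial>lborel)"
      by (simp add: dot_lmul_matrix)
    show ?thesis unfolding 1 2 by linarith
  qed
  then show ?thesis unfolding weak_transport_def by (simp add: divergence_form)
qed

text \<open>Invariance of the test functions under the adjoint flow makes its derivative at time 0
  available at every time.\<close>

lemma test_fun_flow: assumes f: "test_fun f" shows "test_fun (\<lambda>x. Et (- t) *v f (Et t *v x))"
proof -
  have "Ck k (\<lambda>x. f (Et t *v x + 0))" for k
    by (rule Ck_affine) (use f in \<open>auto simp: test_fun_def\<close>)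
  then have "Ck k (\<lambda>x. Et (- t) *v f (Et t *v x))" for k
    by (intro Ck_linear[OF matrix_vector_mul_bounded_linear]) simp
  moreover have "{x. Et (- t) *v f (Et t *v x) \<noteq> 0} \<subseteq> (*v) (Et (- t)) ` {y. f y \<noteq> 0}"
  proof
    fix x assume "x \<in> {x. Et (- t) *v f (Et t *v x) \<noteq> 0}"
    then have "f (Et t *v x) \<noteq> 0" by auto
    then show "x \<in> (*v) (Et (- t)) ` {y. f y \<noteq> 0}"
      by (intro image_eqI[of _ _ "Et t *v x"]) (simp_all add: Et_inv)
  qed
  moreover have "bounded ((*v) (Et (- t)) ` {y. f y \<noteq> 0})"
    by (rule bounded_linear_image) (use f in \<open>auto simp: test_fun_iff\<close>)
  ultimately show ?thesis unfolding test_fun_iff by (blast intro: bounded_subset)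
qed

text \<open>Approximating \<open>w\<close> itself by test functions turns the hypothesis into
  \<open>w \<bullet> w \<le> e * norm w\<close>.\<close>

lemma l2_norm_le_by_test:
  fixes w :: "(real ^ 3) l2"
  assumes "\<And>f. test_fun f \<Longrightarrow> w \<bullet> cls f \<le> e * norm (cls f)" "0 \<le> e"
  shows "norm w \<le> e"
proof -
  obtain f where f: "\<And>n. test_fun (f n)" "(\<lambda>n. cls (f n)) \<longlonglongrightarrow> w" using test_fun_dense[of w] by auto
  have "w \<bullet> w \<le> e * norm w"
  proof (rule LIMSEQ_le)
    show "(\<lambda>n. w \<bullet> cls (f n)) \<longlonglongrightarrow> w \<bullet> w" by (intro tendsto_intros f)
    show "(\<lambda>n. e * norm (cls (f n))) \<longlonglongrightarrow> e * norm w" by (intro tendsto_intros f)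
    show "\<exists>N. \<forall>n\<ge>N. w \<bullet> cls (f n) \<le> e * norm (cls (f n))" using assms(1)[OF f(1)] by blast
  qed
  then have "norm w * norm w \<le> e * norm w" by (simp add: power2_norm_eq_inner flip: power2_eq_square)
  then show ?thesis using assms(2) by (cases "norm w = 0") auto
qed

text \<open>Duality: the pairing of \<open>Tm t a\<close> with a test function is differentiable with derivative the pairing of
  \<open>Tm t g\<close>, so the mean value theorem bounds the difference quotient of \<open>Tm\<close> in norm.\<close>

lemma Tm_deriv:
  assumes L: "\<And>f. test_fun f \<Longrightarrow> a \<bullet> cls (L0 f) = g \<bullet> cls f"
  shows "((\<lambda>s. (1 / s) *\<^sub>R (Tm s (cv a) - cv a)) \<longlongrightarrow> cv g) (at 0)"
proof (rule tendstoI)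
  fix e :: real assume e: "e > 0"
  have D: "((\<lambda>s. Tm s (cv a) \<bullet> cv (cls f)) has_real_derivative Tm t (cv g) \<bullet> cv (cls f)) (at t)" if f: "test_fun f" for f t
  proof -
    let ?f = "\<lambda>x. Et (- t) *v f (Et t *v x)"
    have ft: "test_fun ?f" by (rule test_fun_flow[OF f])
    have b: "Tadj t (cv (cls f)) = cls (\<lambda>x. cvec (?f x))"
      unfolding cv_cls[OF test_fun_L2[OF f]] by (rule Tadj_cvec[OF test_fun_L2[OF f]])
    have "((\<lambda>h. cv a \<bullet> ((1 / h) *\<^sub>R (Tadj h (cls (\<lambda>x. cvec (?f x))) - cls (\<lambda>x. cvec (?f x))))) \<longlongrightarrow> cv a \<bullet> cls (\<lambda>x. cvec (L0 ?f x))) (at 0)"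
      by (intro tendsto_inner tendsto_const Tadj_test_deriv[OF ft])
    also have "cv a \<bullet> cls (\<lambda>x. cvec (L0 ?f x)) = Tm t (cv g) \<bullet> cv (cls f)"
      unfolding Tm_inner b by (simp add: inner_cv L ft L0_L2 test_fun_L2[OF ft] flip: cv_cls)
    finally have "((\<lambda>h. cv a \<bullet> ((1 / h) *\<^sub>R (Tadj h (Tadj t (cv (cls f))) - Tadj t (cv (cls f))))) \<longlongrightarrow> Tm t (cv g) \<bullet> cv (cls f)) (at 0)"
      unfolding b .
    moreover have "cv a \<bullet> ((1 / h) *\<^sub>R (Tadj h (Tadj t (cv (cls f))) - Tadj t (cv (cls f))))
        = (Tm (t + h) (cv a) \<bullet> cv (cls f) - Tm t (cv a) \<bullet> cv (cls f)) / h" for h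
      by (simp add: inner_diff_right Tm_inner Tm_add[symmetric] divide_inverse mult.commute)
    ultimately show ?thesis by (simp only: DERIV_def)
  qed
  have "\<forall>\<^sub>F t in at 0. dist (Tm t (cv g)) (cv g) < e / 2"
    using Tm_tendsto[of "cv g"] e by (intro tendstoD) auto
  then obtain d where d: "d > 0" "\<And>t. t \<noteq> 0 \<Longrightarrow> \<bar>t\<bar> < d \<Longrightarrow> norm (Tm t (cv g) - cv g) < e / 2"
    by (auto simp: eventually_at dist_norm)
  \<comment> \<open>By strong continuity the derivative of each pairing is almost constant near 0,
    with an error that depends on the test function only through its norm.\<close>
  have d': "norm (Tm t (cv g) - cv g) \<le> e / 2" if "\<bar>t\<bar> < d" for t
    using d(2)[of t] that e by (cases "t = 0") (auto simp: Tm_0)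
  have "norm ((1 / s) *\<^sub>R (Tm s (cv a) - cv a) - cv g) \<le> e / 2" if s: "s \<noteq> 0" "\<bar>s\<bar> < d" for s
  proof -
    let ?w = "(1 / s) *\<^sub>R (Tm s (cv a) - cv a) - cv g"
    \<comment> \<open>The test functions are real, so they see \<open>?w\<close> only through its
      real part; as \<open>?w\<close> is real, its norm is still controlled.\<close>
    have r: "is_real ?w" by (intro is_real_diff is_real_scaleR is_real_Tm is_real_cv)
    have "norm (re ?w) \<le> e / 2"
    proof (rule l2_norm_le_by_test)
      fix f :: "real ^ 3 \<Rightarrow> real ^ 3" assume f: "test_fun f"
      \<comment> \<open>Subtracting the linear term leaves a function whose derivative is the
        pairing with \<open>Tm t (cv g) - cv g\<close>, small by \<open>d'\<close>.\<close>
      let ?b = "cv (cls f)" and ?k = "\<lambda>t. Tm t (cv a) \<bullet> cv (cls f) - t * (cv g \<bullet> cv (cls f))"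
      have "norm (?k s - ?k 0) \<le> e / 2 * norm ?b * norm (s - 0)"
      proof (rule field_differentiable_bound[of "{- \<bar>s\<bar>..\<bar>s\<bar>}" ?k])
        fix t assume t: "t \<in> {- \<bar>s\<bar>..\<bar>s\<bar>}"
        have "(?k has_real_derivative Tm t (cv g) \<bullet> ?b - cv g \<bullet> ?b) (at t)"
          by (intro DERIV_diff D[OF f] DERIV_cmult_right DERIV_ident[THEN DERIV_cong]) (auto intro!: derivative_eq_intros)
        then show "(?k has_field_derivative Tm t (cv g) \<bullet> ?b - cv g \<bullet> ?b) (at t within {- \<bar>s\<bar>..\<bar>s\<bar>})"
          by (rule has_field_derivative_at_within)
        have "\<bar>t\<bar> < d" using t s(2) by (auto simp: abs_le_iff)
        then have "norm (Tm t (cv g) - cv g) * norm ?b \<le> e / 2 * norm ?b" by (intro mult_right_mono d') auto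
        then show "norm (Tm t (cv g) \<bullet> ?b - cv g \<bullet> ?b) \<le> e / 2 * norm ?b"
          using Cauchy_Schwarz_ineq2[of "Tm t (cv g) - cv g" ?b] by (simp add: inner_diff_left)
      qed auto
      then have k: "\<bar>Tm s (cv a) \<bullet> ?b - s * (cv g \<bullet> ?b) - cv a \<bullet> ?b\<bar> \<le> e / 2 * norm ?b * \<bar>s\<bar>" by (simp add: Tm_0)
      have "re ?w \<bullet> cls f = ?w \<bullet> ?b" by (simp only: inner_cv[symmetric] cv_re[OF r])
      also have "\<dots> = (Tm s (cv a) \<bullet> ?b - s * (cv g \<bullet> ?b) - cv a \<bullet> ?b) / s"
        unfolding inner_diff_left inner_scaleR_left using s(1) by (simp add: field_simps)
      also have "\<dots> \<le> \<bar>(Tm s (cv a) \<bullet> ?b - s * (cv g \<bullet> ?b) - cv a \<bullet> ?b) / s\<bar>" by (rule abs_ge_self)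
      also have "\<dots> \<le> e / 2 * norm ?b" using k s(1) by (simp add: abs_divide divide_le_eq)
      finally show "re ?w \<bullet> cls f \<le> e / 2 * norm (cls f)" by (simp add: norm_cv)
    qed (use e in simp)
    moreover have "norm ?w = norm (re ?w)" using norm_cv[of "re ?w"] by (simp only: cv_re[OF r])
    ultimately show ?thesis by simp
  qed
  then have "\<forall>s. s \<noteq> 0 \<and> dist s 0 < d \<longrightarrow> dist ((1 / s) *\<^sub>R (Tm s (cv a) - cv a)) (cv g) < e"
    using e by (auto simp: dist_norm) (smt (verit) field_sum_of_halves)
  then show "\<forall>\<^sub>F s in at 0. dist ((1 / s) *\<^sub>R (Tm s (cv a) - cv a)) (cv g) < e"
    using d(1) unfolding eventually_at by blast
qed

text \<open>Used at times other than 0, where convergence of the quotients is known before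
  membership in the domain.\<close>

lemma Tm_deriv_converse:
  assumes "((\<lambda>s. (1 / s) *\<^sub>R (Tm s (cv a) - cv a)) \<longlongrightarrow> cv g) (at 0)" and f: "test_fun f"
  shows "a \<bullet> cls (L0 f) = g \<bullet> cls f"
proof -
  let ?b = "cls (\<lambda>x. cvec (f x))"
  have "((\<lambda>s. cv a \<bullet> ((1 / s) *\<^sub>R (Tadj s ?b - ?b))) \<longlongrightarrow> cv a \<bullet> cls (\<lambda>x. cvec (L0 f x))) (at 0)"
    by (intro tendsto_inner tendsto_const Tadj_test_deriv[OF f])
  moreover have "((\<lambda>s. ((1 / s) *\<^sub>R (Tm s (cv a) - cv a)) \<bullet> ?b) \<longlongrightarrow> cv g \<bullet> ?b) (at 0)"
    by (intro tendsto_inner tendsto_const assms)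
  moreover have "((1 / s) *\<^sub>R (Tm s (cv a) - cv a)) \<bullet> ?b = cv a \<bullet> ((1 / s) *\<^sub>R (Tadj s ?b - ?b))" for s
    by (simp add: inner_diff_left inner_diff_right Tm_inner)
  ultimately have "cv a \<bullet> cls (\<lambda>x. cvec (L0 f x)) = cv g \<bullet> ?b"
    by (simp only:) (rule tendsto_unique[OF trivial_limit_at])
  then show ?thesis by (simp add: inner_cv L0_L2[OF f] test_fun_L2[OF f] flip: cv_cls)
qed

end

lemma measurable_vec_nth:
  fixes f :: "'a \<Rightarrow> 'b::euclidean_space ^ 3"
  shows "f \<in> borel_measurable M \<Longrightarrow> (\<lambda>x. f x $ i) \<in> borel_measurable M"
  by (rule borel_measurable_continuous_on[OF continuous_on_component[OF continuous_on_id]])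

context linear_flow
begin

subsection \<open>Strong solutions\<close>

text \<open>Determines the class of the function chosen in \<open>transport\<close>: two candidates
  pair equally with all test functions, which are dense.\<close>

lemma weak_transport_unique:
  assumes \<phi>: "\<phi> \<in> L2" and g: "g \<in> L2" "weak_transport (u_bar A) \<phi> g"
    and h: "h \<in> L2" "weak_transport (u_bar A) \<phi> h"
  shows "cls g = cls h"
proof -
  have St: "(\<lambda>x. transpose S *v \<phi> x) \<in> L2"
    by (rule L2_linear[OF matrix_vector_mul_bounded_linear \<phi>])
  have split: "cls (\<lambda>x. - k x - transpose S *v \<phi> x) = - cls k - cls (\<lambda>x. transpose S *v \<phi> x)" if "k \<in> L2" for k
    using cls_diff[OF L2_minus[OF that] St] by (simp only: cls_minus[OF that])
  have "norm (cls g - cls h) \<le> 0"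
  proof (rule l2_norm_le_by_test)
    fix f :: "real ^ 3 \<Rightarrow> real ^ 3" assume f: "test_fun f"
    have "cls \<phi> \<bullet> cls (L0 f) = cls (\<lambda>x. - g x - transpose S *v \<phi> x) \<bullet> cls f"
      using weak_transport_iff[OF \<phi> g(1)] g(2) f by blast
    moreover have "cls \<phi> \<bullet> cls (L0 f) = cls (\<lambda>x. - h x - transpose S *v \<phi> x) \<bullet> cls f"
      using weak_transport_iff[OF \<phi> h(1)] h(2) f by blast
    ultimately have "cls (\<lambda>x. - g x - transpose S *v \<phi> x) \<bullet> cls f = cls (\<lambda>x. - h x - transpose S *v \<phi> x) \<bullet> cls f"
      by (rule trans[OF sym])
    then show "(cls g - cls h) \<bullet> cls f \<le> 0 * norm (cls f)"
      by (simp only: split[OF g(1)] split[OF h(1)]) (simp add: inner_diff_left)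
  qed simp
  then show ?thesis by simp
qed

lemma L_op_cls:
  assumes \<phi>: "\<phi> \<in> L2" and g: "g \<in> L2" "weak_transport (u_bar A) \<phi> g"
  shows "L_op A \<phi> \<in> L2"
    and "cls (L_op A \<phi>) = cv (cls (\<lambda>x. - g x - transpose S *v \<phi> x)) + fmult m (cv (cls \<phi>))"
proof -
  let ?t = "transport (u_bar A) \<phi>" and ?f = "\<lambda>y. cvec (\<phi> y)"
  have "\<exists>g. g \<in> L2 \<and> weak_transport (u_bar A) \<phi> g" using g by blast
  from someI_ex[OF this] have "?t \<in> L2 \<and> weak_transport (u_bar A) \<phi> ?t"
    unfolding transport_def .
  then have t: "?t \<in> L2" "cls ?t = cls g" using weak_transport_unique[OF \<phi> _ _ g] by auto
  have St: "(\<lambda>x. transpose S *v \<phi> x) \<in> L2"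
    by (rule L2_linear[OF matrix_vector_mul_bounded_linear \<phi>])
  have f: "?f \<in> L2" by (rule cvec_L2[OF \<phi>])
  have Ff: "fourier ?f \<in> L2" using four.extend_L2[OF f] by simp
  have MF: "mult_m A (fourier ?f) \<in> L2"
    unfolding mult_m_def[abs_def] by (rule mulop_L2[OF bmeas_m Ff])
  let ?i = "inv_fourier (mult_m A (fourier ?f))"
  have i: "?i \<in> L2" using ifour.extend_L2[OF MF] by simp
  have ci: "cls ?i = fmult m (cv (cls \<phi>))"
    using ifour.ext_cls[OF MF] mulop_cls[OF bmeas_m Ff] four.ext_cls[OF f]
    by (simp add: fmult_def cv_cls[OF \<phi>] mult_m_def[abs_def])
  have d: "(\<lambda>x. - ?t x - transpose S *v \<phi> x) \<in> L2" by (intro L2_diff L2_minus t St)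
  have L: "L_op A \<phi> = (\<lambda>x. cvec (- ?t x - transpose S *v \<phi> x) + ?i x)"
    by (simp add: fun_eq_iff L_op_def linear_simps[OF bounded_linear_cvec] del: transpose_matrix_vector)
  show "L_op A \<phi> \<in> L2" unfolding L by (rule L2_add[OF cvec_L2[OF d] i])
  have "cls (\<lambda>x. - ?t x - transpose S *v \<phi> x) = - cls ?t - cls (\<lambda>x. transpose S *v \<phi> x)"
    using cls_diff[OF L2_minus[OF t(1)] St] by (simp only: cls_minus[OF t(1)])
  also have "\<dots> = cls (\<lambda>x. - g x - transpose S *v \<phi> x)"
    using cls_diff[OF L2_minus[OF g(1)] St] by (simp only: cls_minus[OF g(1)] t(2))
  finally show "cls (L_op A \<phi>) = cv (cls (\<lambda>x. - g x - transpose S *v \<phi> x)) + fmult m (cv (cls \<phi>))"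
    unfolding L cls_add[OF cvec_L2[OF d] i] ci cv_cls[OF d, symmetric] by simp
qed

text \<open>A real representative of the evolution. By \<open>sol_cls\<close> it differs from
  \<open>G_op\<close> only on a null set, since real data evolve into real classes.\<close>

definition sol :: "(real ^ 3 \<Rightarrow> real ^ 3) \<Rightarrow> real \<Rightarrow> real ^ 3 \<Rightarrow> real ^ 3" where
  "sol \<phi>0 t = (\<lambda>x. Re_vec (G_op A t \<phi>0 x))"

lemma sol_cls:
  assumes "\<phi>0 \<in> L2"
  shows "sol \<phi>0 t \<in> L2" "cls (sol \<phi>0 t) = re (Gt t (cv (cls \<phi>0)))" "cv (cls (sol \<phi>0 t)) = Gt t (cv (cls \<phi>0))"
    and "AE x in lborel. G_op A t \<phi>0 x = cvec (sol \<phi>0 t x)"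
proof -
  note G = G_op_Gt[OF assms, of t]
  have r: "is_real (Gt t (cv (cls \<phi>0)))" by (intro is_real_Gt is_real_cv)
  show "sol \<phi>0 t \<in> L2" unfolding sol_def by (rule Re_vec_L2[OF G(1)])
  show c: "cls (sol \<phi>0 t) = re (Gt t (cv (cls \<phi>0)))"
    unfolding sol_def re_cls[OF G(1), symmetric] G(2) ..
  show "cv (cls (sol \<phi>0 t)) = Gt t (cv (cls \<phi>0))" unfolding c by (rule cv_re[OF r])
  show "AE x in lborel. G_op A t \<phi>0 x = cvec (sol \<phi>0 t x)"
    using r unfolding G(2)[symmetric] is_real_iff[OF G(1)] sol_def .
qed

lemma sol_0: "\<phi>0 \<in> L2 \<Longrightarrow> AE x in lborel. sol \<phi>0 0 x = \<phi>0 x"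
  using cls_eq_iff[OF sol_cls(1), of \<phi>0 \<phi>0 0] by (simp add: sol_cls(2) Gt_0 re_cv)

lemma Gt_cont: "isCont (\<lambda>t. Gt t a) t"
  unfolding isCont_def by (rule Gt_tendsto)

lemma L2_continuousI:
  assumes "\<And>t. \<phi> t \<in> L2" "\<And>t. isCont (\<lambda>t. cls (\<phi> t)) t"
  shows "L2_continuous \<phi>"
  unfolding L2_continuous_def
proof (intro conjI allI assms(1))
  fix t
  have "((\<lambda>s. norm (cls (\<phi> s) - cls (\<phi> t))) \<longlongrightarrow> 0) (at t)"
    using assms(2)[of t] by (intro tendsto_norm_zero LIM_zero) (simp add: isCont_def)
  moreover have "norm (cls (\<phi> s) - cls (\<phi> t)) = L2norm (\<lambda>x. \<phi> s x - \<phi> t x)" for s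
    by (simp add: assms(1) L2_diff flip: cls_diff norm_cls)
  ultimately show "((\<lambda>s. L2norm (\<lambda>x. \<phi> s x - \<phi> t x)) \<longlongrightarrow> 0) (at t)" by simp
qed

lemma L2_has_derivativeI:
  assumes \<phi>: "\<And>t. \<phi> t \<in> L2" and D: "D \<in> L2" and d: "((\<lambda>t. cls (\<phi> t)) has_vector_derivative cls D) (at t)"
  shows "L2_has_derivative \<phi> D t"
  unfolding L2_has_derivative_def
proof (intro conjI D)
  have "((\<lambda>h. (1 / (t + h - t)) *\<^sub>R (cls (\<phi> (t + h)) - cls (\<phi> t))) \<longlongrightarrow> cls D) (at 0)"
    using d unfolding vd_iff_quotient by simp
  then have "((\<lambda>s. (1 / (s - t)) *\<^sub>R (cls (\<phi> s) - cls (\<phi> t))) \<longlongrightarrow> cls D) (at t)"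
    by (rule LIM_offset_zero_cancel)
  then have "((\<lambda>s. norm ((1 / (s - t)) *\<^sub>R (cls (\<phi> s) - cls (\<phi> t)) - cls D)) \<longlongrightarrow> 0) (at t)"
    by (intro tendsto_norm_zero LIM_zero)
  moreover have "norm ((1 / (s - t)) *\<^sub>R (cls (\<phi> s) - cls (\<phi> t)) - cls D)
      = L2norm (\<lambda>x. (1 / (s - t)) *\<^sub>R (\<phi> s x - \<phi> t x) - D x)" for s
    by (simp only: \<phi> D L2_diff L2_scaleR flip: cls_diff cls_scaleR norm_cls)
  ultimately show "((\<lambda>s. L2norm (\<lambda>x. (1 / (s - t)) *\<^sub>R (\<phi> s x - \<phi> t x) - D x)) \<longlongrightarrow> 0) (at t)" by simp
qed

text \<open>A product rule in which the quotient of the multiplier sits under \<open>Tm s\<close>;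
  its limit is therefore taken with \<open>Tm_tendsto2\<close>.\<close>

lemma Gt_quotient:
  assumes "((\<lambda>s. (1 / s) *\<^sub>R (Tm s a - a)) \<longlongrightarrow> d) (at 0)"
  shows "((\<lambda>s. (1 / s) *\<^sub>R (Gt s a - a)) \<longlongrightarrow> fmult m a + d) (at 0)"
proof -
  have "(1 / s) *\<^sub>R (Gt s a - a) = Tm s ((1 / s) *\<^sub>R (fmult (Mt s) a - a)) + (1 / s) *\<^sub>R (Tm s a - a)" for s
    by (simp add: Gt_def linear_simps[OF bounded_linear_Tm] flip: scaleR_add_right)
  then show ?thesis using tendsto_add[OF Tm_tendsto2[OF fmult_Mt_deriv] assms] by simp
qed

text \<open>The multiplier part of the quotient always converges, so differentiability of the group
  along \<open>a\<close> forces that of the transport factor.\<close>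

lemma Tm_quotient:
  assumes "((\<lambda>s. (1 / s) *\<^sub>R (Gt s a - a)) \<longlongrightarrow> d) (at 0)"
  shows "((\<lambda>s. (1 / s) *\<^sub>R (Tm s a - a)) \<longlongrightarrow> d - fmult m a) (at 0)"
proof -
  have "(1 / s) *\<^sub>R (Tm s a - a) = (1 / s) *\<^sub>R (Gt s a - a) - Tm s ((1 / s) *\<^sub>R (fmult (Mt s) a - a))" for s
    by (simp add: Gt_def linear_simps[OF bounded_linear_Tm] flip: scaleR_diff_right)
  then show ?thesis using tendsto_diff[OF assms Tm_tendsto2[OF fmult_Mt_deriv]] by simp
qed

lemma Gt_quotient_shift:
  assumes "((\<lambda>s. (1 / s) *\<^sub>R (Gt s a - a)) \<longlongrightarrow> d) (at 0)"
  shows "((\<lambda>s. (1 / s) *\<^sub>R (Gt (t + s) a - Gt t a)) \<longlongrightarrow> Gt t d) (at 0)"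
proof -
  have "((\<lambda>s. Gt t ((1 / s) *\<^sub>R (Gt s a - a))) \<longlongrightarrow> Gt t d) (at 0)"
    by (rule bounded_linear.tendsto[OF bounded_linear_Gt assms])
  then show ?thesis by (simp add: linear_simps[OF bounded_linear_Gt] Gt_add)
qed

theorem strong_solution_sol:
  assumes \<phi>0: "\<phi>0 \<in> L2" and dom: "\<phi>0 \<in> dom_L A"
  shows "strong_solution A \<phi>0 (sol \<phi>0)"
proof -
  obtain g where g: "g \<in> L2" "weak_transport (u_bar A) \<phi>0 g" using dom by (auto simp: dom_L_def)
  let ?a = "cv (cls \<phi>0)"
  \<comment> \<open>The value of the operator on the initial datum; the derivative at time
    \<open>t\<close> is going to be \<open>Gt t la\<close>.\<close>
  define la where "la = fmult m ?a + cv (cls (\<lambda>x. - g x - transpose S *v \<phi>0 x))"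
  have real_la: "is_real la"
    unfolding la_def by (intro is_real_add is_real_cv is_real_fmult bmeas_m m_even)
  have "((\<lambda>s. (1 / s) *\<^sub>R (Tm s ?a - ?a)) \<longlongrightarrow> cv (cls (\<lambda>x. - g x - transpose S *v \<phi>0 x))) (at 0)"
    using weak_transport_iff[OF \<phi>0 g(1)] g(2) by (intro Tm_deriv) blast
  then have q: "((\<lambda>s. (1 / s) *\<^sub>R (Gt s ?a - ?a)) \<longlongrightarrow> la) (at 0)"
    unfolding la_def by (rule Gt_quotient)
  define \<phi>' where "\<phi>' t = rp (re (Gt t la))" for t
  have \<phi>'2: "\<phi>' t \<in> L2" "cls (\<phi>' t) = re (Gt t la)" for t by (simp_all add: \<phi>'_def)
  have "L2_continuous \<phi>'"
  proof (rule L2_continuousI)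
    show "isCont (\<lambda>t. cls (\<phi>' t)) t" for t
      unfolding \<phi>'2(2) by (rule bounded_linear.isCont[OF bounded_linear_re Gt_cont])
  qed (rule \<phi>'2)
  moreover have "L2_has_derivative (sol \<phi>0) (\<phi>' t) t" for t
  proof (rule L2_has_derivativeI)
    have "((\<lambda>t. Gt t ?a) has_vector_derivative Gt t la) (at t)"
      unfolding vd_iff_quotient by (rule Gt_quotient_shift[OF q])
    then show "((\<lambda>t. cls (sol \<phi>0 t)) has_vector_derivative cls (\<phi>' t)) (at t)"
      unfolding \<phi>'2(2) sol_cls(2)[OF \<phi>0] by (rule bounded_linear.has_vector_derivative[OF bounded_linear_re])
  qed (use \<phi>0 sol_cls(1) \<phi>'2(1) in auto)
  moreover have "sol \<phi>0 t \<in> dom_L A \<and> (AE x in lborel. cvec (\<phi>' t x) = L_op A (sol \<phi>0 t) x)" for t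
  proof -
    let ?p = "sol \<phi>0 t" and ?w = "Gt t la" and ?c = "Gt t ?a"
    note p2 = sol_cls(1)[OF \<phi>0, of t]
    have pc: "cv (cls ?p) = ?c" by (rule sol_cls(3)[OF \<phi>0])
    \<comment> \<open>By the group law, quotients at time \<open>t\<close> are quotients at time 0
      started from \<open>Gt t ?a\<close>.\<close>
    have "((\<lambda>s. (1 / s) *\<^sub>R (Gt s ?c - ?c)) \<longlongrightarrow> ?w) (at 0)"
      using Gt_quotient_shift[OF q, of t] by (simp add: Gt_add add.commute)
    then have T: "((\<lambda>s. (1 / s) *\<^sub>R (Tm s ?c - ?c)) \<longlongrightarrow> ?w - fmult m ?c) (at 0)" by (rule Tm_quotient)
    have r: "is_real (?w - fmult m ?c)"
      by (intro is_real_diff is_real_Gt is_real_fmult bmeas_m m_even real_la is_real_cv)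
    define h where "h = re (?w - fmult m ?c)"
    have h: "cv h = ?w - fmult m ?c" unfolding h_def by (rule cv_re[OF r])
    \<comment> \<open>The candidate for the transport derivative, solved for in
      \<open>rp h x = - k x - transpose S *v ?p x\<close>.\<close>
    define k where "k x = - rp h x - transpose S *v ?p x" for x
    have St: "(\<lambda>x. transpose S *v ?p x) \<in> L2"
      by (rule L2_linear[OF matrix_vector_mul_bounded_linear p2])
    have k2: "k \<in> L2" unfolding k_def by (intro L2_diff L2_minus rp_L2 St)
    have kh: "(\<lambda>x. - k x - transpose S *v ?p x) = rp h" by (simp add: k_def)
    have wt: "weak_transport (u_bar A) ?p k"
      unfolding weak_transport_iff[OF p2 k2] kh cls_rp
      using Tm_deriv_converse[of "cls ?p" h] T by (simp add: pc h)
    note L = L_op_cls[OF p2 k2 wt, unfolded kh cls_rp h pc]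
    have "cls (\<lambda>x. cvec (\<phi>' t x)) = cls (L_op A ?p)"
      unfolding cv_cls[OF \<phi>'2(1), symmetric] \<phi>'2(2) cv_re[OF is_real_Gt[OF real_la]] L(2) by simp
    then have "AE x in lborel. cvec (\<phi>' t x) = L_op A ?p x"
      using cls_eq_iff[OF cvec_L2[OF \<phi>'2(1)] L(1)] by blast
    moreover have "?p \<in> dom_L A" using p2 k2 wt by (auto simp: dom_L_def)
    ultimately show ?thesis by blast
  qed
  ultimately show ?thesis
    unfolding strong_solution_def using sol_cls(1)[OF \<phi>0] sol_0[OF \<phi>0] by blast
qed

subsection \<open>Weak solutions\<close>

text \<open>Joint differentiability on space-time merges the derivatives in time and along the field
  into one, in the direction \<open>(S *v x, 1)\<close>.\<close>

lemma adjoint_expr_Lf: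
  assumes f: "adm f"
  shows "vector_derivative (\<lambda>s. f (x, s)) (at t) + frechet_derivative (\<lambda>y. f (y, t)) (at x) (u_bar A x) - S *v f (x, t) = Lf f (x, t)"
proof -
  let ?D = "frechet_derivative f (at (x, t))"
  have lin: "linear ?D" using f unfolding adm_def by (blast intro: linear_frechet_derivative)
  have "((\<lambda>s. (x, s)) has_derivative (\<lambda>h. (0, h))) (at t)"
    by (rule has_derivative_Pair[OF has_derivative_const has_derivative_ident])
  from has_derivative_compose[OF this adm_D(1)[OF f]]
  have "((\<lambda>s. f (x, s)) has_derivative (\<lambda>h. ?D (0, h))) (at t)" .
  moreover have "(\<lambda>h. ?D (0, h)) = (\<lambda>h. h *\<^sub>R ?D (0, 1))"
  proof
    fix h
    have "?D (0, h) = ?D (h *\<^sub>R (0, 1))" by simp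
    also have "\<dots> = h *\<^sub>R ?D (0, 1)" by (rule linear_cmul[OF lin])
    finally show "?D (0, h) = h *\<^sub>R ?D (0, 1)" .
  qed
  ultimately have "((\<lambda>s. f (x, s)) has_vector_derivative ?D (0, 1)) (at t)"
    unfolding has_vector_derivative_def by (simp only:)
  then have 1: "vector_derivative (\<lambda>s. f (x, s)) (at t) = ?D (0, 1)"
    by (rule vector_derivative_at)
  have "((\<lambda>y. (y, t)) has_derivative (\<lambda>h. (h, 0))) (at x)"
    by (rule has_derivative_Pair[OF has_derivative_ident has_derivative_const])
  from has_derivative_compose[OF this adm_D(1)[OF f]]
  have "((\<lambda>y. f (y, t)) has_derivative (\<lambda>h. ?D (h, 0))) (at x)" .
  from fun_cong[OF frechet_derivative_at[OF this], of "u_bar A x"]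
  have 2: "frechet_derivative (\<lambda>y. f (y, t)) (at x) (u_bar A x) = ?D (S *v x, 0)" by (simp add: u_bar_def)
  have "?D (S *v x, 1) = ?D ((0, 1) + (S *v x, 0))" by simp
  also have "\<dots> = ?D (0, 1) + ?D (S *v x, 0)" by (rule linear_add[OF lin])
  finally show ?thesis unfolding 1 2 Lf_def by simp
qed

theorem weak_solution_sol:
  assumes \<phi>0: "\<phi>0 \<in> L2"
  shows "weak_solution A \<phi>0 (sol \<phi>0)"
  unfolding weak_solution_def
proof (intro conjI allI impI)
  let ?a = "cv (cls \<phi>0)"
  show "L2_continuous (sol \<phi>0)"
  proof (rule L2_continuousI)
    show "isCont (\<lambda>t. cls (sol \<phi>0 t)) t" for t
      unfolding sol_cls(2)[OF \<phi>0] by (rule bounded_linear.isCont[OF bounded_linear_re Gt_cont])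
  qed (rule sol_cls(1)[OF \<phi>0])
  show "AE x in lborel. sol \<phi>0 0 x = \<phi>0 x" by (rule sol_0[OF \<phi>0])
  fix f :: "(real ^ 3) \<times> real \<Rightarrow> real ^ 3" assume test: "test_fun f"
  have f: "adm f" by (rule adm_test[OF test])
  obtain R where R: "\<forall>x t. norm x > R \<longrightarrow> f (x, t) = 0" using f unfolding adm_def by blast
  have LR: "\<forall>x t. norm x > R \<longrightarrow> Lf f (x, t) = 0" using Lf_zero[OF f R] by blast
  have f2: "(\<lambda>x. f (x, t)) \<in> L2" for t by (rule slice_L2(2)[OF adm_D(2)[OF f] R])
  have L2: "(\<lambda>x. Lf f (x, t)) \<in> L2" for t by (rule slice_L2(2)[OF Lf_cont[OF f] LR])
  let ?cf = "\<lambda>t. cls (\<lambda>x. cvec (f (x, t)))" and ?cl = "\<lambda>t. cls (\<lambda>x. cvec (Lf f (x, t)))"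
  define h where "h t = Gt t ?a \<bullet> ?cf t" for t
  define k where "k t = Gt t ?a \<bullet> (?cl t + fmult m (?cf t))" for t
  have hk: "(h has_real_derivative k t) (at t)" for t
  proof -
    \<comment> \<open>In the pairing at time \<open>t + s\<close> the transport factor
      \<open>Tm s\<close> is moved to the test function as \<open>Tadj s\<close>. Only the bounded
      multiplier remains on the side of the solution, so both factors are differentiable at 0 for
      arbitrary initial data.\<close>
    let ?b = "Gt t ?a" and ?X = "\<lambda>s. fmult (Mt s) (Gt t ?a)" and ?Y = "\<lambda>s. Tadj s (?cf (t + s))"
    have M0: "fmult (Mt 0) c = c" for c
      using Gt_0[of c] by (simp add: Gt_def Tm_0)
    have Y0: "?Y 0 = ?cf t"
      using Tadj_cvec[OF f2[of t], of 0] by (simp add: Et_0)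
    have X: "(?X has_vector_derivative fmult m ?b) (at 0)"
      unfolding vd_iff_quotient using fmult_Mt_deriv[of ?b] by (simp add: M0)
    have Y: "(?Y has_vector_derivative ?cl t) (at 0)"
      unfolding vd_iff_quotient using Tadj_curve_deriv[OF f, of t] Y0 by simp
    have "((\<lambda>s. ?X s \<bullet> ?Y s) has_vector_derivative ?X 0 \<bullet> ?cl t + fmult m ?b \<bullet> ?Y 0) (at 0)"
      by (rule bounded_bilinear.has_vector_derivative[OF bounded_bilinear_inner X Y])
    moreover have "?X s \<bullet> ?Y s = h (t + s)" for s
      by (simp add: h_def Tm_inner[symmetric] Gt_add[of s t, symmetric, unfolded Gt_def[of s]] add.commute)
    moreover have "?X 0 \<bullet> ?cl t + fmult m ?b \<bullet> ?Y 0 = k t"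
      unfolding M0 Y0 by (simp add: k_def inner_add_right inner_fmult bmeas_m)
    ultimately have "((\<lambda>s. h (t + s)) has_vector_derivative k t) (at 0)" by simp
    then have "(h has_vector_derivative k t) (at t)" unfolding vd_iff_quotient by simp
    then show ?thesis by (simp add: has_real_derivative_iff_has_vector_derivative)
  qed
  have kc: "isCont k t" for t
    unfolding k_def
    by (intro isCont_inner isCont_add Gt_cont bounded_linear.isCont[OF bounded_linear_fmult[OF bmeas_m]]
        slice_curve_cont[OF adm_D(2)[OF f] R] slice_curve_cont[OF Lf_cont[OF f] LR])
  obtain T where T: "T > 0" "\<forall>p\<in>{p. f p \<noteq> 0}. norm p \<le> T"
    using test unfolding test_fun_iff bounded_pos by blast
  have fT: "f (x, t) = 0" if "\<bar>t\<bar> > T" for x t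
  proof (rule ccontr)
    assume "f (x, t) \<noteq> 0"
    then have "norm (x, t) \<le> T" using T(2) by blast
    then show False using that norm_snd_le[of t x] by simp
  qed
  have hT: "h t = 0" if "\<bar>t\<bar> > T" for t
  proof -
    have "cls (\<lambda>x. cvec (f (x, t))) = 0" using cls_0 fT[OF that] by (simp add: linear_simps[OF bounded_linear_cvec])
    then show ?thesis by (simp add: h_def)
  qed
  have kT: "k t = 0" if "\<bar>t\<bar> > T" for t
  proof -
    have "((\<lambda>_. 0) has_real_derivative 0) (at t)" by simp
    moreover have "open {t :: real. T < \<bar>t\<bar>}" by (intro open_Collect_less continuous_intros)
    ultimately have "(h has_real_derivative 0) (at t)"
      by (rule has_field_derivative_transform_within_open) (use that hT in auto)
    then show ?thesis using hk DERIV_unique by blast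
  qed
  \<comment> \<open>The interval reaches one unit beyond the time support, since \<open>hT\<close>
    makes \<open>h\<close> vanish only for \<open>\<bar>t\<bar> > T\<close>.\<close>
  have FTC: "(\<integral>t. k t * indicator {- (T + 1)..T + 1} t \<partial>lborel) = h (T + 1) - h (- (T + 1))"
    using T(1) by (intro integral_FTC_Icc_real hk kc) simp
  have ind: "k t * indicator {- (T + 1)..T + 1} t = k t" for t
  proof (cases "\<bar>t\<bar> > T")
    case False
    then have "t \<in> {- (T + 1)..T + 1}" by auto
    then show ?thesis by simp
  qed (simp add: kT)
  have "h (T + 1) = 0" "h (- (T + 1)) = 0" using T(1) by (auto intro!: hT)
  then have k0: "(\<integral>t. k t \<partial>lborel) = 0" using FTC unfolding ind by simp
  \<comment> \<open>The multiplier term of the adjoint expression is real almost everywhere, so the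
    complex integrand is a real inner product and integrates to the derivative \<open>k\<close> of
    the pairing.\<close>
  have inner: "(\<integral>x. (\<Sum>i\<in>UNIV. complex_of_real (sol \<phi>0 t x $ i) * adjoint_expr A f t x $ i) \<partial>lborel) = complex_of_real (k t)" for t
  proof -
    let ?p = "sol \<phi>0 t" and ?g = "\<lambda>y. cvec (f (y, t))"
    note p2 = sol_cls(1)[OF \<phi>0, of t]
    have g: "?g \<in> L2" by (rule cvec_L2[OF f2])
    have Fg: "inv_fourier ?g \<in> L2" using ifour.extend_L2[OF g] by simp
    have MF: "mult_m A (inv_fourier ?g) \<in> L2"
      unfolding mult_m_def[abs_def] by (rule mulop_L2[OF bmeas_m Fg])
    let ?w = "fourier (mult_m A (inv_fourier ?g))"
    have w: "?w \<in> L2" using four.extend_L2[OF MF] by simp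
    have cw: "cls ?w = fmult m (?cf t)"
      using four.ext_cls[OF MF] mulop_cls[OF bmeas_m Fg] ifour.ext_cls[OF g]
      by (simp add: fmult_swap[OF bmeas_m m_even, symmetric] mult_m_def[abs_def])
    have rw: "is_real (cls ?w)"
      unfolding cw cv_cls[OF f2, symmetric] by (intro is_real_fmult bmeas_m m_even is_real_cv)
    then have wr: "AE x in lborel. ?w x = cvec (Re_vec (?w x))" by (simp add: is_real_iff[OF w])
    let ?q = "\<lambda>x. Lf f (x, t) + Re_vec (?w x)"
    have q2: "?q \<in> L2" by (rule L2_add[OF L2 Re_vec_L2[OF w]])
    have adj: "adjoint_expr A f t x = cvec (Lf f (x, t)) + ?w x" for x
      by (simp add: adjoint_expr_def adjoint_expr_Lf[OF f])
    note [measurable] = L2_measurable[OF p2] L2_measurable[OF L2[of t]] L2_measurable[OF w] L2_measurable[OF q2]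
      L2_measurable[OF cvec_L2[OF L2[of t]]]
    have comp: "(\<Sum>i\<in>UNIV. complex_of_real (v $ i) * cvec u $ i) = complex_of_real (v \<bullet> u)" for v u
      by (simp add: cvec_def inner_vec_def)
    have "(\<integral>x. (\<Sum>i\<in>UNIV. complex_of_real (?p x $ i) * adjoint_expr A f t x $ i) \<partial>lborel)
        = (\<integral>x. complex_of_real (?p x \<bullet> ?q x) \<partial>lborel)"
    proof (rule integral_cong_AE)
      show "AE x in lborel. (\<Sum>i\<in>UNIV. complex_of_real (?p x $ i) * adjoint_expr A f t x $ i) = complex_of_real (?p x \<bullet> ?q x)"
        using wr
      proof eventually_elim
        case (elim x)
        have "adjoint_expr A f t x = cvec (?q x)"
          unfolding adj by (subst elim) (simp add: linear_simps[OF bounded_linear_cvec])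
        then show ?case by (simp only: comp)
      qed
      show "(\<lambda>x. \<Sum>i\<in>UNIV. complex_of_real (?p x $ i) * adjoint_expr A f t x $ i) \<in> borel_measurable lborel"
      proof -
        have "?p \<in> borel_measurable lborel" using L2_measurable[OF p2] by simp
        then have "(\<lambda>x. complex_of_real (?p x $ i)) \<in> borel_measurable lborel" for i
          by (rule borel_measurable_continuous_on[OF continuous_on_of_real[OF continuous_on_id] measurable_vec_nth])
        moreover have "(\<lambda>x. cvec (Lf f (x, t)) + ?w x) \<in> borel_measurable lborel"
          using L2_measurable[OF L2_add[OF cvec_L2[OF L2] w]] by simp
        ultimately show ?thesis
          unfolding adj
          by (intro borel_measurable_sum borel_measurable_times measurable_vec_nth)
      qed
    qed measurable
    also have "\<dots> = complex_of_real (cls ?p \<bullet> cls ?q)"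
      by (simp add: inner_cls p2 q2)
    also have "cls ?p \<bullet> cls ?q = Gt t ?a \<bullet> cv (cls ?q)"
      by (simp only: inner_cv[symmetric] sol_cls(3)[OF \<phi>0])
    also have "cv (cls ?q) = ?cl t + fmult m (?cf t)"
    proof -
      have "cls ?q = cls (\<lambda>x. Lf f (x, t)) + re (cls ?w)"
        unfolding re_cls[OF w] by (rule cls_add[OF L2 Re_vec_L2[OF w]])
      then show ?thesis
        by (simp only: linear_simps(1)[OF bounded_linear_cv] cv_cls[OF L2] cw cv_re[OF rw[unfolded cw]])
    qed
    finally show ?thesis by (simp only: k_def)
  qed
  show "(\<integral>t. (\<integral>x. (\<Sum>i\<in>UNIV. complex_of_real (sol \<phi>0 t x $ i) * adjoint_expr A f t x $ i) \<partial>lborel) \<partial>lborel) = 0"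
    unfolding inner by (simp add: k0)
qed

end

subsection \<open>Fourier transforms of test functions\<close>

lemma test_fun_partial:
  fixes \<psi> :: "real ^ 3 \<Rightarrow> real"
  assumes "test_fun \<psi>" shows "test_fun (partial_deriv j \<psi>)"
  unfolding test_fun_iff
proof
  have "Ck (Suc k) \<psi>" for k using assms by (simp only: test_fun_def)
  then show "\<forall>k. Ck k (partial_deriv j \<psi>)"
    unfolding partial_deriv_def[abs_def] by (auto intro: Ck_SucE(2))
  have "{x. partial_deriv j \<psi> x \<noteq> 0} \<subseteq> closure {x. \<psi> x \<noteq> 0}"
  proof
    fix x assume x: "x \<in> {x. partial_deriv j \<psi> x \<noteq> 0}"
    show "x \<in> closure {x. \<psi> x \<noteq> 0}"
    proof (rule ccontr)
      assume nx: "x \<notin> closure {x. \<psi> x \<noteq> 0}"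
      have "((\<lambda>_. 0) has_derivative (\<lambda>_. 0)) (at x)" by (rule has_derivative_const)
      then have "(\<psi> has_derivative (\<lambda>_. 0)) (at x)"
      proof (rule has_derivative_transform_within_open)
        show "open (- closure {x. \<psi> x \<noteq> 0})" by auto
        show "0 = \<psi> y" if "y \<in> - closure {x. \<psi> x \<noteq> 0}" for y
          using that closure_subset[of "{x. \<psi> x \<noteq> 0}"] by auto
      qed (use nx in simp)
      from fun_cong[OF frechet_derivative_at[OF this], of "axis j 1"]
      show False using x by (simp add: partial_deriv_def)
    qed
  qed
  moreover have "bounded (closure {x. \<psi> x \<noteq> 0})" using assms by (simp add: test_fun_iff bounded_closure)
  ultimately show "bounded {x. partial_deriv j \<psi> x \<noteq> 0}" by (rule bounded_subset[rotated])
qed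

text \<open>Translation invariance gives every difference quotient of \<open>h\<close> integral 0,
  and dominated convergence passes this on to the derivative. It plays the part of integration by
  parts in \<open>sft_partial\<close>.\<close>

lemma integral_deriv_zero:
  fixes h D :: "real ^ 3 \<Rightarrow> complex"
  assumes h: "continuous_on UNIV h" "bounded {x. h x \<noteq> 0}" and D: "continuous_on UNIV D" "bounded {x. D x \<noteq> 0}"
    and d: "\<And>x s. ((\<lambda>s. h (x + s *\<^sub>R v)) has_vector_derivative D (x + s *\<^sub>R v)) (at s)"
  shows "(\<integral>x. D x \<partial>lborel) = 0"
proof -
  let ?r = "\<lambda>n. 1 / real (Suc n)"
  let ?q = "\<lambda>n x. (1 / ?r n) *\<^sub>R (h (x + ?r n *\<^sub>R v) - h x)"
  obtain B R where BR: "B \<ge> 0" "R > 0" "\<And>x. norm (h x) \<le> B * indicator (cball 0 R) x"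
    using compact_support_bound[OF h] by blast
  obtain K R' where K: "K \<ge> 0" "R' > 0" "\<And>x. norm (D x) \<le> K * indicator (cball 0 R') x"
    using compact_support_bound[OF D] by blast
  have DK: "norm (D x) \<le> K" for x
    by (rule order_trans[OF K(3)]) (simp add: indicator_def K(1))
  have [measurable]: "h \<in> borel_measurable borel" "D \<in> borel_measurable borel"
    by (intro borel_measurable_continuous_onI h D)+
  have hi: "integrable lborel h" by (rule compact_support_L2(2)[OF h])
  have hz: "h y = 0" if "norm y > R" for y using BR(3)[of y] that by simp
  have "(\<lambda>n. \<integral>x. ?q n x \<partial>lborel) \<longlonglongrightarrow> (\<integral>x. D x \<partial>lborel)"
  proof (rule integral_dominated_convergence[where w = "\<lambda>x. K * indicator (cball 0 (R + norm v)) x"])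
    show "integrable lborel (\<lambda>x :: real ^ 3. K * indicator (cball 0 (R + norm v)) x :: real)"
      by (intro integrable_mult_right integrable_indicator_cball)
    show "AE x in lborel. (\<lambda>n. ?q n x) \<longlonglongrightarrow> D x"
    proof (intro AE_I2)
      fix x
      have "((\<lambda>s. (1 / s) *\<^sub>R (h (x + (0 + s) *\<^sub>R v) - h (x + 0 *\<^sub>R v))) \<longlongrightarrow> D (x + 0 *\<^sub>R v)) (at 0)"
        using d[of x 0] by (simp only: vd_iff_quotient)
      then have "((\<lambda>s. (1 / s) *\<^sub>R (h (x + s *\<^sub>R v) - h x)) \<longlongrightarrow> D x) (at 0)" by simp
      moreover have "filterlim ?r (at 0) sequentially"
        using LIMSEQ_Suc[OF lim_1_over_n] by (simp add: filterlim_at)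
      ultimately show "(\<lambda>n. ?q n x) \<longlonglongrightarrow> D x" by (rule filterlim_compose)
    qed
    show "AE x in lborel. norm (?q n x) \<le> K * indicator (cball 0 (R + norm v)) x" for n
    proof (intro AE_I2)
      fix x
      show "norm (?q n x) \<le> K * indicator (cball 0 (R + norm v)) x"
      proof (cases "norm x \<le> R + norm v")
        case True
        have "norm (h (x + ?r n *\<^sub>R v) - h (x + 0 *\<^sub>R v)) \<le> K * \<bar>?r n\<bar>"
          by (rule vector_deriv_bound[where F = "\<lambda>s. h (x + s *\<^sub>R v)", OF d DK]) simp
        then have "norm (h (x + ?r n *\<^sub>R v) - h x) \<le> K * ?r n" by simp
        then have "real (Suc n) * norm (h (x + ?r n *\<^sub>R v) - h x) \<le> real (Suc n) * (K * ?r n)"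
          by (intro mult_left_mono) auto
        then show ?thesis using True by simp
      next
        case False
        have "?r n * norm v \<le> 1 * norm v" by (intro mult_right_mono) auto
        then have "norm (?r n *\<^sub>R v) \<le> norm v" by simp
        then have "norm x \<le> norm (x + ?r n *\<^sub>R v) + norm v"
          using norm_triangle_ineq4[of "x + ?r n *\<^sub>R v" "?r n *\<^sub>R v"] by simp
        then have "h (x + ?r n *\<^sub>R v) = 0" "h x = 0" using False by (auto intro!: hz) (use norm_ge_zero[of v] in linarith)
        then show ?thesis using False by simp
      qed
    qed
  qed measurable
  moreover have "(\<integral>x. ?q n x \<partial>lborel) = 0" for n
  proof -
    have t: "integrable lborel (\<lambda>x. h (?r n *\<^sub>R v + x))" "(\<integral>x. h (?r n *\<^sub>R v + x) \<partial>lborel) = (\<integral>x. h x \<partial>lborel)"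
      using mp_integrable[OF mp_translation, of h] mp_integral[OF mp_translation, of h] hi by auto
    have "(\<integral>x. h (x + ?r n *\<^sub>R v) - h x \<partial>lborel) = 0"
      using t hi by (simp add: add.commute)
    then show ?thesis by (simp only: integral_scaleR_right scaleR_zero_right)
  qed
  ultimately show ?thesis by (simp add: LIMSEQ_const_iff)
qed

text \<open>A scalar transform with a value at every point; \<open>test_field\<close> embeds it into
  the vector-valued theory along a fixed direction.\<close>

definition sft :: "(real ^ 3 \<Rightarrow> real) \<Rightarrow> real ^ 3 \<Rightarrow> complex" where
  "sft \<psi> \<xi> = (\<integral>x. cis (- 2 * pi * (\<xi> \<bullet> x)) * complex_of_real (\<psi> x) \<partial>lborel)"

lemma sft_integrable:
  fixes \<xi> :: "real ^ 3"
  assumes "test_fun \<psi>" shows "integrable lborel (\<lambda>x. cis (- 2 * pi * (\<xi> \<bullet> x)) * complex_of_real (\<psi> x))"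
proof -
  have [measurable]: "\<psi> \<in> borel_measurable borel" by (rule L2_measurable[OF test_fun_L2[OF assms]])
  show ?thesis
    by (rule Bochner_Integration.integrable_bound[OF test_fun_integrable[OF assms]]) (auto simp: norm_mult)
qed

text \<open>The derivative along the axis of \<open>\<psi>\<close> times the character has integral
  0, and the product rule splits it into the two transforms.\<close>

lemma sft_partial:
  assumes \<psi>: "test_fun \<psi>"
  shows "sft (partial_deriv j \<psi>) \<xi> = 2 * pi * \<i> * complex_of_real (\<xi> $ j) * sft \<psi> \<xi>"
proof -
  let ?v = "axis j 1 :: real ^ 3"
  let ?c = "\<lambda>x :: real ^ 3. cis (- 2 * pi * (\<xi> \<bullet> x))"
  let ?k = "- 2 * pi * (\<xi> \<bullet> ?v)"
  let ?h = "\<lambda>x. ?c x * complex_of_real (\<psi> x)"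
  let ?D = "\<lambda>x. ?c x * complex_of_real (partial_deriv j \<psi> x) + (complex_of_real ?k * \<i>) * ?h x"
  note p = test_fun_partial[OF \<psi>, of j]
  have cc: "continuous_on UNIV ?c" by (intro continuous_intros)
  have c\<psi>: "continuous_on UNIV (\<lambda>x. complex_of_real (\<psi> x))" "continuous_on UNIV (\<lambda>x. complex_of_real (partial_deriv j \<psi> x))"
    by (intro continuous_on_of_real test_fun_cont \<psi> p)+
  have bs: "bounded {x. \<psi> x \<noteq> 0}" "bounded {x. partial_deriv j \<psi> x \<noteq> 0}"
    using \<psi> p by (simp_all add: test_fun_iff)
  have "(\<integral>x. ?D x \<partial>lborel) = 0"
  proof (rule integral_deriv_zero)
    show ch: "continuous_on UNIV ?h" by (intro continuous_on_mult cc c\<psi>)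
    show "continuous_on UNIV ?D" by (intro continuous_on_add continuous_on_mult[OF cc c\<psi>(2)] continuous_on_mult[OF continuous_on_const ch])
    show "bounded {x. ?h x \<noteq> 0}" by (rule bounded_subset[OF bs(1)]) auto
    show "bounded {x. ?D x \<noteq> 0}"
      by (rule bounded_subset[OF bounded_Un[THEN iffD2, OF conjI[OF bs]]]) auto
    fix x and s :: real
    let ?y = "x + s *\<^sub>R ?v"
    have th: "((\<lambda>s. - 2 * pi * (\<xi> \<bullet> (x + s *\<^sub>R ?v))) has_vector_derivative ?k) (at s)"
      by (auto intro!: derivative_eq_intros simp: inner_add_right simp flip: has_real_derivative_iff_has_vector_derivative)
    from vector_diff_chain_at[OF th has_vector_derivative_iexp]
    have 1: "((\<lambda>s. ?c (x + s *\<^sub>R ?v)) has_vector_derivative ?k *\<^sub>R (\<i> * ?c ?y)) (at s)"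
      by (simp only: comp_def cis_conv_exp)
    have "(\<psi> has_derivative frechet_derivative \<psi> (at ?y)) (at ?y)"
      using Ck_SucE(1)[of 0 \<psi>] \<psi> by (simp only: test_fun_def)
    moreover have "((\<lambda>s. x + s *\<^sub>R ?v) has_vector_derivative ?v) (at s)"
      by (auto intro!: derivative_eq_intros)
    then have "((\<lambda>s. x + s *\<^sub>R ?v) has_derivative (\<lambda>h. h *\<^sub>R ?v)) (at s)" by (simp only: has_vector_derivative_def)
    ultimately have "((\<lambda>s. \<psi> (x + s *\<^sub>R ?v)) has_derivative (\<lambda>h. frechet_derivative \<psi> (at ?y) (h *\<^sub>R ?v))) (at s)"
      by (rule has_derivative_compose[rotated])
    moreover have "linear (frechet_derivative \<psi> (at ?y))"
      using has_derivative_linear[OF \<open>(\<psi> has_derivative frechet_derivative \<psi> (at ?y)) (at ?y)\<close>] .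
    then have "(\<lambda>h. frechet_derivative \<psi> (at ?y) (h *\<^sub>R ?v)) = (\<lambda>h. h *\<^sub>R partial_deriv j \<psi> ?y)"
      unfolding partial_deriv_def by (intro ext linear_cmul)
    ultimately have "((\<lambda>s. \<psi> (x + s *\<^sub>R ?v)) has_vector_derivative partial_deriv j \<psi> ?y) (at s)"
      by (simp only: has_vector_derivative_def)
    then have 2: "((\<lambda>s. complex_of_real (\<psi> (x + s *\<^sub>R ?v))) has_vector_derivative complex_of_real (partial_deriv j \<psi> ?y)) (at s)"
      by (rule bounded_linear.has_vector_derivative[OF bounded_linear_of_real])
    have "((\<lambda>s. ?h (x + s *\<^sub>R ?v)) has_vector_derivative
        ?c ?y * complex_of_real (partial_deriv j \<psi> ?y) + (?k *\<^sub>R (\<i> * ?c ?y)) * complex_of_real (\<psi> ?y)) (at s)"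
      by (rule has_vector_derivative_mult[OF 1 2])
    moreover have "?c ?y * complex_of_real (partial_deriv j \<psi> ?y) + (?k *\<^sub>R (\<i> * ?c ?y)) * complex_of_real (\<psi> ?y) = ?D ?y"
      by (simp only: scaleR_conv_of_real mult_ac)
    ultimately show "((\<lambda>s. ?h (x + s *\<^sub>R ?v)) has_vector_derivative ?D ?y) (at s)" by (simp only:)
  qed
  moreover have "(\<integral>x. ?D x \<partial>lborel) = sft (partial_deriv j \<psi>) \<xi> + (complex_of_real ?k * \<i>) * sft \<psi> \<xi>"
    unfolding sft_def
      Bochner_Integration.integral_add[OF sft_integrable[OF p] integrable_mult_right[OF sft_integrable[OF \<psi>]]]
      integral_mult_right_zero ..
  ultimately show ?thesis by (simp add: inner_axis algebra_simps eq_neg_iff_add_eq_0)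
qed

lemma bounded_linear_vs_left: "bounded_linear (\<lambda>c. c *s (w :: complex ^ 3))"
  by (rule bounded_linear_intro[where K = "norm w"]) (auto simp: norm_vs vec_eq_iff algebra_simps)

lemma test_field:
  fixes v :: "real ^ 3"
  assumes \<psi>: "test_fun \<psi>"
  shows "test_fun (\<lambda>x. \<psi> x *\<^sub>R v)" and "fourier_L1 (\<lambda>x. cvec (\<psi> x *\<^sub>R v)) = (\<lambda>\<xi>. sft \<psi> \<xi> *s cvec v)"
    and "FT (cv (cls (\<lambda>x. \<psi> x *\<^sub>R v))) = cls (\<lambda>\<xi>. sft \<psi> \<xi> *s cvec v)"
    and "(\<lambda>\<xi>. sft \<psi> \<xi> *s cvec v) \<in> L2" "integrable lborel (\<lambda>x. cvec (\<psi> x *\<^sub>R v))"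
proof -
  show t: "test_fun (\<lambda>x. \<psi> x *\<^sub>R v)" by (rule test_fun_linear[OF bounded_linear_scaleR_left \<psi>])
  show i: "integrable lborel (\<lambda>x. cvec (\<psi> x *\<^sub>R v))"
    by (rule integrable_bounded_linear[OF bounded_linear_cvec test_fun_integrable[OF t]])
  have e: "cis k *s cvec (r *\<^sub>R v) = (cis k * complex_of_real r) *s cvec v" for k r
    by (simp add: cvec_def vec_eq_iff)
  show F: "fourier_L1 (\<lambda>x. cvec (\<psi> x *\<^sub>R v)) = (\<lambda>\<xi>. sft \<psi> \<xi> *s cvec v)"
    unfolding fourier_L1_def sft_def e
    by (intro ext integral_bounded_linear[OF bounded_linear_vs_left sft_integrable[OF \<psi>]])
  have l: "(\<lambda>x. cvec (\<psi> x *\<^sub>R v)) \<in> L2" by (rule cvec_L2[OF test_fun_L2[OF t]])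
  show "FT (cv (cls (\<lambda>x. \<psi> x *\<^sub>R v))) = cls (\<lambda>\<xi>. sft \<psi> \<xi> *s cvec v)"
    unfolding cv_cls[OF test_fun_L2[OF t]] four.ext_L1[OF i l] F ..
  show "(\<lambda>\<xi>. sft \<psi> \<xi> *s cvec v) \<in> L2" using four.T_L2[OF i l] unfolding F .
qed

lemma inner_axis_vs: "z \<bullet> (c *s cvec (axis j 1)) = Re (z $ j * cnj c)"
proof -
  have "z \<bullet> (c *s cvec (axis j 1)) = (\<Sum>i\<in>UNIV. if i = j then Re (z $ j * cnj c) else 0)"
    unfolding inner_vec_def by (intro sum.cong refl) (simp add: cvec_def axis_def inner_complex_def)
  then show ?thesis by simp
qed

text \<open>Plancherel applied to \<open>\<psi>\<close> times the j-th unit vector. Only a real part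
  appears, because the inner product on \<open>complex ^ 3\<close> is real.\<close>

lemma pairing_fourier:
  assumes \<phi>: "\<phi> \<in> L2" and \<psi>: "test_fun \<psi>"
  shows "(\<integral>x. \<phi> x $ j * \<psi> x \<partial>lborel) = (\<integral>\<xi>. Re (rp (FT (cv (cls \<phi>))) \<xi> $ j * cnj (sft \<psi> \<xi>)) \<partial>lborel)"
    and "integrable lborel (\<lambda>\<xi>. Re (rp (FT (cv (cls \<phi>))) \<xi> $ j * cnj (sft \<psi> \<xi>)))"
proof -
  let ?v = "axis j 1 :: real ^ 3"
  note t = test_field[OF \<psi>, of ?v]
  have "(\<integral>x. \<phi> x $ j * \<psi> x \<partial>lborel) = cls \<phi> \<bullet> cls (\<lambda>x. \<psi> x *\<^sub>R ?v)"
    by (simp add: inner_cls[OF \<phi> test_fun_L2[OF t(1)]] inner_axis mult.commute)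
  also have "\<dots> = FT (cv (cls \<phi>)) \<bullet> FT (cv (cls (\<lambda>x. \<psi> x *\<^sub>R ?v)))" by (simp only: four.inner_ext inner_cv)
  also have "\<dots> = cls (rp (FT (cv (cls \<phi>)))) \<bullet> cls (\<lambda>\<xi>. sft \<psi> \<xi> *s cvec ?v)" by (simp only: t(3) cls_rp)
  also have "\<dots> = (\<integral>\<xi>. Re (rp (FT (cv (cls \<phi>))) \<xi> $ j * cnj (sft \<psi> \<xi>)) \<partial>lborel)"
    unfolding inner_cls[OF rp_L2 t(4)] inner_axis_vs ..
  finally show "(\<integral>x. \<phi> x $ j * \<psi> x \<partial>lborel) = (\<integral>\<xi>. Re (rp (FT (cv (cls \<phi>))) \<xi> $ j * cnj (sft \<psi> \<xi>)) \<partial>lborel)" .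
  show "integrable lborel (\<lambda>\<xi>. Re (rp (FT (cv (cls \<phi>))) \<xi> $ j * cnj (sft \<psi> \<xi>)))"
    using L2_inner_integrable[OF rp_L2 t(4)] unfolding inner_axis_vs .
qed

text \<open>Injectivity of the Fourier transform replaces the symmetry of the second derivative.\<close>

lemma partial_commute:
  fixes \<psi> :: "real ^ 3 \<Rightarrow> real"
  assumes \<psi>: "test_fun \<psi>"
  shows "AE x in lborel. partial_deriv j (partial_deriv k \<psi>) x = partial_deriv k (partial_deriv j \<psi>) x"
proof -
  let ?v = "axis 1 1 :: real ^ 3"
  let ?a = "partial_deriv j (partial_deriv k \<psi>)" and ?b = "partial_deriv k (partial_deriv j \<psi>)"
  have a: "test_fun ?a" by (intro test_fun_partial \<psi>)
  have b: "test_fun ?b" by (intro test_fun_partial \<psi>)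
  have "sft ?a = sft ?b"
    by (simp add: fun_eq_iff sft_partial test_fun_partial \<psi>)
  then have "FT (cv (cls (\<lambda>x. ?a x *\<^sub>R ?v))) = FT (cv (cls (\<lambda>x. ?b x *\<^sub>R ?v)))"
    by (simp only: test_field(3)[OF a] test_field(3)[OF b])
  then have "IFT (FT (cv (cls (\<lambda>x. ?a x *\<^sub>R ?v)))) = IFT (FT (cv (cls (\<lambda>x. ?b x *\<^sub>R ?v))))" by (rule arg_cong)
  then have "re (cv (cls (\<lambda>x. ?a x *\<^sub>R ?v))) = re (cv (cls (\<lambda>x. ?b x *\<^sub>R ?v)))" by (simp only: IFT_FT)
  then have "AE x in lborel. ?a x *\<^sub>R ?v = ?b x *\<^sub>R ?v"
    unfolding re_cv cls_eq_iff[OF test_fun_L2[OF test_field(1)[OF a]] test_fun_L2[OF test_field(1)[OF b]]] .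
  then show ?thesis by eventually_elim (auto simp: axis_eq_0_iff)
qed

subsection \<open>Conservative fields in Fourier variables\<close>

text \<open>All 2 by 2 minors of the pair vanish. This makes sense for a real frequency with a
  complex amplitude and requires no case distinction at \<open>\<xi> = 0\<close>.\<close>

definition par :: "real ^ 3 \<Rightarrow> complex ^ 3 \<Rightarrow> bool" where
  "par \<xi> P \<longleftrightarrow> (\<forall>j k. complex_of_real (\<xi> $ j) * P $ k = complex_of_real (\<xi> $ k) * P $ j)"

lemma test_fun_shift:
  fixes \<psi> :: "real ^ 3 \<Rightarrow> real"
  assumes \<psi>: "test_fun \<psi>"
  shows "test_fun (\<lambda>x. \<psi> (x - a))" and "partial_deriv k (\<lambda>x. \<psi> (x - a)) = (\<lambda>x. partial_deriv k \<psi> (x - a))"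
proof -
  have "{x. \<psi> (x - a) \<noteq> 0} \<subseteq> (\<lambda>x. a + x) ` {x. \<psi> x \<noteq> 0}"
    by (intro subsetI image_eqI[of _ _ "_ - a"]) auto
  moreover have "bounded ((\<lambda>x. a + x) ` {x. \<psi> x \<noteq> 0})"
    by (rule bounded_translation) (use \<psi> in \<open>simp add: test_fun_iff\<close>)
  ultimately have "bounded {x. \<psi> (x - a) \<noteq> 0}" by (rule bounded_subset[rotated])
  moreover have "Ck k \<psi>" for k using \<psi> by (simp add: test_fun_def)
  then have "Ck k (\<lambda>x. \<psi> (x + - a))" for k by (intro Ck_affine[OF bounded_linear_ident])
  ultimately show "test_fun (\<lambda>x. \<psi> (x - a))" by (simp add: test_fun_iff)
  have "frechet_derivative (\<lambda>x. \<psi> (x - a)) (at x) = frechet_derivative \<psi> (at (x - a))" for x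
  proof -
    have "(\<psi> has_derivative frechet_derivative \<psi> (at (x - a))) (at (x - a))"
      using Ck_SucE(1)[of 0 \<psi>] \<psi> by (simp only: test_fun_def)
    moreover have "((\<lambda>x. x - a) has_derivative (\<lambda>h. h)) (at x)" by (auto intro!: derivative_eq_intros)
    ultimately have "((\<lambda>x. \<psi> (x - a)) has_derivative frechet_derivative \<psi> (at (x - a))) (at x)"
      using has_derivative_compose by fastforce
    from frechet_derivative_at[OF this] show ?thesis ..
  qed
  then show "partial_deriv k (\<lambda>x. \<psi> (x - a)) = (\<lambda>x. partial_deriv k \<psi> (x - a))"
    by (simp add: fun_eq_iff partial_deriv_def)
qed

lemma sft_shift:
  assumes \<psi>: "test_fun \<psi>"
  shows "sft (\<lambda>x. \<psi> (x - a)) \<xi> = cis (- 2 * pi * (\<xi> \<bullet> a)) * sft \<psi> \<xi>"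
proof -
  have [measurable]: "\<psi> \<in> borel_measurable borel" by (rule L2_measurable[OF test_fun_L2[OF \<psi>]])
  have "sft (\<lambda>x. \<psi> (x - a)) \<xi> = (\<integral>x. cis (- 2 * pi * (\<xi> \<bullet> (a + x))) * complex_of_real (\<psi> (a + x - a)) \<partial>lborel)"
    unfolding sft_def by (rule mp_integral[OF mp_translation, symmetric]) measurable
  also have "\<dots> = (\<integral>x. cis (- 2 * pi * (\<xi> \<bullet> a)) * (cis (- 2 * pi * (\<xi> \<bullet> x)) * complex_of_real (\<psi> x)) \<partial>lborel)"
  proof -
    have "cis (- 2 * pi * (\<xi> \<bullet> (a + x))) = cis (- 2 * pi * (\<xi> \<bullet> a)) * cis (- 2 * pi * (\<xi> \<bullet> x))" for x
      by (simp only: cis_mult inner_add_right distrib_left)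
    then show ?thesis by (simp only: mult.assoc add_diff_cancel_left')
  qed
  finally show ?thesis by (simp add: sft_def)
qed

lemma sft_uminus:
  assumes "test_fun \<psi>" shows "sft \<psi> (- \<xi>) = cnj (sft \<psi> \<xi>)"
proof -
  have "sft \<psi> (- \<xi>) = (\<integral>x. cnj (cis (- 2 * pi * (\<xi> \<bullet> x)) * complex_of_real (\<psi> x)) \<partial>lborel)"
    by (simp add: sft_def cis_cnj)
  also have "\<dots> = cnj (sft \<psi> \<xi>)"
    unfolding sft_def by (rule integral_bounded_linear[OF bounded_linear_cnj sft_integrable[OF assms]])
  finally show ?thesis .
qed

lemma sft_bounded:
  "cmod (sft \<psi> \<xi>) \<le> (\<integral>x. \<bar>\<psi> x\<bar> \<partial>lborel)"
  unfolding sft_def by (rule order_trans[OF integral_norm_bound]) (simp add: norm_mult)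

lemma sft_component_L2:
  assumes "test_fun \<psi>" shows "sft \<psi> \<in> L2"
proof -
  have "(\<lambda>\<xi>. (sft \<psi> \<xi> *s cvec (axis 1 1)) $ 1) \<in> L2"
    by (rule L2_linear[OF bounded_linear_vec_nth test_field(4)[OF assms]])
  then show ?thesis by (simp add: cvec_def)
qed

text \<open>The real pairings of \<open>\<phi>\<close> with all translates of \<open>\<psi>\<close> show that the function \<open>W\<close> in question has a purely
  imaginary inverse Fourier transform; it is also Hermitian, hence zero.\<close>

lemma curl_free_fourier:
  assumes c: "conservative \<phi>" and \<psi>: "test_fun \<psi>"
  shows "AE \<xi> in lborel. rp (FT (cv (cls \<phi>))) \<xi> $ j * cnj (sft (partial_deriv k \<psi>) \<xi>)
    = rp (FT (cv (cls \<phi>))) \<xi> $ k * cnj (sft (partial_deriv j \<psi>) \<xi>)"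
proof -
  let ?P = "rp (FT (cv (cls \<phi>)))"
  have \<phi>: "\<phi> \<in> L2" using c by (simp add: conservative_def)
  obtain f0 where f0: "f0 \<in> borel_measurable lborel"
    "\<And>\<psi> j. test_fun \<psi> \<Longrightarrow> (\<integral>x. \<phi> x $ j * \<psi> x \<partial>lborel) = - (\<integral>x. f0 x * partial_deriv j \<psi> x \<partial>lborel)"
    using c unfolding conservative_def by blast
  \<comment> \<open>Up to sign, both sides are integrals of \<open>f0\<close> against a mixed second
    derivative, and the order of differentiation does not matter almost everywhere.\<close>
  have curl: "(\<integral>x. \<phi> x $ j * partial_deriv k \<psi> x \<partial>lborel) = (\<integral>x. \<phi> x $ k * partial_deriv j \<psi> x \<partial>lborel)" if \<psi>: "test_fun \<psi>" for \<psi>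
  proof -
    have m: "partial_deriv a (partial_deriv b \<psi>) \<in> borel_measurable borel" for a b
      by (rule L2_measurable[OF test_fun_L2]) (intro test_fun_partial \<psi>)
    have "(\<integral>x. f0 x * partial_deriv j (partial_deriv k \<psi>) x \<partial>lborel) = (\<integral>x. f0 x * partial_deriv k (partial_deriv j \<psi>) x \<partial>lborel)"
    proof (rule integral_cong_AE)
      show "AE x in lborel. f0 x * partial_deriv j (partial_deriv k \<psi>) x = f0 x * partial_deriv k (partial_deriv j \<psi>) x"
        using partial_commute[OF \<psi>, of j k] by eventually_elim simp
    qed (use f0(1) m in measurable)
    then show ?thesis by (simp add: f0(2) test_fun_partial \<psi>)
  qed
  let ?W = "\<lambda>\<xi>. ?P \<xi> $ j * cnj (sft (partial_deriv k \<psi>) \<xi>) - ?P \<xi> $ k * cnj (sft (partial_deriv j \<psi>) \<xi>)"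
  let ?e = "cvec (axis 1 1)"
  let ?V = "\<lambda>\<xi>. ?W \<xi> *s ?e"
  have Pc: "(\<lambda>\<xi>. ?P \<xi> $ i) \<in> L2" for i by (rule L2_linear[OF bounded_linear_vec_nth rp_L2])
  note s2 = sft_component_L2[OF test_fun_partial[OF \<psi>]]
  have [measurable]: "(\<lambda>\<xi>. ?P \<xi> $ i) \<in> borel_measurable borel" for i by (rule L2_measurable[OF Pc])
  have [measurable]: "sft (partial_deriv i \<psi>) \<in> borel_measurable borel" for i by (rule L2_measurable[OF s2])
  have [measurable]: "(\<lambda>\<xi>. cnj (sft (partial_deriv i \<psi>) \<xi>)) \<in> borel_measurable borel" for i
    by (rule borel_measurable_continuous_on[OF continuous_on_cnj[OF continuous_on_id] L2_measurable[OF s2]])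
  have W2: "?W \<in> L2"
  proof -
    have "(\<lambda>\<xi>. ?P \<xi> $ a * cnj (sft (partial_deriv b \<psi>) \<xi>)) \<in> L2" for a b
    proof (rule L2_bound_L2[OF _ Pc[of a]])
      show "AE \<xi> in lborel. norm (?P \<xi> $ a * cnj (sft (partial_deriv b \<psi>) \<xi>)) \<le> (\<integral>x. \<bar>partial_deriv b \<psi> x\<bar> \<partial>lborel) * norm (?P \<xi> $ a)"
        by (intro AE_I2) (simp only: norm_mult complex_mod_cnj, subst mult.commute, rule mult_right_mono[OF sft_bounded norm_ge_zero])
    qed measurable
    from L2_diff[OF this this] show ?thesis .
  qed
  have W1: "integrable lborel ?W"
  proof -
    have "integrable lborel (\<lambda>\<xi>. ?P \<xi> $ a * cnj (sft (partial_deriv b \<psi>) \<xi>))" for a b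
    proof (rule Bochner_Integration.integrable_bound)
      have "(\<lambda>\<xi>. cmod (?P \<xi> $ a)) \<in> L2" "(\<lambda>\<xi>. cmod (sft (partial_deriv b \<psi>) \<xi>)) \<in> L2"
        by (rule L2_bound_L2[OF _ Pc[of a], where C = 1], auto) (rule L2_bound_L2[OF _ s2[of b], where C = 1], auto)
      from L2_inner_integrable[OF this]
      show "integrable lborel (\<lambda>\<xi>. cmod (?P \<xi> $ a) * cmod (sft (partial_deriv b \<psi>) \<xi>))" by simp
    qed (auto simp: norm_mult)
    from Bochner_Integration.integrable_diff[OF this this] show ?thesis .
  qed
  have V1: "integrable lborel ?V" by (rule integrable_bounded_linear[OF bounded_linear_vs_left W1])
  have V2: "?V \<in> L2" by (rule L2_linear[OF bounded_linear_vs_left W2])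
  \<comment> \<open>Translating the test function by \<open>a\<close> multiplies its transform by a
    character, so \<open>curl\<close> for the translate yields the real part of the inverse
    transform of \<open>?W\<close> at the point \<open>a\<close>.\<close>
  have re0: "Re (\<integral>\<xi>. cis (2 * pi * (\<xi> \<bullet> a)) * ?W \<xi> \<partial>lborel) = 0" for a
  proof -
    let ?\<psi> = "\<lambda>x. \<psi> (x - a)"
    note t = test_fun_shift[OF \<psi>, where a = a]
    have s: "cnj (sft (partial_deriv i ?\<psi>) \<xi>) = cis (2 * pi * (\<xi> \<bullet> a)) * cnj (sft (partial_deriv i \<psi>) \<xi>)" for i \<xi>
      unfolding t(2) by (subst sft_shift[OF test_fun_partial[OF \<psi>]]) (simp add: cis_cnj)
    note f = pairing_fourier[OF \<phi> test_fun_partial[OF t(1)]]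
    have "0 = (\<integral>\<xi>. Re (?P \<xi> $ j * cnj (sft (partial_deriv k ?\<psi>) \<xi>)) \<partial>lborel) - (\<integral>\<xi>. Re (?P \<xi> $ k * cnj (sft (partial_deriv j ?\<psi>) \<xi>)) \<partial>lborel)"
      using curl[OF t(1)] by (simp add: f(1))
    also have "\<dots> = (\<integral>\<xi>. Re (?P \<xi> $ j * cnj (sft (partial_deriv k ?\<psi>) \<xi>)) - Re (?P \<xi> $ k * cnj (sft (partial_deriv j ?\<psi>) \<xi>)) \<partial>lborel)"
      by (rule Bochner_Integration.integral_diff[symmetric, OF f(2) f(2)])
    also have "\<dots> = (\<integral>\<xi>. Re (cis (2 * pi * (\<xi> \<bullet> a)) * ?W \<xi>) \<partial>lborel)"
      unfolding s by (intro Bochner_Integration.integral_cong refl) (simp only: minus_complex.sel[symmetric] right_diff_distrib mult_ac)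
    also have "\<dots> = Re (\<integral>\<xi>. cis (2 * pi * (\<xi> \<bullet> a)) * ?W \<xi> \<partial>lborel)"
    proof (rule integral_Re)
      show "integrable lborel (\<lambda>\<xi>. cis (2 * pi * (\<xi> \<bullet> a)) * ?W \<xi>)"
        by (rule Bochner_Integration.integrable_bound[OF W1]) (auto simp: norm_mult)
    qed
    finally show ?thesis ..
  qed
  have inv: "inv_fourier_L1 ?V x = (\<integral>\<xi>. cis (2 * pi * (\<xi> \<bullet> x)) * ?W \<xi> \<partial>lborel) *s ?e" for x
  proof -
    have "integrable lborel (\<lambda>\<xi>. cis (2 * pi * (\<xi> \<bullet> x)) * ?W \<xi>)"
      by (rule Bochner_Integration.integrable_bound[OF W1]) (auto simp: norm_mult)
    from integral_bounded_linear[OF bounded_linear_vs_left this]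
    show ?thesis unfolding inv_fourier_L1_def vector_smult_assoc .
  qed
  have neg: "vcnj (inv_fourier_L1 ?V x) = - inv_fourier_L1 ?V x" for x
    unfolding inv using re0[of x]
    by (simp add: vcnj_def cvec_def axis_def vec_eq_iff complex_eq_iff)
  have "pull vcnj (\<lambda>x. x) (IFT (cls ?V)) = - IFT (cls ?V)"
    unfolding ifour.ext_L1[OF V1 V2] pull_cls[OF bounded_linear_vcnj mp_id ifour.T_L2[OF V1 V2]] neg
    by (rule cls_minus[OF ifour.T_L2[OF V1 V2]])
  then have "IFT (pull vcnj uminus (cls ?V)) = IFT (- cls ?V)"
    by (simp add: IFT_vcnj linear_simps[OF ifour.bounded_linear_ext])
  from arg_cong[OF this, of FT] have 1: "pull vcnj uminus (cls ?V) = - cls ?V" by (simp only: FT_IFT)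
  have "pull vcnj uminus (FT (cv (cls \<phi>))) = FT (cv (cls \<phi>))"
    using FT_vcnj[of "cv (cls \<phi>)"] is_real_cv[of "cls \<phi>"] by (simp add: is_real_def)
  then have "cls (\<lambda>\<xi>. vcnj (?P (- \<xi>))) = cls ?P" by (simp add: pull_def)
  then have "AE \<xi> in lborel. vcnj (?P (- \<xi>)) = ?P \<xi>"
    by (subst (asm) cls_eq_iff) (auto intro: pull_L2 bounded_linear_vcnj mp_uminus)
  then have "AE \<xi> in lborel. vcnj (?V (- \<xi>)) = ?V \<xi>"
  proof eventually_elim
    case (elim \<xi>)
    have "cnj (?P (- \<xi>) $ i) = ?P \<xi> $ i" for i
      using arg_cong[OF elim, of "\<lambda>v. v $ i"] by (simp add: vcnj_def)
    then have "cnj (?W (- \<xi>)) = ?W \<xi>" by (simp add: sft_uminus test_fun_partial \<psi>)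
    then have "cnj (?W (- \<xi>)) *s vcnj ?e = ?W \<xi> *s vcnj ?e" by (simp only:)
    then show ?case by (simp only: vcnj_vs vcnj_cvec)
  qed
  then have 2: "pull vcnj uminus (cls ?V) = cls ?V"
    unfolding pull_cls[OF bounded_linear_vcnj mp_uminus V2]
    by (intro cls_eqI V2 pull_L2[OF bounded_linear_vcnj mp_uminus V2])
  \<comment> \<open>The same involution \<open>pull vcnj uminus\<close> sends the class to its
    negative by \<open>1\<close> and to itself by \<open>2\<close>.\<close>
  have "cls ?V = - cls ?V" using 1 2 by (simp only:)
  then have "2 *\<^sub>R cls ?V = 0" unfolding scaleR_2 eq_neg_iff_add_eq_0 .
  then have "cls ?V = cls (\<lambda>x. 0)"
    by (simp only: cls_0 scaleR_eq_0_iff) simp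
  then have "AE \<xi> in lborel. ?V \<xi> = 0" unfolding cls_eq_iff[OF V2 L2_0] .
  then show ?thesis
  proof eventually_elim
    case (elim \<xi>)
    have "(?V \<xi>) $ 1 = 0" using elim by (simp only: zero_index)
    then show ?case by (simp add: cvec_def)
  qed
qed

text \<open>The bump is supported so close to the origin that the cosine in the real part of its
  transform is positive there. How close depends on \<open>\<xi>\<close>, but one countable family
  of bumps serves all frequencies.\<close>

lemma sft_nonzero: "\<exists>n :: nat. sft (box_bump 1 (- ((1 / real (Suc n)) *\<^sub>R One)) ((1 / real (Suc n)) *\<^sub>R One)) \<xi> \<noteq> 0"
proof -
  define s where "s = (\<Sum>b\<in>Basis. \<bar>\<xi> \<bullet> b\<bar>)"
  have s0: "s \<ge> 0" by (simp add: s_def sum_nonneg)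
  \<comment> \<open>On the box \<open>\<bar>\<xi> \<bullet> x\<bar>\<close> is at most
    \<open>s / real (Suc n)\<close>, hence below \<open>1 / 4\<close>, so the angle stays below a
    quarter turn.\<close>
  obtain n :: nat where n: "4 * s < real n" using reals_Archimedean2 by blast
  let ?r = "1 / real (Suc n)"
  let ?u = "?r *\<^sub>R One :: real ^ 3"
  let ?\<psi> = "box_bump 1 (- ?u) ?u"
  have t: "test_fun ?\<psi>" using test_fun_box_bump[of 1 "- ?u" ?u "1 :: real"] by simp
  have cospos: "cos (- 2 * pi * (\<xi> \<bullet> x)) > 0" if x: "x \<in> box (- ?u) ?u" for x
  proof -
    have "\<bar>\<xi> \<bullet> x\<bar> = \<bar>\<Sum>b\<in>Basis. (\<xi> \<bullet> b) * (x \<bullet> b)\<bar>" by (subst euclidean_inner) simp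
    also have "\<dots> \<le> (\<Sum>b\<in>Basis. \<bar>(\<xi> \<bullet> b) * (x \<bullet> b)\<bar>)" by (rule sum_abs)
    also have "\<dots> \<le> (\<Sum>b\<in>Basis. \<bar>\<xi> \<bullet> b\<bar> * ?r)"
    proof (rule sum_mono)
      fix b :: "real ^ 3" assume b: "b \<in> Basis"
      have "\<bar>x \<bullet> b\<bar> \<le> ?r" using x b by (auto simp: mem_box abs_le_iff)
      then show "\<bar>(\<xi> \<bullet> b) * (x \<bullet> b)\<bar> \<le> \<bar>\<xi> \<bullet> b\<bar> * ?r" unfolding abs_mult by (rule mult_left_mono) simp
    qed
    also have "\<dots> = s * ?r" unfolding s_def by (rule sum_distrib_right[symmetric])
    also have "\<dots> < 1 / 4" using n s0 by (simp add: field_simps)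
    finally have "\<bar>\<xi> \<bullet> x\<bar> < 1 / 4" .
    then have "2 * pi * \<bar>\<xi> \<bullet> x\<bar> < 2 * pi * (1 / 4)" by (intro mult_strict_left_mono) auto
    then have "\<bar>- 2 * pi * (\<xi> \<bullet> x)\<bar> < pi / 2" by (simp add: abs_mult)
    then have "- (pi / 2) < - 2 * pi * (\<xi> \<bullet> x)" "- 2 * pi * (\<xi> \<bullet> x) < pi / 2"
      unfolding abs_less_iff by linarith+
    then show ?thesis by (rule cos_gt_zero_pi)
  qed
  let ?I = "\<lambda>x. cos (- 2 * pi * (\<xi> \<bullet> x)) * ?\<psi> x"
  have i: "integrable lborel ?I"
    using integrable_Re[OF sft_integrable[OF t, of \<xi>]] by (simp only: Re_complex_of_real Im_complex_of_real times_complex.sel cis.sel mult_zero_right diff_zero)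
  have I: "Re (sft ?\<psi> \<xi>) = (\<integral>x. ?I x \<partial>lborel)"
    unfolding sft_def using integral_Re[OF sft_integrable[OF t, of \<xi>]] by (simp only: Re_complex_of_real Im_complex_of_real times_complex.sel cis.sel mult_zero_right diff_zero)
  have Ipos: "?I x > 0" if "x \<in> box (- ?u) ?u" for x
    using cospos[OF that] box_bump_bounds(1)[of 1 "- ?u" ?u x] box_bump_pos_iff[of 1 "- ?u" ?u x] that by (intro mult_pos_pos) auto
  have Inn: "?I x \<ge> 0" for x
    using Ipos[of x] box_bump_pos_iff[of 1 "- ?u" ?u x] by (cases "x \<in> box (- ?u) ?u") auto
  have "sft ?\<psi> \<xi> \<noteq> 0"
  proof
    assume "sft ?\<psi> \<xi> = 0"
    then have "(\<integral>x. ?I x \<partial>lborel) = 0" using I by simp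
    then have "AE x in lborel. ?I x = 0" using integral_nonneg_eq_0_iff_AE[OF i] Inn by simp
    then have "AE x in lborel. x \<notin> box (- ?u) ?u" by eventually_elim (use Ipos in force)
    then have "emeasure lborel (box (- ?u) ?u) = 0"
      by (subst (asm) AE_iff_measurable[OF _ refl]) auto
    moreover have "0 < (\<Prod>b\<in>(Basis :: (real ^ 3) set). (?u - - ?u) \<bullet> b)"
      by (intro prod_pos) (simp only: diff_minus_eq_add inner_add_left inner_scaleR_left inner_sum_left_Basis, simp)
    moreover have "emeasure lborel (box (- ?u) ?u) = ennreal (\<Prod>b\<in>Basis. (?u - - ?u) \<bullet> b)"
      by (rule emeasure_lborel_box) (simp add: inner_simps)
    ultimately show False by (simp add: ennreal_eq_0_iff not_le)
  qed
  then show ?thesis by blast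
qed

text \<open>The bumps are countable in number, so the exceptional null sets of
  \<open>curl_free_fourier\<close> can be joined. At each remaining frequency some bump has a
  nonzero transform, which cancels once its partial derivatives are turned into factors by
  \<open>sft_partial\<close>.\<close>

lemma conservative_par:
  assumes c: "conservative \<phi>"
  shows "AE \<xi> in lborel. par \<xi> (rp (FT (cv (cls \<phi>))) \<xi>)"
proof -
  let ?P = "rp (FT (cv (cls \<phi>)))"
  let ?\<psi> = "\<lambda>n :: nat. box_bump 1 (- ((1 / real (Suc n)) *\<^sub>R One)) ((1 / real (Suc n)) *\<^sub>R One :: real ^ 3)"
  have t: "test_fun (?\<psi> n)" for n using test_fun_box_bump[of 1 _ _ "1 :: real"] by simp
  have "AE \<xi> in lborel. \<forall>n. \<forall>j k. ?P \<xi> $ j * cnj (sft (partial_deriv k (?\<psi> n)) \<xi>) = ?P \<xi> $ k * cnj (sft (partial_deriv j (?\<psi> n)) \<xi>)"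
    unfolding AE_all_countable using curl_free_fourier[OF c t] by blast
  then show ?thesis
  proof eventually_elim
    case (elim \<xi>)
    obtain n where n: "sft (?\<psi> n) \<xi> \<noteq> 0" using sft_nonzero[of \<xi>] by blast
    have "complex_of_real (\<xi> $ j) * ?P \<xi> $ k = complex_of_real (\<xi> $ k) * ?P \<xi> $ j" for j k
    proof -
      have "?P \<xi> $ k * cnj (sft (partial_deriv j (?\<psi> n)) \<xi>) = ?P \<xi> $ j * cnj (sft (partial_deriv k (?\<psi> n)) \<xi>)"
        using elim by blast
      from this[unfolded sft_partial[OF t]] n show ?thesis by (simp add: mult_ac del: of_nat_Suc)
    qed
    then show ?case by (simp add: par_def)
  qed
qed

subsection \<open>Potentials\<close>

text \<open>The integral is compared with a sum over the dyadic cubes of side \<open>2\<^sup>1\<^sup>-\<^sup>n\<close>.\<close>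

lemma inverse_square_integrable:
  "(\<lambda>x :: real ^ 3. indicator (cball 0 1) x / norm x) \<in> L2"
proof -
  let ?C = "\<lambda>n :: nat. cbox (- ((1/2)^n *\<^sub>R One)) ((1/2)^n *\<^sub>R One) :: (real ^ 3) set"
  have m [measurable]: "(\<lambda>x :: real ^ 3. indicator (cball 0 1) x / norm x) \<in> borel_measurable borel"
    by (intro borel_measurable_divide borel_measurable_indicator) auto
  have le: "ennreal ((norm (indicator (cball 0 1) x / norm x))\<^sup>2) \<le> (\<Sum>n. ennreal (4 ^ (n + 1)) * indicator (?C n) x)" for x :: "real ^ 3"
  proof (cases "x \<in> cball 0 1 \<and> x \<noteq> 0")
    case False then show ?thesis by auto
  next
    case True
    then have x: "0 < norm x" "norm x \<le> 1" by auto
    obtain k :: nat where "(1/2) ^ k < norm x" using real_arch_pow_inv[OF x(1), of "1/2"] by auto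
    \<comment> \<open>The least such index places \<open>x\<close> in the dyadic shell between
      \<open>(1/2) ^ (n + 1)\<close> and \<open>(1/2) ^ n\<close>. The shell lies in the cube
      \<open>?C n\<close>, and on it the squared inverse norm is at most
      \<open>4 ^ (n + 1)\<close>.\<close>
    define n where "n = (LEAST k. (1/2 :: real) ^ (k + 1) < norm x)"
    have "(1/2 :: real) ^ (k + 1) < norm x"
      using \<open>(1/2) ^ k < norm x\<close> x(1) unfolding power_add power_one_right by linarith
    then have n1: "(1/2 :: real) ^ (n + 1) < norm x" unfolding n_def by (rule LeastI)
    have n2: "norm x \<le> (1/2) ^ n"
    proof (cases n)
      case 0 then show ?thesis using x by simp
    next
      case (Suc j)
      then have "j < n" by simp
      then have "\<not> (1/2 :: real) ^ (j + 1) < norm x" unfolding n_def by (rule not_less_Least)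
      then show ?thesis using Suc by simp
    qed
    have xC: "x \<in> ?C n"
    proof -
      have "\<bar>x \<bullet> b\<bar> \<le> (1/2)^n" if "b \<in> Basis" for b using Basis_le_norm[OF that, of x] n2 by linarith
      then show ?thesis by (auto simp: mem_box abs_le_iff) (metis minus_le_iff)
    qed
    have "1 / norm x < 2 ^ (n + 1)"
      using n1 x(1) by (simp add: power_divide field_simps)
    then have "(1 / norm x)\<^sup>2 \<le> (2 ^ (n + 1))\<^sup>2" using x(1) by (intro power_mono) auto
    also have "\<dots> = (4 :: real) ^ (n + 1)" by (simp add: power_mult_distrib power2_eq_square flip: power_mult_distrib)
    finally have "ennreal ((norm (indicator (cball 0 1) x / norm x))\<^sup>2) \<le> ennreal (4 ^ (n + 1)) * indicator (?C n) x"
      using True xC by (simp add: indicator_def ennreal_leI del: power_Suc ennreal_numeral ennreal_power)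
    also have "\<dots> \<le> (\<Sum>n. ennreal (4 ^ (n + 1)) * indicator (?C n) x)"
    proof -
      have "f n \<le> (\<Sum>k. f k)" for f :: "nat \<Rightarrow> ennreal" using sum_le_suminf[of f "{n}"] by simp
      then show ?thesis .
    qed
    finally show ?thesis .
  qed
  \<comment> \<open>Volume \<open>8 * (1/8) ^ n\<close> against height \<open>4 ^ (n + 1)\<close>
    leaves the convergent series with terms \<open>32 * (1/2) ^ n\<close>.\<close>
  have em: "emeasure lborel (?C n) = ennreal (8 * (1/8) ^ n)" for n
  proof -
    let ?u = "(1/2)^n *\<^sub>R One :: real ^ 3"
    have u: "(?u - - ?u) \<bullet> b = 2 * (1/2)^n" if "b \<in> Basis" for b
      using that by (simp only: diff_minus_eq_add inner_add_left inner_scaleR_left inner_sum_left_Basis) simp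
    have "emeasure lborel (?C n) = ennreal (\<Prod>b\<in>(Basis :: (real ^ 3) set). (?u - - ?u) \<bullet> b)"
      by (rule emeasure_lborel_cbox) (simp only: inner_minus_left inner_scaleR_left inner_sum_left_Basis, simp)
    also have "(\<Prod>b\<in>(Basis :: (real ^ 3) set). (?u - - ?u) \<bullet> b) = (\<Prod>b\<in>(Basis :: (real ^ 3) set). 2 * (1/2)^n)"
      by (rule prod.cong[OF refl u])
    also have "(\<Prod>b\<in>(Basis :: (real ^ 3) set). 2 * (1/2 :: real)^n) = 8 * ((1/2)^n)^3"
      by (simp add: power_mult_distrib)
    also have "((1/2 :: real)^n)^3 = ((1/2)^3)^n" by (simp only: power_mult[symmetric] mult.commute)
    also have "(1/2 :: real)^3 = 1/8" by (simp add: power3_eq_cube)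
    finally show ?thesis .
  qed
  have "(\<integral>\<^sup>+x. ennreal ((norm (indicator (cball 0 1) x / norm (x :: real ^ 3)))\<^sup>2) \<partial>lborel)
      \<le> (\<integral>\<^sup>+x. (\<Sum>n. ennreal (4 ^ (n + 1)) * indicator (?C n) x) \<partial>lborel)"
    by (intro nn_integral_mono le)
  also have "\<dots> = (\<Sum>n. \<integral>\<^sup>+x. ennreal (4 ^ (n + 1)) * indicator (?C n) x \<partial>lborel)"
    by (rule nn_integral_suminf) measurable
  also have "\<dots> = (\<Sum>n. ennreal (32 * (1/2) ^ n))"
  proof (rule suminf_cong)
    fix n
    have "(\<integral>\<^sup>+x. ennreal (4 ^ (n + 1)) * indicator (?C n) x \<partial>lborel) = ennreal (4 ^ (n + 1)) * ennreal (8 * (1/8) ^ n)"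
      by (subst nn_integral_cmult_indicator) (auto simp: em)
    also have "\<dots> = ennreal (4 ^ (n + 1) * (8 * (1/8) ^ n))" by (rule ennreal_mult[symmetric]) auto
    also have "4 ^ (n + 1) * (8 * (1/8 :: real) ^ n) = 32 * (4 ^ n * (1/8) ^ n)" by simp
    also have "(4 :: real) ^ n * (1/8) ^ n = (1/2) ^ n" by (simp flip: power_mult_distrib)
    finally show "(\<integral>\<^sup>+x. ennreal (4 ^ (n + 1)) * indicator (?C n) x \<partial>lborel) = ennreal (32 * (1/2) ^ n)" .
  qed
  also have "\<dots> = ennreal (\<Sum>n. 32 * (1/2) ^ n)"
    by (rule suminf_ennreal2) (auto intro!: summable_mult summable_geometric)
  also have "\<dots> < \<infinity>" by simp
  finally have fin: "(\<integral>\<^sup>+x. ennreal ((norm (indicator (cball 0 1) x / norm (x :: real ^ 3)))\<^sup>2) \<partial>lborel) < \<infinity>" .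
  have "integrable lborel (\<lambda>x :: real ^ 3. (norm (indicator (cball 0 1) x / norm x))\<^sup>2)"
    by (rule integrableI_bounded) (use fin in auto)
  then show ?thesis using m by (simp add: L2_iff)
qed

text \<open>By parallelism, \<open>\<xi> $ j\<close> times the sum of all
  \<open>\<xi> $ k * P $ k\<close> is \<open>P $ j\<close> times the squared norm of
  \<open>\<xi>\<close>. The quotient is the transform that a potential must have, since
  differentiation multiplies transforms by \<open>2 * pi * \<i> * \<xi> $ j\<close>.\<close>

lemma par_div:
  assumes "par \<xi> P" "\<xi> \<noteq> 0"
  shows "2 * pi * \<i> * complex_of_real (\<xi> $ j) * ((\<Sum>k\<in>UNIV. complex_of_real (\<xi> $ k) * P $ k) / (2 * pi * \<i> * complex_of_real ((norm \<xi>)\<^sup>2))) = P $ j"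
proof -
  have "complex_of_real (\<xi> $ j) * (\<Sum>k\<in>UNIV. complex_of_real (\<xi> $ k) * P $ k)
      = (\<Sum>k\<in>UNIV. complex_of_real (\<xi> $ k) * (complex_of_real (\<xi> $ j) * P $ k))"
    by (simp add: sum_distrib_left mult_ac)
  also have "\<dots> = (\<Sum>k\<in>UNIV. complex_of_real (\<xi> $ k) * (complex_of_real (\<xi> $ k) * P $ j))"
    using assms(1) by (simp add: par_def)
  also have "\<dots> = complex_of_real (\<Sum>k\<in>UNIV. \<xi> $ k * \<xi> $ k) * P $ j"
    by (simp add: sum_distrib_right mult.assoc)
  also have "(\<Sum>k\<in>UNIV. \<xi> $ k * \<xi> $ k) = (norm \<xi>)\<^sup>2"
    by (simp add: power2_norm_eq_inner inner_vec_def)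
  finally have *: "complex_of_real (\<xi> $ j) * (\<Sum>k\<in>UNIV. complex_of_real (\<xi> $ k) * P $ k) = complex_of_real ((norm \<xi>)\<^sup>2) * P $ j" .
  have n: "complex_of_real ((norm \<xi>)\<^sup>2) \<noteq> 0" using assms(2) by simp
  have "2 * pi * \<i> * complex_of_real (\<xi> $ j) * ((\<Sum>k\<in>UNIV. complex_of_real (\<xi> $ k) * P $ k) / (2 * pi * \<i> * complex_of_real ((norm \<xi>)\<^sup>2)))
      = (2 * pi * \<i>) * (complex_of_real (\<xi> $ j) * (\<Sum>k\<in>UNIV. complex_of_real (\<xi> $ k) * P $ k)) / ((2 * pi * \<i>) * complex_of_real ((norm \<xi>)\<^sup>2))"
    by (simp only: times_divide_eq_right mult.assoc)
  also have "\<dots> = P $ j" unfolding * using n by simp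
  finally show ?thesis .
qed

lemma conservative_if_par:
  assumes \<phi>: "\<phi> \<in> L2" and par: "AE \<xi> in lborel. par \<xi> (rp (FT (cv (cls \<phi>))) \<xi>)"
  shows "conservative \<phi>"
proof -
  let ?P = "rp (FT (cv (cls \<phi>)))" and ?e = "cvec (axis 1 1)"
  define p where "p \<xi> = (\<Sum>k\<in>UNIV. complex_of_real (\<xi> $ k) * ?P \<xi> $ k) / (2 * pi * \<i> * complex_of_real ((norm \<xi>)\<^sup>2))" for \<xi>
  have [measurable]: "(\<lambda>\<xi>. ?P \<xi> $ k) \<in> borel_measurable borel" for k by (rule measurable_vec_nth[OF rp_measurable])
  have [measurable]: "(\<lambda>\<xi> :: real ^ 3. \<xi> $ k) \<in> borel_measurable borel" for k by (rule measurable_vec_nth) simp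
  have pm [measurable]: "p \<in> borel_measurable borel" unfolding p_def[abs_def] by measurable
  \<comment> \<open>The crude factor 3 from the three summands is absorbed by the
    \<open>2 * pi\<close> in the denominator.\<close>
  have pb: "cmod (p \<xi>) \<le> norm (?P \<xi>) / norm \<xi>" for \<xi>
  proof (cases "\<xi> = 0")
    case False
    have "cmod (\<Sum>k\<in>UNIV. complex_of_real (\<xi> $ k) * ?P \<xi> $ k) \<le> (\<Sum>k\<in>(UNIV :: 3 set). norm \<xi> * norm (?P \<xi>))"
      by (rule order_trans[OF norm_sum], rule sum_mono)
        (auto simp: norm_mult intro!: mult_mono component_le_norm_cart Finite_Cartesian_Product.norm_nth_le)
    also have "\<dots> = 3 * (norm \<xi> * norm (?P \<xi>))" by simp
    also have "\<dots> \<le> (2 * pi) * (norm \<xi> * norm (?P \<xi>))"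
      using pi_gt3 by (intro mult_right_mono) auto
    finally show ?thesis using False by (simp add: p_def norm_mult norm_divide divide_le_eq power2_eq_square mult_ac)
  qed (simp add: p_def)
  \<comment> \<open>The inverse transform of \<open>lo\<close> is bounded and that of
    \<open>hi\<close> lies in \<open>L2\<close>, so both are locally integrable. The constant unit
    vector \<open>?e\<close> makes the scalar \<open>p\<close> accessible to the vector-valued
    transforms.\<close>
  define lo where "lo \<xi> = (indicator (cball 0 1) \<xi> *\<^sub>R p \<xi>) *s ?e" for \<xi> :: "real ^ 3"
  define hi where "hi \<xi> = (indicator (- cball 0 1) \<xi> *\<^sub>R p \<xi>) *s ?e" for \<xi> :: "real ^ 3"
  have e1: "norm ?e = 1" by (simp add: norm_cvec)
  have cut: "(\<lambda>\<xi>. (indicator B \<xi> *\<^sub>R p \<xi>) *s ?e) \<in> borel_measurable borel" if "B \<in> sets borel" for B :: "(real ^ 3) set"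
    by (rule borel_measurable_continuous_on[OF linear_continuous_on[OF bounded_linear_vs_left]])
      (intro borel_measurable_scaleR borel_measurable_indicator that pm)
  have lo1: "integrable lborel lo"
  proof (rule Bochner_Integration.integrable_bound)
    have "(\<lambda>\<xi>. norm (?P \<xi>)) \<in> L2" by (rule L2_bound_L2[OF _ rp_L2, where C = 1]) auto
    from L2_inner_integrable[OF this inverse_square_integrable]
    show "integrable lborel (\<lambda>\<xi>. norm (?P \<xi>) * (indicator (cball 0 1) \<xi> / norm \<xi>))" by simp
    show "AE \<xi> in lborel. norm (lo \<xi>) \<le> norm (norm (?P \<xi>) * (indicator (cball 0 1) \<xi> / norm \<xi>))"
      using pb by (intro AE_I2) (auto simp: lo_def norm_vs e1 indicator_def)
    show "lo \<in> borel_measurable lborel" using cut[of "cball 0 1"] by (simp add: lo_def[abs_def])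
  qed
  have hi2: "hi \<in> L2"
  proof (rule L2_bound_L2[OF _ rp_L2[of "FT (cv (cls \<phi>))"], where C = 1])
    show "hi \<in> borel_measurable borel" unfolding hi_def[abs_def] by (rule cut) (simp add: Compl_eq_Diff_UNIV)
    show "AE \<xi> in lborel. norm (hi \<xi>) \<le> 1 * norm (?P \<xi>)"
    proof (intro AE_I2)
      fix \<xi>
      show "norm (hi \<xi>) \<le> 1 * norm (?P \<xi>)"
      proof (cases "\<xi> \<in> cball 0 1")
        case False
        then have "norm (?P \<xi>) / norm \<xi> \<le> norm (?P \<xi>)" by (simp add: divide_le_eq mult_left_le) (metis mult_left_mono mult.right_neutral norm_ge_zero less_imp_le not_le)
        then show ?thesis using pb[of \<xi>] False by (simp add: hi_def norm_vs e1)
      qed (simp add: hi_def)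
    qed
  qed
  \<comment> \<open>Pairing with \<open>?e\<close> takes the real part of the first component, so
    the potential is real by construction.\<close>
  define f0 where "f0 x = inv_fourier_L1 lo x \<bullet> ?e + rp (IFT (cls hi)) x \<bullet> ?e" for x
  have ilm: "inv_fourier_L1 lo \<in> borel_measurable borel"
  proof -
    have "fourier_L1 lo \<in> borel_measurable borel" by (rule fourier_L1_measurable[OF lo1])
    from measurable_compose[OF mp_measurable[OF mp_uminus] this]
    show ?thesis unfolding inv_fourier_L1_eq[abs_def] by simp
  qed
  have f0m: "f0 \<in> borel_measurable borel"
    unfolding f0_def[abs_def] using ilm by measurable
  have f0b: "\<bar>f0 x\<bar> \<le> (\<integral>\<xi>. norm (lo \<xi>) \<partial>lborel) + (1 + (norm (rp (IFT (cls hi)) x))\<^sup>2)" for x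
  proof -
    have "\<bar>inv_fourier_L1 lo x \<bullet> ?e\<bar> \<le> norm (inv_fourier_L1 lo x) * norm ?e" by (rule Cauchy_Schwarz_ineq2)
    also have "\<dots> \<le> (\<integral>\<xi>. norm (lo \<xi>) \<partial>lborel)" using norm_fourier_L1[of lo "- x"] by (simp add: e1 inv_fourier_L1_eq)
    finally have 1: "\<bar>inv_fourier_L1 lo x \<bullet> ?e\<bar> \<le> (\<integral>\<xi>. norm (lo \<xi>) \<partial>lborel)" .
    let ?y = "norm (rp (IFT (cls hi)) x)"
    have "\<bar>rp (IFT (cls hi)) x \<bullet> ?e\<bar> \<le> ?y * norm ?e" by (rule Cauchy_Schwarz_ineq2)
    also have "\<dots> \<le> 1 + ?y\<^sup>2"
      using sum_squares_bound[of 1 ?y] norm_ge_zero[of "rp (IFT (cls hi)) x"]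
      unfolding e1 power_one mult_1_right by linarith
    finally show ?thesis using 1 unfolding f0_def by linarith
  qed
  have "set_integrable lborel K f0" if K: "compact K" for K
    unfolding set_integrable_def
  proof (rule Bochner_Integration.integrable_bound)
    have Kb: "K \<in> sets borel" using K by (simp add: borel_compact)
    have "integrable lborel (\<lambda>x. indicator K x :: real)"
      using Kb emeasure_bounded_finite[OF compact_imp_bounded[OF K]] by (simp add: integrable_indicator_iff)
    moreover have "integrable lborel (\<lambda>x. (norm (rp (IFT (cls hi)) x))\<^sup>2)" using rp_L2[of "IFT (cls hi)"] by (simp add: L2_iff)
    ultimately show "integrable lborel (\<lambda>x. indicator K x * ((\<integral>\<xi>. norm (lo \<xi>) \<partial>lborel) + 1) + (norm (rp (IFT (cls hi)) x))\<^sup>2)"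
      by simp
    show "(\<lambda>x. indicator K x *\<^sub>R f0 x) \<in> borel_measurable lborel" using f0m Kb by measurable
    have nn: "0 \<le> (\<integral>\<xi>. norm (lo \<xi>) \<partial>lborel)" by (rule integral_nonneg_AE) simp
    show "AE x in lborel. norm (indicator K x *\<^sub>R f0 x) \<le> norm (indicator K x * ((\<integral>\<xi>. norm (lo \<xi>) \<partial>lborel) + 1) + (norm (rp (IFT (cls hi)) x))\<^sup>2)"
    proof (intro AE_I2)
      fix x
      show "norm (indicator K x *\<^sub>R f0 x) \<le> norm (indicator K x * ((\<integral>\<xi>. norm (lo \<xi>) \<partial>lborel) + 1) + (norm (rp (IFT (cls hi)) x))\<^sup>2)"
        using f0b[of x] nn by (cases "x \<in> K") auto
    qed
  qed
  moreover have "(\<integral>x. \<phi> x $ j * \<psi> x \<partial>lborel) = - (\<integral>x. f0 x * partial_deriv j \<psi> x \<partial>lborel)" if \<psi>: "test_fun \<psi>" for \<psi> j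
  proof -
    let ?d = "partial_deriv j \<psi>" and ?D = "\<lambda>x. cvec (partial_deriv j \<psi> x *\<^sub>R axis 1 1)"
    have d: "test_fun ?d" by (rule test_fun_partial[OF \<psi>])
    note t = test_field[OF d, of "axis 1 1"]
    have D2: "?D \<in> L2" by (rule cvec_L2[OF test_fun_L2[OF t(1)]])
    have De: "z \<bullet> ?D x = (z \<bullet> ?e) * ?d x" for z x
      by (simp add: linear_simps[OF bounded_linear_cvec])
    have FD: "fourier_L1 ?D = (\<lambda>\<xi>. sft ?d \<xi> *s ?e)" by (rule t(2))
    have [measurable]: "?d \<in> borel_measurable borel" by (rule L2_measurable[OF test_fun_L2[OF d]])
    have lo_ad: "(\<integral>x. (inv_fourier_L1 lo x \<bullet> ?e) * ?d x \<partial>lborel) = (\<integral>\<xi>. lo \<xi> \<bullet> (sft ?d \<xi> *s ?e) \<partial>lborel)"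
      using fourier_L1_adjoint[OF t(5) lo1] unfolding FD by (simp add: De[symmetric] inner_commute)
    have hi_ad: "(\<integral>x. (rp (IFT (cls hi)) x \<bullet> ?e) * ?d x \<partial>lborel) = (\<integral>\<xi>. hi \<xi> \<bullet> (sft ?d \<xi> *s ?e) \<partial>lborel)"
    proof -
      have "(\<integral>x. (rp (IFT (cls hi)) x \<bullet> ?e) * ?d x \<partial>lborel) = cls (rp (IFT (cls hi))) \<bullet> cls ?D"
        unfolding inner_cls[OF rp_L2 D2] De ..
      also have "\<dots> = cls hi \<bullet> FT (cls ?D)" by (simp add: IFT_adjoint)
      also have "FT (cls ?D) = cls (\<lambda>\<xi>. sft ?d \<xi> *s ?e)" using t(3) by (simp only: cv_cls[OF test_fun_L2[OF t(1)]])
      finally show ?thesis unfolding inner_cls[OF hi2 t(4)] .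
    qed
    have i1: "integrable lborel (\<lambda>x. (inv_fourier_L1 lo x \<bullet> ?e) * ?d x)"
    proof (rule Bochner_Integration.integrable_bound)
      show "integrable lborel (\<lambda>x. (\<integral>\<xi>. norm (lo \<xi>) \<partial>lborel) * ?d x)" using test_fun_integrable[OF d] by simp
      show "AE x in lborel. norm ((inv_fourier_L1 lo x \<bullet> ?e) * ?d x) \<le> norm ((\<integral>\<xi>. norm (lo \<xi>) \<partial>lborel) * ?d x)"
      proof (intro AE_I2)
        fix x
        have "\<bar>inv_fourier_L1 lo x \<bullet> ?e\<bar> \<le> norm (inv_fourier_L1 lo x) * norm ?e" by (rule Cauchy_Schwarz_ineq2)
        also have "\<dots> \<le> \<bar>\<integral>\<xi>. norm (lo \<xi>) \<partial>lborel\<bar>" using norm_fourier_L1[of lo "- x"] by (simp add: e1 inv_fourier_L1_eq)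
        finally show "norm ((inv_fourier_L1 lo x \<bullet> ?e) * ?d x) \<le> norm ((\<integral>\<xi>. norm (lo \<xi>) \<partial>lborel) * ?d x)"
          unfolding real_norm_def abs_mult by (rule mult_right_mono) simp
      qed
      show "(\<lambda>x. (inv_fourier_L1 lo x \<bullet> ?e) * ?d x) \<in> borel_measurable lborel" using ilm by measurable
    qed
    have i2: "integrable lborel (\<lambda>x. (rp (IFT (cls hi)) x \<bullet> ?e) * ?d x)"
      using L2_inner_integrable[OF rp_L2 D2] unfolding De .
    have i3: "integrable lborel (\<lambda>\<xi>. hi \<xi> \<bullet> (sft ?d \<xi> *s ?e))" by (rule L2_inner_integrable[OF hi2 t(4)])
    have [measurable]: "sft ?d \<in> borel_measurable borel" by (rule L2_measurable[OF sft_component_L2[OF d]])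
    have [measurable]: "lo \<in> borel_measurable borel" using lo1 by auto
    have i4: "integrable lborel (\<lambda>\<xi>. lo \<xi> \<bullet> (sft ?d \<xi> *s ?e))"
    proof (rule Bochner_Integration.integrable_bound)
      show "integrable lborel (\<lambda>\<xi>. (\<integral>x. \<bar>?d x\<bar> \<partial>lborel) *\<^sub>R lo \<xi>)" by (rule integrable_scaleR_right[OF lo1])
      show "AE \<xi> in lborel. norm (lo \<xi> \<bullet> (sft ?d \<xi> *s ?e)) \<le> norm ((\<integral>x. \<bar>?d x\<bar> \<partial>lborel) *\<^sub>R lo \<xi>)"
      proof (intro AE_I2)
        fix \<xi>
        have "\<bar>lo \<xi> \<bullet> (sft ?d \<xi> *s ?e)\<bar> \<le> norm (lo \<xi>) * norm (sft ?d \<xi> *s ?e)" by (rule Cauchy_Schwarz_ineq2)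
        also have "\<dots> \<le> norm (lo \<xi>) * \<bar>\<integral>x. \<bar>?d x\<bar> \<partial>lborel\<bar>"
          unfolding norm_vs e1 mult_1_right by (intro mult_left_mono order_trans[OF sft_bounded abs_ge_self]) simp
        finally show "norm (lo \<xi> \<bullet> (sft ?d \<xi> *s ?e)) \<le> norm ((\<integral>x. \<bar>?d x\<bar> \<partial>lborel) *\<^sub>R lo \<xi>)"
          by (simp add: mult.commute)
      qed
    qed measurable
    have "(\<integral>x. f0 x * ?d x \<partial>lborel) = (\<integral>\<xi>. lo \<xi> \<bullet> (sft ?d \<xi> *s ?e) \<partial>lborel) + (\<integral>\<xi>. hi \<xi> \<bullet> (sft ?d \<xi> *s ?e) \<partial>lborel)"
      unfolding f0_def distrib_right Bochner_Integration.integral_add[OF i1 i2] lo_ad hi_ad ..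
    also have "\<dots> = (\<integral>\<xi>. lo \<xi> \<bullet> (sft ?d \<xi> *s ?e) + hi \<xi> \<bullet> (sft ?d \<xi> *s ?e) \<partial>lborel)"
      by (rule Bochner_Integration.integral_add[OF i4 i3, symmetric])
    also have "\<dots> = (\<integral>\<xi>. - Re (?P \<xi> $ j * cnj (sft \<psi> \<xi>)) \<partial>lborel)"
    proof (rule integral_cong_AE)
      \<comment> \<open>\<open>par_div\<close> divides by the squared norm of the frequency; the
        origin is a null set.\<close>
      have n0: "AE \<xi> in lborel. \<xi> \<noteq> (0 :: real ^ 3)" by (rule AE_lborel_singleton)
      show "AE \<xi> in lborel. lo \<xi> \<bullet> (sft ?d \<xi> *s ?e) + hi \<xi> \<bullet> (sft ?d \<xi> *s ?e) = - Re (?P \<xi> $ j * cnj (sft \<psi> \<xi>))"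
        using par n0
      proof eventually_elim
        case (elim \<xi>)
        have Pj: "2 * pi * \<i> * complex_of_real (\<xi> $ j) * p \<xi> = ?P \<xi> $ j"
          unfolding p_def by (rule par_div[OF elim])
        have "lo \<xi> + hi \<xi> = p \<xi> *s ?e"
          by (simp add: lo_def hi_def indicator_def)
        then have "lo \<xi> \<bullet> (sft ?d \<xi> *s ?e) + hi \<xi> \<bullet> (sft ?d \<xi> *s ?e) = (p \<xi> *s ?e) \<bullet> (sft ?d \<xi> *s ?e)"
          by (simp only: inner_add_left[symmetric])
        also have "\<dots> = Re (p \<xi> * cnj (sft ?d \<xi>))"
          unfolding inner_axis_vs by (simp add: cvec_def)
        also have "\<dots> = Re (- ((2 * pi * \<i> * complex_of_real (\<xi> $ j) * p \<xi>) * cnj (sft \<psi> \<xi>)))"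
          unfolding sft_partial[OF \<psi>] by (rule arg_cong[of _ _ Re]) (simp add: mult_ac)
        finally show ?case unfolding Pj by simp
      qed
      show "(\<lambda>\<xi>. - Re (?P \<xi> $ j * cnj (sft \<psi> \<xi>))) \<in> borel_measurable lborel"
        using borel_measurable_integrable[OF pairing_fourier(2)[OF \<phi> \<psi>]] by measurable
    qed (use i3 i4 in measurable)
    also have "\<dots> = - (\<integral>x. \<phi> x $ j * \<psi> x \<partial>lborel)"
      unfolding pairing_fourier(1)[OF \<phi> \<psi>] by (rule Bochner_Integration.integral_minus)
    finally show ?thesis by simp
  qed
  ultimately show ?thesis
    unfolding conservative_def using \<phi> f0m by (intro conjI exI[of _ f0]) auto
qed

text \<open>Each minor of the image is a combination of the minors of the original pair, with
  coefficients \<open>X $ j $ l * X $ k $ i\<close>.\<close>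

lemma par_cmat: "par \<xi> P \<Longrightarrow> par (X *v \<xi>) (cmat X *v P)"
proof -
  assume p: "par \<xi> P"
  have "complex_of_real ((X *v \<xi>) $ j) * (cmat X *v P) $ k
      = (\<Sum>l\<in>UNIV. \<Sum>i\<in>UNIV. complex_of_real (X $ j $ l * X $ k $ i) * (complex_of_real (\<xi> $ l) * P $ i))" for j k
    by (simp add: matrix_vector_mult_def cmat_def sum_product mult.assoc mult.left_commute)
  note e = this
  have "complex_of_real ((X *v \<xi>) $ j) * (cmat X *v P) $ k = complex_of_real ((X *v \<xi>) $ k) * (cmat X *v P) $ j" for j k
  proof -
    have "complex_of_real ((X *v \<xi>) $ k) * (cmat X *v P) $ j
        = (\<Sum>l\<in>UNIV. \<Sum>i\<in>UNIV. complex_of_real (X $ k $ l * X $ j $ i) * (complex_of_real (\<xi> $ i) * P $ l))"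
      unfolding e using p by (intro sum.cong refl) (simp add: par_def)
    also have "\<dots> = complex_of_real ((X *v \<xi>) $ j) * (cmat X *v P) $ k"
      unfolding e by (subst sum.swap) (simp add: mult_ac)
    finally show ?thesis ..
  qed
  then show ?thesis by (simp add: par_def)
qed

lemma par_scaleR: "par \<xi> P \<Longrightarrow> par \<xi> (c *\<^sub>R P)"
  by (simp add: par_def)

context linear_flow
begin

text \<open>On the frequency side the evolution moves frequency and amplitude by the same matrix
  \<open>Qt t\<close> and multiplies the amplitude by a real scalar; both operations keep the two
  parallel.\<close>

theorem conservative_sol:
  assumes \<phi>0: "\<phi>0 \<in> L2" and c: "conservative \<phi>0"
  shows "conservative (sol \<phi>0 t)"
proof (rule conservative_if_par[OF sol_cls(1)[OF \<phi>0]])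
  let ?P = "rp (FT (cv (cls \<phi>0)))"
  have MP: "(\<lambda>\<xi>. Mt t \<xi> *\<^sub>R ?P \<xi>) \<in> L2" by (rule mulop_L2[OF bmeas_Mt rp_L2])
  have "FT (cv (cls (sol \<phi>0 t))) = FT (Tm t (fmult (Mt t) (cv (cls \<phi>0))))"
    by (simp add: sol_cls(3)[OF \<phi>0] Gt_def)
  also have "\<dots> = pull ((*v) (cmat (Qt t))) ((*v) (Qt (- t))) (FT (fmult (Mt t) (cv (cls \<phi>0))))"
    unfolding Tm_def
    by (rule FT_pull) (auto simp: mp_Et mp_Qt cmat_vs Qt_inner Et_inv)
  also have "FT (fmult (Mt t) (cv (cls \<phi>0))) = cls (\<lambda>\<xi>. Mt t \<xi> *\<^sub>R ?P \<xi>)"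
    by (simp add: fmult_def FT_IFT mulop_def)
  also have "pull ((*v) (cmat (Qt t))) ((*v) (Qt (- t))) \<dots> = cls (\<lambda>\<xi>. cmat (Qt t) *v (Mt t (Qt (- t) *v \<xi>) *\<^sub>R ?P (Qt (- t) *v \<xi>)))"
    by (rule pull_cls[OF matrix_vector_mul_bounded_linear mp_Qt MP])
  finally have F: "FT (cv (cls (sol \<phi>0 t))) = cls (\<lambda>\<xi>. cmat (Qt t) *v (Mt t (Qt (- t) *v \<xi>) *\<^sub>R ?P (Qt (- t) *v \<xi>)))" .
  have "AE \<xi> in lborel. rp (FT (cv (cls (sol \<phi>0 t)))) \<xi> = cmat (Qt t) *v (Mt t (Qt (- t) *v \<xi>) *\<^sub>R ?P (Qt (- t) *v \<xi>))"
    unfolding F by (rule rp_cls[OF pull_L2[OF matrix_vector_mul_bounded_linear mp_Qt MP]])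
  moreover have "AE \<xi> in lborel. par (Qt (- t) *v \<xi>) (?P (Qt (- t) *v \<xi>))"
    by (rule mp_AE[OF mp_Qt conservative_par[OF c]])
  ultimately show "AE \<xi> in lborel. par \<xi> (rp (FT (cv (cls (sol \<phi>0 t)))) \<xi>)"
  proof eventually_elim
    case (elim \<xi>)
    have "par (Qt t *v (Qt (- t) *v \<xi>)) (cmat (Qt t) *v (Mt t (Qt (- t) *v \<xi>) *\<^sub>R ?P (Qt (- t) *v \<xi>)))"
      by (rule par_cmat[OF par_scaleR[OF elim(2)]])
    then show ?case by (simp add: elim(1) Qt_Qt Qt_0)
  qed
qed

end

theorem theorem3p1:
  fixes A :: "real ^ 3 ^ 3" and \<phi>0 :: "real ^ 3 \<Rightarrow> real ^ 3"
  assumes symmetric: "transpose A = A"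
    and pos_def: "\<And>x :: real ^ 3. x \<noteq> 0 \<Longrightarrow> x \<bullet> (A *v x) > 0"
    and phi0: "\<phi>0 \<in> L2"
  shows "let \<phi> = (\<lambda>t x. Re_vec (G_op A t \<phi>0 x)) in
      (\<forall>t. AE x in lborel. G_op A t \<phi>0 x = cvec (\<phi> t x)) \<and>
      weak_solution A \<phi>0 \<phi> \<and>
      (\<phi>0 \<in> dom_L A \<longrightarrow> strong_solution A \<phi>0 \<phi>) \<and>
      (conservative \<phi>0 \<longrightarrow> (\<forall>t. conservative (\<phi> t)))"
proof -
  interpret linear_flow A by standard (fact symmetric, fact pos_def)
  have "(\<lambda>t x. Re_vec (G_op A t \<phi>0 x)) = sol \<phi>0" by (simp add: sol_def fun_eq_iff)
  then show ?thesis
    using sol_cls(4)[OF phi0] weak_solution_sol[OF phi0] strong_solution_sol[OF phi0] conservative_sol[OF phi0]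
    by (simp add: Let_def)
qed

end
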